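(* In the setting described in the context (with the Euclidean norm $|\cdot|_2$ on $\mathbb{R}^n$), let $\bar u$ be a local minimum of (P). Write $\nabla\bar u=\bar h\,|\nabla\bar u|$ with $|\bar h(x)|_2=1$ for $|\nabla\bar u|$-a.e. $x$, and for $v\in BV(\omega)$ let $\nabla v=h_v\,|\nabla\bar u|+(\nabla v)_s$ be the Lebesgue decomposition of $\nabla v$ with respect to $|\nabla\bar u|$. Let $$C_{\bar u}=\{v\in BV(\omega)\cap L^2(\omega):F'(\bar u)v+\alpha G'(\bar u;v)=0\ \text{and}\ |h_v|_2\in L^2(|\nabla\bar u|)\}.$$ Then $$F''(\bar u)v^2+\alpha\int_\omega\Big(|h_v(x)|_2^2-(\bar h(x)\cdot h_v(x))^2\Big)\,d|\nabla\bar u|(x)\ge0\quad\forall v\in C_{\bar u}.$$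
   Context: $\Omega\subset\mathbb{R}^n$, $n\in\{2,3\}$, bounded domain with Lipschitz boundary $\Gamma$; $\omega\subset\Omega$ open; $\alpha>0$, $\beta\ge0$, $\gamma\ge0$, $y_d\in L^2(\Omega)$; if $n=3$ then $\gamma>0$. $f:\Omega\times\mathbb{R}\to\mathbb{R}$ Borel, $C^2$ in $y$, with for a.e. $x$: $f(\cdot,0)\in L^{\hat p}(\Omega)$, $\hat p>n/2$; $\partial_yf\ge0$; for every $M$ there is $C_M$ with $|\partial_yf(x,y)|+|\partial^2_{yy}f(x,y)|\le C_M$ for $|y|\le M$; for every $M,\rho>0$ there is $\varepsilon>0$ with $|\partial^2_{yy}f(x,y_2)-\partial^2_{yy}f(x,y_1)|\le\rho$ if $|y_2-y_1|<\varepsilon$, $|y_i|\le M$. $y_u$ solves $-\Delta y+f(x,y)=u\chi_\omega$ in $\Omega$, $y=0$ on $\Gamma$. $F(u)=\frac12\int_\Omega|y_u-y_d|^2dx+\frac\beta2(\int_\omega u\,dx)^2+\frac\gamma2\int_\omega u^2dx$ ($C^2$ on $L^2(\omega)$), $F''(\bar u)v^2=F''(\bar u)(v,v)$. $M(\omega)$: real regular Borel measures on $\omega$; $C_0(\omega)$: continuous functions on $\bar\omega$ vanishing on $\partial\omega$; $\|\mu\|_{M(\omega)^n}=\sup\{\int_\omega z\cdot d\mu: z\in C_0(\omega)^n, |z(x)|_2\le1\}$, and $|\mu|$ is the total variation measure relative to $|\cdot|_2$. $BV(\omega)$: $u\in L^1(\omega)$ with $\nabla u\in M(\omega)^n$;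 $G(u)=\|\nabla u\|_{M(\omega)^n}$, $G'(\bar u;v)=\lim_{\rho\searrow0}(G(\bar u+\rho v)-G(\bar u))/\rho$. Problem (P): minimize $J=F+\alpha G$ over $BV(\omega)$ (with $u\in L^2(\omega)$ if $n=3$); a local minimum is $\bar u\in BV(\omega)\cap L^2(\omega)$ with $J(\bar u)\le J(u)$ for all $u\in BV(\omega)\cap L^2(\omega)$ in a neighborhood of $\bar u$. *)

theory Defs
  imports "HOL-Analysis.Analysis"
begin

definition grad :: "(real^'n \<Rightarrow> real) \<Rightarrow> real^'n \<Rightarrow> real^'n" where
  "grad \<phi> x = (\<chi> i. frechet_derivative \<phi> (at x) (axis i 1))"

definition test_fun :: "(real^'n) set \<Rightarrow> (real^'n \<Rightarrow> real) \<Rightarrow> bool" where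
  "test_fun U \<phi> \<longleftrightarrow> (\<forall>x. \<phi> differentiable (at x)) \<and> continuous_on UNIV (grad \<phi>)
     \<and> compact (closure {x. \<phi> x \<noteq> 0}) \<and> closure {x. \<phi> x \<noteq> 0} \<subseteq> U"

definition test_field :: "(real^'n) set \<Rightarrow> (real^'n \<Rightarrow> real^'n) \<Rightarrow> bool" where
  "test_field U \<phi> \<longleftrightarrow> (\<forall>i. test_fun U (\<lambda>x. \<phi> x $ i))"

definition divg :: "(real^'n \<Rightarrow> real^'n) \<Rightarrow> real^'n \<Rightarrow> real" where
  "divg \<phi> x = (\<Sum>i\<in>UNIV. grad (\<lambda>y. \<phi> y $ i) x $ i)"

text \<open>Strong Lipschitz boundary: locally, after a rigid motion, the domain is the
  subgraph of a Lipschitz function of the remaining coordinates.\<close>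
definition lipschitz_boundary :: "(real^'n) set \<Rightarrow> bool" where
  "lipschitz_boundary \<Omega> \<longleftrightarrow> (\<forall>p\<in>frontier \<Omega>. \<exists>r>0. \<exists>(T::real^'n \<Rightarrow> real^'n) (j::'n) (g::real^'n \<Rightarrow> real) (L::real).
      orthogonal_transformation T \<and> L-lipschitz_on UNIV g \<and>
      (\<forall>x. g x = g (\<chi> i. if i = j then 0 else x $ i)) \<and>
      \<Omega> \<inter> ball p r = {x \<in> ball p r. T (x - p) $ j < g (T (x - p))})"

definition bounded_lipschitz_domain :: "(real^'n) set \<Rightarrow> bool" where
  "bounded_lipschitz_domain \<Omega> \<longleftrightarrow> open \<Omega> \<and> connected \<Omega> \<and> \<Omega> \<noteq> {} \<and> bounded \<Omega>
      \<and> lipschitz_boundary \<Omega>"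

definition L2 :: "(real^'n) set \<Rightarrow> (real^'n \<Rightarrow> real) \<Rightarrow> bool" where
  "L2 U u \<longleftrightarrow> u \<in> borel_measurable (lebesgue_on U) \<and> integrable (lebesgue_on U) (\<lambda>x. (u x)^2)"

definition L2norm :: "(real^'n) set \<Rightarrow> (real^'n \<Rightarrow> real) \<Rightarrow> real" where
  "L2norm U u = sqrt (LINT x|lebesgue_on U. (u x)^2)"

definition weak_grad :: "(real^'n) set \<Rightarrow> (real^'n \<Rightarrow> real) \<Rightarrow> (real^'n \<Rightarrow> real^'n) \<Rightarrow> bool" where
  "weak_grad U y g \<longleftrightarrow> (\<forall>\<phi> i. test_fun U \<phi> \<longrightarrow>
      (LINT x|lebesgue_on U. y x * grad \<phi> x $ i) = - (LINT x|lebesgue_on U. g x $ i * \<phi> x))"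

definition H10 :: "(real^'n) set \<Rightarrow> (real^'n \<Rightarrow> real) \<Rightarrow> (real^'n \<Rightarrow> real^'n) \<Rightarrow> bool" where
  "H10 U y g \<longleftrightarrow> L2 U y \<and> (\<forall>i. L2 U (\<lambda>x. g x $ i)) \<and> weak_grad U y g \<and>
     (\<exists>\<phi>. (\<forall>k. test_fun U (\<phi> k)) \<and>
        ((\<lambda>k. LINT x|lebesgue_on U. (\<phi> k x - y x)^2 + (norm (grad (\<phi> k) x - g x))^2) \<longlonglongrightarrow> 0))"

text \<open>Weak solution of  -Delta y + f(x,y) = u chi_omega in Omega, y = 0 on the boundary,
  in H^1_0(Omega) \<inter> L^\<infinity>(Omega).\<close>
definition state_sol :: "(real^'n) set \<Rightarrow> (real^'n) set \<Rightarrow> (real^'n \<Rightarrow> real \<Rightarrow> real)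
    \<Rightarrow> (real^'n \<Rightarrow> real) \<Rightarrow> (real^'n \<Rightarrow> real) \<Rightarrow> bool" where
  "state_sol \<Omega> \<omega> f u y \<longleftrightarrow> (\<exists>g. H10 \<Omega> y g \<and> (\<exists>M. AE x in lebesgue_on \<Omega>. \<bar>y x\<bar> \<le> M) \<and>
     (\<forall>\<phi>. test_fun \<Omega> \<phi> \<longrightarrow>
        (LINT x|lebesgue_on \<Omega>. g x \<bullet> grad \<phi> x + f x (y x) * \<phi> x)
          = (LINT x|lebesgue_on \<omega>. u x * \<phi> x)))"

definition state :: "(real^'n) set \<Rightarrow> (real^'n) set \<Rightarrow> (real^'n \<Rightarrow> real \<Rightarrow> real)
    \<Rightarrow> (real^'n \<Rightarrow> real) \<Rightarrow> real^'n \<Rightarrow> real" where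
  "state \<Omega> \<omega> f u = (SOME y. state_sol \<Omega> \<omega> f u y)"

definition Fobj :: "(real^'n) set \<Rightarrow> (real^'n) set \<Rightarrow> (real^'n \<Rightarrow> real \<Rightarrow> real)
    \<Rightarrow> (real^'n \<Rightarrow> real) \<Rightarrow> real \<Rightarrow> real \<Rightarrow> (real^'n \<Rightarrow> real) \<Rightarrow> real" where
  "Fobj \<Omega> \<omega> f yd \<beta> \<gamma> u =
     1/2 * (LINT x|lebesgue_on \<Omega>. (state \<Omega> \<omega> f u x - yd x)^2)
     + \<beta>/2 * (LINT x|lebesgue_on \<omega>. u x)^2 + \<gamma>/2 * (LINT x|lebesgue_on \<omega>. (u x)^2)"

text \<open>F'(u)v and F''(u)v^2 (F is C^2 on L^2(omega), so these are the first and
  second derivatives of t \<mapsto> F(u + t v) at 0).\<close>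
definition dF where
  "dF \<Omega> \<omega> f yd \<beta> \<gamma> u v = deriv (\<lambda>t. Fobj \<Omega> \<omega> f yd \<beta> \<gamma> (\<lambda>x. u x + t * v x)) 0"

definition d2F where
  "d2F \<Omega> \<omega> f yd \<beta> \<gamma> u v =
     deriv (\<lambda>s. deriv (\<lambda>t. Fobj \<Omega> \<omega> f yd \<beta> \<gamma> (\<lambda>x. u x + t * v x)) s) 0"

text \<open>An R^n-valued measure mu in M(omega)^n is encoded by its polar decomposition
  mu = k |mu|: a finite Borel measure lam = |mu| on omega and a density k with |k|_2 = 1
  lam-a.e.\<close>
definition vmeas_on :: "(real^'n) set \<Rightarrow> (real^'n) measure \<Rightarrow> (real^'n \<Rightarrow> real^'n) \<Rightarrow> bool" where
  "vmeas_on U lam k \<longleftrightarrow> sets lam = sets (restrict_space borel U) \<and> finite_measure lam \<and>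
     k \<in> borel_measurable lam \<and> (AE x in lam. norm (k x) = 1)"

definition grad_rep :: "(real^'n) set \<Rightarrow> (real^'n \<Rightarrow> real) \<Rightarrow> (real^'n) measure
    \<Rightarrow> (real^'n \<Rightarrow> real^'n) \<Rightarrow> bool" where
  "grad_rep \<omega> u lam k \<longleftrightarrow> vmeas_on \<omega> lam k \<and>
     (\<forall>\<phi>. test_field \<omega> \<phi> \<longrightarrow>
        (LINT x|lebesgue_on \<omega>. u x * divg \<phi> x) = - (LINT x|lam. \<phi> x \<bullet> k x))"

definition BV :: "(real^'n) set \<Rightarrow> (real^'n \<Rightarrow> real) \<Rightarrow> bool" where
  "BV \<omega> u \<longleftrightarrow> integrable (lebesgue_on \<omega>) u \<and> (\<exists>lam k. grad_rep \<omega> u lam k)"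

definition C0 :: "(real^'n) set \<Rightarrow> (real^'n \<Rightarrow> real^'n) \<Rightarrow> bool" where
  "C0 \<omega> z \<longleftrightarrow> continuous_on (closure \<omega>) z \<and> (\<forall>x\<in>frontier \<omega>. z x = 0)"

definition mnorm :: "(real^'n) set \<Rightarrow> (real^'n) measure \<Rightarrow> (real^'n \<Rightarrow> real^'n) \<Rightarrow> real" where
  "mnorm \<omega> lam k = Sup {LINT x|lam. z x \<bullet> k x | z. C0 \<omega> z \<and> (\<forall>x\<in>closure \<omega>. norm (z x) \<le> 1)}"

definition TV :: "(real^'n) set \<Rightarrow> (real^'n \<Rightarrow> real) \<Rightarrow> real" where
  "TV \<omega> u = (SOME t. \<exists>lam k. grad_rep \<omega> u lam k \<and> t = mnorm \<omega> lam k)"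

definition dTV :: "(real^'n) set \<Rightarrow> (real^'n \<Rightarrow> real) \<Rightarrow> (real^'n \<Rightarrow> real) \<Rightarrow> real" where
  "dTV \<omega> u v = Lim (at_right 0) (\<lambda>\<rho>. (TV \<omega> (\<lambda>x. u x + \<rho> * v x) - TV \<omega> u) / \<rho>)"

definition leb_decomp :: "(real^'n) set \<Rightarrow> (real^'n) measure \<Rightarrow> (real^'n \<Rightarrow> real)
    \<Rightarrow> (real^'n \<Rightarrow> real^'n) \<Rightarrow> bool" where
  "leb_decomp \<omega> lamb v h \<longleftrightarrow> h \<in> borel_measurable lamb \<and> integrable lamb h \<and>
     (\<exists>lams ks N. vmeas_on \<omega> lams ks \<and> N \<in> sets lamb \<and> emeasure lamb N = 0 \<and>
        emeasure lams (\<omega> - N) = 0 \<and>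
        (\<forall>\<phi>. test_field \<omega> \<phi> \<longrightarrow>
           (LINT x|lebesgue_on \<omega>. v x * divg \<phi> x)
             = - ((LINT x|lamb. \<phi> x \<bullet> h x) + (LINT x|lams. \<phi> x \<bullet> ks x))))"

definition Jobj where
  "Jobj \<Omega> \<omega> f yd \<alpha> \<beta> \<gamma> u = Fobj \<Omega> \<omega> f yd \<beta> \<gamma> u + \<alpha> * TV \<omega> u"

text \<open>Local minimum w.r.t. the norm of BV(omega) \<inter> L^2(omega).\<close>
definition loc_min where
  "loc_min \<Omega> \<omega> f yd \<alpha> \<beta> \<gamma> ub \<longleftrightarrow> BV \<omega> ub \<and> L2 \<omega> ub \<and>
     (\<exists>r>0. \<forall>u. BV \<omega> u \<and> L2 \<omega> u \<and> L2norm \<omega> (\<lambda>x. u x - ub x) + TV \<omega> (\<lambda>x. u x - ub x) < r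
        \<longrightarrow> Jobj \<Omega> \<omega> f yd \<alpha> \<beta> \<gamma> ub \<le> Jobj \<Omega> \<omega> f yd \<alpha> \<beta> \<gamma> u)"

end

theory Submission
  imports Defs
begin

text \<open>Along the ray \<open>u + \<rho> v\<close> the singular part of \<open>\<nabla> v\<close> contributes exactly linearly to the total variation,
  since it is carried by a null set of \<open>|\<nabla> u|\<close>; the absolutely continuous part contributes
  the integral of \<open>|h\<^sub>b + \<rho> h|\<close>, and \<open>|a + \<rho> b| = 1 + \<rho> a \<cdot> b + (\<rho>\<^sup>2/2)(|b|\<^sup>2 - (a \<cdot> b)\<^sup>2) + o(\<rho>\<^sup>2)\<close> for
  \<open>|a| = 1\<close>, where everything past the linear term lies between 0 and \<open>\<rho>\<^sup>2 |b|\<^sup>2/2\<close>, so dominated convergence applies.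
  Dividing the inequality \<open>J(u) \<le> J(u + \<rho> v)\<close> by \<open>\<rho>\<^sup>2\<close>, whose first-order terms
  cancel for critical \<open>v\<close>, and letting \<open>\<rho>\<close> tend to 0 gives the claim.

  The expansion of \<open>F\<close> rests on uniform bounds for the linearised state equations. These come from testing with
  the regularised fundamental solution: if \<open>- \<Delta> y = r\<close> with \<open>r y \<le> G |y|\<close>, then \<open>|y|\<close> is bounded by the potential
  of \<open>G\<close>. Monotonicity of \<open>f\<close> provides the sign condition.\<close>

section \<open>Square-integrable functions\<close>

text \<open>The objects of the statement come from choice or from operators with default values:
  \<open>state\<close> and \<open>TV\<close> from \<open>SOME\<close>, \<open>dF\<close> and
  \<open>d2F\<close> from \<open>deriv\<close>, \<open>dTV\<close> from \<open>Lim\<close>. Nothing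
  can be read off them until the matching facts are proved: a state exists and whichever one is
  chosen obeys the bounds; the curve t -> F(u + t v) is twice differentiable at 0; all
  representations of a gradient measure have the same mass; the difference quotients of the total
  variation converge. Since only lines through the minimiser occur, every expansion is in one real
  variable t. The derivatives of f are controlled only on bounded sets of y, and the data are merely
  L^p with p > n/2, possibly less than 2. Energy estimates therefore do not suffice, and each
  remainder (of the state, of its first and of its second derivative in t) has to be bounded almost
  everywhere. Each remainder solves an equation of the form - \<Delta> e + a e = - R with a
  nonnegative. The damping term has the good sign, so one potential estimate serves all of
  them.\<close>

definition sqint :: "'a measure \<Rightarrow> ('a \<Rightarrow> 'b::euclidean_space) \<Rightarrow> bool" where
  "sqint M w \<longleftrightarrow> w \<in> borel_measurable M \<and> integrable M (\<lambda>x. (norm (w x))\<^sup>2)"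

text \<open>Values in a Euclidean space let functions, gradients and pairs of both share one Hilbert
  space theory. The square is kept because energy identities and the Poincare inequality are
  quadratic.\<close>

definition l2sq :: "'a measure \<Rightarrow> ('a \<Rightarrow> 'b::euclidean_space) \<Rightarrow> real" where
  "l2sq M w = (LINT x|M. (norm (w x))\<^sup>2)"

lemma sqint_measurable [measurable_dest]: "sqint M w \<Longrightarrow> w \<in> borel_measurable M"
  by (simp add: sqint_def)

lemma l2sq_nonneg [simp]: "0 \<le> l2sq M w"
  by (simp add: l2sq_def)

lemma norm_add_sq_le: "(norm (a + b :: 'b::real_normed_vector))\<^sup>2 \<le> 2 * (norm a)\<^sup>2 + 2 * (norm b)\<^sup>2"
proof -
  have "(norm (a + b))\<^sup>2 \<le> (norm a + norm b)\<^sup>2"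
    by (simp add: norm_triangle_ineq power_mono)
  also have "\<dots> \<le> 2 * (norm a)\<^sup>2 + 2 * (norm b)\<^sup>2"
    using sum_squares_bound[of "norm a" "norm b"] by (simp add: power2_sum)
  finally show ?thesis .
qed

lemma sqint_add:
  assumes "sqint M u" "sqint M v" shows "sqint M (\<lambda>x. u x + v x)"
proof -
  have [measurable]: "u \<in> borel_measurable M" "v \<in> borel_measurable M"
    using assms by (auto simp: sqint_def)
  have "integrable M (\<lambda>x. (norm (u x + v x))\<^sup>2)"
  proof (rule Bochner_Integration.integrable_bound)
    show "integrable M (\<lambda>x. 2 * (norm (u x))\<^sup>2 + 2 * (norm (v x))\<^sup>2)"
      using assms by (auto simp: sqint_def)
  qed (use norm_add_sq_le in \<open>auto intro!: AE_I2 simp: abs_of_nonneg\<close>)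
  then show ?thesis by (auto simp: sqint_def)
qed

lemma sqint_scaleR:
  assumes "sqint M u" shows "sqint M (\<lambda>x. c *\<^sub>R u x)"
  using assms by (auto simp: sqint_def power_mult_distrib)

lemma sqint_diff:
  assumes "sqint M u" "sqint M v" shows "sqint M (\<lambda>x. u x - v x)"
  using sqint_add[OF assms(1) sqint_scaleR[OF assms(2), of "-1"]] by simp

lemma sqint_inner:
  assumes "sqint M u" "sqint M v" shows "integrable M (\<lambda>x. u x \<bullet> v x)"
proof -
  have [measurable]: "u \<in> borel_measurable M" "v \<in> borel_measurable M"
    using assms by (auto simp: sqint_def)
  have "\<bar>a \<bullet> b\<bar> \<le> (norm a)\<^sup>2 + (norm b)\<^sup>2" for a b :: 'b
  proof -
    have "\<bar>a \<bullet> b\<bar> \<le> norm a * norm b" by (rule Cauchy_Schwarz_ineq2)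
    also have "\<dots> \<le> (norm a)\<^sup>2 + (norm b)\<^sup>2"
      using sum_squares_bound[of "norm a" "norm b"] mult_nonneg_nonneg[OF norm_ge_zero[of a] norm_ge_zero[of b]]
      by linarith
    finally show ?thesis .
  qed
  then have le: "norm (u x \<bullet> v x) \<le> norm ((norm (u x))\<^sup>2 + (norm (v x))\<^sup>2)" for x
    by (metis abs_of_nonneg add_nonneg_nonneg real_norm_def zero_le_power2)
  show ?thesis
  proof (rule Bochner_Integration.integrable_bound)
    show "integrable M (\<lambda>x. (norm (u x))\<^sup>2 + (norm (v x))\<^sup>2)"
      using assms by (auto simp: sqint_def)
    show "AE x in M. norm (u x \<bullet> v x) \<le> norm ((norm (u x))\<^sup>2 + (norm (v x))\<^sup>2)"
      using le by (intro AE_I2)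
  qed simp
qed

lemma sqint_mult:
  fixes u v :: "'a \<Rightarrow> real"
  assumes "sqint M u" "sqint M v" shows "integrable M (\<lambda>x. u x * v x)"
  using sqint_inner[OF assms] by simp

lemma l2sq_inner: "l2sq M u = (LINT x|M. u x \<bullet> u x)"
  by (simp add: l2sq_def power2_norm_eq_inner)

lemma l2sq_add:
  assumes "sqint M u" "sqint M v"
  shows "l2sq M (\<lambda>x. u x + c *\<^sub>R v x) = l2sq M u + 2 * c * (LINT x|M. u x \<bullet> v x) + c\<^sup>2 * l2sq M v"
proof -
  have i: "integrable M (\<lambda>x. u x \<bullet> v x)" "integrable M (\<lambda>x. u x \<bullet> u x)" "integrable M (\<lambda>x. v x \<bullet> v x)"
    using assms by (auto intro: sqint_inner)
  have "l2sq M (\<lambda>x. u x + c *\<^sub>R v x) = (LINT x|M. u x \<bullet> u x + (2 * c) * (u x \<bullet> v x) + c\<^sup>2 * (v x \<bullet> v x))"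
    unfolding l2sq_inner
    by (intro Bochner_Integration.integral_cong)
      (auto simp: inner_add_left inner_add_right inner_commute power2_eq_square algebra_simps)
  then show ?thesis using i by (simp add: l2sq_inner)
qed

lemma l2sq_scaleR: "l2sq M (\<lambda>x. c *\<^sub>R u x) = c\<^sup>2 * l2sq M u"
  by (simp add: l2sq_def power_mult_distrib)

lemma l2sq_minus_commute: "l2sq M (\<lambda>x. u x - v x) = l2sq M (\<lambda>x. v x - u x)"
  by (simp add: l2sq_def norm_minus_commute)

lemma l2sq_add_le:
  assumes "sqint M u" "sqint M v"
  shows "l2sq M (\<lambda>x. u x + v x) \<le> 2 * l2sq M u + 2 * l2sq M v"
proof -
  have "l2sq M (\<lambda>x. u x + v x) \<le> (LINT x|M. 2 * (norm (u x))\<^sup>2 + 2 * (norm (v x))\<^sup>2)"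
    unfolding l2sq_def using assms sqint_add[OF assms]
    by (intro integral_mono norm_add_sq_le) (auto simp: sqint_def)
  also have "\<dots> = 2 * l2sq M u + 2 * l2sq M v"
    using assms by (simp add: l2sq_def sqint_def)
  finally show ?thesis .
qed

lemma l2sq_triangle:
  assumes "sqint M u" "sqint M v" "sqint M w"
  shows "l2sq M (\<lambda>x. u x - w x) \<le> 2 * l2sq M (\<lambda>x. u x - v x) + 2 * l2sq M (\<lambda>x. v x - w x)"
  using l2sq_add_le[OF sqint_diff[OF assms(1,2)] sqint_diff[OF assms(2,3)]] by simp

text \<open>Discriminant of the nonnegative quadratic
  \<open>t \<mapsto> l2sq M (u + t v)\<close>.\<close>

lemma l2_Cauchy_Schwarz:
  assumes "sqint M u" "sqint M v"
  shows "(LINT x|M. u x \<bullet> v x)\<^sup>2 \<le> l2sq M u * l2sq M v"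
proof -
  define a b c where "a = l2sq M u" and "b = (LINT x|M. u x \<bullet> v x)" and "c = l2sq M v"
  have q: "0 \<le> a + 2 * t * b + t\<^sup>2 * c" for t
    using l2sq_add[OF assms, of t] l2sq_nonneg[of M "\<lambda>x. u x + t *\<^sub>R v x"]
    by (simp add: a_def b_def c_def)
  have "c \<ge> 0" by (simp add: c_def)
  have "b\<^sup>2 \<le> a * c"
  proof (cases "c = 0")
    case True
    have "b = 0"
    proof (rule ccontr)
      assume "b \<noteq> 0"
      \<comment> \<open>For \<open>c = 0\<close> the quadratic degenerates to an affine function of
        \<open>t\<close>, and this \<open>t\<close> gives it the value -1.\<close>
      with q[of "- (a + 1) / (2 * b)"] True show False by (simp add: field_simps)
    qed
    then show ?thesis using True by simp
  next
    case False
    with q[of "- b / c"] \<open>c \<ge> 0\<close> show ?thesis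
      by (simp add: field_simps power2_eq_square)
  qed
  then show ?thesis by (simp add: a_def b_def c_def)
qed

lemma l2_inner_le:
  assumes "sqint M u" "sqint M v"
  shows "\<bar>LINT x|M. u x \<bullet> v x\<bar> \<le> sqrt (l2sq M u) * sqrt (l2sq M v)"
  using real_le_rsqrt[of "\<bar>LINT x|M. u x \<bullet> v x\<bar>" "l2sq M u * l2sq M v"] l2_Cauchy_Schwarz[OF assms]
  by (simp add: real_sqrt_mult)

text \<open>The difference of the two products splits into three terms, each with at least one
  factor tending to zero in the norm, so Cauchy-Schwarz handles all three.\<close>

lemma l2_inner_tendsto:
  assumes w: "\<And>k. sqint M (w k)" "sqint M w'" and u: "\<And>k. sqint M (u k)" "sqint M u'"
    and lw: "(\<lambda>k. l2sq M (\<lambda>x. w k x - w' x)) \<longlonglongrightarrow> 0" and lu: "(\<lambda>k. l2sq M (\<lambda>x. u k x - u' x)) \<longlonglongrightarrow> 0"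
  shows "(\<lambda>k. LINT x|M. w k x \<bullet> u k x) \<longlonglongrightarrow> (LINT x|M. w' x \<bullet> u' x)"
proof -
  have eq: "(LINT x|M. w k x \<bullet> u k x) = (LINT x|M. (w k x - w' x) \<bullet> (u k x - u' x))
      + (LINT x|M. (w k x - w' x) \<bullet> u' x) + (LINT x|M. w' x \<bullet> (u k x - u' x)) + (LINT x|M. w' x \<bullet> u' x)" for k
  proof -
    have i: "integrable M (\<lambda>x. (w k x - w' x) \<bullet> (u k x - u' x))" "integrable M (\<lambda>x. (w k x - w' x) \<bullet> u' x)"
      "integrable M (\<lambda>x. w' x \<bullet> (u k x - u' x))" "integrable M (\<lambda>x. w' x \<bullet> u' x)"
      using w u by (auto intro!: sqint_inner sqint_diff)
    have "(LINT x|M. w k x \<bullet> u k x) = (LINT x|M. (w k x - w' x) \<bullet> (u k x - u' x)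
      + (w k x - w' x) \<bullet> u' x + w' x \<bullet> (u k x - u' x) + w' x \<bullet> u' x)"
      by (intro Bochner_Integration.integral_cong) (auto simp: inner_diff_left inner_diff_right)
    then show ?thesis using i by simp
  qed
  have z: "(\<lambda>k. LINT x|M. a k x \<bullet> b k x) \<longlonglongrightarrow> 0"
    if "\<And>k. sqint M (a k)" "\<And>k. sqint M (b k)" "(\<lambda>k. sqrt (l2sq M (a k)) * sqrt (l2sq M (b k))) \<longlonglongrightarrow> 0"
    for a b :: "nat \<Rightarrow> 'a \<Rightarrow> 'b"
  proof (rule tendsto_rabs_zero_cancel, rule tendsto_sandwich[OF _ _ tendsto_const that(3)])
    show "\<forall>\<^sub>F k in sequentially. \<bar>LINT x|M. a k x \<bullet> b k x\<bar> \<le> sqrt (l2sq M (a k)) * sqrt (l2sq M (b k))"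
      using l2_inner_le[OF that(1,2)] by (intro always_eventually allI)
  qed simp
  have s: "(\<lambda>k. sqrt (l2sq M (\<lambda>x. w k x - w' x))) \<longlonglongrightarrow> 0" "(\<lambda>k. sqrt (l2sq M (\<lambda>x. u k x - u' x))) \<longlonglongrightarrow> 0"
    using tendsto_real_sqrt[OF lw] tendsto_real_sqrt[OF lu] by simp_all
  have d: "sqint M (\<lambda>x. w k x - w' x)" "sqint M (\<lambda>x. u k x - u' x)" for k
    using w u by (auto intro: sqint_diff)
  have "(\<lambda>k. LINT x|M. (w k x - w' x) \<bullet> (u k x - u' x)) \<longlonglongrightarrow> 0"
    by (rule z[OF d]) (use tendsto_mult[OF s] in simp)
  moreover have "(\<lambda>k. LINT x|M. (w k x - w' x) \<bullet> u' x) \<longlonglongrightarrow> 0"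
    by (rule z[OF d(1) u(2)]) (use tendsto_mult_right[OF s(1)] in simp)
  moreover have "(\<lambda>k. LINT x|M. w' x \<bullet> (u k x - u' x)) \<longlonglongrightarrow> 0"
    by (rule z[OF w(2) d(2)]) (use tendsto_mult_left[OF s(2)] in simp)
  ultimately have "(\<lambda>k. (LINT x|M. (w k x - w' x) \<bullet> (u k x - u' x))
      + (LINT x|M. (w k x - w' x) \<bullet> u' x) + (LINT x|M. w' x \<bullet> (u k x - u' x)) + (LINT x|M. w' x \<bullet> u' x))
     \<longlonglongrightarrow> 0 + 0 + 0 + (LINT x|M. w' x \<bullet> u' x)"
    by (intro tendsto_add tendsto_const)
  then show ?thesis unfolding eq by simp
qed

lemma l2_inner_tendsto_left:
  assumes w: "\<And>k. sqint M (w k)" "sqint M w'" and u: "sqint M u"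
    and lw: "(\<lambda>k. l2sq M (\<lambda>x. w k x - w' x)) \<longlonglongrightarrow> 0"
  shows "(\<lambda>k. LINT x|M. w k x \<bullet> u x) \<longlonglongrightarrow> (LINT x|M. w' x \<bullet> u x)"
  by (rule l2_inner_tendsto[OF w u u lw]) (simp add: l2sq_def)

lemma l2sq_tendsto:
  assumes w: "\<And>k. sqint M (w k)" "sqint M w'"
    and lw: "(\<lambda>k. l2sq M (\<lambda>x. w k x - w' x)) \<longlonglongrightarrow> 0"
  shows "(\<lambda>k. l2sq M (w k)) \<longlonglongrightarrow> l2sq M w'"
  unfolding l2sq_inner by (rule l2_inner_tendsto[OF w w lw lw])

section \<open>Completeness of the space of square-integrable functions and orthogonal
  projection\<close>

lemma l2_AE_subseq:
  assumes w: "\<And>k. sqint M (w k)" "sqint M w'"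
    and lw: "(\<lambda>k. l2sq M (\<lambda>x. w k x - w' x)) \<longlonglongrightarrow> 0"
  shows "\<exists>r. strict_mono r \<and> (AE x in M. (\<lambda>k. w (r k) x) \<longlonglongrightarrow> w' x)"
proof -
  have "\<exists>r. strict_mono r \<and> (AE x in M. (\<lambda>k. (norm (w (r k) x - w' x))\<^sup>2) \<longlonglongrightarrow> 0)"
  proof (rule tendsto_L1_AE_subseq)
    show "integrable M (\<lambda>x. (norm (w k x - w' x))\<^sup>2)" for k
      using sqint_diff[OF w(1) w(2)] by (auto simp: sqint_def)
    show "(\<lambda>k. LINT x|M. norm ((norm (w k x - w' x))\<^sup>2)) \<longlonglongrightarrow> 0"
      using lw by (simp add: l2sq_def)
  qed
  then obtain r where r: "strict_mono r" "AE x in M. (\<lambda>k. (norm (w (r k) x - w' x))\<^sup>2) \<longlonglongrightarrow> 0" by auto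
  have "AE x in M. (\<lambda>k. w (r k) x) \<longlonglongrightarrow> w' x"
    using r(2)
  proof eventually_elim
    case (elim x)
    then have "(\<lambda>k. norm (w (r k) x - w' x)) \<longlonglongrightarrow> 0"
      using tendsto_real_sqrt[OF elim] by simp
    then show ?case by (subst tendsto_dist_iff) (simp add: dist_norm)
  qed
  with r(1) show ?thesis by (intro exI[of _ r] conjI)
qed

text \<open>Riesz-Fischer: a rapidly converging subsequence has almost everywhere summable
  increments, and Fatou's lemma transfers the Cauchy bound to its pointwise limit.\<close>

theorem l2_complete:
  fixes w :: "nat \<Rightarrow> 'a \<Rightarrow> 'b::euclidean_space"
  assumes w: "\<And>k. sqint M (w k)"
    and C: "\<And>e. e > 0 \<Longrightarrow> \<exists>N. \<forall>m\<ge>N. \<forall>n\<ge>N. l2sq M (\<lambda>x. w m x - w n x) \<le> e"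
  shows "\<exists>w'. sqint M w' \<and> (\<lambda>k. l2sq M (\<lambda>x. w k x - w' x)) \<longlonglongrightarrow> 0"
proof -
  have [measurable]: "w k \<in> borel_measurable M" for k using w[of k] by (simp add: sqint_def)
  have wi: "integrable M (\<lambda>x. (norm (w m x - w n x))\<^sup>2)" for m n
    using sqint_diff[OF w w] by (auto simp: sqint_def)
  have "\<exists>N. \<forall>m\<ge>N. \<forall>n\<ge>N. l2sq M (\<lambda>x. w m x - w n x) \<le> (1/4)^j" for j :: nat
    by (rule C) simp
  then obtain N where N: "\<And>j m n. m \<ge> N j \<Longrightarrow> n \<ge> N j \<Longrightarrow> l2sq M (\<lambda>x. w m x - w n x) \<le> (1/4)^j"
    by metis
  \<comment> \<open>Partial sums give at once monotonicity, \<open>N j \<le> r j\<close> and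
    \<open>j \<le> r j\<close>.\<close>
  define r where "r j = (\<Sum>i\<le>j. N i) + j" for j
  have rN: "N j \<le> r j" "r j \<le> r (Suc j)" "j \<le> r j" for j
    by (auto simp: r_def intro: order_trans[OF member_le_sum[of j "{..j}" N]])
  \<comment> \<open>The weight 2^j is affordable, since the increments decay like 4^(-j); it will
    turn summability of squares into summability of norms.\<close>
  define a where "a j x = 2^j * (norm (w (r (Suc j)) x - w (r j) x))\<^sup>2" for j x
  have [measurable]: "a j \<in> borel_measurable M" for j by (simp add: a_def[abs_def])
  have a0: "a j x \<ge> 0" for j x by (simp add: a_def)
  have "(\<integral>\<^sup>+x. (\<Sum>j. ennreal (a j x)) \<partial>M) = (\<Sum>j. \<integral>\<^sup>+x. ennreal (a j x) \<partial>M)"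
    by (rule nn_integral_suminf) simp
  also have "\<dots> \<le> (\<Sum>j. ennreal ((1/2)^j))"
  proof (intro suminf_le allI summableI)
    fix j
    have "(\<integral>\<^sup>+x. ennreal (a j x) \<partial>M) = ennreal (LINT x|M. a j x)"
      using wi by (intro nn_integral_eq_integral) (auto simp: a_def)
    also have "(LINT x|M. a j x) = 2^j * l2sq M (\<lambda>x. w (r (Suc j)) x - w (r j) x)"
      by (simp add: a_def l2sq_def)
    also have "\<dots> \<le> 2^j * (1/4)^j"
      using rN[of j] by (intro mult_left_mono N) auto
    also have "\<dots> = (1/2)^j" by (simp flip: power_mult_distrib)
    finally show "(\<integral>\<^sup>+x. ennreal (a j x) \<partial>M) \<le> ennreal ((1/2)^j)" by (simp add: ennreal_leI)
  qed
  also have "\<dots> = ennreal (\<Sum>j. (1/2)^j)"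
    by (intro suminf_ennreal2) (auto intro: summable_geometric)
  also have "\<dots> < \<infinity>" by simp
  finally have "(\<integral>\<^sup>+x. (\<Sum>j. ennreal (a j x)) \<partial>M) \<noteq> \<infinity>" by simp
  then have "AE x in M. (\<Sum>j. ennreal (a j x)) \<noteq> \<infinity>"
    by (intro nn_integral_PInf_AE) auto
  then have ae: "AE x in M. convergent (\<lambda>j. w (r j) x)"
  proof eventually_elim
    case (elim x)
    then have s: "summable (\<lambda>j. a j x)"
      by (intro summable_suminf_not_top) (auto simp: a0)
    have "summable (\<lambda>j. norm (w (r (Suc j)) x - w (r j) x))"
    proof (rule summable_comparison_test')
      show "summable (\<lambda>j. a j x + (1/2)^j)" using s by (intro summable_add) (auto intro: summable_geometric)
      fix j
      define b where "b = norm (w (r (Suc j)) x - w (r j) x)"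
      have "b \<le> 2^j * b\<^sup>2 + (1/2)^j"
      proof -
        \<comment> \<open>With X = 2^j b this is X \<le> X^2 + 1; division by 2^j bounds
          \<open>b\<close> by the weighted square plus a geometric term.\<close>
        have "0 \<le> (2^j * b - 1)\<^sup>2 + 2^j * b" by (intro add_nonneg_nonneg) (auto simp: b_def)
        then have "2^j * b \<le> (2^j)\<^sup>2 * b\<^sup>2 + 1" by (simp add: power2_diff power_mult_distrib mult_ac)
        then show ?thesis
          by (simp add: field_simps power2_eq_square)
      qed
      then show "norm (norm (w (r (Suc j)) x - w (r j) x)) \<le> a j x + (1/2)^j"
        by (simp add: b_def a_def)
    qed
    then have "summable (\<lambda>j. w (r (Suc j)) x - w (r j) x)" by (rule summable_norm_cancel)
    then have "convergent (\<lambda>n. \<Sum>j<n. w (r (Suc j)) x - w (r j) x)"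
      by (simp add: summable_iff_convergent)
    then have "convergent (\<lambda>n. w (r n) x - w (r 0) x)"
      using sum_lessThan_telescope[of "\<lambda>j. w (r j) x"] by simp
    then show ?case
      using convergent_diff_const_right_iff by blast
  qed
  define w' where "w' x = lim (\<lambda>j. w (r j) x)" for x
  have [measurable]: "w' \<in> borel_measurable M"
    unfolding w'_def[abs_def] by (intro borel_measurable_lim_metric) simp
  have ae': "AE x in M. (\<lambda>j. w (r j) x) \<longlonglongrightarrow> w' x"
    using ae by eventually_elim (simp add: w'_def convergent_LIMSEQ_iff)
  \<comment> \<open>Fatou along the subsequence, with the index \<open>m\<close> fixed.\<close>
  have key: "integrable M (\<lambda>x. (norm (w m x - w' x))\<^sup>2) \<and> l2sq M (\<lambda>x. w m x - w' x) \<le> e"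
    if e: "e > 0" and "\<And>n. n \<ge> N0 \<Longrightarrow> l2sq M (\<lambda>x. w m x - w n x) \<le> e" for m N0 e
  proof -
    have "(\<integral>\<^sup>+x. ennreal ((norm (w m x - w' x))\<^sup>2) \<partial>M)
        \<le> (\<integral>\<^sup>+x. liminf (\<lambda>j. ennreal ((norm (w m x - w (r j) x))\<^sup>2)) \<partial>M)"
    proof (rule nn_integral_mono_AE)
      show "AE x in M. ennreal ((norm (w m x - w' x))\<^sup>2) \<le> liminf (\<lambda>j. ennreal ((norm (w m x - w (r j) x))\<^sup>2))"
        using ae'
      proof eventually_elim
        case (elim x)
        have "(\<lambda>j. ennreal ((norm (w m x - w (r j) x))\<^sup>2)) \<longlonglongrightarrow> ennreal ((norm (w m x - w' x))\<^sup>2)"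
          by (intro tendsto_intros tendsto_ennrealI elim)
        from lim_imp_Liminf[OF _ this] show ?case by simp
      qed
    qed
    also have "\<dots> \<le> liminf (\<lambda>j. \<integral>\<^sup>+x. ennreal ((norm (w m x - w (r j) x))\<^sup>2) \<partial>M)"
      by (intro nn_integral_liminf) simp
    also have "\<dots> \<le> ennreal e"
    proof -
      have "eventually (\<lambda>j. (\<integral>\<^sup>+x. ennreal ((norm (w m x - w (r j) x))\<^sup>2) \<partial>M) \<le> ennreal e) sequentially"
        using eventually_ge_at_top[of N0]
      proof eventually_elim
        case (elim j)
        have "(\<integral>\<^sup>+x. ennreal ((norm (w m x - w (r j) x))\<^sup>2) \<partial>M) = ennreal (l2sq M (\<lambda>x. w m x - w (r j) x))"
          unfolding l2sq_def by (intro nn_integral_eq_integral wi) auto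
        also have "\<dots> \<le> ennreal e"
          using elim rN(3)[of j] by (intro ennreal_leI that) auto
        finally show ?case .
      qed
      then show ?thesis
        by (intro order_trans[OF Liminf_le_Limsup] Limsup_bounded) auto
    qed
    finally have f: "(\<integral>\<^sup>+x. ennreal ((norm (w m x - w' x))\<^sup>2) \<partial>M) \<le> ennreal e" .
    have i: "integrable M (\<lambda>x. (norm (w m x - w' x))\<^sup>2)"
      by (intro integrableI_nonneg) (use f in \<open>auto intro: le_less_trans\<close>)
    have "ennreal (l2sq M (\<lambda>x. w m x - w' x)) \<le> ennreal e"
      using f i by (simp add: l2sq_def nn_integral_eq_integral)
    with i e show ?thesis by simp
  qed
  obtain N1 where N1: "\<And>m n. m \<ge> N1 \<Longrightarrow> n \<ge> N1 \<Longrightarrow> l2sq M (\<lambda>x. w m x - w n x) \<le> 1"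
    using C[of 1] by auto
  \<comment> \<open>The limit is square-integrable because it differs from one member of the
    sequence by a square-integrable function.\<close>
  have "sqint M (\<lambda>x. w N1 x - w' x)"
    using key[of 1 N1 N1] N1 by (auto simp: sqint_def)
  from sqint_diff[OF w this, of N1] have w': "sqint M w'" by simp
  moreover have "(\<lambda>k. l2sq M (\<lambda>x. w k x - w' x)) \<longlonglongrightarrow> 0"
  proof (rule LIMSEQ_I)
    fix e :: real assume "e > 0"
    then obtain N2 where N2: "\<And>m n. m \<ge> N2 \<Longrightarrow> n \<ge> N2 \<Longrightarrow> l2sq M (\<lambda>x. w m x - w n x) \<le> e/2"
      using C[of "e/2"] by auto
    have "l2sq M (\<lambda>x. w k x - w' x) \<le> e/2" if "k \<ge> N2" for k
      using key[of "e/2" N2 k] N2 that \<open>e > 0\<close> by auto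
    with \<open>e > 0\<close> show "\<exists>no. \<forall>n\<ge>no. norm (l2sq M (\<lambda>x. w n x - w' x) - 0) < e"
      by (intro exI[of _ N2]) (force simp: abs_of_nonneg)
  qed
  ultimately show ?thesis by blast
qed

text \<open>\<open>S\<close> is a subspace that need not be closed, so \<open>w\<close> is the point
  of its closure nearest to \<open>g\<close>. The approximating sequence is part of the conclusion:
  through it \<open>w\<close> is later recognised as an element of H^1_0 together with its
  gradient.\<close>

theorem l2_projection:
  fixes S :: "('a \<Rightarrow> 'b::euclidean_space) set"
  assumes S: "\<And>s. s \<in> S \<Longrightarrow> sqint M s" and ne: "(\<lambda>x. 0) \<in> S"
    and lin: "\<And>s t c. s \<in> S \<Longrightarrow> t \<in> S \<Longrightarrow> (\<lambda>x. s x + c *\<^sub>R t x) \<in> S"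
    and g: "sqint M g"
  shows "\<exists>w s. sqint M w \<and> (\<forall>k::nat. s k \<in> S) \<and> (\<lambda>k. l2sq M (\<lambda>x. s k x - w x)) \<longlonglongrightarrow> 0
     \<and> (\<forall>t\<in>S. (LINT x|M. w x \<bullet> t x) = (LINT x|M. g x \<bullet> t x))"
proof -
  define D where "D s = l2sq M (\<lambda>x. s x - g x)" for s
  define d where "d = Inf (D ` S)"
  have bdd: "bdd_below (D ` S)" by (intro bdd_belowI[of _ 0]) (auto simp: D_def)
  have d_le: "d \<le> D s" if "s \<in> S" for s
    unfolding d_def using bdd that by (intro cInf_lower) auto
  have "\<exists>s\<in>S. D s < d + (inverse (Suc k))" for k :: nat
    using cInf_lessD[of "D ` S" "d + inverse (Suc k)"] ne by (auto simp: d_def)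
  then obtain s where s: "\<And>k. s k \<in> S" "\<And>k. D (s k) < d + inverse (Suc k)" by metis
  have sg: "sqint M (\<lambda>x. s k x - g x)" for k using S[OF s(1)] g by (rule sqint_diff)
  \<comment> \<open>Parallelogram law: the midpoint of two nearly optimal elements lies in
    \<open>S\<close>, hence its squared distance to \<open>g\<close> is at least \<open>d\<close>,
    which forces the two elements together.\<close>
  have par: "l2sq M (\<lambda>x. s m x - s n x) \<le> 2 * inverse (Suc m) + 2 * inverse (Suc n)" for m n
  proof -
    define p q where "p = (\<lambda>x. s m x - g x)" and "q = (\<lambda>x. s n x - g x)"
    have pq: "sqint M p" "sqint M q" using sg by (auto simp: p_def q_def)
    have "l2sq M (\<lambda>x. p x + (-1) *\<^sub>R q x) + l2sq M (\<lambda>x. p x + 1 *\<^sub>R q x) = 2 * l2sq M p + 2 * l2sq M q"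
      unfolding l2sq_add[OF pq] by simp
    moreover have "(\<lambda>x. (1/2) *\<^sub>R s m x + (1/2) *\<^sub>R s n x) \<in> S"
      using lin[OF lin[OF ne s(1)[of m], of "1/2"] s(1)[of n], of "1/2"] by simp
    from d_le[OF this] have "d \<le> l2sq M (\<lambda>x. (1/2) *\<^sub>R (p x + 1 *\<^sub>R q x))"
    proof -
      have eq: "(1/2) *\<^sub>R (p x + 1 *\<^sub>R q x) = (1/2) *\<^sub>R s m x + (1/2) *\<^sub>R s n x - g x" for x
      proof -
        have "g x = (1/2) *\<^sub>R g x + (1/2) *\<^sub>R g x" by (simp flip: scaleR_left_distrib)
        moreover have "(1/2) *\<^sub>R (p x + 1 *\<^sub>R q x) = (1/2) *\<^sub>R s m x + (1/2) *\<^sub>R s n x - ((1/2) *\<^sub>R g x + (1/2) *\<^sub>R g x)"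
          by (simp add: p_def q_def scaleR_right_distrib scaleR_diff_right)
        ultimately show ?thesis by metis
      qed
      from \<open>d \<le> D _\<close> show ?thesis by (simp only: eq D_def)
    qed
    then have "4 * d \<le> l2sq M (\<lambda>x. p x + 1 *\<^sub>R q x)"
      unfolding l2sq_scaleR by (simp add: power2_eq_square)
    moreover have "l2sq M p < d + inverse (Suc m)" "l2sq M q < d + inverse (Suc n)"
      using s(2)[of m] s(2)[of n] by (simp_all add: D_def p_def q_def)
    ultimately show ?thesis by (simp add: p_def q_def)
  qed
  have "\<exists>w. sqint M w \<and> (\<lambda>k. l2sq M (\<lambda>x. s k x - w x)) \<longlonglongrightarrow> 0"
  proof (rule l2_complete)
    fix e :: real assume "e > 0"
    then obtain N where N: "inverse (Suc N) < e/4"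
      using reals_Archimedean[of "e/4"] by auto
    have "l2sq M (\<lambda>x. s m x - s n x) \<le> e" if "m \<ge> N" "n \<ge> N" for m n
    proof -
      have "inverse (real (Suc m)) \<le> inverse (real (Suc N))" "inverse (real (Suc n)) \<le> inverse (real (Suc N))"
        using that by (auto intro!: le_imp_inverse_le)
      with par[of m n] N show ?thesis by linarith
    qed
    then show "\<exists>N. \<forall>m\<ge>N. \<forall>n\<ge>N. l2sq M (\<lambda>x. s m x - s n x) \<le> e" by auto
  qed (use s S in auto)
  then obtain w where w: "sqint M w" "(\<lambda>k. l2sq M (\<lambda>x. s k x - w x)) \<longlonglongrightarrow> 0" by auto
  have Dw: "(\<lambda>k. D (s k)) \<longlonglongrightarrow> l2sq M (\<lambda>x. w x - g x)"
    unfolding D_def by (rule l2sq_tendsto) (use w sg g sqint_diff in auto)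
  have "(\<lambda>k. d + inverse (real (Suc k))) \<longlonglongrightarrow> d + 0"
    by (intro tendsto_intros LIMSEQ_inverse_real_of_nat)
  then have "l2sq M (\<lambda>x. w x - g x) \<le> d"
    using Dw s(2) by (intro LIMSEQ_le[OF Dw]) (auto intro: less_imp_le)
  have "(LINT x|M. w x \<bullet> t x) = (LINT x|M. g x \<bullet> t x)" if t: "t \<in> S" for t
  proof -
    have st: "sqint M t" using S t by auto
    define b where "b = (LINT x|M. (w x - g x) \<bullet> t x)"
    have wg: "sqint M (\<lambda>x. w x - g x)" using w g by (auto intro: sqint_diff)
    have q: "0 \<le> 2 * c * b + c\<^sup>2 * l2sq M t" for c
    proof -
      have "(\<lambda>k. l2sq M (\<lambda>x. (s k x - g x) + c *\<^sub>R t x)) \<longlonglongrightarrow> l2sq M (\<lambda>x. (w x - g x) + c *\<^sub>R t x)"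
        by (rule l2sq_tendsto) (use w sg wg st in \<open>auto intro!: sqint_add sqint_scaleR\<close>)
      moreover have "d \<le> l2sq M (\<lambda>x. (s k x - g x) + c *\<^sub>R t x)" for k
        using d_le[OF lin[OF s(1) t]] by (simp add: D_def algebra_simps)
      ultimately have "d \<le> l2sq M (\<lambda>x. (w x - g x) + c *\<^sub>R t x)"
        by (intro LIMSEQ_le_const) auto
      with \<open>l2sq M (\<lambda>x. w x - g x) \<le> d\<close> show ?thesis
        unfolding l2sq_add[OF wg st] by (simp add: b_def)
    qed
    have "b = 0"
    proof (rule ccontr)
      assume b: "b \<noteq> 0"
      \<comment> \<open>The minimiser of the quadratic in \<open>c\<close> would be
        \<open>- b / l2sq M t\<close>; adding 1 avoids a zero denominator and still yields a
        negative value.\<close>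
      define L where "L = l2sq M t + 1"
      have L: "L > 0" "l2sq M t \<le> L" by (auto simp: L_def add_nonneg_pos)
      have "0 \<le> 2 * (- b / L) * b + (- b / L)\<^sup>2 * L"
        using q[of "- b / L"] L by (smt (verit) mult_left_mono zero_le_power2)
      also have "\<dots> = - (b\<^sup>2) / L" using L by (simp add: field_simps power2_eq_square)
      finally show False using b L by (simp add: divide_simps)
    qed
    then show ?thesis
      using sqint_inner[OF w(1) st] sqint_inner[OF g st] by (simp add: b_def inner_diff_left)
  qed
  then show ?thesis using w s(1) by (intro exI[of _ w] exI[of _ s] conjI ballI allI)
qed

section \<open>Test functions and integration by parts\<close>

text \<open>The gradient is an explicit argument so that the calculus rules produce it along with
  the function; \<open>C1_grad\<close> identifies it with \<open>grad\<close>.\<close>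

definition C1 :: "(real^'n \<Rightarrow> real) \<Rightarrow> (real^'n \<Rightarrow> real^'n) \<Rightarrow> bool" where
  "C1 \<phi> D \<longleftrightarrow> (\<forall>x. (\<phi> has_derivative (\<lambda>h. D x \<bullet> h)) (at x)) \<and> continuous_on UNIV D"

lemma has_derivative_imp_grad:
  assumes "(\<phi> has_derivative (\<lambda>h. d \<bullet> h)) (at x)"
  shows "grad \<phi> x = d"
  using frechet_derivative_at[OF assms, symmetric]
  by (simp add: grad_def vec_eq_iff inner_axis)

lemma differentiable_imp_grad:
  fixes \<phi> :: "real^'n \<Rightarrow> real"
  assumes "\<phi> differentiable (at x)"
  shows "(\<phi> has_derivative (\<lambda>h. grad \<phi> x \<bullet> h)) (at x)"
proof -
  define F where "F = frechet_derivative \<phi> (at x)"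
  have F: "(\<phi> has_derivative F) (at x)"
    using assms by (simp add: F_def frechet_derivative_works)
  then interpret F: linear F by (simp add: has_derivative_linear)
  have "F h = grad \<phi> x \<bullet> h" for h
  proof -
    have "F h = F (\<Sum>i\<in>UNIV. h $ i *\<^sub>R axis i 1)"
      using basis_expansion[of h] by (simp add: scalar_mult_eq_scaleR)
    also have "\<dots> = (\<Sum>i\<in>UNIV. h $ i * F (axis i 1))"
      by (simp add: F.sum F.scaleR)
    also have "\<dots> = grad \<phi> x \<bullet> h"
      by (simp add: grad_def F_def inner_vec_def mult.commute)
    finally show ?thesis .
  qed
  then have "F = (\<lambda>h. grad \<phi> x \<bullet> h)" by auto
  with F show ?thesis by simp
qed

lemma C1_grad: "C1 \<phi> D \<Longrightarrow> grad \<phi> = D"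
  by (auto simp: C1_def intro: has_derivative_imp_grad)

lemma C1_continuous: "C1 \<phi> D \<Longrightarrow> continuous_on UNIV \<phi>"
  by (auto simp: C1_def intro!: continuous_at_imp_continuous_on has_derivative_continuous)

lemma C1_continuous_grad: "C1 \<phi> D \<Longrightarrow> continuous_on UNIV D"
  by (simp add: C1_def)

lemma C1_mult:
  assumes "C1 \<phi> D" "C1 \<psi> E"
  shows "C1 (\<lambda>x. \<phi> x * \<psi> x) (\<lambda>x. \<phi> x *\<^sub>R E x + \<psi> x *\<^sub>R D x)"
proof -
  have "((\<lambda>x. \<phi> x * \<psi> x) has_derivative (\<lambda>h. (\<phi> x *\<^sub>R E x + \<psi> x *\<^sub>R D x) \<bullet> h)) (at x)" for x
    using has_derivative_mult[of \<phi> "\<lambda>h. D x \<bullet> h" x UNIV \<psi> "\<lambda>h. E x \<bullet> h"] assms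
    by (simp add: C1_def inner_add_left mult.commute)
  moreover have "continuous_on UNIV (\<lambda>x. \<phi> x *\<^sub>R E x + \<psi> x *\<^sub>R D x)"
    using assms by (intro continuous_intros) (auto intro: C1_continuous C1_continuous_grad)
  ultimately show ?thesis by (simp add: C1_def)
qed

lemma C1_add:
  assumes "C1 \<phi> D" "C1 \<psi> E"
  shows "C1 (\<lambda>x. \<phi> x + c * \<psi> x) (\<lambda>x. D x + c *\<^sub>R E x)"
proof -
  have "((\<lambda>x. \<phi> x + c * \<psi> x) has_derivative (\<lambda>h. (D x + c *\<^sub>R E x) \<bullet> h)) (at x)" for x
    using has_derivative_add[of \<phi> "\<lambda>h. D x \<bullet> h" "at x" "\<lambda>x. c * \<psi> x" "\<lambda>h. c * (E x \<bullet> h)"]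
      has_derivative_mult_right[of \<psi> "\<lambda>h. E x \<bullet> h" "at x" c] assms
    by (simp add: C1_def inner_add_left)
  moreover have "continuous_on UNIV (\<lambda>x. D x + c *\<^sub>R E x)"
    using assms by (intro continuous_intros) (auto intro: C1_continuous C1_continuous_grad)
  ultimately show ?thesis by (simp add: C1_def)
qed

lemma C1_const: "C1 (\<lambda>x. c) (\<lambda>x. 0)"
  by (simp add: C1_def)

lemma C1_component:
  fixes i :: "'n::finite"
  shows "C1 (\<lambda>x::real^'n. x $ i) (\<lambda>x. axis i 1)"
proof -
  have "((\<lambda>x::real^'n. x $ i) has_derivative (\<lambda>h. axis i 1 \<bullet> h)) (at x)" for x
  proof -
    have "(\<lambda>h::real^'n. axis i 1 \<bullet> h) = (\<lambda>h. h $ i)" by (simp add: inner_axis' fun_eq_iff)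
    then show ?thesis
      using bounded_linear.has_derivative[OF bounded_linear_vec_nth has_derivative_ident] by simp
  qed
  then show ?thesis by (simp add: C1_def)
qed

lemma C1_compose:
  assumes "C1 \<phi> D" "\<And>s. (X has_real_derivative X' s) (at s)" "continuous_on UNIV X'"
  shows "C1 (\<lambda>x. X (\<phi> x)) (\<lambda>x. X' (\<phi> x) *\<^sub>R D x)"
proof -
  have "((\<lambda>x. X (\<phi> x)) has_derivative (\<lambda>h. (X' (\<phi> x) *\<^sub>R D x) \<bullet> h)) (at x)" for x
    using has_derivative_compose[of \<phi> "\<lambda>h. D x \<bullet> h" x UNIV X "\<lambda>h. X' (\<phi> x) * h"] assms
    by (simp add: C1_def has_field_derivative_def)
  moreover have "continuous_on UNIV (\<lambda>x. X' (\<phi> x) *\<^sub>R D x)"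
    using assms C1_continuous[OF assms(1)]
    by (intro continuous_intros continuous_on_compose2[OF assms(3)]) (auto intro: C1_continuous_grad)
  ultimately show ?thesis by (simp add: C1_def)
qed

lemma test_funD: "test_fun U \<phi> \<Longrightarrow> C1 \<phi> (grad \<phi>)"
  by (auto simp: test_fun_def C1_def intro: differentiable_imp_grad)

lemma C1_zero_off:
  assumes "C1 \<phi> D" "closed K" "\<And>x. x \<notin> K \<Longrightarrow> \<phi> x = 0" "x \<notin> K"
  shows "D x = 0"
proof -
  have "(\<phi> has_derivative (\<lambda>h. 0 \<bullet> h)) (at x)"
  proof (rule has_derivative_transform_within_open[of "\<lambda>x. 0" "\<lambda>h. 0 \<bullet> h" x UNIV "- K"])
    show "open (- K)" using assms(2) by (simp add: open_Compl)
  qed (use assms in auto)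
  with assms(1) show ?thesis
    using has_derivative_imp_grad[of \<phi> _ x] by (metis C1_def)
qed

text \<open>Any compact set outside of which the function vanishes may serve in place of the support
  itself.\<close>

lemma test_funI:
  assumes "C1 \<phi> D" "compact K" "K \<subseteq> U" "\<And>x. x \<notin> K \<Longrightarrow> \<phi> x = 0"
  shows "test_fun U \<phi>"
proof -
  have "closure {x. \<phi> x \<noteq> 0} \<subseteq> K"
    using assms by (intro closure_minimal compact_imp_closed) auto
  moreover from this have "compact (closure {x. \<phi> x \<noteq> 0})"
    using assms(2) compact_Int_closed[of K "closure {x. \<phi> x \<noteq> 0}"] by (simp add: inf.absorb2)
  ultimately show ?thesis
    using assms C1_grad[OF assms(1)]
    by (auto simp: test_fun_def C1_def differentiable_def)
qed

lemma test_funE: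
  assumes "test_fun U \<phi>"
  obtains K where "compact K" "K \<subseteq> U" "\<And>x. x \<notin> K \<Longrightarrow> \<phi> x = 0" "\<And>x. x \<notin> K \<Longrightarrow> grad \<phi> x = 0"
proof
  let ?K = "closure {x. \<phi> x \<noteq> 0}"
  show "compact ?K" "?K \<subseteq> U" using assms by (auto simp: test_fun_def)
  show z: "\<phi> x = 0" if "x \<notin> ?K" for x using that closure_subset[of "{x. \<phi> x \<noteq> 0}"] by auto
  show "grad \<phi> x = 0" if "x \<notin> ?K" for x
    by (rule C1_zero_off[OF test_funD[OF assms] _ z that]) auto
qed

lemma test_fun_mono: "test_fun U \<phi> \<Longrightarrow> U \<subseteq> V \<Longrightarrow> test_fun V \<phi>"
  by (auto simp: test_fun_def)

lemma test_fun_outside: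
  assumes "test_fun U \<phi>" "x \<notin> U" shows "\<phi> x = 0" "grad \<phi> x = 0"
  using assms by (auto elim!: test_funE)

lemma test_fun_continuous: "test_fun U \<phi> \<Longrightarrow> continuous_on S \<phi>" "test_fun U \<phi> \<Longrightarrow> continuous_on S (grad \<phi>)"
  by (meson C1_continuous C1_continuous_grad test_funD continuous_on_subset subset_UNIV)+

lemma test_fun_borel [measurable_dest]:
  "test_fun U \<phi> \<Longrightarrow> \<phi> \<in> borel_measurable borel"
  by (intro borel_measurable_continuous_onI test_fun_continuous)

lemma test_fun_grad_borel:
  "test_fun U \<phi> \<Longrightarrow> grad \<phi> \<in> borel_measurable borel"
  by (intro borel_measurable_continuous_onI test_fun_continuous)

lemma compact_support_bounded:
  fixes f :: "'a::metric_space \<Rightarrow> 'b::real_normed_vector"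
  assumes "continuous_on UNIV f" "compact K" "\<And>x. x \<notin> K \<Longrightarrow> f x = 0"
  shows "\<exists>B>0. \<forall>x. norm (f x) \<le> B"
proof -
  have "bounded (f ` K)"
    using assms by (intro compact_imp_bounded compact_continuous_image) (auto intro: continuous_on_subset)
  then obtain B where "B > 0" "\<And>x. x \<in> K \<Longrightarrow> norm (f x) \<le> B"
    by (auto simp: bounded_pos)
  with assms(3) show ?thesis by (metis less_imp_le norm_zero)
qed

lemma test_fun_bounded:
  assumes "test_fun U \<phi>"
  shows "\<exists>B>0. \<forall>x. \<bar>\<phi> x\<bar> \<le> B \<and> norm (grad \<phi> x) \<le> B"
proof -
  obtain K where K: "compact K" "\<And>x. x \<notin> K \<Longrightarrow> \<phi> x = 0" "\<And>x. x \<notin> K \<Longrightarrow> grad \<phi> x = 0"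
    using assms by (rule test_funE) auto
  obtain A where "A > 0" "\<And>x. norm (\<phi> x) \<le> A"
    using compact_support_bounded[OF test_fun_continuous(1)[OF assms] K(1,2)] by auto
  moreover obtain B where "B > 0" "\<And>x. norm (grad \<phi> x) \<le> B"
    using compact_support_bounded[OF test_fun_continuous(2)[OF assms] K(1,3)] by auto
  ultimately show ?thesis by (intro exI[of _ "max A B"]) (auto simp: le_max_iff_disj)
qed

lemma test_fun_mult_C1:
  assumes "test_fun U \<phi>" "C1 \<psi> E"
  shows "test_fun U (\<lambda>x. \<phi> x * \<psi> x)" "grad (\<lambda>x. \<phi> x * \<psi> x) = (\<lambda>x. \<phi> x *\<^sub>R E x + \<psi> x *\<^sub>R grad \<phi> x)"
proof -
  obtain K where K: "compact K" "K \<subseteq> U" "\<And>x. x \<notin> K \<Longrightarrow> \<phi> x = 0"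
    using assms(1) by (rule test_funE) auto
  note c = C1_mult[OF test_funD[OF assms(1)] assms(2)]
  show "test_fun U (\<lambda>x. \<phi> x * \<psi> x)" by (rule test_funI[OF c K(1,2)]) (simp add: K(3))
  show "grad (\<lambda>x. \<phi> x * \<psi> x) = (\<lambda>x. \<phi> x *\<^sub>R E x + \<psi> x *\<^sub>R grad \<phi> x)" by (rule C1_grad[OF c])
qed

text \<open>\<open>X 0 = 0\<close> keeps the support from growing.\<close>

lemma test_fun_compose:
  assumes "test_fun U \<phi>" "\<And>s. (X has_real_derivative X' s) (at s)" "continuous_on UNIV X'" "X 0 = 0"
  shows "test_fun U (\<lambda>x. X (\<phi> x))" "grad (\<lambda>x. X (\<phi> x)) = (\<lambda>x. X' (\<phi> x) *\<^sub>R grad \<phi> x)"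
proof -
  obtain K where K: "compact K" "K \<subseteq> U" "\<And>x. x \<notin> K \<Longrightarrow> \<phi> x = 0"
    using assms(1) by (rule test_funE) auto
  note c = C1_compose[OF test_funD[OF assms(1)] assms(2,3)]
  show "test_fun U (\<lambda>x. X (\<phi> x))" by (rule test_funI[OF c K(1,2)]) (simp add: K(3) assms(4))
  show "grad (\<lambda>x. X (\<phi> x)) = (\<lambda>x. X' (\<phi> x) *\<^sub>R grad \<phi> x)" by (rule C1_grad[OF c])
qed

lemma test_fun_add:
  assumes "test_fun U \<phi>" "test_fun U \<psi>"
  shows "test_fun U (\<lambda>x. \<phi> x + c * \<psi> x)" "grad (\<lambda>x. \<phi> x + c * \<psi> x) = (\<lambda>x. grad \<phi> x + c *\<^sub>R grad \<psi> x)"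
proof -
  obtain K where K: "compact K" "K \<subseteq> U" "\<And>x. x \<notin> K \<Longrightarrow> \<phi> x = 0"
    using assms(1) by (rule test_funE) auto
  obtain L where L: "compact L" "L \<subseteq> U" "\<And>x. x \<notin> L \<Longrightarrow> \<psi> x = 0"
    using assms(2) by (rule test_funE) auto
  note c = C1_add[OF test_funD[OF assms(1)] test_funD[OF assms(2)], of c]
  show "test_fun U (\<lambda>x. \<phi> x + c * \<psi> x)"
    by (rule test_funI[OF c compact_Un[OF K(1) L(1)]]) (use K L in auto)
  show "grad (\<lambda>x. \<phi> x + c * \<psi> x) = (\<lambda>x. grad \<phi> x + c *\<^sub>R grad \<psi> x)" by (rule C1_grad[OF c])
qed

lemma test_fun_zero: "test_fun U (\<lambda>x. 0)" "grad (\<lambda>x. 0) = (\<lambda>x. 0)"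
  using test_funI[OF C1_const[of 0], of "{}"] C1_grad[OF C1_const] by auto

lemma C1_lipschitz:
  fixes \<phi> :: "real^'n \<Rightarrow> real"
  assumes "C1 \<phi> D" "\<And>x. norm (D x) \<le> B"
  shows "\<bar>\<phi> x - \<phi> y\<bar> \<le> B * norm (x - y)"
proof -
  have "norm (\<phi> x - \<phi> y) \<le> B * norm (x - y)"
  proof (rule differentiable_bound[of UNIV \<phi> "\<lambda>x h. D x \<bullet> h"])
    show "onorm (\<lambda>h. D x \<bullet> h) \<le> B" for x
    proof (rule onorm_le)
      show "norm (D x \<bullet> h) \<le> B * norm h" for h
        using Cauchy_Schwarz_ineq2[of "D x" h] mult_right_mono[OF assms(2)[of x] norm_ge_zero[of h]] by simp
    qed
  qed (use assms in \<open>auto simp: C1_def\<close>)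
  then show ?thesis by simp
qed

lemma lborel_integral_translation:
  fixes f :: "'a::euclidean_space \<Rightarrow> real"
  assumes [measurable]: "f \<in> borel_measurable borel"
  shows "(LINT x|lborel. f (c + x)) = (LINT x|lborel. f x)"
  by (subst lborel_distr_plus[of c, symmetric], subst integral_distr) auto

lemma integrable_compact_support:
  fixes f :: "'a::euclidean_space \<Rightarrow> 'b::euclidean_space"
  assumes "continuous_on UNIV f" "compact K" "\<And>x. x \<notin> K \<Longrightarrow> f x = 0"
  shows "integrable lborel f"
proof -
  have "(\<lambda>x. indicator K x *\<^sub>R f x) = f" using assms(3) by (auto simp: indicator_def fun_eq_iff)
  moreover have "integrable lborel (\<lambda>x. indicator K x *\<^sub>R f x)"
    using assms by (intro borel_integrable_compact) (auto intro: continuous_on_subset)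
  ultimately show ?thesis by simp
qed

text \<open>Difference quotients integrate to zero by translation invariance.\<close>
lemma integral_partial_derivative:
  fixes \<Phi> :: "real^'n \<Rightarrow> real"
  assumes C: "C1 \<Phi> D" and K: "compact K" "\<And>x. x \<notin> K \<Longrightarrow> \<Phi> x = 0"
  shows "(LINT x|lborel. D x $ i) = 0"
proof -
  have D0: "D x = 0" if "x \<notin> K" for x
    by (rule C1_zero_off[OF C compact_imp_closed[OF K(1)] K(2) that])
  have cont: "continuous_on UNIV \<Phi>" "continuous_on UNIV D"
    using C by (auto intro: C1_continuous C1_continuous_grad)
  have [measurable]: "\<Phi> \<in> borel_measurable borel"  "D \<in> borel_measurable borel"
    using cont by (auto intro: borel_measurable_continuous_onI)
  obtain B where B: "B > 0" "\<And>x. norm (D x) \<le> B"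
    using compact_support_bounded[OF cont(2) K(1) D0] by auto
  obtain R where R: "R > 0" "\<And>x. x \<in> K \<Longrightarrow> norm x \<le> R"
    using compact_imp_bounded[OF K(1)] by (auto simp: bounded_pos)
  define e :: "real^'n" where "e = axis i 1"
  have ne: "norm e = 1" by (simp add: e_def)
  define h where "h k = inverse (real (Suc k))" for k
  have h: "h k > 0" "h k \<le> 1" "h \<longlonglongrightarrow> 0" for k
    using LIMSEQ_inverse_real_of_nat by (auto simp: h_def[abs_def] inverse_le_1_iff)
  define q where "q k x = (\<Phi> (h k *\<^sub>R e + x) - \<Phi> x) / h k" for k x
  have int: "integrable lborel \<Phi>" by (rule integrable_compact_support[OF cont(1) K])
  have "integrable lborel (\<lambda>x. \<Phi> (c + x))" for c
    using int by (subst (asm) lborel_distr_plus[of c, symmetric], subst (asm) integrable_distr_eq) auto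
  then have q0: "(LINT x|lborel. q k x) = 0" for k
    using int by (simp add: q_def lborel_integral_translation)
  have "(\<lambda>k. LINT x|lborel. q k x) \<longlonglongrightarrow> (LINT x|lborel. D x $ i)"
  proof (rule integral_dominated_convergence)
    \<comment> \<open>The shifts have length at most 1, so every quotient vanishes outside the ball
      of radius \<open>R + 1\<close>, and inside it the Lipschitz constant \<open>B\<close>
      dominates.\<close>
    show "integrable lborel (\<lambda>x. indicator (cball (0::real^'n) (R+1)) x *\<^sub>R B)"
      by (intro borel_integrable_compact) auto
    show "AE x in lborel. norm (q k x) \<le> indicator (cball 0 (R+1)) x *\<^sub>R B" for k
    proof (rule AE_I2)
      fix x :: "real^'n"
      show "norm (q k x) \<le> indicator (cball 0 (R+1)) x *\<^sub>R B"
      proof (cases "x \<in> cball 0 (R+1)")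
        case True
        have "\<bar>\<Phi> (h k *\<^sub>R e + x) - \<Phi> x\<bar> \<le> B * norm (h k *\<^sub>R e + x - x)"
          by (rule C1_lipschitz[OF C B(2)])
        also have "\<dots> = B * h k" using ne h(1)[of k] by simp
        finally show ?thesis using h(1)[of k] True by (simp add: q_def field_simps)
      next
        case False
        then have "x \<notin> K" using R(2)[of x] by auto
        moreover have "h k *\<^sub>R e + x \<notin> K"
        proof
          assume "h k *\<^sub>R e + x \<in> K"
          then have "norm (h k *\<^sub>R e + x) \<le> R" by (rule R)
          moreover have "norm x \<le> norm (h k *\<^sub>R e + x) + norm (h k *\<^sub>R e)"
            using norm_triangle_ineq4[of "h k *\<^sub>R e + x" "h k *\<^sub>R e"] by simp
          ultimately show False using False ne h(1,2)[of k] by simp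
        qed
        ultimately show ?thesis using K(2) False by (simp add: q_def)
      qed
    qed
    show "AE x in lborel. (\<lambda>k. q k x) \<longlonglongrightarrow> D x $ i"
    proof (rule AE_I2)
      fix x
      have "(\<Phi> has_derivative (\<lambda>h. D x \<bullet> h)) (at x)" using C by (simp add: C1_def)
      moreover have "((\<lambda>t::real. t *\<^sub>R e + x) has_derivative (\<lambda>t. t *\<^sub>R e)) (at 0)"
        by (auto intro!: derivative_eq_intros)
      ultimately have "((\<lambda>t. \<Phi> (t *\<^sub>R e + x)) has_derivative (\<lambda>t. D x \<bullet> (t *\<^sub>R e))) (at 0)"
        using has_derivative_compose[of "\<lambda>t::real. t *\<^sub>R e + x" "\<lambda>t. t *\<^sub>R e" 0 UNIV \<Phi> "\<lambda>h. D x \<bullet> h"] by simp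
      then have "((\<lambda>t. \<Phi> (t *\<^sub>R e + x)) has_real_derivative D x $ i) (at 0)"
        by (simp add: has_field_derivative_def e_def inner_axis mult.commute[of _ "D x $ i"] mult_commute_abs)
      then have "((\<lambda>t. (\<Phi> (t *\<^sub>R e + x) - \<Phi> x) / t) \<longlongrightarrow> D x $ i) (at 0)"
        by (simp add: has_field_derivative_iff)
      moreover have "filterlim h (at 0) sequentially"
        using h by (intro filterlim_atI) (auto intro!: always_eventually simp: less_imp_neq[symmetric] dest: less_imp_neq)
      ultimately have "((\<lambda>k. (\<Phi> (h k *\<^sub>R e + x) - \<Phi> x) / h k) \<longlongrightarrow> D x $ i) sequentially"
        by (rule filterlim_compose)
      then show "(\<lambda>k. q k x) \<longlonglongrightarrow> D x $ i" by (simp add: q_def)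
    qed
  qed (auto simp: q_def[abs_def] intro!: borel_measurable_continuous_onI continuous_intros cont(2))
  with q0 show ?thesis by (simp add: LIMSEQ_const_iff)
qed

text \<open>Passes between Lebesgue measure on the domain, in which the problem is posed, and
  \<open>lborel\<close>, where translation invariance is available.\<close>

lemma lebesgue_on_zero_ext:
  fixes f :: "'a::euclidean_space \<Rightarrow> 'b::euclidean_space"
  assumes [measurable]: "f \<in> borel_measurable borel" and "\<Omega> \<in> sets lebesgue" and z: "\<And>x. x \<notin> \<Omega> \<Longrightarrow> f x = 0"
  shows "(LINT x|lebesgue_on \<Omega>. f x) = (LINT x|lborel. f x)"
    "integrable (lebesgue_on \<Omega>) f \<longleftrightarrow> integrable lborel f"
proof -
  have f: "(\<lambda>x. indicator \<Omega> x *\<^sub>R f x) = f" using z by (auto simp: indicator_def fun_eq_iff)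
  have f': "f \<in> borel_measurable lborel" by simp
  show "(LINT x|lebesgue_on \<Omega>. f x) = (LINT x|lborel. f x)"
    using assms(2) by (subst integral_restrict_space) (auto simp: f integral_completion[OF f'])
  show "integrable (lebesgue_on \<Omega>) f \<longleftrightarrow> integrable lborel f"
    using assms(2) by (subst integrable_restrict_space) (auto simp: f integrable_completion[OF f'])
qed

text \<open>The product of \<open>\<phi>\<close> and \<open>\<psi>\<close> inherits the compact
  support of \<open>\<phi>\<close>, so its partial derivatives integrate to zero and no condition on
  \<open>\<psi>\<close> at the boundary arises.\<close>

lemma test_fun_by_parts:
  assumes t: "test_fun \<Omega> \<phi>" and C: "C1 \<psi> E" and \<Omega>: "open \<Omega>"
  shows "(LINT x|lebesgue_on \<Omega>. \<psi> x * grad \<phi> x $ i) = - (LINT x|lebesgue_on \<Omega>. E x $ i * \<phi> x)"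
proof -
  obtain K where K: "compact K" "K \<subseteq> \<Omega>" "\<And>x. x \<notin> K \<Longrightarrow> \<phi> x = 0" "\<And>x. x \<notin> K \<Longrightarrow> grad \<phi> x = 0"
    using t by (rule test_funE) auto
  have s: "\<Omega> \<in> sets lebesgue" using \<Omega> by (simp add: borel_open sets_completionI_sets)
  have cont: "continuous_on UNIV (\<lambda>x. \<psi> x * grad \<phi> x $ i)" "continuous_on UNIV (\<lambda>x. E x $ i * \<phi> x)"
    using C1_continuous[OF C] C1_continuous_grad[OF C] test_fun_continuous[OF t] by (auto intro!: continuous_intros)
  have int: "integrable lborel (\<lambda>x. \<psi> x * grad \<phi> x $ i)" "integrable lborel (\<lambda>x. E x $ i * \<phi> x)"
    using K by (auto intro!: integrable_compact_support[OF _ K(1)] cont)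
  have "(LINT x|lborel. (\<phi> x *\<^sub>R E x + \<psi> x *\<^sub>R grad \<phi> x) $ i) = 0"
    by (rule integral_partial_derivative[OF C1_mult[OF test_funD[OF t] C] K(1)]) (simp add: K(3))
  then have "(LINT x|lborel. \<psi> x * grad \<phi> x $ i) = - (LINT x|lborel. E x $ i * \<phi> x)"
    using int by (simp add: mult.commute add_eq_0_iff)
  moreover have "(LINT x|lebesgue_on \<Omega>. \<psi> x * grad \<phi> x $ i) = (LINT x|lborel. \<psi> x * grad \<phi> x $ i)"
    by (rule lebesgue_on_zero_ext[OF borel_measurable_continuous_onI[OF cont(1)] s]) (use test_fun_outside[OF t] in auto)
  moreover have "(LINT x|lebesgue_on \<Omega>. E x $ i * \<phi> x) = (LINT x|lborel. E x $ i * \<phi> x)"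
    by (rule lebesgue_on_zero_ext[OF borel_measurable_continuous_onI[OF cont(2)] s]) (use test_fun_outside[OF t] in auto)
  ultimately show ?thesis by simp
qed

section \<open>Weak solutions of the Poisson equation\<close>

lemma norm_Pair_sq: "(norm (a, b))\<^sup>2 = (norm a)\<^sup>2 + (norm b)\<^sup>2"
  by (simp add: norm_Pair)

lemma borel_measurable_vec_iff:
  fixes f :: "'a \<Rightarrow> real^'n"
  shows "f \<in> borel_measurable M \<longleftrightarrow> (\<forall>i. (\<lambda>x. f x $ i) \<in> borel_measurable M)"
proof -
  have "(\<forall>b\<in>Basis. (\<lambda>x. f x \<bullet> b) \<in> borel_measurable M) \<longleftrightarrow> (\<forall>i. (\<lambda>x. f x $ i) \<in> borel_measurable M)"
    by (auto simp: Basis_vec_def inner_axis)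
  then show ?thesis by (subst borel_measurable_euclidean_space)
qed

lemma sqint_pair_iff:
  "sqint M (\<lambda>x. (y x, g x)) \<longleftrightarrow> sqint M y \<and> sqint M g"
proof
  assume s: "sqint M (\<lambda>x. (y x, g x))"
  then have "(\<lambda>x. (y x, g x)) \<in> borel_measurable M" by (simp add: sqint_def)
  from measurable_compose[OF this borel_measurable_continuous_onI[OF continuous_on_fst[OF continuous_on_id]]]
    measurable_compose[OF this borel_measurable_continuous_onI[OF continuous_on_snd[OF continuous_on_id]]]
  have [measurable]: "y \<in> borel_measurable M" "g \<in> borel_measurable M" by auto
  have i: "integrable M (\<lambda>x. (norm (y x))\<^sup>2 + (norm (g x))\<^sup>2)"
    using s by (simp add: sqint_def norm_Pair_sq)
  show "sqint M y \<and> sqint M g"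
    by (auto simp: sqint_def intro!: Bochner_Integration.integrable_bound[OF i] AE_I2)
next
  assume "sqint M y \<and> sqint M g"
  then show "sqint M (\<lambda>x. (y x, g x))"
    by (auto simp: sqint_def norm_Pair_sq intro: borel_measurable_Pair)
qed

lemma l2sq_pair:
  assumes "sqint M y" "sqint M g"
  shows "l2sq M (\<lambda>x. (y x, g x)) = l2sq M y + l2sq M g"
  using assms by (simp add: l2sq_def norm_Pair_sq sqint_def)

lemma integrable_bounded:
  fixes f :: "'a \<Rightarrow> 'b::euclidean_space"
  assumes "finite_measure M" "f \<in> borel_measurable M" "AE x in M. norm (f x) \<le> B"
  shows "integrable M f"
proof -
  interpret finite_measure M by fact
  show ?thesis by (rule integrable_const_bound[OF assms(3,2)])
qed

lemma sqint_bounded: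
  fixes f :: "'a \<Rightarrow> 'b::euclidean_space"
  assumes "finite_measure M" "f \<in> borel_measurable M" "AE x in M. norm (f x) \<le> B"
  shows "sqint M f"
proof -
  have "integrable M (\<lambda>x. (norm (f x))\<^sup>2)"
  proof (rule integrable_bounded[OF assms(1)])
    show "AE x in M. norm ((norm (f x))\<^sup>2) \<le> B\<^sup>2" using assms(3)
      by eventually_elim (simp add: power_mono)
  qed (use assms in auto)
  with assms show ?thesis by (simp add: sqint_def)
qed

lemma sqint_integrable:
  fixes f :: "'a \<Rightarrow> 'b::euclidean_space"
  assumes "finite_measure M" "sqint M f"
  shows "integrable M f"
proof -
  interpret finite_measure M by fact
  show ?thesis
  proof (rule Bochner_Integration.integrable_bound)
    show "integrable M (\<lambda>x. 1 + (norm (f x))\<^sup>2)" using assms by (auto simp: sqint_def)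
    have "norm a \<le> 1 + (norm a)\<^sup>2" for a :: 'b
      using sum_squares_bound[of 1 "norm a"] norm_ge_zero[of a] by (simp del: norm_ge_zero)
    then show "AE x in M. norm (f x) \<le> norm (1 + (norm (f x))\<^sup>2)"
      by (intro AE_I2) (metis abs_of_nonneg add_nonneg_nonneg real_norm_def zero_le_one zero_le_power2)
  qed (use assms in \<open>auto simp: sqint_def\<close>)
qed

section \<open>The space H^1_0 on a bounded open set and weak solutions in it\<close>

locale bdd_dom =
  fixes \<Omega> :: "(real^'n) set"
  assumes opn: "open \<Omega>" and bdd: "bounded \<Omega>"
begin

abbreviation "M \<equiv> lebesgue_on \<Omega>"

lemma dom_sets [measurable, simp]: "\<Omega> \<in> sets lebesgue"
  using opn by (simp add: borel_open sets_completionI_sets)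

lemma fin: "finite_measure M"
proof
  have "\<Omega> \<in> lmeasurable" using opn bdd by (simp add: lmeasurable_open)
  then show "emeasure M (space M) \<noteq> \<infinity>"
    by (simp add: emeasure_restrict_space fmeasurable_def top.not_eq_extremum)
qed

lemma borel_M: "f \<in> borel_measurable borel \<Longrightarrow> f \<in> borel_measurable M"
  by (simp add: measurable_completion measurable_restrict_space1)

text \<open>Value and gradient form one square-integrable map, so that convergence in H^1 becomes
  convergence in \<open>l2sq\<close>.\<close>

definition jet :: "(real^'n \<Rightarrow> real) \<Rightarrow> real^'n \<Rightarrow> real \<times> (real^'n)" where
  "jet \<phi> x = (\<phi> x, grad \<phi> x)"

definition H0 :: "(real^'n \<Rightarrow> real) \<Rightarrow> (real^'n \<Rightarrow> real^'n) \<Rightarrow> bool" where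
  "H0 y g \<longleftrightarrow> sqint M y \<and> sqint M g \<and> (\<exists>\<phi>. (\<forall>k::nat. test_fun \<Omega> (\<phi> k)) \<and>
     (\<lambda>k. l2sq M (\<lambda>x. jet (\<phi> k) x - (y x, g x))) \<longlonglongrightarrow> 0)"

lemma test_fun_meas: "test_fun \<Omega> \<phi> \<Longrightarrow> \<phi> \<in> borel_measurable M" "test_fun \<Omega> \<phi> \<Longrightarrow> grad \<phi> \<in> borel_measurable M"
  by (auto intro: borel_M test_fun_borel test_fun_grad_borel)

lemma test_fun_sqint:
  assumes "test_fun \<Omega> \<phi>" shows "sqint M \<phi>" "sqint M (grad \<phi>)"
proof -
  obtain B where B: "\<And>x. \<bar>\<phi> x\<bar> \<le> B \<and> norm (grad \<phi> x) \<le> B" using test_fun_bounded[OF assms] by auto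
  then show "sqint M \<phi>" "sqint M (grad \<phi>)"
    using test_fun_meas[OF assms] by (auto intro!: sqint_bounded[OF fin, where B=B])
qed

lemma H0_sqint: "H0 y g \<Longrightarrow> sqint M y" "H0 y g \<Longrightarrow> sqint M g" "H0 y g \<Longrightarrow> sqint M (\<lambda>x. (y x, g x))"
  by (auto simp: H0_def sqint_pair_iff)

text \<open>The pointwise convergence is bought by passing to a subsequence; it is what nonlinear
  expressions in the approximating functions require.\<close>

lemma H0_approx:
  assumes "H0 y g"
  obtains \<phi> where "\<And>k::nat. test_fun \<Omega> (\<phi> k)" "(\<lambda>k. l2sq M (\<lambda>x. \<phi> k x - y x)) \<longlonglongrightarrow> 0"
    "(\<lambda>k. l2sq M (\<lambda>x. grad (\<phi> k) x - g x)) \<longlonglongrightarrow> 0"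
    "AE x in M. (\<lambda>k. \<phi> k x) \<longlonglongrightarrow> y x"
proof -
  obtain \<psi> where \<psi>: "\<And>k::nat. test_fun \<Omega> (\<psi> k)" "(\<lambda>k. l2sq M (\<lambda>x. jet (\<psi> k) x - (y x, g x))) \<longlonglongrightarrow> 0"
    using assms by (auto simp: H0_def)
  have eq: "l2sq M (\<lambda>x. jet (\<psi> k) x - (y x, g x)) = l2sq M (\<lambda>x. \<psi> k x - y x) + l2sq M (\<lambda>x. grad (\<psi> k) x - g x)" for k
    using l2sq_pair[OF sqint_diff[OF test_fun_sqint(1)[OF \<psi>(1)] H0_sqint(1)[OF assms]] sqint_diff[OF test_fun_sqint(2)[OF \<psi>(1)] H0_sqint(2)[OF assms]]]
    by (simp add: jet_def)
  have 1: "(\<lambda>k. l2sq M (\<lambda>x. \<psi> k x - y x)) \<longlonglongrightarrow> 0"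
    by (rule tendsto_sandwich[OF _ _ tendsto_const \<psi>(2)]) (auto simp: eq)
  have 2: "(\<lambda>k. l2sq M (\<lambda>x. grad (\<psi> k) x - g x)) \<longlonglongrightarrow> 0"
    by (rule tendsto_sandwich[OF _ _ tendsto_const \<psi>(2)]) (auto simp: eq)
  obtain r where r: "strict_mono r" "AE x in M. (\<lambda>k. \<psi> (r k) x) \<longlonglongrightarrow> y x"
    using l2_AE_subseq[OF test_fun_sqint(1)[OF \<psi>(1)] H0_sqint(1)[OF assms] 1] by blast
  show ?thesis
    using that[of "\<lambda>k. \<psi> (r k)"] \<psi>(1) r LIMSEQ_subseq_LIMSEQ[OF 1 r(1)] LIMSEQ_subseq_LIMSEQ[OF 2 r(1)]
    by (simp add: o_def)
qed

lemma H0_approx':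
  assumes "H0 y g"
  obtains \<phi> where "\<And>k::nat. test_fun \<Omega> (\<phi> k)" "(\<lambda>k. l2sq M (\<lambda>x. \<phi> k x - y x)) \<longlonglongrightarrow> 0"
    "(\<lambda>k. l2sq M (\<lambda>x. grad (\<phi> k) x - g x)) \<longlonglongrightarrow> 0"
  by (rule H0_approx[OF assms]) (rule that)

lemma H0I:
  assumes "\<And>k::nat. test_fun \<Omega> (\<phi> k)" "sqint M y" "sqint M g" "(\<lambda>k. l2sq M (\<lambda>x. \<phi> k x - y x)) \<longlonglongrightarrow> 0"
    "(\<lambda>k. l2sq M (\<lambda>x. grad (\<phi> k) x - g x)) \<longlonglongrightarrow> 0"
  shows "H0 y g"
proof -
  have eq: "l2sq M (\<lambda>x. jet (\<phi> k) x - (y x, g x)) = l2sq M (\<lambda>x. \<phi> k x - y x) + l2sq M (\<lambda>x. grad (\<phi> k) x - g x)" for k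
    using l2sq_pair[OF sqint_diff[OF test_fun_sqint(1)[OF assms(1)] assms(2)] sqint_diff[OF test_fun_sqint(2)[OF assms(1)] assms(3)]]
    by (simp add: jet_def)
  have "(\<lambda>k. l2sq M (\<lambda>x. jet (\<phi> k) x - (y x, g x))) \<longlonglongrightarrow> 0 + 0"
    unfolding eq using assms by (intro tendsto_add)
  with assms show ?thesis unfolding H0_def by (intro conjI exI[of _ \<phi>]) auto
qed

text \<open>Diagonal choice: a test function within 1/(k+1) of the k-th member, measured by the
  squared distances of values and gradients.\<close>

lemma H0_limit:
  assumes H: "\<And>k::nat. H0 (y k) (g k)" and s: "sqint M y'" "sqint M g'"
    and l: "(\<lambda>k. l2sq M (\<lambda>x. y k x - y' x)) \<longlonglongrightarrow> 0" "(\<lambda>k. l2sq M (\<lambda>x. g k x - g' x)) \<longlonglongrightarrow> 0"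
  shows "H0 y' g'"
proof -
  have ex: "\<exists>\<phi>. test_fun \<Omega> \<phi> \<and> l2sq M (\<lambda>x. \<phi> x - y k x) < inverse (Suc k) \<and> l2sq M (\<lambda>x. grad \<phi> x - g k x) < inverse (Suc k)" for k
  proof -
    obtain \<phi> where \<phi>: "\<And>j::nat. test_fun \<Omega> (\<phi> j)" "(\<lambda>j. l2sq M (\<lambda>x. \<phi> j x - y k x)) \<longlonglongrightarrow> 0"
      "(\<lambda>j. l2sq M (\<lambda>x. grad (\<phi> j) x - g k x)) \<longlonglongrightarrow> 0"
      using H[of k] by (rule H0_approx') (rule that)
    have "\<forall>\<^sub>F j in sequentially. l2sq M (\<lambda>x. \<phi> j x - y k x) < inverse (Suc k) \<and> l2sq M (\<lambda>x. grad (\<phi> j) x - g k x) < inverse (Suc k)"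
      using order_tendstoD(2)[OF \<phi>(2), of "inverse (Suc k)"] order_tendstoD(2)[OF \<phi>(3), of "inverse (Suc k)"]
      by (intro eventually_conj) auto
    then obtain j where "l2sq M (\<lambda>x. \<phi> j x - y k x) < inverse (Suc k) \<and> l2sq M (\<lambda>x. grad (\<phi> j) x - g k x) < inverse (Suc k)"
      by (auto dest: eventually_happens)
    with \<phi>(1) show ?thesis by (intro exI[of _ "\<phi> j"]) auto
  qed
  have "\<forall>k. \<exists>\<phi>. test_fun \<Omega> \<phi> \<and> l2sq M (\<lambda>x. \<phi> x - y k x) < inverse (Suc k) \<and> l2sq M (\<lambda>x. grad \<phi> x - g k x) < inverse (Suc k)"
    using ex by (rule allI)
  from choice[OF this] obtain \<phi> where "\<forall>k. test_fun \<Omega> (\<phi> k) \<and> l2sq M (\<lambda>x. \<phi> k x - y k x) < inverse (Suc k) \<and>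
    l2sq M (\<lambda>x. grad (\<phi> k) x - g k x) < inverse (Suc k)" by (elim exE) (rule that)
  then have \<phi>: "\<And>k. test_fun \<Omega> (\<phi> k)" "\<And>k. l2sq M (\<lambda>x. \<phi> k x - y k x) < inverse (Suc k)"
    "\<And>k. l2sq M (\<lambda>x. grad (\<phi> k) x - g k x) < inverse (Suc k)" by auto
  have z: "(\<lambda>k. 2 * inverse (real (Suc k)) + 2 * a k) \<longlonglongrightarrow> 0" if "a \<longlonglongrightarrow> 0" for a :: "nat \<Rightarrow> real"
    using tendsto_add[OF tendsto_mult_right_zero[OF LIMSEQ_inverse_real_of_nat, of 2] tendsto_mult_right_zero[OF that, of 2]] by simp
  show ?thesis
  proof (rule H0I[OF \<phi>(1) s])
    show "(\<lambda>k. l2sq M (\<lambda>x. \<phi> k x - y' x)) \<longlonglongrightarrow> 0"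
    proof (rule tendsto_sandwich[OF _ _ tendsto_const z[OF l(1)]])
      have "l2sq M (\<lambda>x. \<phi> k x - y' x) \<le> 2 * inverse (real (Suc k)) + 2 * l2sq M (\<lambda>x. y k x - y' x)" for k
        by (rule order_trans[OF l2sq_triangle[OF test_fun_sqint(1)[OF \<phi>(1)[of k]] H0_sqint(1)[OF H[of k]] s(1)]])
          (intro add_right_mono mult_left_mono less_imp_le[OF \<phi>(2)[of k]] zero_le_numeral)
      then show "\<forall>\<^sub>F k in sequentially. l2sq M (\<lambda>x. \<phi> k x - y' x) \<le> 2 * inverse (real (Suc k)) + 2 * l2sq M (\<lambda>x. y k x - y' x)"
        by (intro always_eventually allI)
    qed simp
    show "(\<lambda>k. l2sq M (\<lambda>x. grad (\<phi> k) x - g' x)) \<longlonglongrightarrow> 0"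
    proof (rule tendsto_sandwich[OF _ _ tendsto_const z[OF l(2)]])
      have "l2sq M (\<lambda>x. grad (\<phi> k) x - g' x) \<le> 2 * inverse (real (Suc k)) + 2 * l2sq M (\<lambda>x. g k x - g' x)" for k
        by (rule order_trans[OF l2sq_triangle[OF test_fun_sqint(2)[OF \<phi>(1)[of k]] H0_sqint(2)[OF H[of k]] s(2)]])
          (intro add_right_mono mult_left_mono less_imp_le[OF \<phi>(3)[of k]] zero_le_numeral)
      then show "\<forall>\<^sub>F k in sequentially. l2sq M (\<lambda>x. grad (\<phi> k) x - g' x) \<le> 2 * inverse (real (Suc k)) + 2 * l2sq M (\<lambda>x. g k x - g' x)"
        by (intro always_eventually allI)
    qed simp
  qed
qed

lemma H0_lin:
  assumes "H0 y g" "H0 z h"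
  shows "H0 (\<lambda>x. y x + c * z x) (\<lambda>x. g x + c *\<^sub>R h x)"
proof -
  obtain \<phi> where \<phi>: "\<And>k::nat. test_fun \<Omega> (\<phi> k)" "(\<lambda>k. l2sq M (\<lambda>x. \<phi> k x - y x)) \<longlonglongrightarrow> 0"
      "(\<lambda>k. l2sq M (\<lambda>x. grad (\<phi> k) x - g x)) \<longlonglongrightarrow> 0" using assms(1) by (rule H0_approx') (rule that)
  obtain \<psi> where \<psi>: "\<And>k::nat. test_fun \<Omega> (\<psi> k)" "(\<lambda>k. l2sq M (\<lambda>x. \<psi> k x - z x)) \<longlonglongrightarrow> 0"
      "(\<lambda>k. l2sq M (\<lambda>x. grad (\<psi> k) x - h x)) \<longlonglongrightarrow> 0" using assms(2) by (rule H0_approx') (rule that)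
  note s = H0_sqint(1,2)[OF assms(1)] H0_sqint(1,2)[OF assms(2)]
    test_fun_sqint[OF \<phi>(1)] test_fun_sqint[OF \<psi>(1)]
  have key: "(\<lambda>k. l2sq M (\<lambda>x. (a k x + c *\<^sub>R b k x) - (a' x + c *\<^sub>R b' x))) \<longlonglongrightarrow> 0"
    if "\<And>k. sqint M (a k)" "sqint M a'" "\<And>k. sqint M (b k)" "sqint M b'" "(\<lambda>k. l2sq M (\<lambda>x. a k x - a' x)) \<longlonglongrightarrow> 0"
      "(\<lambda>k. l2sq M (\<lambda>x. b k x - b' x)) \<longlonglongrightarrow> 0" for a b :: "nat \<Rightarrow> real^'n \<Rightarrow> 'e::euclidean_space" and a' b'
  proof (rule tendsto_sandwich[OF _ _ tendsto_const])
    have "l2sq M (\<lambda>x. (a k x + c *\<^sub>R b k x) - (a' x + c *\<^sub>R b' x)) \<le> 2 * l2sq M (\<lambda>x. a k x - a' x) + 2 * (c\<^sup>2 * l2sq M (\<lambda>x. b k x - b' x))" for k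
    proof -
      have "(\<lambda>x. (a k x + c *\<^sub>R b k x) - (a' x + c *\<^sub>R b' x)) = (\<lambda>x. (a k x - a' x) + c *\<^sub>R (b k x - b' x))"
        by (simp add: fun_eq_iff algebra_simps)
      then show ?thesis
        using l2sq_add_le[OF sqint_diff[OF that(1,2)] sqint_scaleR[OF sqint_diff[OF that(3,4)]], of k c k] by (simp only: l2sq_scaleR)
    qed
    then show "\<forall>\<^sub>F k in sequentially. l2sq M (\<lambda>x. (a k x + c *\<^sub>R b k x) - (a' x + c *\<^sub>R b' x)) \<le> 2 * l2sq M (\<lambda>x. a k x - a' x) + 2 * (c\<^sup>2 * l2sq M (\<lambda>x. b k x - b' x))"
      by (intro always_eventually allI)
    show "(\<lambda>k. 2 * l2sq M (\<lambda>x. a k x - a' x) + 2 * (c\<^sup>2 * l2sq M (\<lambda>x. b k x - b' x))) \<longlonglongrightarrow> 0"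
      using tendsto_add[OF tendsto_mult_right_zero[OF that(5), of 2] tendsto_mult_right_zero[OF tendsto_mult_right_zero[OF that(6), of "c\<^sup>2"], of 2]]
      by simp
  qed simp
  show ?thesis
  proof (rule H0I)
    show "test_fun \<Omega> (\<lambda>x. \<phi> k x + c * \<psi> k x)" for k by (rule test_fun_add[OF \<phi>(1) \<psi>(1)])
    show "sqint M (\<lambda>x. y x + c * z x)" "sqint M (\<lambda>x. g x + c *\<^sub>R h x)"
      using s sqint_add[OF s(1) sqint_scaleR[OF s(3), of c]] by (auto intro: sqint_add sqint_scaleR)
    show "(\<lambda>k. l2sq M (\<lambda>x. \<phi> k x + c * \<psi> k x - (y x + c * z x))) \<longlonglongrightarrow> 0"
      using key[OF s(5) s(1) s(7) s(3) \<phi>(2) \<psi>(2)] by simp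
    show "(\<lambda>k. l2sq M (\<lambda>x. grad (\<lambda>x. \<phi> k x + c * \<psi> k x) x - (g x + c *\<^sub>R h x))) \<longlonglongrightarrow> 0"
      unfolding test_fun_add(2)[OF \<phi>(1) \<psi>(1)]
      using key[OF s(6) s(2) s(8) s(4) \<phi>(3) \<psi>(3)] by simp
  qed
qed

text \<open>Integrating \<open>\<phi>^2\<close> by parts against the coordinate function
  \<open>x $ i\<close> gives a product of \<open>\<phi>\<close> and its gradient with factor at most
  2R. Young's inequality absorbs half of \<open>l2sq M \<phi>\<close>, which leaves the constant 4
  R^2.\<close>

lemma Poincare_test: "\<exists>C>0. \<forall>\<phi>. test_fun \<Omega> \<phi> \<longrightarrow> l2sq M \<phi> \<le> C * l2sq M (grad \<phi>)"
proof -
  obtain R where R: "R > 0" "\<And>x. x \<in> \<Omega> \<Longrightarrow> norm x \<le> R" using bdd by (auto simp: bounded_pos)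
  \<comment> \<open>Any single coordinate direction will do.\<close>
  define i :: 'n where "i = undefined"
  have "l2sq M \<phi> \<le> (4 * R\<^sup>2) * l2sq M (grad \<phi>)" if t: "test_fun \<Omega> \<phi>" for \<phi>
  proof -
    have t2: "test_fun \<Omega> (\<lambda>x. \<phi> x * \<phi> x)" and g2: "grad (\<lambda>x. \<phi> x * \<phi> x) = (\<lambda>x. \<phi> x *\<^sub>R grad \<phi> x + \<phi> x *\<^sub>R grad \<phi> x)"
      using test_fun_mult_C1[OF t test_funD[OF t]] by auto
    have "l2sq M \<phi> = - (LINT x|M. x $ i * grad (\<lambda>x. \<phi> x * \<phi> x) x $ i)"
      unfolding test_fun_by_parts[OF t2 C1_component opn] by (simp add: l2sq_def power2_eq_square)
    also have "\<dots> = (LINT x|M. - (x $ i * grad (\<lambda>x. \<phi> x * \<phi> x) x $ i))" by simp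
    also have "\<dots> \<le> (LINT x|M. 1/2 * (norm (\<phi> x))\<^sup>2 + 2 * R\<^sup>2 * (norm (grad \<phi> x))\<^sup>2)"
    proof (rule integral_mono)
      show i2: "integrable M (\<lambda>x. 1/2 * (norm (\<phi> x))\<^sup>2 + 2 * R\<^sup>2 * (norm (grad \<phi> x))\<^sup>2)"
        using test_fun_sqint[OF t] by (auto simp: sqint_def)
      have b: "\<bar>x $ i * grad (\<lambda>x. \<phi> x * \<phi> x) x $ i\<bar> \<le> 1/2 * (norm (\<phi> x))\<^sup>2 + 2 * R\<^sup>2 * (norm (grad \<phi> x))\<^sup>2" if "x \<in> \<Omega>" for x
      proof -
        have "\<bar>x $ i\<bar> \<le> R" using R(2)[OF that] component_le_norm_cart[of x i] by linarith
        moreover have "\<bar>grad \<phi> x $ i\<bar> \<le> norm (grad \<phi> x)" by (rule component_le_norm_cart)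
        ultimately have "\<bar>x $ i\<bar> * \<bar>grad \<phi> x $ i\<bar> \<le> R * norm (grad \<phi> x)"
          using R(1) by (intro mult_mono) auto
        then have "\<bar>x $ i * grad (\<lambda>x. \<phi> x * \<phi> x) x $ i\<bar> \<le> 2 * (\<bar>\<phi> x\<bar> * (R * norm (grad \<phi> x)))"
          using mult_left_mono[of "\<bar>x $ i\<bar> * \<bar>grad \<phi> x $ i\<bar>" "R * norm (grad \<phi> x)" "\<bar>\<phi> x\<bar>"]
          by (simp add: g2 abs_mult flip: mult_2) (simp add: mult_ac)
        also have "\<dots> \<le> 1/2 * \<bar>\<phi> x\<bar>\<^sup>2 + 2 * (R * norm (grad \<phi> x))\<^sup>2"
          using zero_le_power2[of "\<bar>\<phi> x\<bar> - 2 * (R * norm (grad \<phi> x))"]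
          unfolding power2_diff by (simp add: power_mult_distrib field_simps)
        finally show ?thesis by (simp add: power_mult_distrib)
      qed
      show "integrable M (\<lambda>x. - (x $ i * grad (\<lambda>x. \<phi> x * \<phi> x) x $ i))"
      proof (rule Bochner_Integration.integrable_bound[OF i2])
        have "(\<lambda>x. grad (\<lambda>x. \<phi> x * \<phi> x) x $ i) \<in> borel_measurable M"
          using test_fun_meas(2)[OF t2] borel_measurable_vec_iff by auto
        moreover have "(\<lambda>x::real^'n. x $ i) \<in> borel_measurable M"
          by (intro borel_M borel_measurable_continuous_onI continuous_intros)
        ultimately show "(\<lambda>x. - (x $ i * grad (\<lambda>x. \<phi> x * \<phi> x) x $ i)) \<in> borel_measurable M" by simp
        show "AE x in M. norm (- (x $ i * grad (\<lambda>x. \<phi> x * \<phi> x) x $ i)) \<le> norm (1/2 * (norm (\<phi> x))\<^sup>2 + 2 * R\<^sup>2 * (norm (grad \<phi> x))\<^sup>2)"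
        proof (rule AE_I2)
          fix x assume "x \<in> space M"
          then show "norm (- (x $ i * grad (\<lambda>x. \<phi> x * \<phi> x) x $ i)) \<le> norm (1/2 * (norm (\<phi> x))\<^sup>2 + 2 * R\<^sup>2 * (norm (grad \<phi> x))\<^sup>2)"
            using b[of x] by simp
        qed
      qed
      show "- (x $ i * grad (\<lambda>x. \<phi> x * \<phi> x) x $ i) \<le> 1/2 * (norm (\<phi> x))\<^sup>2 + 2 * R\<^sup>2 * (norm (grad \<phi> x))\<^sup>2" if "x \<in> space M" for x
        using b[of x] that by auto
    qed
    also have "\<dots> = 1/2 * l2sq M \<phi> + 2 * R\<^sup>2 * l2sq M (grad \<phi>)"
      using test_fun_sqint[OF t] by (simp add: sqint_def l2sq_def)
    finally show ?thesis by simp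
  qed
  then show ?thesis using R(1) by (intro exI[of _ "4 * R\<^sup>2"]) auto
qed

lemma Poincare: "\<exists>C>0. \<forall>y g. H0 y g \<longrightarrow> l2sq M y \<le> C * l2sq M g"
proof -
  obtain C where C: "C > 0" "\<And>\<phi>. test_fun \<Omega> \<phi> \<Longrightarrow> l2sq M \<phi> \<le> C * l2sq M (grad \<phi>)"
    using Poincare_test by auto
  have "l2sq M y \<le> C * l2sq M g" if H: "H0 y g" for y g
  proof -
    obtain \<phi> where \<phi>: "\<And>k::nat. test_fun \<Omega> (\<phi> k)" "(\<lambda>k. l2sq M (\<lambda>x. \<phi> k x - y x)) \<longlonglongrightarrow> 0"
        "(\<lambda>k. l2sq M (\<lambda>x. grad (\<phi> k) x - g x)) \<longlonglongrightarrow> 0" using H by (rule H0_approx') (rule that)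
    show ?thesis
      using C(2)[OF \<phi>(1)]
      by (intro LIMSEQ_le[OF l2sq_tendsto[OF test_fun_sqint(1)[OF \<phi>(1)] H0_sqint(1)[OF H] \<phi>(2)]
          tendsto_mult_left[OF l2sq_tendsto[OF test_fun_sqint(2)[OF \<phi>(1)] H0_sqint(2)[OF H] \<phi>(3)]]]) auto
  qed
  with C(1) show ?thesis by auto
qed

lemma H0_weak_grad:
  assumes H: "H0 y g" and t: "test_fun \<Omega> \<psi>"
  shows "(LINT x|M. y x * grad \<psi> x $ i) = - (LINT x|M. g x $ i * \<psi> x)"
proof -
  obtain \<phi> where \<phi>: "\<And>k::nat. test_fun \<Omega> (\<phi> k)" "(\<lambda>k. l2sq M (\<lambda>x. \<phi> k x - y x)) \<longlonglongrightarrow> 0"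
      "(\<lambda>k. l2sq M (\<lambda>x. grad (\<phi> k) x - g x)) \<longlonglongrightarrow> 0" using H by (rule H0_approx') (rule that)
  have sp: "sqint M (\<lambda>x. \<psi> x *\<^sub>R axis i (1::real))"
  proof -
    have "norm (\<psi> x *\<^sub>R axis i (1::real)) = norm (\<psi> x)" for x by simp
    then show ?thesis using test_fun_sqint(1)[OF t] by (auto simp: sqint_def intro: borel_measurable_scaleR)
  qed
  have sg: "sqint M (\<lambda>x. grad \<psi> x $ i)"
  proof -
    have m: "(\<lambda>x. grad \<psi> x $ i) \<in> borel_measurable M" using test_fun_meas(2)[OF t] borel_measurable_vec_iff by auto
    obtain B where "\<And>x. norm (grad \<psi> x) \<le> B" using test_fun_bounded[OF t] by auto
    then have "norm (grad \<psi> x $ i) \<le> B" for x using component_le_norm_cart[of "grad \<psi> x" i] by (metis order_trans real_norm_def)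
    then show ?thesis by (intro sqint_bounded[OF fin m, of B]) auto
  qed
  have "(\<lambda>k. LINT x|M. \<phi> k x \<bullet> grad \<psi> x $ i) \<longlonglongrightarrow> (LINT x|M. y x \<bullet> grad \<psi> x $ i)"
    by (rule l2_inner_tendsto_left[OF test_fun_sqint(1)[OF \<phi>(1)] H0_sqint(1)[OF H] sg \<phi>(2)])
  moreover have "(LINT x|M. \<phi> k x \<bullet> grad \<psi> x $ i) = - (LINT x|M. grad (\<phi> k) x \<bullet> (\<psi> x *\<^sub>R axis i 1))" for k
    using test_fun_by_parts[OF t test_funD[OF \<phi>(1)] opn, of k i] by (simp add: inner_axis mult.commute)
  moreover have "(\<lambda>k. LINT x|M. grad (\<phi> k) x \<bullet> (\<psi> x *\<^sub>R axis i 1)) \<longlonglongrightarrow> (LINT x|M. g x \<bullet> (\<psi> x *\<^sub>R axis i 1))"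
    by (rule l2_inner_tendsto_left[OF test_fun_sqint(2)[OF \<phi>(1)] H0_sqint(2)[OF H] sp \<phi>(3)])
  ultimately have "(LINT x|M. y x \<bullet> grad \<psi> x $ i) = - (LINT x|M. g x \<bullet> (\<psi> x *\<^sub>R axis i 1))"
    using LIMSEQ_unique[OF _ tendsto_minus] by simp
  then show ?thesis by (simp add: inner_axis mult.commute)
qed

text \<open>The weak gradient identity passes from test functions to their limits, and square
  integrability of all components of the gradient amounts to that of its norm.\<close>

lemma H10_iff: "H10 \<Omega> y g \<longleftrightarrow> H0 y g"
proof -
  have L2_iff: "L2 \<Omega> u \<longleftrightarrow> sqint M u" for u by (simp add: L2_def sqint_def)
  have sg: "(\<forall>i. sqint M (\<lambda>x. g x $ i)) \<longleftrightarrow> sqint M g"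
  proof -
    have n: "(norm (g x))\<^sup>2 = (\<Sum>i\<in>UNIV. (norm (g x $ i))\<^sup>2)" for x
      by (simp add: norm_vec_def L2_set_def sum_nonneg)
    show ?thesis
    proof
      assume "\<forall>i. sqint M (\<lambda>x. g x $ i)"
      then show "sqint M g" unfolding sqint_def n borel_measurable_vec_iff by auto
    next
      assume s: "sqint M g"
      then have "(\<lambda>x. g x $ i) \<in> borel_measurable M" for i by (simp add: sqint_def borel_measurable_vec_iff)
      moreover have "norm (norm (g x $ i) ^ 2) \<le> norm ((norm (g x))\<^sup>2)" for x i
        using component_le_norm_cart[of "g x" i] by (simp flip: abs_le_square_iff)
      ultimately show "\<forall>i. sqint M (\<lambda>x. g x $ i)"
        using s by (auto simp: sqint_def intro!: Bochner_Integration.integrable_bound[where f="\<lambda>x. (norm (g x))\<^sup>2"])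
    qed
  qed
  have eq: "l2sq M (\<lambda>x. jet \<phi> x - (y x, g x)) = (LINT x|M. (\<phi> x - y x)\<^sup>2 + (norm (grad \<phi> x - g x))\<^sup>2)" for \<phi>
    by (simp add: l2sq_def jet_def norm_Pair_sq)
  show ?thesis
  proof
    assume "H10 \<Omega> y g"
    then show "H0 y g" unfolding H10_def H0_def eq L2_iff sg by blast
  next
    assume H: "H0 y g"
    then have "weak_grad \<Omega> y g" unfolding weak_grad_def using H0_weak_grad by blast
    with H show "H10 \<Omega> y g" unfolding H10_def H0_def eq L2_iff sg by blast
  qed
qed

text \<open>The right-hand side is only required to be integrable, because \<open>f x 0\<close>
  belongs to L^p with p > n/2 and p may be below 2. Testing is therefore restricted to the bounded
  functions of \<open>test_fun\<close>.\<close>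

definition wsol :: "(real^'n \<Rightarrow> real) \<Rightarrow> (real^'n \<Rightarrow> real^'n) \<Rightarrow> (real^'n \<Rightarrow> real) \<Rightarrow> bool" where
  "wsol y g r \<longleftrightarrow> H0 y g \<and> integrable M r \<and>
     (\<forall>\<phi>. test_fun \<Omega> \<phi> \<longrightarrow> (LINT x|M. g x \<bullet> grad \<phi> x) = (LINT x|M. r x * \<phi> x))"

lemma integrable_mult_bounded:
  fixes r b :: "real^'n \<Rightarrow> real"
  assumes "integrable M r" "b \<in> borel_measurable M" "AE x in M. \<bar>b x\<bar> \<le> B"
  shows "integrable M (\<lambda>x. r x * b x)"
proof (rule Bochner_Integration.integrable_bound)
  show "integrable M (\<lambda>x. B * r x)" using assms by simp
  show "AE x in M. norm (r x * b x) \<le> norm (B * r x)"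
    using assms(3)
  proof eventually_elim
    case (elim x)
    then show ?case using mult_left_mono[of "\<bar>b x\<bar>" "\<bar>B\<bar>" "\<bar>r x\<bar>"] by (auto simp: abs_mult mult.commute)
  qed
qed (use assms in auto)

lemma integrable_mult_test:
  assumes "integrable M r" "test_fun \<Omega> \<phi>"
  shows "integrable M (\<lambda>x. r x * \<phi> x)"
proof -
  obtain B where "\<And>x. \<bar>\<phi> x\<bar> \<le> B" using test_fun_bounded[OF assms(2)] by auto
  then show ?thesis using assms test_fun_meas(1) by (auto intro!: integrable_mult_bounded[where B=B])
qed

lemma wsol_lin:
  assumes "wsol y g r" "wsol z h q"
  shows "wsol (\<lambda>x. y x + c * z x) (\<lambda>x. g x + c *\<^sub>R h x) (\<lambda>x. r x + c * q x)"
proof -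
  have "(LINT x|M. (g x + c *\<^sub>R h x) \<bullet> grad \<phi> x) = (LINT x|M. (r x + c * q x) * \<phi> x)" if t: "test_fun \<Omega> \<phi>" for \<phi>
  proof -
    have "integrable M (\<lambda>x. g x \<bullet> grad \<phi> x)" "integrable M (\<lambda>x. h x \<bullet> grad \<phi> x)"
      "integrable M (\<lambda>x. r x * \<phi> x)" "integrable M (\<lambda>x. q x * \<phi> x)"
      using assms t by (auto simp: wsol_def intro!: sqint_inner integrable_mult_test dest: H0_sqint test_fun_sqint)
    then show ?thesis
      using assms t by (simp add: wsol_def inner_add_left distrib_right mult.assoc)
  qed
  with assms show ?thesis by (auto simp: wsol_def intro: H0_lin)
qed

lemma wsol_diff:
  assumes "wsol y g r" "wsol z h q"
  shows "wsol (\<lambda>x. y x - z x) (\<lambda>x. g x - h x) (\<lambda>x. r x - q x)"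
  using wsol_lin[OF assms, of "-1"] by simp

lemma wsol_cong_rhs:
  assumes "wsol y g r" "AE x in M. r x = q x" "q \<in> borel_measurable M"
  shows "wsol y g q"
proof -
  have "integrable M q" using assms by (auto simp: wsol_def intro: integrable_cong_AE_imp)
  moreover have "(LINT x|M. r x * \<phi> x) = (LINT x|M. q x * \<phi> x)" if "test_fun \<Omega> \<phi>" for \<phi>
    using assms test_fun_meas(1)[OF that] by (intro integral_cong_AE) (auto simp: wsol_def)
  ultimately show ?thesis using assms(1) by (simp add: wsol_def)
qed

text \<open>For a square-integrable right-hand side the equation extends to all of H^1_0 by density;
  in particular it may be tested with the solution itself, which is the energy identity.\<close>

lemma wsol_test_H0:
  assumes w: "wsol y g r" and r: "sqint M r" and z: "H0 z h"
  shows "(LINT x|M. g x \<bullet> h x) = (LINT x|M. r x * z x)"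
proof -
  obtain \<phi> where \<phi>: "\<And>k::nat. test_fun \<Omega> (\<phi> k)" "(\<lambda>k. l2sq M (\<lambda>x. \<phi> k x - z x)) \<longlonglongrightarrow> 0"
      "(\<lambda>k. l2sq M (\<lambda>x. grad (\<phi> k) x - h x)) \<longlonglongrightarrow> 0" using z by (rule H0_approx') (rule that)
  have g: "sqint M g" using w by (auto simp: wsol_def dest: H0_sqint)
  have "(\<lambda>k. LINT x|M. grad (\<phi> k) x \<bullet> g x) \<longlonglongrightarrow> (LINT x|M. h x \<bullet> g x)"
    by (rule l2_inner_tendsto_left[OF test_fun_sqint(2)[OF \<phi>(1)] H0_sqint(2)[OF z] g \<phi>(3)])
  moreover have "(\<lambda>k. LINT x|M. \<phi> k x \<bullet> r x) \<longlonglongrightarrow> (LINT x|M. z x \<bullet> r x)"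
    by (rule l2_inner_tendsto_left[OF test_fun_sqint(1)[OF \<phi>(1)] H0_sqint(1)[OF z] r \<phi>(2)])
  moreover have "(LINT x|M. grad (\<phi> k) x \<bullet> g x) = (LINT x|M. \<phi> k x \<bullet> r x)" for k
    using w \<phi>(1)[of k] by (simp add: wsol_def inner_commute mult.commute)
  ultimately have "(LINT x|M. h x \<bullet> g x) = (LINT x|M. z x \<bullet> r x)"
    using LIMSEQ_unique by simp
  then show ?thesis by (simp add: inner_commute mult.commute)
qed

end

section \<open>Pointwise bounds from potential estimates\<close>

text \<open>Vitali covering: a bound on ball averages passes to open sets, hence to almost every point.\<close>
lemma ball_average_bound:
  fixes f :: "'a::euclidean_space \<Rightarrow> real"
  assumes \<Omega>: "open \<Omega>" "bounded \<Omega>" and f: "f \<in> borel_measurable (lebesgue_on \<Omega>)" and A: "A \<ge> 0"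
    and avg: "\<And>x \<epsilon>. cball x \<epsilon> \<subseteq> \<Omega> \<Longrightarrow> 0 < \<epsilon> \<Longrightarrow> \<epsilon> \<le> 1 \<Longrightarrow>
       (\<integral>\<^sup>+y. ennreal (f y) * indicator (cball x \<epsilon>) y \<partial>lebesgue_on \<Omega>) \<le> ennreal A * emeasure lebesgue (cball x \<epsilon>)"
  shows "AE x in lebesgue_on \<Omega>. f x \<le> A"
proof -
  have sets: "\<Omega> \<in> sets lebesgue" using \<Omega> by (simp add: borel_open sets_completionI_sets)
  have open_sets: "T \<in> sets lebesgue" if "open T" for T :: "'a set"
    using that by (simp add: borel_open sets_completionI_sets)
  \<comment> \<open>The conversion to \<open>ennreal\<close> discards the negative part of
    \<open>f\<close>, so \<open>F\<close> is a density on the whole space.\<close>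
  define F where "F x = indicator \<Omega> x * ennreal (f x)" for x
  have Fm: "F \<in> borel_measurable lebesgue"
  proof -
    have "(\<lambda>x. ennreal (f x)) \<in> borel_measurable (lebesgue_on \<Omega>)" using f by simp
    then show ?thesis using sets
      by (subst (asm) borel_measurable_restrict_space_iff_ennreal) (auto simp: F_def[abs_def] mult.commute)
  qed
  define \<nu> where "\<nu> = density lebesgue F"
  have \<nu>_sets: "sets \<nu> = sets lebesgue" by (simp add: \<nu>_def)
  have \<nu>: "emeasure \<nu> S = (\<integral>\<^sup>+x. F x * indicator S x \<partial>lebesgue)" if "S \<in> sets lebesgue" for S
    using that Fm by (simp add: \<nu>_def emeasure_density)
  have \<nu>_null: "emeasure \<nu> S = 0" if "negligible S" for S
  proof -
    have "S \<in> null_sets lebesgue" using that by (simp add: negligible_iff_null_sets)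
    then have "S \<in> null_sets \<nu>" using absolutely_continuousI_density[OF Fm] by (auto simp: \<nu>_def absolutely_continuous_def)
    then show ?thesis by auto
  qed
  have ball: "emeasure \<nu> (cball x \<epsilon>) \<le> ennreal A * emeasure lebesgue (cball x \<epsilon>)"
    if "cball x \<epsilon> \<subseteq> \<Omega>" "0 < \<epsilon>" "\<epsilon> \<le> 1" for x \<epsilon>
  proof -
    have "emeasure \<nu> (cball x \<epsilon>) = (\<integral>\<^sup>+y. ennreal (f y) * indicator (cball x \<epsilon>) y * indicator \<Omega> y \<partial>lebesgue)"
      by (subst \<nu>) (auto intro!: nn_integral_cong simp: F_def mult_ac)
    also have "\<dots> = (\<integral>\<^sup>+y. ennreal (f y) * indicator (cball x \<epsilon>) y \<partial>lebesgue_on \<Omega>)"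
      using sets by (subst nn_integral_restrict_space) auto
    finally show ?thesis using avg[OF that] by simp
  qed
  \<comment> \<open>Small closed balls inside \<open>T\<close> form a Vitali cover; disjoint
    countably many of them exhaust \<open>T\<close> up to a set that is null for
    \<open>\<nu>\<close> as well.\<close>
  have opn: "emeasure \<nu> T \<le> ennreal A * emeasure lebesgue T" if T: "open T" "T \<subseteq> \<Omega>" for T
  proof -
    define K where "K = {(x, \<epsilon>). 0 < \<epsilon> \<and> \<epsilon> \<le> 1 \<and> cball x \<epsilon> \<subseteq> T}"
    have ex: "\<exists>i. i \<in> K \<and> x \<in> cball (fst i) (snd i) \<and> snd i < d" if "x \<in> T" "0 < d" for x d
    proof -
      obtain e where "e > 0" "cball x e \<subseteq> T" using T(1) \<open>x \<in> T\<close> open_contains_cball by blast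
      then have "cball x (min (min e 1) (d/2)) \<subseteq> T" using subset_cball[of "min (min e 1) (d/2)" e x] by auto
      with \<open>e > 0\<close> that show ?thesis
        by (intro exI[of _ "(x, min (min e 1) (d/2))"]) (auto simp: K_def)
    qed
    have pos: "0 < snd i" if "i \<in> K" for i using that by (auto simp: K_def)
    obtain C where C: "countable C" "C \<subseteq> K"
      "pairwise (\<lambda>i j. disjnt (cball (fst i) (snd i)) (cball (fst j) (snd j))) C"
      "negligible (T - (\<Union>i\<in>C. cball (fst i) (snd i)))"
      by (rule Vitali_covering_theorem_cballs[of K snd T fst]) (erule pos, erule (1) ex, rule that)
    define U where "U = (\<Union>i\<in>C. cball (fst i) (snd i))"
    have US: "U \<in> sets lebesgue" unfolding U_def using C(1)
      by (intro sets.countable_UN'') auto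
    have UT: "U \<subseteq> T" using C(2) by (force simp: U_def K_def)
    have KC: "cball (fst i) (snd i) \<subseteq> \<Omega>" "0 < snd i" "snd i \<le> 1" if "i \<in> C" for i
      using subsetD[OF C(2) that] T(2) by (auto simp: K_def split_beta)
    have d: "disjoint_family_on (\<lambda>i. cball (fst i) (snd i)) C"
      using C(3) by (auto simp: disjoint_family_on_def pairwise_def disjnt_def)
    have "emeasure \<nu> T \<le> emeasure \<nu> (U \<union> (T - U))"
      using UT open_sets[OF T(1)] US by (intro emeasure_mono) (auto simp: \<nu>_sets)
    also have "\<dots> \<le> emeasure \<nu> U + emeasure \<nu> (T - U)"
      using open_sets[OF T(1)] US by (intro emeasure_subadditive) (auto simp: \<nu>_sets)
    also have "emeasure \<nu> (T - U) = 0" using C(4) by (intro \<nu>_null) (simp add: U_def)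
    also have "emeasure \<nu> U = (\<integral>\<^sup>+i. emeasure \<nu> (cball (fst i) (snd i)) \<partial>count_space C)"
      unfolding U_def using C(1) d by (intro emeasure_UN_countable) (auto simp: \<nu>_sets)
    also have "\<dots> \<le> (\<integral>\<^sup>+i. ennreal A * emeasure lebesgue (cball (fst i) (snd i)) \<partial>count_space C)"
      using KC by (intro nn_integral_mono ball) auto
    also have "\<dots> = ennreal A * (\<integral>\<^sup>+i. emeasure lebesgue (cball (fst i) (snd i)) \<partial>count_space C)"
      by (intro nn_integral_cmult) auto
    also have "(\<integral>\<^sup>+i. emeasure lebesgue (cball (fst i) (snd i)) \<partial>count_space C) = emeasure lebesgue U"
      unfolding U_def using C(1) d by (intro emeasure_UN_countable[symmetric]) auto
    also have "ennreal A * emeasure lebesgue U \<le> ennreal A * emeasure lebesgue T"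
      using UT open_sets[OF T(1)] by (intro mult_left_mono emeasure_mono) auto
    finally show ?thesis by simp
  qed
  have lm: "\<Omega> \<in> lmeasurable" using \<Omega> by (simp add: lmeasurable_open)
  have null: "AE x in lebesgue_on \<Omega>. \<not> (f x \<ge> A + c)" if "c > 0" for c
  proof -
    define S where "S = {x \<in> \<Omega>. f x \<ge> A + c}"
    have Sm: "S \<in> sets (lebesgue_on \<Omega>)"
    proof -
      have "{x \<in> space (lebesgue_on \<Omega>). A + c \<le> f x} \<in> sets (lebesgue_on \<Omega>)" using f by measurable
      then show ?thesis by (simp add: S_def)
    qed
    then have S: "S \<in> sets lebesgue" using sets by (auto simp: sets_restrict_space)
    have Sl: "S \<in> lmeasurable" by (rule fmeasurableI2[OF lm _ S]) (auto simp: S_def)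
    \<comment> \<open>On \<open>S\<close> the density is at least \<open>A + c\<close>, while an
      open set containing \<open>S\<close> has \<open>\<nu>\<close>-mass at most \<open>A\<close>
      times its volume. An open set exceeding \<open>S\<close> by less than \<open>e\<close> gives
      the bound, and \<open>e\<close> is arbitrary.\<close>
    have le: "c * measure lebesgue S \<le> A * e" if "e > 0" for e
    proof -
      obtain T where T: "open T" "S \<subseteq> T" "T - S \<in> lmeasurable" "emeasure lebesgue (T - S) < ennreal e"
        using sets_lebesgue_outer_open[OF S \<open>e > 0\<close>] by blast
      define T' where "T' = T \<inter> \<Omega>"
      have T': "open T'" "S \<subseteq> T'" "T' \<subseteq> \<Omega>" using T \<Omega> by (auto simp: T'_def S_def)
      have "ennreal (A + c) * emeasure lebesgue S = (\<integral>\<^sup>+x. ennreal (A + c) * indicator S x \<partial>lebesgue)"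
        using S by (simp add: nn_integral_cmult_indicator)
      also have "\<dots> \<le> (\<integral>\<^sup>+x. F x * indicator S x \<partial>lebesgue)"
        by (intro nn_integral_mono) (auto simp: F_def S_def indicator_def intro: ennreal_leI)
      also have "\<dots> = emeasure \<nu> S" by (simp add: \<nu>[OF S])
      also have "\<dots> \<le> emeasure \<nu> T'" using T' open_sets by (intro emeasure_mono) (auto simp: \<nu>_sets)
      also have "\<dots> \<le> ennreal A * emeasure lebesgue T'" by (rule opn[OF T'(1,3)])
      also have "emeasure lebesgue T' \<le> emeasure lebesgue (S \<union> (T - S))"
        using T(1,2) open_sets S by (intro emeasure_mono) (auto simp: T'_def)
      also have "\<dots> \<le> emeasure lebesgue S + emeasure lebesgue (T - S)"
        using T(1) open_sets S by (intro emeasure_subadditive) auto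
      also have "\<dots> \<le> emeasure lebesgue S + ennreal e" using T(4) by (intro add_left_mono) auto
      finally have "ennreal (A + c) * emeasure lebesgue S \<le> ennreal A * (emeasure lebesgue S + ennreal e)"
        by (simp add: mult_left_mono)
      then have "ennreal ((A + c) * measure lebesgue S) \<le> ennreal (A * (measure lebesgue S + e))"
        using A that \<open>c > 0\<close> by (simp add: emeasure_eq_measure2[OF Sl] ennreal_mult ennreal_plus)
      then have "(A + c) * measure lebesgue S \<le> A * (measure lebesgue S + e)"
        using A that by (subst (asm) ennreal_le_iff) auto
      then show ?thesis by (simp add: algebra_simps)
    qed
    have "measure lebesgue S \<le> 0"
    proof (rule ccontr)
      assume "\<not> measure lebesgue S \<le> 0"
      then have m: "measure lebesgue S > 0" by simp
      \<comment> \<open>Small enough that \<open>A * e\<close> is at most half of \<open>c\<close>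
        times the measure of \<open>S\<close>; the 1 in the denominator covers
        \<open>A = 0\<close>.\<close>
      define e where "e = c * measure lebesgue S / (2 * (A + 1))"
      have "e > 0" using m \<open>c > 0\<close> A by (auto simp: e_def)
      have "A * e \<le> (A + 1) * e" using \<open>e > 0\<close> by (simp add: mult_right_mono)
      also have "\<dots> = c * measure lebesgue S / 2" using A by (simp add: e_def divide_simps)
      also have "\<dots> < c * measure lebesgue S" using m \<open>c > 0\<close> by simp
      finally show False using le[OF \<open>e > 0\<close>] by simp
    qed
    then have "emeasure lebesgue S = 0" using Sl by (simp add: emeasure_eq_measure2 measure_le_0_iff)
    then have "emeasure (lebesgue_on \<Omega>) S = 0" using sets by (subst emeasure_restrict_space) (auto simp: S_def)
    then have "S \<in> null_sets (lebesgue_on \<Omega>)" using Sm by auto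
    then show ?thesis by (rule AE_I') (auto simp: S_def)
  qed
  have "AE x in lebesgue_on \<Omega>. \<forall>m::nat. \<not> (f x \<ge> A + inverse (Suc m))"
    by (intro AE_all_countable[THEN iffD2] allI null) simp
  then show ?thesis
  proof eventually_elim
    case (elim x)
    show "f x \<le> A"
    proof (rule ccontr)
      assume "\<not> f x \<le> A"
      then obtain m where "inverse (real (Suc m)) < f x - A" using reals_Archimedean[of "f x - A"] by auto
      with spec[OF elim, of m] show False by linarith
    qed
  qed
qed

text \<open>Young's inequality without its weights: if b is at most a^(p-1) the first power alone
  dominates the product, otherwise the second does.\<close>

lemma Young_powr:
  fixes a b p :: real
  assumes "a \<ge> 0" "b \<ge> 0" "p > 1"
  shows "a * b \<le> a powr p + b powr (p / (p - 1))"
proof (cases "a = 0 \<or> b = 0")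
  case False
  then have ab: "a > 0" "b > 0" using assms by auto
  show ?thesis
  proof (cases "b \<le> a powr (p - 1)")
    case True
    then have "a * b \<le> a powr 1 * a powr (p - 1)" using ab by (simp add: mult_left_mono)
    also have "\<dots> = a powr p" by (subst powr_add[symmetric]) simp
    finally show ?thesis by (simp add: add_increasing2)
  next
    case False
    have "a = (a powr (p - 1)) powr (1 / (p - 1))" using ab assms by (simp add: powr_powr)
    also have "\<dots> \<le> b powr (1 / (p - 1))" using False ab assms by (intro powr_mono2) auto
    finally have "a * b \<le> b powr (1 / (p - 1)) * b powr 1" using ab by (simp add: mult_right_mono del: powr_mult_base)
    also have "\<dots> = b powr (p / (p - 1))" using assms by (subst powr_add[symmetric]) (simp add: field_simps)
    finally show ?thesis by (simp add: add_increasing)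
  qed
qed auto

text \<open>On the k-th dyadic shell the integrand is at most the constant \<open>c k\<close>, and
  the volumes of the dyadic balls make the terms \<open>t k\<close> geometric with ratio 2^(s-n),
  which is below 1. Translation does not change these numbers, so the bound is uniform in the
  centre.\<close>

lemma radial_singularity_integrable:
  fixes s \<rho> :: real
  assumes "0 < \<rho>" "0 \<le> s" "s < DIM('a)"
  shows "\<exists>C\<ge>0. \<forall>x0::'a::euclidean_space. (\<integral>\<^sup>+x. ennreal (norm (x - x0) powr (- s)) * indicator (cball x0 \<rho>) x \<partial>lborel) \<le> ennreal C"
proof -
  define n where "n = DIM('a)"
  define c where "c k = (\<rho> / 2^(Suc k)) powr (- s)" for k
  define V where "V = unit_ball_vol n"
  have V: "V \<ge> 0" by (simp add: V_def)
  define t where "t k = c k * (V * (\<rho> / 2^k) ^ n)" for k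
  have c0: "c k \<ge> 0" for k by (simp add: c_def)
  have t0: "t k \<ge> 0" for k using c0 V \<open>0 < \<rho>\<close> by (simp add: t_def)
  define q where "q = 2 powr (s - n)"
  have q: "0 \<le> q" "q < 1"
  proof -
    have "2 powr (s - n) < 2 powr (0::real)" using assms by (intro powr_less_mono) (auto simp: n_def)
    then show "q < 1" by (simp add: q_def)
  qed (simp add: q_def)
  have tq: "t k = t 0 * q ^ k" for k
  proof (induction k)
    case (Suc k)
    have "c (Suc k) = c k * 2 powr s"
    proof -
      have "\<rho> / 2 ^ Suc (Suc k) = (\<rho> / 2 ^ Suc k) / 2" by simp
      then have "c (Suc k) = ((\<rho> / 2 ^ Suc k) / 2) powr (- s)" by (simp only: c_def)
      also have "\<dots> = c k * 2 powr s" unfolding c_def using \<open>0 < \<rho>\<close> by (subst powr_divide) (auto simp: powr_minus field_simps)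
      finally show ?thesis .
    qed
    moreover have "(\<rho> / 2 ^ Suc k) ^ n = (\<rho> / 2 ^ k) ^ n * 2 powr (- real n)"
    proof -
      have "\<rho> / 2 ^ Suc k = (\<rho> / 2 ^ k) / 2" by simp
      then have "(\<rho> / 2 ^ Suc k) ^ n = (\<rho> / 2 ^ k) ^ n / 2 ^ n" by (simp only: power_divide)
      then show ?thesis by (simp add: powr_minus powr_realpow field_simps)
    qed
    ultimately have "t (Suc k) = t k * (2 powr s * 2 powr (- real n))" by (simp add: t_def)
    also have "2 powr s * 2 powr (- real n) = q" by (simp add: q_def flip: powr_add)
    finally show ?case using Suc by simp
  qed simp
  have sm: "summable t"
    by (subst summable_cong[OF always_eventually[OF allI[OF tq]]]) (use q in \<open>auto intro!: summable_mult summable_geometric\<close>)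
  have "(\<integral>\<^sup>+x. ennreal (norm (x - x0) powr (- s)) * indicator (cball x0 \<rho>) x \<partial>lborel) \<le> ennreal (suminf t)" for x0 :: 'a
  proof -
    have "ennreal (norm (x - x0) powr (- s)) * indicator (cball x0 \<rho>) x
        \<le> (\<Sum>k. ennreal (c k) * indicator (cball x0 (\<rho> / 2^k)) x)" for x
    \<comment> \<open>At the centre the left side is zero, since \<open>0 powr\<close> of anything
      is 0.\<close>
    proof (cases "x = x0 \<or> x \<notin> cball x0 \<rho>")
      case False
      define d where "d = norm (x - x0)"
      have d: "0 < d" "d \<le> \<rho>" using False by (auto simp: d_def dist_norm norm_minus_commute)
      have "\<exists>k. \<rho> / 2^Suc k < d"
      proof -
        have "(\<lambda>k. \<rho> * inverse (2 ^ Suc k)) \<longlonglongrightarrow> \<rho> * 0"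
          by (intro tendsto_intros LIMSEQ_Suc LIMSEQ_inverse_realpow_zero) auto
        then have "\<forall>\<^sub>F k in sequentially. \<rho> * inverse (2 ^ Suc k) < d" using d(1) by (intro order_tendstoD(2)) auto
        from eventually_happens'[OF sequentially_bot this] show ?thesis unfolding divide_inverse .
      qed
      then have ex: "\<exists>k. \<rho> / 2^Suc k < d" .
      \<comment> \<open>Minimality gives both \<open>\<rho> / 2^Suc k < d\<close> and
        \<open>d \<le> \<rho> / 2^k\<close>, which places \<open>x\<close> in the k-th
        shell.\<close>
      define k where "k = (LEAST k. \<rho> / 2^Suc k < d)"
      have k: "\<rho> / 2^Suc k < d" "\<And>j. j < k \<Longrightarrow> \<not> \<rho> / 2^Suc j < d"
        using LeastI_ex[OF ex] not_less_Least[of _ "\<lambda>k. \<rho> / 2^Suc k < d"] by (auto simp only: k_def)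
      have "d \<le> \<rho> / 2^k"
      proof (cases "k = 0")
        case True
        then have "\<rho> / 2^k = \<rho>" by (simp only: power_0 div_by_1)
        with d(2) show ?thesis by (simp only:)
      next
        case False
        then have "\<not> \<rho> / 2^Suc (k - 1) < d" by (intro k(2)) (simp only: diff_less zero_less_one neq0_conv)
        moreover from False have "Suc (k - 1) = k" by (simp only: Suc_diff_1 neq0_conv)
        ultimately show ?thesis by (simp only: not_less)
      qed
      then have x: "x \<in> cball x0 (\<rho> / 2^k)" by (simp add: d_def dist_norm norm_minus_commute)
      have "d powr (- s) \<le> c k"
        unfolding c_def using k(1) assms by (intro powr_mono2') auto
      then have "ennreal (norm (x - x0) powr (- s)) * indicator (cball x0 \<rho>) x \<le> ennreal (c k) * indicator (cball x0 (\<rho> / 2^k)) x"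
        using x False by (auto simp: d_def intro: ennreal_leI)
      also have "\<dots> \<le> (\<Sum>k. ennreal (c k) * indicator (cball x0 (\<rho> / 2^k)) x)"
      proof -
        define h where "h k = ennreal (c k) * indicator (cball x0 (\<rho> / 2^k)) x" for k
        have "h k \<le> suminf h" using sum_le_suminf[of h "{k}"] by simp
        then show ?thesis by (simp only: h_def[abs_def])
      qed
      finally show ?thesis .
    qed auto
    then have "(\<integral>\<^sup>+x. ennreal (norm (x - x0) powr (- s)) * indicator (cball x0 \<rho>) x \<partial>lborel)
      \<le> (\<integral>\<^sup>+x. (\<Sum>k. ennreal (c k) * indicator (cball x0 (\<rho> / 2^k)) x) \<partial>lborel)" by (intro nn_integral_mono)
    also have "\<dots> = (\<Sum>k. \<integral>\<^sup>+x. ennreal (c k) * indicator (cball x0 (\<rho> / 2^k)) x \<partial>lborel)"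
      by (rule nn_integral_suminf) (intro borel_measurable_times_ennreal borel_measurable_const borel_measurable_indicator, simp)
    also have "\<dots> = (\<Sum>k. ennreal (t k))"
    proof (intro suminf_cong)
      fix k
      have "(\<integral>\<^sup>+x. ennreal (c k) * indicator (cball x0 (\<rho> / 2^k)) x \<partial>lborel) = ennreal (c k) * emeasure lborel (cball x0 (\<rho> / 2^k))"
        by (simp add: nn_integral_cmult_indicator)
      also have "\<dots> = ennreal (t k)"
        using \<open>0 < \<rho>\<close> c0 V by (subst emeasure_cball) (auto simp: t_def V_def n_def ennreal_mult[symmetric])
      finally show "(\<integral>\<^sup>+x. ennreal (c k) * indicator (cball x0 (\<rho> / 2^k)) x \<partial>lborel) = ennreal (t k)" .
    qed
    also have "\<dots> = ennreal (suminf t)" by (rule suminf_ennreal2[OF t0 sm])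
    finally show ?thesis .
  qed
  then show ?thesis using suminf_nonneg[OF sm t0] by (intro exI[of _ "suminf t"]) auto
qed

text \<open>Covers logarithms and real powers, which are differentiable only on the positive
  half-line.\<close>

lemma C1_compose_pos:
  assumes C: "C1 \<phi> D" and pos: "\<And>x. \<phi> x > 0" and X: "\<And>s. s > 0 \<Longrightarrow> (X has_real_derivative X' s) (at s)"
    and cX: "continuous_on {0<..} X'"
  shows "C1 (\<lambda>x. X (\<phi> x)) (\<lambda>x. X' (\<phi> x) *\<^sub>R D x)"
proof -
  have "((\<lambda>x. X (\<phi> x)) has_derivative (\<lambda>h. (X' (\<phi> x) *\<^sub>R D x) \<bullet> h)) (at x)" for x
    using has_derivative_compose[of \<phi> "\<lambda>h. D x \<bullet> h" x UNIV X "\<lambda>h. X' (\<phi> x) * h"] C X[OF pos[of x]]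
    by (simp add: C1_def has_field_derivative_def)
  moreover have "continuous_on UNIV (\<lambda>x. X' (\<phi> x) *\<^sub>R D x)"
    using C1_continuous[OF C] C1_continuous_grad[OF C] pos
    by (intro continuous_intros continuous_on_compose2[OF cX]) auto
  ultimately show ?thesis by (simp add: C1_def)
qed

lemma C1_dist_sq: "C1 (\<lambda>x::real^'n. (norm (x - x0))\<^sup>2 + e) (\<lambda>x. 2 *\<^sub>R (x - x0))"
proof -
  have "((\<lambda>x::real^'n. (x - x0) \<bullet> (x - x0) + e) has_derivative (\<lambda>h. (2 *\<^sub>R (x - x0)) \<bullet> h)) (at x)" for x
    by (auto intro!: derivative_eq_intros simp: inner_commute inner_diff_left inner_diff_right)
  then show ?thesis
    by (auto simp: C1_def power2_norm_eq_inner intro!: continuous_intros)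
qed

section \<open>The regularised fundamental solution in dimensions two and three\<close>

locale pde_dom =
  fixes \<Omega> :: "(real^'n) set" and nn :: real
  assumes opn': "open \<Omega>" and bdd': "bounded \<Omega>"
    and nn_def: "nn = real CARD('n)" and nn_cases: "nn = 2 \<or> nn = 3"
begin

sublocale bdd_dom \<Omega> by unfold_locales (rule opn' bdd')+

definition rad :: real where "rad = (SOME R. R > 0 \<and> (\<forall>x\<in>\<Omega>. norm x \<le> R))"

lemma rad: "rad > 0" "x \<in> \<Omega> \<Longrightarrow> norm x \<le> rad"
proof -
  have "\<exists>R>0. \<forall>x\<in>\<Omega>. norm x \<le> R" using bdd by (auto simp: bounded_pos)
  then have "rad > 0 \<and> (\<forall>x\<in>\<Omega>. norm x \<le> rad)" unfolding rad_def by (rule someI_ex)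
  then show "rad > 0" "x \<in> \<Omega> \<Longrightarrow> norm x \<le> rad" by auto
qed

text \<open>An upper bound for the argument
  \<open>(norm (x - x0))\<^sup>2 + \<epsilon>\<^sup>2\<close> of the kernel over points of the
  domain and \<open>\<epsilon> \<le> 1\<close>.\<close>

definition qmax :: real where "qmax = (2 * rad)\<^sup>2 + 1"

lemma qmax: "qmax > 0" by (simp add: qmax_def add_nonneg_pos)

text \<open>As a function of the squared distance; for \<open>n = 2\<close> the constant makes it nonnegative on \<open>\<Omega>\<close>.\<close>
definition kap :: "real \<Rightarrow> real" where
  "kap q = (if nn = 2 then (ln qmax - ln q) / 2 else q powr (- 1/2))"

text \<open>\<open>Ker\<close> is the regularised fundamental solution, \<open>Kgrad\<close> its gradient and \<open>Kw\<close> its negative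
  Laplacian, an approximate identity as \<open>\<epsilon>\<close> tends to 0.\<close>
definition Ker :: "real^'n \<Rightarrow> real \<Rightarrow> real^'n \<Rightarrow> real" where
  "Ker x0 \<epsilon> x = kap ((norm (x - x0))\<^sup>2 + \<epsilon>\<^sup>2)"

definition Kgrad :: "real^'n \<Rightarrow> real \<Rightarrow> real^'n \<Rightarrow> real^'n" where
  "Kgrad x0 \<epsilon> x = - (((norm (x - x0))\<^sup>2 + \<epsilon>\<^sup>2) powr (- nn/2)) *\<^sub>R (x - x0)"

definition Kw :: "real^'n \<Rightarrow> real \<Rightarrow> real^'n \<Rightarrow> real" where
  "Kw x0 \<epsilon> x = nn * \<epsilon>\<^sup>2 * ((norm (x - x0))\<^sup>2 + \<epsilon>\<^sup>2) powr (- nn/2 - 1)"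

text \<open>The factor 1/2 in front of the logarithm gives both dimensions the same form of
  derivative, so that the formulas for \<open>Kgrad\<close> and \<open>Kw\<close> depend on
  \<open>nn\<close> alone.\<close>

lemma kap_deriv: "q > 0 \<Longrightarrow> (kap has_real_derivative (- 1/2 * q powr (- nn/2))) (at q)"
proof -
  assume q: "q > 0"
  show ?thesis
  proof (cases "nn = 2")
    case True
    then have k: "kap = (\<lambda>q. (ln qmax - ln q) / 2)" unfolding kap_def[abs_def] by simp
    have "((\<lambda>q. (ln qmax - ln q) / 2) has_real_derivative (- 1/2 * inverse q)) (at q)"
      using q by (auto intro!: derivative_eq_intros simp: field_simps)
    then show ?thesis unfolding k using q True by (simp add: powr_minus)
  next
    case False
    then have n: "nn = 3" using nn_cases by auto
    then have k: "kap = (\<lambda>q. q powr (- 1/2))" unfolding kap_def[abs_def] by simp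
    have "((\<lambda>q. q powr (- 1/2)) has_real_derivative (- 1/2 * q powr (- 1/2 - 1))) (at q)"
      using q by (auto intro!: derivative_eq_intros simp: field_simps)
    then show ?thesis unfolding k using n by simp
  qed
qed

lemma kap_nonneg: "0 < q \<Longrightarrow> q \<le> qmax \<Longrightarrow> 0 \<le> kap q"
  by (simp add: kap_def)

text \<open>For n = 2 every positive power beats the logarithm; for n = 3 the surplus power of q is
  bounded by its value at \<open>qmax\<close>.\<close>

lemma kap_bound:
  assumes a: "a > nn/2 - 1"
  shows "\<exists>C\<ge>0. \<forall>q. 0 < q \<and> q \<le> qmax \<longrightarrow> kap q \<le> C * q powr (- a)"
proof (cases "nn = 2")
  case True
  then have a0: "a > 0" using a by simp
  have "kap q \<le> (qmax powr a / a) * q powr (- a)" if q: "0 < q" "q \<le> qmax" for q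
  proof -
    have "kap q = ln (qmax / q) / 2" unfolding kap_def using True q qmax by (simp add: ln_div)
    also have "\<dots> \<le> ln (qmax / q)" using q qmax by simp
    also have "\<dots> \<le> (qmax / q) powr a / a" using q a0 by (intro ln_powr_bound) auto
    also have "\<dots> = (qmax powr a / a) * q powr (- a)" using q qmax by (simp add: powr_divide powr_minus field_simps)
    finally show ?thesis .
  qed
  then show ?thesis using a0 by (intro exI[of _ "qmax powr a / a"]) auto
next
  case False
  then have n: "nn = 3" using nn_cases by auto
  have "kap q \<le> qmax powr (a - 1/2) * q powr (- a)" if q: "0 < q" "q \<le> qmax" for q
  proof -
    have "kap q = q powr (a - 1/2) * q powr (- a)" using False by (simp add: kap_def flip: powr_add)
    also have "\<dots> \<le> qmax powr (a - 1/2) * q powr (- a)"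
      using q a n by (intro mult_right_mono powr_mono2) auto
    finally show ?thesis .
  qed
  then show ?thesis by (intro exI[of _ "qmax powr (a - 1/2)"]) auto
qed

lemma q_range:
  assumes "x \<in> \<Omega>" "x0 \<in> \<Omega>" "0 < \<epsilon>" "\<epsilon> \<le> 1"
  shows "0 < (norm (x - x0))\<^sup>2 + \<epsilon>\<^sup>2" "(norm (x - x0))\<^sup>2 + \<epsilon>\<^sup>2 \<le> qmax"
proof -
  show "0 < (norm (x - x0))\<^sup>2 + \<epsilon>\<^sup>2" using assms by (simp add: add_nonneg_pos)
  have "norm (x - x0) \<le> 2 * rad" using rad(2)[OF assms(1)] rad(2)[OF assms(2)] norm_triangle_ineq4[of x x0] by simp
  then have "(norm (x - x0))\<^sup>2 \<le> (2 * rad)\<^sup>2" by (intro power_mono) auto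
  moreover have "\<epsilon>\<^sup>2 \<le> 1" using assms by (simp add: power_le_one)
  ultimately show "(norm (x - x0))\<^sup>2 + \<epsilon>\<^sup>2 \<le> qmax" by (simp add: qmax_def)
qed

lemma Ker_nonneg: "x \<in> \<Omega> \<Longrightarrow> x0 \<in> \<Omega> \<Longrightarrow> 0 < \<epsilon> \<Longrightarrow> \<epsilon> \<le> 1 \<Longrightarrow> 0 \<le> Ker x0 \<epsilon> x"
  unfolding Ker_def by (intro kap_nonneg q_range)

lemma q_pos: "\<epsilon> > 0 \<Longrightarrow> (norm (x - x0))\<^sup>2 + \<epsilon>\<^sup>2 > 0" for x x0 :: "real^'n"
  by (simp add: add_nonneg_pos)

lemma Ker_C1: assumes "\<epsilon> > 0" shows "C1 (Ker x0 \<epsilon>) (Kgrad x0 \<epsilon>)"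
proof -
  have "C1 (\<lambda>x. kap ((norm (x - x0))\<^sup>2 + \<epsilon>\<^sup>2)) (\<lambda>x. (- 1/2 * ((norm (x - x0))\<^sup>2 + \<epsilon>\<^sup>2) powr (- nn/2)) *\<^sub>R (2 *\<^sub>R (x - x0)))"
    by (rule C1_compose_pos[OF C1_dist_sq q_pos[OF assms] kap_deriv]) (auto intro!: continuous_intros)
  then show ?thesis by (simp add: Ker_def[abs_def] Kgrad_def[abs_def])
qed

text \<open>With q = |x - x0|^2 + \<epsilon>^2 the divergence of \<open>Kgrad\<close> is - n
  q^(-n/2) + n |x - x0|^2 q^(-n/2-1), and replacing |x - x0|^2 by q - \<epsilon>^2 leaves only
  \<open>- Kw\<close>.\<close>

lemma Kgrad_C1:
  assumes "\<epsilon> > 0"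
  shows "\<exists>E. (\<forall>i. C1 (\<lambda>x. Kgrad x0 \<epsilon> x $ i) (E i)) \<and> (\<forall>x. (\<Sum>i\<in>UNIV. E i x $ i) = - Kw x0 \<epsilon> x)"
proof -
  define q where "q x = (norm (x - x0))\<^sup>2 + \<epsilon>\<^sup>2" for x
  have qp: "q x > 0" for x using q_pos[OF assms] by (simp add: q_def)
  have pd: "((\<lambda>s. - (s powr (- nn/2))) has_real_derivative (nn/2 * s powr (- nn/2 - 1))) (at s)" if "s > 0" for s
    using that by (auto intro!: derivative_eq_intros)
  have p: "C1 (\<lambda>x. - (q x powr (- nn/2))) (\<lambda>x. (nn/2 * q x powr (- nn/2 - 1)) *\<^sub>R (2 *\<^sub>R (x - x0)))"
    unfolding q_def
    by (rule C1_compose_pos[OF C1_dist_sq q_pos[OF assms] pd]) (auto intro!: continuous_intros)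
  define E where "E i x = - (q x powr (- nn/2)) *\<^sub>R axis i 1 + (x $ i - x0 $ i) *\<^sub>R ((nn * q x powr (- nn/2 - 1)) *\<^sub>R (x - x0))" for i x
  have C: "C1 (\<lambda>x. Kgrad x0 \<epsilon> x $ i) (E i)" for i
  proof -
    have "C1 (\<lambda>x. x $ i - x0 $ i) (\<lambda>x. axis i 1)"
      using C1_add[OF C1_component[of i] C1_const[of "x0 $ i"], of "-1"] by simp
    from C1_mult[OF p this] show ?thesis
      by (simp add: E_def[abs_def] Kgrad_def[abs_def] q_def)
  qed
  have "(\<Sum>i\<in>UNIV. E i x $ i) = - Kw x0 \<epsilon> x" for x
  proof -
    have "(\<Sum>i\<in>UNIV. E i x $ i) = (\<Sum>i\<in>(UNIV::'n set). - (q x powr (- nn/2))) + (nn * q x powr (- nn/2 - 1)) * (\<Sum>i\<in>UNIV. (x - x0) $ i * (x - x0) $ i)"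
      by (simp add: E_def sum.distrib sum_subtractf sum_distrib_left mult_ac)
    also have "(\<Sum>i\<in>UNIV. (x - x0) $ i * (x - x0) $ i) = (norm (x - x0))\<^sup>2"
      by (simp add: power2_norm_eq_inner inner_vec_def)
    also have "(\<Sum>i\<in>(UNIV::'n set). - (q x powr (- nn/2))) = - nn * q x powr (- nn/2)" by (simp add: nn_def)
    also have "q x powr (- nn/2) = q x * q x powr (- nn/2 - 1)"
      using qp[of x] powr_add[of "q x" 1 "- nn/2 - 1"] by simp
    finally show ?thesis by (simp add: Kw_def q_def algebra_simps)
  qed
  with C show ?thesis by blast
qed

lemma cont_bounded_dom:
  fixes f :: "real^'n \<Rightarrow> 'b::real_normed_vector"
  assumes "continuous_on UNIV f" shows "\<exists>B>0. \<forall>x\<in>\<Omega>. norm (f x) \<le> B"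
proof -
  have "compact (f ` closure \<Omega>)" using assms bdd by (intro compact_continuous_image) (auto intro: continuous_on_subset)
  then have "bounded (f ` closure \<Omega>)" by (rule compact_imp_bounded)
  then obtain B where "B > 0" "\<And>x. x \<in> closure \<Omega> \<Longrightarrow> norm (f x) \<le> B" by (auto simp: bounded_pos)
  then show ?thesis using closure_subset by blast
qed

lemma Kw_cont: "\<epsilon> > 0 \<Longrightarrow> continuous_on UNIV (Kw x0 \<epsilon>)"
  unfolding Kw_def[abs_def] by (intro continuous_intros) (auto dest: q_pos[of \<epsilon> _ x0] simp: add_nonneg_eq_0_iff)

text \<open>The weak form of - \<Delta> \<open>Ker\<close> = \<open>Kw\<close>, obtained by summing
  the integrations by parts of the components of \<open>Kgrad\<close>.\<close>

lemma integral_grad_Kgrad: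
  assumes t: "test_fun \<Omega> \<psi>" and e: "\<epsilon> > 0"
  shows "(LINT x|M. grad \<psi> x \<bullet> Kgrad x0 \<epsilon> x) = (LINT x|M. \<psi> x * Kw x0 \<epsilon> x)"
proof -
  obtain E where E: "\<And>i. C1 (\<lambda>x. Kgrad x0 \<epsilon> x $ i) (E i)" "\<And>x. (\<Sum>i\<in>UNIV. E i x $ i) = - Kw x0 \<epsilon> x"
    using Kgrad_C1[OF e] by blast
  obtain K where K: "compact K" "K \<subseteq> \<Omega>" "\<And>x. x \<notin> K \<Longrightarrow> \<psi> x = 0" "\<And>x. x \<notin> K \<Longrightarrow> grad \<psi> x = 0"
    using t by (rule test_funE) (rule that)
  have cg: "continuous_on UNIV (\<lambda>x. Kgrad x0 \<epsilon> x $ i * grad \<psi> x $ i)" "continuous_on UNIV (\<lambda>x. E i x $ i * \<psi> x)" for i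
  proof -
    have "continuous_on UNIV (\<lambda>x. grad \<psi> x $ i)" "continuous_on UNIV (\<lambda>x. E i x $ i)"
      by (intro continuous_intros test_fun_continuous[OF t] C1_continuous_grad[OF E(1)])+
    then show "continuous_on UNIV (\<lambda>x. Kgrad x0 \<epsilon> x $ i * grad \<psi> x $ i)" "continuous_on UNIV (\<lambda>x. E i x $ i * \<psi> x)"
      by (auto intro!: continuous_on_mult C1_continuous[OF E(1)] test_fun_continuous[OF t])
  qed
  have "integrable lborel (\<lambda>x. Kgrad x0 \<epsilon> x $ i * grad \<psi> x $ i)" "integrable lborel (\<lambda>x. E i x $ i * \<psi> x)" for i
    using K by (auto intro!: integrable_compact_support[OF _ K(1)] cg)
  then have i: "integrable M (\<lambda>x. Kgrad x0 \<epsilon> x $ i * grad \<psi> x $ i)" "integrable M (\<lambda>x. E i x $ i * \<psi> x)" for i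
    by (subst lebesgue_on_zero_ext(2)[OF borel_measurable_continuous_onI[OF cg(1)]],
        auto simp: test_fun_outside[OF t])
      (subst lebesgue_on_zero_ext(2)[OF borel_measurable_continuous_onI[OF cg(2)]], auto simp: test_fun_outside[OF t])
  have "(LINT x|M. grad \<psi> x \<bullet> Kgrad x0 \<epsilon> x) = (\<Sum>j\<in>UNIV. LINT x|M. Kgrad x0 \<epsilon> x $ j * grad \<psi> x $ j)"
    using i(1) by (simp add: inner_vec_def mult.commute)
  also have "\<dots> = (\<Sum>j\<in>UNIV. - (LINT x|M. E j x $ j * \<psi> x))"
    by (intro sum.cong refl test_fun_by_parts[OF t E(1) opn])
  also have "\<dots> = - (LINT x|M. (\<Sum>j\<in>UNIV. E j x $ j) * \<psi> x)"
    using i(2) by (simp add: sum_negf sum_distrib_right)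
  also have "\<dots> = (LINT x|M. \<psi> x * Kw x0 \<epsilon> x)" by (simp add: E(2) mult.commute)
  finally show ?thesis .
qed

text \<open>Uniformly bounded potential, as in the Kato class: all that is used of a right-hand side in
  \<open>L\<^sup>p\<close> with \<open>p > n/2\<close>.\<close>
definition kato :: "(real^'n \<Rightarrow> real) \<Rightarrow> real \<Rightarrow> bool" where
  "kato G B \<longleftrightarrow> integrable M G \<and> (AE x in M. 0 \<le> G x) \<and>
    (\<forall>x0\<in>\<Omega>. \<forall>\<epsilon>. 0 < \<epsilon> \<and> \<epsilon> \<le> 1 \<longrightarrow> (LINT x|M. G x * Ker x0 \<epsilon> x) \<le> B)"

lemma Ker_meas: "\<epsilon> > 0 \<Longrightarrow> Ker x0 \<epsilon> \<in> borel_measurable M"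
  by (intro borel_M borel_measurable_continuous_onI C1_continuous[OF Ker_C1])

lemma integrable_mult_Ker:
  assumes "integrable M G" "\<epsilon> > 0" shows "integrable M (\<lambda>x. G x * Ker x0 \<epsilon> x)"
proof -
  obtain B where "\<forall>x\<in>\<Omega>. norm (Ker x0 \<epsilon> x) \<le> B" using cont_bounded_dom[OF C1_continuous[OF Ker_C1[OF assms(2)]]] by blast
  then show ?thesis using assms Ker_meas by (intro integrable_mult_bounded[where B=B]) (auto intro!: AE_I2)
qed

lemma kato_lin:
  assumes "kato G B" "kato H D" "c \<ge> 0"
  shows "kato (\<lambda>x. G x + c * H x) (B + c * D)"
proof -
  have ae: "AE x in M. 0 \<le> G x" "AE x in M. 0 \<le> H x" and i: "integrable M G" "integrable M H" using assms by (auto simp: kato_def)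
  have "(LINT x|M. (G x + c * H x) * Ker x0 \<epsilon> x) \<le> B + c * D" if x: "x0 \<in> \<Omega>" "0 < \<epsilon>" "\<epsilon> \<le> 1" for x0 \<epsilon>
  proof -
    have "(LINT x|M. (G x + c * H x) * Ker x0 \<epsilon> x) = (LINT x|M. G x * Ker x0 \<epsilon> x) + c * (LINT x|M. H x * Ker x0 \<epsilon> x)"
      using integrable_mult_Ker[OF i(1) x(2)] integrable_mult_Ker[OF i(2) x(2)] by (simp add: distrib_right mult.assoc)
    also have "\<dots> \<le> B + c * D" using assms x by (intro add_mono mult_left_mono) (auto simp: kato_def)
    finally show ?thesis .
  qed
  moreover have "AE x in M. 0 \<le> G x + c * H x" using ae by eventually_elim (use assms in auto)
  ultimately show ?thesis using i by (auto simp: kato_def)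
qed

text \<open>Potentials are monotone in their density because the kernel is nonnegative on the
  domain.\<close>

lemma kato_mono:
  assumes "kato G B" "H \<in> borel_measurable M" "AE x in M. 0 \<le> H x \<and> H x \<le> G x"
  shows "kato H B"
proof -
  have i: "integrable M H"
  proof (rule Bochner_Integration.integrable_bound[of M G])
    show "AE x in M. norm (H x) \<le> norm (G x)" using assms(3) by eventually_elim auto
  qed (use assms in \<open>auto simp: kato_def\<close>)
  have "(LINT x|M. H x * Ker x0 \<epsilon> x) \<le> B" if x: "x0 \<in> \<Omega>" "0 < \<epsilon>" "\<epsilon> \<le> 1" for x0 \<epsilon>
  proof -
    have "AE x in M. x \<in> \<Omega>" by (rule AE_I2) simp
    with assms(3) have "AE x in M. H x * Ker x0 \<epsilon> x \<le> G x * Ker x0 \<epsilon> x"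
      by eventually_elim (auto intro!: mult_right_mono Ker_nonneg x)
    then have "(LINT x|M. H x * Ker x0 \<epsilon> x) \<le> (LINT x|M. G x * Ker x0 \<epsilon> x)"
      using assms(1) i x by (intro integral_mono_AE integrable_mult_Ker) (auto simp: kato_def)
    also have "\<dots> \<le> B" using assms x by (auto simp: kato_def)
    finally show ?thesis .
  qed
  with i assms(3) show ?thesis by (auto simp: kato_def elim: eventually_mono)
qed

text \<open>Young's inequality separates \<open>h\<close> from the kernel. What remains is to
  integrate the kernel to the conjugate power p', uniformly in \<open>x0\<close> and
  \<open>\<epsilon>\<close>; its singularity is then of order 2 a p', and p > n/2 is exactly what
  leaves room for this to be below n.\<close>

lemma kato_Lp:
  assumes p: "p > nn / 2" and h: "h \<in> borel_measurable M" "integrable M (\<lambda>x. \<bar>h x\<bar> powr p)"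
  shows "\<exists>B. kato (\<lambda>x. \<bar>h x\<bar>) B"
proof -
  have p1: "p > 1" using p nn_cases by auto
  define p' where "p' = p / (p - 1)"
  have p': "p' > 0" using p1 by (simp add: p'_def)
  \<comment> \<open>The critical exponent: a < b means 2 a p' < n, while \<open>kap_bound\<close>
    asks for a > n/2 - 1. Since b = n/2 - n/(2p), the hypothesis on p puts b above n/2 - 1, and
    \<open>a\<close> is taken midway.\<close>
  define b where "b = nn / (2 * p')"
  have "b = nn/2 - nn/(2*p)" using p1 by (simp add: b_def p'_def field_simps)
  moreover have "nn / (2 * p) < 1" using p p1 by (simp add: field_simps)
  ultimately have b: "b > nn/2 - 1" by simp
  define a where "a = (b + (nn/2 - 1)) / 2"
  have a: "a > nn/2 - 1" "a < b" using b by (auto simp: a_def)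
  have a0: "a \<ge> 0" using a nn_cases by auto
  have s: "2 * a * p' < DIM(real^'n)" using a(2) p' by (simp add: b_def nn_def field_simps)
  obtain C where C: "C \<ge> 0" "\<And>q. 0 < q \<Longrightarrow> q \<le> qmax \<Longrightarrow> kap q \<le> C * q powr (- a)" using kap_bound[OF a(1)] by blast
  obtain D where D: "D \<ge> 0" "\<And>x0::real^'n. (\<integral>\<^sup>+x. ennreal (norm (x - x0) powr (- (2 * a * p'))) * indicator (cball x0 (2 * rad)) x \<partial>lborel) \<le> ennreal D"
    using radial_singularity_integrable[OF _ _ s, of "2 * rad"] rad(1) a0 p' by auto
  have bound: "(LINT x|M. \<bar>h x\<bar> * Ker x0 \<epsilon> x) \<le> (LINT x|M. \<bar>h x\<bar> powr p) + C powr p' * D" and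
    hint: "integrable M h" if x0: "x0 \<in> \<Omega>" "0 < \<epsilon>" "\<epsilon> \<le> 1" for x0 \<epsilon>
  proof -
    have K: "Ker x0 \<epsilon> x powr p' \<le> C powr p' * norm (x - x0) powr (- (2 * a * p'))" if "x \<in> \<Omega>" "x \<noteq> x0" for x
    proof -
      define q where "q = (norm (x - x0))\<^sup>2 + \<epsilon>\<^sup>2"
      have n: "norm (x - x0) > 0" using that by simp
      have "Ker x0 \<epsilon> x \<le> C * q powr (- a)" unfolding Ker_def q_def by (intro C(2) q_range that x0)
      also have "\<dots> \<le> C * ((norm (x - x0))\<^sup>2) powr (- a)"
        using C(1) a0 n by (intro mult_left_mono powr_mono2') (auto simp: q_def)
      also have "((norm (x - x0))\<^sup>2) powr (- a) = norm (x - x0) powr (- (2 * a))"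
        using n by (simp add: powr_powr flip: powr_numeral)
      finally have "Ker x0 \<epsilon> x powr p' \<le> (C * norm (x - x0) powr (- (2 * a))) powr p'"
        using p' Ker_nonneg[OF that(1) x0] by (intro powr_mono2) auto
      also have "\<dots> = C powr p' * norm (x - x0) powr (- (2 * a * p'))"
        using C(1) n by (simp add: powr_mult powr_powr)
      finally show ?thesis .
    qed
    have Km: "(\<lambda>x. Ker x0 \<epsilon> x powr p') \<in> borel_measurable M" using Ker_meas[OF x0(2)] by simp
    have "AE x in lebesgue. x \<noteq> x0"
      using AE_lborel_singleton[of x0] by (rule AE_completion)
    then have ne: "AE x in M. x \<noteq> x0"
      by (subst AE_restrict_space_iff) (auto elim: eventually_mono)
    have nn: "(\<integral>\<^sup>+x. ennreal (Ker x0 \<epsilon> x powr p') \<partial>M) \<le> ennreal (C powr p' * D)"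
    proof -
      have "(\<integral>\<^sup>+x. ennreal (Ker x0 \<epsilon> x powr p') \<partial>M) \<le> (\<integral>\<^sup>+x. ennreal (C powr p') * (ennreal (norm (x - x0) powr (- (2 * a * p'))) * indicator (cball x0 (2 * rad)) x) \<partial>M)"
      proof (rule nn_integral_mono_AE)
        have "AE x in M. x \<in> \<Omega>" by (rule AE_I2) simp
        with ne show "AE x in M. ennreal (Ker x0 \<epsilon> x powr p') \<le> ennreal (C powr p') * (ennreal (norm (x - x0) powr (- (2 * a * p'))) * indicator (cball x0 (2 * rad)) x)"
        proof eventually_elim
          case (elim x)
          have "x \<in> cball x0 (2 * rad)"
            using rad(2)[OF elim(2)] rad(2)[OF x0(1)] norm_triangle_ineq4[of x0 x] by (simp add: dist_norm)
          then show ?case using K[OF elim(2,1)] by (simp add: ennreal_mult[symmetric] ennreal_leI)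
        qed
      qed
      also have "\<dots> \<le> (\<integral>\<^sup>+x. ennreal (C powr p') * (ennreal (norm (x - x0) powr (- (2 * a * p'))) * indicator (cball x0 (2 * rad)) x) \<partial>lborel)"
      proof (subst nn_integral_restrict_space)
        show "(\<integral>\<^sup>+x. ennreal (C powr p') * (ennreal (norm (x - x0) powr (- (2 * a * p'))) * indicator (cball x0 (2 * rad)) x) * indicator \<Omega> x \<partial>lebesgue)
           \<le> (\<integral>\<^sup>+x. ennreal (C powr p') * (ennreal (norm (x - x0) powr (- (2 * a * p'))) * indicator (cball x0 (2 * rad)) x) \<partial>lborel)"
          by (subst nn_integral_completion[of lborel, symmetric], intro nn_integral_mono) (auto simp: indicator_def)
      qed simp
      also have "\<dots> = ennreal (C powr p') * (\<integral>\<^sup>+x. (ennreal (norm (x - x0) powr (- (2 * a * p'))) * indicator (cball x0 (2 * rad)) x) \<partial>lborel)"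
      proof (rule nn_integral_cmult)
        have "(\<lambda>x. ennreal (norm (x - x0) powr (- (2 * a * p')))) \<in> borel_measurable lborel" by measurable
        then show "(\<lambda>x. ennreal (norm (x - x0) powr (- (2 * a * p'))) * indicator (cball x0 (2 * rad)) x) \<in> borel_measurable lborel"
          by (intro borel_measurable_times_ennreal borel_measurable_indicator) simp_all
      qed
      also have "\<dots> \<le> ennreal (C powr p') * ennreal D" by (intro mult_left_mono D(2)) simp
      also have "\<dots> = ennreal (C powr p' * D)" using D(1) by (simp add: ennreal_mult)
      finally show ?thesis .
    qed
    have iK: "integrable M (\<lambda>x. Ker x0 \<epsilon> x powr p')"
      by (rule integrableI_nonneg[OF Km]) (use nn in \<open>auto intro: le_less_trans\<close>)
    have lK: "(LINT x|M. Ker x0 \<epsilon> x powr p') \<le> C powr p' * D"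
    proof -
      have "ennreal (LINT x|M. Ker x0 \<epsilon> x powr p') \<le> ennreal (C powr p' * D)"
        using nn by (subst nn_integral_eq_integral[OF iK, symmetric]) auto
      then show ?thesis using C D by (subst (asm) ennreal_le_iff) auto
    qed
    have young: "\<bar>h x\<bar> * Ker x0 \<epsilon> x \<le> \<bar>h x\<bar> powr p + Ker x0 \<epsilon> x powr p'" if "x \<in> \<Omega>" for x
      unfolding p'_def using Ker_nonneg[OF that x0] p1 by (intro Young_powr) auto
    have i1: "integrable M (\<lambda>x. \<bar>h x\<bar> * Ker x0 \<epsilon> x)"
    proof (rule Bochner_Integration.integrable_bound)
      show "integrable M (\<lambda>x. \<bar>h x\<bar> powr p + Ker x0 \<epsilon> x powr p')" using h(2) iK by simp
      show "AE x in M. norm (\<bar>h x\<bar> * Ker x0 \<epsilon> x) \<le> norm (\<bar>h x\<bar> powr p + Ker x0 \<epsilon> x powr p')"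
      proof (rule AE_I2)
        fix x assume "x \<in> space M"
        then have "x \<in> \<Omega>" by simp
        then show "norm (\<bar>h x\<bar> * Ker x0 \<epsilon> x) \<le> norm (\<bar>h x\<bar> powr p + Ker x0 \<epsilon> x powr p')"
          using young[of x] Ker_nonneg[of x x0 \<epsilon>] x0 by simp
      qed
      show "(\<lambda>x. \<bar>h x\<bar> * Ker x0 \<epsilon> x) \<in> borel_measurable M" using h(1) Ker_meas[OF x0(2)] by simp
    qed
    have "(LINT x|M. \<bar>h x\<bar> * Ker x0 \<epsilon> x) \<le> (LINT x|M. \<bar>h x\<bar> powr p + Ker x0 \<epsilon> x powr p')"
      using h(2) iK i1 young by (intro integral_mono) auto
    also have "\<dots> \<le> (LINT x|M. \<bar>h x\<bar> powr p) + C powr p' * D" using h(2) iK lK by simp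
    finally show "(LINT x|M. \<bar>h x\<bar> * Ker x0 \<epsilon> x) \<le> (LINT x|M. \<bar>h x\<bar> powr p) + C powr p' * D" .
    show "integrable M h"
    proof -
      interpret finite_measure M by (rule fin)
      show ?thesis
      proof (rule Bochner_Integration.integrable_bound)
        show "integrable M (\<lambda>x. \<bar>h x\<bar> powr p + 1)" using h(2) by simp
        have "a \<le> a powr p + 1" if "a \<ge> 0" for a :: real
          using Young_powr[OF that zero_le_one p1] by simp
        then show "AE x in M. norm (h x) \<le> norm (\<bar>h x\<bar> powr p + 1)"
          by (intro AE_I2) (metis abs_ge_zero abs_of_nonneg add_nonneg_nonneg powr_ge_zero real_norm_def zero_le_one)
      qed (rule h(1))
    qed
  qed
  show ?thesis
  \<comment> \<open>Integrability of \<open>h\<close> was derived relative to a point of the domain,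
    so the empty domain is treated apart.\<close>
  proof (cases "\<Omega> = {}")
    case True
    then have "integrable M h" by (intro integrable_bounded[OF fin h(1), of 0]) (auto intro!: AE_I2)
    then show ?thesis unfolding kato_def using True by (auto intro!: AE_I2)
  next
    case False
    then obtain x1 where "x1 \<in> \<Omega>" by auto
    from hint[OF this, of 1] have "integrable M h" by simp
    with bound show ?thesis by (intro exI[of _ "(LINT x|M. \<bar>h x\<bar> powr p) + C powr p' * D"]) (auto simp: kato_def)
  qed
qed

text \<open>Dimension at most three makes 2 > n/2, so square-integrable controls have bounded
  potentials.\<close>

lemma kato_sqint:
  assumes "sqint M h" shows "\<exists>B. kato (\<lambda>x. \<bar>h x\<bar>) B"
proof (rule kato_Lp)
  show "2 > nn / 2" using nn_cases by auto
  have "\<bar>a\<bar> powr 2 = a\<^sup>2" for a :: real by simp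
  then show "integrable M (\<lambda>x. \<bar>h x\<bar> powr 2)" using assms by (simp add: sqint_def)
qed (use assms in \<open>simp add: sqint_def\<close>)

lemma kato_one: "\<exists>B. kato (\<lambda>x. 1) B"
  using kato_sqint[OF sqint_bounded[OF fin, of "\<lambda>x. 1::real" 1]] by simp

end

text \<open>Smooth convex approximation of the absolute value.\<close>
definition Xd :: "real \<Rightarrow> real \<Rightarrow> real" where "Xd \<delta> s = sqrt (\<delta>\<^sup>2 + s\<^sup>2) - \<delta>"
definition Xd1 :: "real \<Rightarrow> real \<Rightarrow> real" where "Xd1 \<delta> s = s / sqrt (\<delta>\<^sup>2 + s\<^sup>2)"
definition Xd2 :: "real \<Rightarrow> real \<Rightarrow> real" where "Xd2 \<delta> s = \<delta>\<^sup>2 / (sqrt (\<delta>\<^sup>2 + s\<^sup>2))^3"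

context fixes \<delta> :: real assumes \<delta>: "\<delta> > 0"
begin

lemma Xd_pos: "\<delta>\<^sup>2 + s\<^sup>2 > 0" "sqrt (\<delta>\<^sup>2 + s\<^sup>2) \<ge> \<delta>" "sqrt (\<delta>\<^sup>2 + s\<^sup>2) > 0" "sqrt (\<delta>\<^sup>2 + s\<^sup>2) \<ge> \<bar>s\<bar>"
proof -
  show p: "\<delta>\<^sup>2 + s\<^sup>2 > 0" using \<delta> by (simp add: add_pos_nonneg)
  show "sqrt (\<delta>\<^sup>2 + s\<^sup>2) \<ge> \<delta>" using \<delta> by (intro real_le_rsqrt) simp
  show "sqrt (\<delta>\<^sup>2 + s\<^sup>2) > 0" using p by simp
  show "sqrt (\<delta>\<^sup>2 + s\<^sup>2) \<ge> \<bar>s\<bar>" by (intro real_le_rsqrt) simp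
qed

lemma Xd_deriv: "(Xd \<delta> has_real_derivative Xd1 \<delta> s) (at s)"
proof -
  have "((\<lambda>s. sqrt (\<delta>\<^sup>2 + s\<^sup>2) - \<delta>) has_real_derivative (inverse (sqrt (\<delta>\<^sup>2 + s\<^sup>2)) / 2) * (2 * s)) (at s)"
    using Xd_pos(1)[of s] by (auto intro!: derivative_eq_intros)
  moreover have "(inverse (sqrt (\<delta>\<^sup>2 + s\<^sup>2)) / 2) * (2 * s) = Xd1 \<delta> s"
    using Xd_pos(3)[of s] unfolding Xd1_def by (simp add: field_simps)
  moreover have "Xd \<delta> = (\<lambda>s. sqrt (\<delta>\<^sup>2 + s\<^sup>2) - \<delta>)" by (rule ext) (rule Xd_def)
  ultimately show ?thesis by metis
qed

lemma Xd1_deriv: "(Xd1 \<delta> has_real_derivative Xd2 \<delta> s) (at s)"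
proof -
  define R where "R = sqrt (\<delta>\<^sup>2 + s\<^sup>2)"
  have R: "R > 0" "R\<^sup>2 = \<delta>\<^sup>2 + s\<^sup>2" using Xd_pos[of s] by (auto simp: R_def)
  have "((\<lambda>s. s / sqrt (\<delta>\<^sup>2 + s\<^sup>2)) has_real_derivative (1 * R - s * ((inverse R / 2) * (2 * s))) / (R * R)) (at s)"
    using Xd_pos[of s] unfolding R_def
    by (intro DERIV_divide) (auto intro!: derivative_eq_intros)
  moreover have "(1 * R - s * ((inverse R / 2) * (2 * s))) / (R * R) = \<delta>\<^sup>2 / R^3"
  proof -
    have "(1 * R - s * ((inverse R / 2) * (2 * s))) / (R * R) = (R\<^sup>2 - s\<^sup>2) / R^3"
      using R(1) by (simp add: field_simps power2_eq_square power3_eq_cube)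
    then show ?thesis using R(2) by simp
  qed
  ultimately show ?thesis by (simp add: Xd1_def[abs_def] Xd2_def R_def)
qed

lemma Xd_cont: "continuous_on UNIV (Xd1 \<delta>)" "continuous_on UNIV (Xd2 \<delta>)"
proof -
  have "sqrt (\<delta>\<^sup>2 + s\<^sup>2) \<noteq> 0" for s using Xd_pos(3)[of s] by linarith
  then show "continuous_on UNIV (Xd1 \<delta>)" "continuous_on UNIV (Xd2 \<delta>)"
    unfolding Xd1_def[abs_def] Xd2_def[abs_def] by (auto intro!: continuous_intros)
qed

lemma Xd_zero: "Xd \<delta> 0 = 0" "Xd1 \<delta> 0 = 0" using \<delta> by (auto simp: Xd_def Xd1_def)

lemma Xd1_bound: "\<bar>Xd1 \<delta> s\<bar> \<le> 1"
  using Xd_pos(3,4)[of s] by (simp add: Xd1_def abs_divide)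

lemma Xd2_bound: "0 \<le> Xd2 \<delta> s" "Xd2 \<delta> s \<le> 1 / \<delta>"
proof -
  show "0 \<le> Xd2 \<delta> s" using Xd_pos(3)[of s] by (simp add: Xd2_def)
  have "\<delta>^3 \<le> (sqrt (\<delta>\<^sup>2 + s\<^sup>2))^3" using Xd_pos(2)[of s] \<delta> by (intro power_mono) auto
  then have "Xd2 \<delta> s \<le> \<delta>\<^sup>2 / \<delta>^3" unfolding Xd2_def using \<delta> Xd_pos(3)[of s] by (intro divide_left_mono mult_pos_pos zero_less_power) auto
  also have "\<dots> = 1 / \<delta>" using \<delta> by (simp add: power2_eq_square power3_eq_cube)
  finally show "Xd2 \<delta> s \<le> 1 / \<delta>" .
qed

lemma Xd_bounds: "0 \<le> Xd \<delta> s" "\<bar>s\<bar> - \<delta> \<le> Xd \<delta> s"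
  using Xd_pos(2,4)[of s] by (auto simp: Xd_def)

lemma Xd_lipschitz: "\<bar>Xd \<delta> a - Xd \<delta> b\<bar> \<le> \<bar>a - b\<bar>"
  using field_differentiable_bound[of UNIV "Xd \<delta>" "Xd1 \<delta>" 1 a b] Xd_deriv Xd1_bound by simp

end

context bdd_dom
begin

lemma sqint_mult_bounded:
  fixes u :: "real^'n \<Rightarrow> 'b::euclidean_space"
  assumes "sqint M u" "c \<in> borel_measurable M" "\<And>x. x \<in> \<Omega> \<Longrightarrow> \<bar>c x\<bar> \<le> B"
  shows "sqint M (\<lambda>x. c x *\<^sub>R u x)"
proof -
  have "integrable M (\<lambda>x. (norm (c x *\<^sub>R u x))\<^sup>2)"
  proof (rule Bochner_Integration.integrable_bound)
    show "integrable M (\<lambda>x. B\<^sup>2 * (norm (u x))\<^sup>2)" using assms by (simp add: sqint_def)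
    show "AE x in M. norm ((norm (c x *\<^sub>R u x))\<^sup>2) \<le> norm (B\<^sup>2 * (norm (u x))\<^sup>2)"
    proof (rule AE_I2)
      fix x assume "x \<in> space M"
      then have "\<bar>c x\<bar> \<le> \<bar>B\<bar>" using assms(3)[of x] by simp
      then have "(c x)\<^sup>2 \<le> B\<^sup>2" by (simp flip: abs_le_square_iff)
      then show "norm ((norm (c x *\<^sub>R u x))\<^sup>2) \<le> norm (B\<^sup>2 * (norm (u x))\<^sup>2)"
        by (simp add: power_mult_distrib mult_right_mono)
    qed
  qed (use assms in \<open>auto simp: sqint_def\<close>)
  with assms show ?thesis by (auto simp: sqint_def)
qed

end

section \<open>The essential bound for weak solutions\<close>

context pde_dom
begin

lemma Kgrad_cont: "\<epsilon> > 0 \<Longrightarrow> continuous_on UNIV (Kgrad x0 \<epsilon>)"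
  by (rule C1_continuous_grad[OF Ker_C1])

text \<open>An integrated Kato inequality. The test function is \<open>Xd1 \<delta> y\<close> times
  the kernel: convexity of \<open>Xd\<close> and nonnegativity of the kernel allow the term with
  \<open>Xd2\<close> to be dropped, and integration by parts moves the remaining gradient onto the
  kernel, where it becomes \<open>Kw\<close>. The approximations \<open>\<phi> k\<close> replace
  \<open>y\<close> because \<open>r\<close> is only integrable and may be tested only with test
  functions.\<close>

lemma subsolution_test:
  assumes w: "wsol y g r" and k: "kato G B" and sgn: "AE x in M. r x * y x \<le> G x * \<bar>y x\<bar>"
    and x0: "x0 \<in> \<Omega>" and e: "0 < \<epsilon>" "\<epsilon> \<le> 1" and \<delta>: "\<delta> > 0"
  shows "integrable M (\<lambda>x. Xd \<delta> (y x) * Kw x0 \<epsilon> x)" "(LINT x|M. Xd \<delta> (y x) * Kw x0 \<epsilon> x) \<le> B"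
proof -
  have H: "H0 y g" and r: "integrable M r" using w by (auto simp: wsol_def)
  have sy: "sqint M y" and sg: "sqint M g" using H0_sqint[OF H] by auto
  have ym: "y \<in> borel_measurable M" and rm: "r \<in> borel_measurable M"
    using sy r by (auto simp: sqint_def)
  obtain \<phi> where \<phi>: "\<And>k::nat. test_fun \<Omega> (\<phi> k)" "(\<lambda>k. l2sq M (\<lambda>x. \<phi> k x - y x)) \<longlonglongrightarrow> 0"
    "(\<lambda>k. l2sq M (\<lambda>x. grad (\<phi> k) x - g x)) \<longlonglongrightarrow> 0" "AE x in M. (\<lambda>k. \<phi> k x) \<longlonglongrightarrow> y x"
    using H by (rule H0_approx) (rule that)
  obtain bK where bK: "bK > 0" "\<And>x. x \<in> \<Omega> \<Longrightarrow> norm (Ker x0 \<epsilon> x) \<le> bK"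
    using cont_bounded_dom[OF C1_continuous[OF Ker_C1[OF e(1)]]] by blast
  obtain bV where bV: "bV > 0" "\<And>x. x \<in> \<Omega> \<Longrightarrow> norm (Kgrad x0 \<epsilon> x) \<le> bV"
    using cont_bounded_dom[OF Kgrad_cont[OF e(1)]] by blast
  obtain bW where bW: "bW > 0" "\<And>x. x \<in> \<Omega> \<Longrightarrow> norm (Kw x0 \<epsilon> x) \<le> bW"
    using cont_bounded_dom[OF Kw_cont[OF e(1)]] by blast
  have Km: "Ker x0 \<epsilon> \<in> borel_measurable M" by (rule Ker_meas[OF e(1)])
  have Vm: "Kgrad x0 \<epsilon> \<in> borel_measurable M" by (intro borel_M borel_measurable_continuous_onI Kgrad_cont e)
  have Wm: "Kw x0 \<epsilon> \<in> borel_measurable M" by (intro borel_M borel_measurable_continuous_onI Kw_cont e)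
  have sV: "sqint M (Kgrad x0 \<epsilon>)" by (rule sqint_bounded[OF fin Vm, of bV]) (auto intro!: AE_I2 bV)
  have sW: "sqint M (Kw x0 \<epsilon>)" by (rule sqint_bounded[OF fin Wm, of bW]) (auto intro!: AE_I2 bW(2)[simplified])
  have X1m: "(\<lambda>x. Xd1 \<delta> (u x)) \<in> borel_measurable M" and X2m: "(\<lambda>x. Xd2 \<delta> (u x)) \<in> borel_measurable M"
    and Xm: "(\<lambda>x. Xd \<delta> (u x)) \<in> borel_measurable M"
    if "u \<in> borel_measurable M" for u
  proof -
    have "continuous_on UNIV (Xd \<delta>)" using Xd_deriv[OF \<delta>] by (intro DERIV_continuous_on) auto
    then show "(\<lambda>x. Xd1 \<delta> (u x)) \<in> borel_measurable M" "(\<lambda>x. Xd2 \<delta> (u x)) \<in> borel_measurable M" "(\<lambda>x. Xd \<delta> (u x)) \<in> borel_measurable M"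
      using Xd_cont[OF \<delta>] that by (auto intro: measurable_compose[OF that borel_measurable_continuous_onI])
  qed
  have pm: "\<phi> k \<in> borel_measurable M" for k by (rule test_fun_meas[OF \<phi>(1)])
  have sX: "sqint M (\<lambda>x. Xd \<delta> (u x))" if "sqint M u" for u
  proof -
    have um: "u \<in> borel_measurable M" using that by (simp add: sqint_def)
    have "\<bar>Xd \<delta> s\<bar> \<le> \<bar>s\<bar>" for s using Xd_lipschitz[OF \<delta>, of s 0] Xd_zero[OF \<delta>] by simp
    then have le: "norm ((norm (Xd \<delta> s))\<^sup>2) \<le> norm ((norm s)\<^sup>2)" for s by (simp flip: abs_le_square_iff)
    have "integrable M (\<lambda>x. (norm (Xd \<delta> (u x)))\<^sup>2)"
    proof (rule Bochner_Integration.integrable_bound)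
      show "integrable M (\<lambda>x. (norm (u x))\<^sup>2)" using that by (simp add: sqint_def)
      show "(\<lambda>x. (norm (Xd \<delta> (u x)))\<^sup>2) \<in> borel_measurable M" using Xm[OF um] by measurable
    qed (rule AE_I2, rule le)
    then show ?thesis using Xm[OF um] by (simp add: sqint_def)
  qed
  have sp: "sqint M (\<phi> k)" and sD: "sqint M (grad (\<phi> k))" for k using test_fun_sqint[OF \<phi>(1)] by auto
  define \<zeta> where "\<zeta> k x = Xd1 \<delta> (\<phi> k x) * Ker x0 \<epsilon> x" for k x
  note tX1 = test_fun_compose[OF \<phi>(1) Xd1_deriv[OF \<delta>] Xd_cont(2)[OF \<delta>] Xd_zero(2)[OF \<delta>]]
  note tX = test_fun_compose[OF \<phi>(1) Xd_deriv[OF \<delta>] Xd_cont(1)[OF \<delta>] Xd_zero(1)[OF \<delta>]]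
  note t\<zeta> = test_fun_mult_C1[OF tX1(1) Ker_C1[OF e(1)]]
  have test\<zeta>: "test_fun \<Omega> (\<zeta> k)" for k using t\<zeta>(1) by (simp add: \<zeta>_def[abs_def])
  have grad\<zeta>: "grad (\<zeta> k) x = Xd1 \<delta> (\<phi> k x) *\<^sub>R Kgrad x0 \<epsilon> x + Ker x0 \<epsilon> x *\<^sub>R (Xd2 \<delta> (\<phi> k x) *\<^sub>R grad (\<phi> k) x)" for k x
    using t\<zeta>(2) by (simp add: \<zeta>_def[abs_def] tX1(2))
  \<comment> \<open>The coefficient of the error \<open>grad (\<phi> k) - g\<close>. It is chosen
    such that \<open>g \<bullet> grad (\<zeta> k) + a k \<bullet> (grad (\<phi> k) - g)\<close>
    exceeds \<open>Xd1 \<delta> (\<phi> k) * (grad (\<phi> k) \<bullet> Kgrad x0 \<epsilon>)\<close>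
    by exactly \<open>Ker x0 \<epsilon> * Xd2 \<delta> (\<phi> k) * (g \<bullet> g)\<close>, which
    is nonnegative.\<close>
  define a where "a k x = Xd1 \<delta> (\<phi> k x) *\<^sub>R Kgrad x0 \<epsilon> x - (Ker x0 \<epsilon> x * Xd2 \<delta> (\<phi> k x)) *\<^sub>R g x" for k x
  have KX2: "\<bar>Ker x0 \<epsilon> x * Xd2 \<delta> s\<bar> \<le> bK / \<delta>" if "x \<in> \<Omega>" for x s
    using mult_mono[OF bK(2)[OF that] Xd2_bound(2)[OF \<delta>, of s]] Xd2_bound(1)[OF \<delta>, of s] bK(1) by (simp add: abs_mult)
  have sa: "sqint M (a k)" for k
    unfolding a_def[abs_def]
  proof (rule sqint_diff)
    show "sqint M (\<lambda>x. Xd1 \<delta> (\<phi> k x) *\<^sub>R Kgrad x0 \<epsilon> x)"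
      by (rule sqint_mult_bounded[OF sV X1m[OF pm] Xd1_bound[OF \<delta>]])
    show "sqint M (\<lambda>x. (Ker x0 \<epsilon> x * Xd2 \<delta> (\<phi> k x)) *\<^sub>R g x)"
      by (rule sqint_mult_bounded[OF sg borel_measurable_times[OF Km X2m[OF pm]] KX2])
  qed
  \<comment> \<open>A bound independent of \<open>k\<close>, so that the error term vanishes by
    Cauchy-Schwarz.\<close>
  define L where "L = (LINT x|M. 2 * bV\<^sup>2 + 2 * ((bK / \<delta>)\<^sup>2 * (norm (g x))\<^sup>2))"
  have aL: "l2sq M (a k) \<le> L" for k
    unfolding L_def l2sq_def
  proof (rule integral_mono)
    interpret finite_measure M by (rule fin)
    show "integrable M (\<lambda>x. (norm (a k x))\<^sup>2)" using sa by (simp add: sqint_def)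
    show "integrable M (\<lambda>x. 2 * bV\<^sup>2 + 2 * ((bK / \<delta>)\<^sup>2 * (norm (g x))\<^sup>2))" using sg by (simp add: sqint_def)
    fix x assume "x \<in> space M"
    then have x: "x \<in> \<Omega>" by simp
    have "norm (Xd1 \<delta> (\<phi> k x) *\<^sub>R Kgrad x0 \<epsilon> x) \<le> 1 * bV"
      unfolding norm_scaleR using Xd1_bound[OF \<delta>] bV(2)[OF x] by (intro mult_mono) auto
    then have 1: "(norm (Xd1 \<delta> (\<phi> k x) *\<^sub>R Kgrad x0 \<epsilon> x))\<^sup>2 \<le> bV\<^sup>2" by (intro power_mono) auto
    have "norm ((- (Ker x0 \<epsilon> x * Xd2 \<delta> (\<phi> k x))) *\<^sub>R g x) \<le> (bK / \<delta>) * norm (g x)"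
      unfolding norm_scaleR abs_minus_cancel using KX2[OF x] by (intro mult_right_mono) auto
    then have 2: "(norm ((- (Ker x0 \<epsilon> x * Xd2 \<delta> (\<phi> k x))) *\<^sub>R g x))\<^sup>2 \<le> (bK / \<delta>)\<^sup>2 * (norm (g x))\<^sup>2"
      using power_mono[OF _ norm_ge_zero, of _ _ 2] by (metis power_mult_distrib)
    show "(norm (a k x))\<^sup>2 \<le> 2 * bV\<^sup>2 + 2 * ((bK / \<delta>)\<^sup>2 * (norm (g x))\<^sup>2)"
      using norm_add_sq_le[of "Xd1 \<delta> (\<phi> k x) *\<^sub>R Kgrad x0 \<epsilon> x" "(- (Ker x0 \<epsilon> x * Xd2 \<delta> (\<phi> k x))) *\<^sub>R g x"] 1 2
      by (simp add: a_def)
  qed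
  have main: "(LINT x|M. Xd \<delta> (\<phi> k x) * Kw x0 \<epsilon> x) \<le> (LINT x|M. r x * \<zeta> k x) + (LINT x|M. a k x \<bullet> (grad (\<phi> k) x - g x))" for k
  proof -
    have "(LINT x|M. Xd \<delta> (\<phi> k x) * Kw x0 \<epsilon> x) = (LINT x|M. (Xd1 \<delta> (\<phi> k x) *\<^sub>R grad (\<phi> k) x) \<bullet> Kgrad x0 \<epsilon> x)"
      using integral_grad_Kgrad[OF tX(1) e(1), of k x0] by (simp add: tX(2))
    also have "\<dots> \<le> (LINT x|M. g x \<bullet> grad (\<zeta> k) x + a k x \<bullet> (grad (\<phi> k) x - g x))"
    proof (rule integral_mono)
      show "integrable M (\<lambda>x. (Xd1 \<delta> (\<phi> k x) *\<^sub>R grad (\<phi> k) x) \<bullet> Kgrad x0 \<epsilon> x)"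
        using test_fun_sqint(2)[OF tX(1)] by (intro sqint_inner[OF _ sV]) (simp add: tX(2))
      show "integrable M (\<lambda>x. g x \<bullet> grad (\<zeta> k) x + a k x \<bullet> (grad (\<phi> k) x - g x))"
        by (intro Bochner_Integration.integrable_add sqint_inner sg sa sqint_diff sD test_fun_sqint[OF test\<zeta>])
      fix x assume "x \<in> space M"
      then have x: "x \<in> \<Omega>" by simp
      have "0 \<le> (Ker x0 \<epsilon> x * Xd2 \<delta> (\<phi> k x)) * (g x \<bullet> g x)"
        using Ker_nonneg[OF x x0 e] Xd2_bound(1)[OF \<delta>] by (intro mult_nonneg_nonneg) auto
      then show "(Xd1 \<delta> (\<phi> k x) *\<^sub>R grad (\<phi> k) x) \<bullet> Kgrad x0 \<epsilon> x \<le> g x \<bullet> grad (\<zeta> k) x + a k x \<bullet> (grad (\<phi> k) x - g x)"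
        by (simp add: grad\<zeta> a_def inner_simps inner_commute algebra_simps)
    qed
    also have "\<dots> = (LINT x|M. g x \<bullet> grad (\<zeta> k) x) + (LINT x|M. a k x \<bullet> (grad (\<phi> k) x - g x))"
      by (intro Bochner_Integration.integral_add sqint_inner sg sa sqint_diff sD test_fun_sqint[OF test\<zeta>])
    also have "(LINT x|M. g x \<bullet> grad (\<zeta> k) x) = (LINT x|M. r x * \<zeta> k x)"
      using w test\<zeta>[of k] by (simp add: wsol_def)
    finally show ?thesis .
  qed
  have lim1: "(\<lambda>k. LINT x|M. Xd \<delta> (\<phi> k x) * Kw x0 \<epsilon> x) \<longlonglongrightarrow> (LINT x|M. Xd \<delta> (y x) * Kw x0 \<epsilon> x)"
  proof -
    have "(\<lambda>k. l2sq M (\<lambda>x. Xd \<delta> (\<phi> k x) - Xd \<delta> (y x))) \<longlonglongrightarrow> 0"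
    proof (rule tendsto_sandwich[OF _ _ tendsto_const \<phi>(2)])
      have "l2sq M (\<lambda>x. Xd \<delta> (\<phi> k x) - Xd \<delta> (y x)) \<le> l2sq M (\<lambda>x. \<phi> k x - y x)" for k
        unfolding l2sq_def
      proof (rule integral_mono)
        show "integrable M (\<lambda>x. (norm (Xd \<delta> (\<phi> k x) - Xd \<delta> (y x)))\<^sup>2)"
          using sqint_diff[OF sX[OF sp[of k]] sX[OF sy]] by (simp add: sqint_def)
        show "integrable M (\<lambda>x. (norm (\<phi> k x - y x))\<^sup>2)"
          using sqint_diff[OF sp[of k] sy] by (simp add: sqint_def)
        show "(norm (Xd \<delta> (\<phi> k x) - Xd \<delta> (y x)))\<^sup>2 \<le> (norm (\<phi> k x - y x))\<^sup>2" for x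
          using Xd_lipschitz[OF \<delta>] by (intro power_mono) auto
      qed
      then show "\<forall>\<^sub>F k in sequentially. l2sq M (\<lambda>x. Xd \<delta> (\<phi> k x) - Xd \<delta> (y x)) \<le> l2sq M (\<lambda>x. \<phi> k x - y x)"
        by (intro always_eventually allI)
    qed simp
    from l2_inner_tendsto_left[OF sX[OF sp] sX[OF sy] sW this] show ?thesis by simp
  qed
  have lim2: "(\<lambda>k. LINT x|M. r x * \<zeta> k x) \<longlonglongrightarrow> (LINT x|M. r x * (Xd1 \<delta> (y x) * Ker x0 \<epsilon> x))"
  proof (rule integral_dominated_convergence)
    show "integrable M (\<lambda>x. bK * \<bar>r x\<bar>)" using r by simp
    show "(\<lambda>x. r x * (Xd1 \<delta> (y x) * Ker x0 \<epsilon> x)) \<in> borel_measurable M"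
      by (intro borel_measurable_times rm Km X1m ym)
    show "(\<lambda>x. r x * \<zeta> k x) \<in> borel_measurable M" for k
      unfolding \<zeta>_def by (intro borel_measurable_times rm Km X1m pm)
    show "AE x in M. (\<lambda>k. r x * \<zeta> k x) \<longlonglongrightarrow> r x * (Xd1 \<delta> (y x) * Ker x0 \<epsilon> x)"
      using \<phi>(4)
    proof eventually_elim
      case (elim x)
      have "isCont (Xd1 \<delta>) (y x)" using Xd_cont(1)[OF \<delta>] by (simp add: continuous_on_eq_continuous_at)
      from isCont_tendsto_compose[OF this elim] show ?case unfolding \<zeta>_def by (intro tendsto_intros)
    qed
    show "AE x in M. norm (r x * \<zeta> k x) \<le> bK * \<bar>r x\<bar>" for k
    proof (rule AE_I2)
      fix x assume "x \<in> space M"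
      then have x: "x \<in> \<Omega>" by simp
      have "\<bar>\<zeta> k x\<bar> \<le> 1 * bK"
        unfolding \<zeta>_def abs_mult using Xd1_bound[OF \<delta>] bK(2)[OF x] by (intro mult_mono) auto
      then show "norm (r x * \<zeta> k x) \<le> bK * \<bar>r x\<bar>"
        using mult_left_mono[of "\<bar>\<zeta> k x\<bar>" bK "\<bar>r x\<bar>"] by (simp add: abs_mult mult.commute)
    qed
  qed
  have lim3: "(\<lambda>k. LINT x|M. a k x \<bullet> (grad (\<phi> k) x - g x)) \<longlonglongrightarrow> 0"
  proof (rule tendsto_rabs_zero_cancel, rule tendsto_sandwich[OF _ _ tendsto_const])
    have "\<bar>LINT x|M. a k x \<bullet> (grad (\<phi> k) x - g x)\<bar> \<le> sqrt L * sqrt (l2sq M (\<lambda>x. grad (\<phi> k) x - g x))" for k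
      by (rule order_trans[OF l2_inner_le[OF sa sqint_diff[OF sD sg]]])
        (intro mult_right_mono real_sqrt_le_mono aL real_sqrt_ge_zero l2sq_nonneg)
    then show "\<forall>\<^sub>F k in sequentially. \<bar>LINT x|M. a k x \<bullet> (grad (\<phi> k) x - g x)\<bar> \<le> sqrt L * sqrt (l2sq M (\<lambda>x. grad (\<phi> k) x - g x))"
      by (intro always_eventually allI)
    show "(\<lambda>k. sqrt L * sqrt (l2sq M (\<lambda>x. grad (\<phi> k) x - g x))) \<longlonglongrightarrow> 0"
      using tendsto_mult_right_zero[OF tendsto_real_sqrt[OF \<phi>(3), simplified], of "sqrt L"] by simp
  qed simp
  have "(LINT x|M. Xd \<delta> (y x) * Kw x0 \<epsilon> x) \<le> (LINT x|M. r x * (Xd1 \<delta> (y x) * Ker x0 \<epsilon> x)) + 0"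
    by (rule LIMSEQ_le[OF lim1 tendsto_add[OF lim2 lim3]]) (use main in auto)
  also have "\<dots> \<le> (LINT x|M. G x * Ker x0 \<epsilon> x) + 0"
  proof (rule add_right_mono, rule integral_mono_AE)
    have "\<bar>Xd1 \<delta> (y x) * Ker x0 \<epsilon> x\<bar> \<le> bK" if "x \<in> \<Omega>" for x
      using mult_mono[OF Xd1_bound[OF \<delta>, of "y x"] bK(2)[OF that]] by (simp add: abs_mult)
    then show "integrable M (\<lambda>x. r x * (Xd1 \<delta> (y x) * Ker x0 \<epsilon> x))"
      by (intro integrable_mult_bounded[OF r, of _ bK] borel_measurable_times Km X1m ym AE_I2) simp
    show "integrable M (\<lambda>x. G x * Ker x0 \<epsilon> x)" using k e by (intro integrable_mult_Ker) (auto simp: kato_def)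
    have "AE x in M. x \<in> \<Omega>" by (rule AE_I2) simp
    moreover have "AE x in M. 0 \<le> G x" using k by (simp add: kato_def)
    ultimately show "AE x in M. r x * (Xd1 \<delta> (y x) * Ker x0 \<epsilon> x) \<le> G x * Ker x0 \<epsilon> x"
      using sgn
    proof eventually_elim
      case (elim x)
      \<comment> \<open>\<open>Xd1 \<delta> (y x)\<close> is \<open>y x\<close> times a positive
        factor, so the sign hypothesis on \<open>r x * y x\<close> applies.\<close>
      have "r x * Xd1 \<delta> (y x) = (r x * y x) / sqrt (\<delta>\<^sup>2 + (y x)\<^sup>2)" by (simp add: Xd1_def)
      also have "\<dots> \<le> (G x * \<bar>y x\<bar>) / sqrt (\<delta>\<^sup>2 + (y x)\<^sup>2)"
        using elim(3) Xd_pos(3)[OF \<delta>, of "y x"] by (intro divide_right_mono) auto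
      also have "\<dots> = G x * \<bar>Xd1 \<delta> (y x)\<bar>" using Xd_pos(3)[OF \<delta>, of "y x"] by (simp add: Xd1_def abs_divide)
      also have "\<dots> \<le> G x * 1" using elim(2) Xd1_bound[OF \<delta>] by (intro mult_left_mono) auto
      finally have "r x * Xd1 \<delta> (y x) \<le> G x" by simp
      from mult_right_mono[OF this Ker_nonneg[OF elim(1) x0 e]] show ?case by (simp add: mult.assoc)
    qed
  qed
  also have "\<dots> \<le> B" using k x0 e by (simp add: kato_def)
  finally show "(LINT x|M. Xd \<delta> (y x) * Kw x0 \<epsilon> x) \<le> B" .
  show "integrable M (\<lambda>x. Xd \<delta> (y x) * Kw x0 \<epsilon> x)" by (rule sqint_mult[OF sX[OF sy] sW])
qed

text \<open>Chosen such that on the ball of radius \<open>\<epsilon>\<close> about \<open>x0\<close>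
  the kernel \<open>Kw\<close> is at least 1 / (\<open>Cinf\<close> times the volume of that
  ball).\<close>

definition Cinf :: real where "Cinf = 2 powr (nn/2 + 1) / (nn * unit_ball_vol nn)"

lemma Cinf_pos: "Cinf > 0"
proof -
  have "nn > 0" using nn_cases by auto
  then show ?thesis by (simp add: Cinf_def)
qed

text \<open>\<open>Kw\<close> dominates a fixed multiple of the normalised indicator of a small
  ball, so \<open>subsolution_test\<close> bounds all ball averages of \<open>Xd \<delta> y\<close>
  by \<open>Cinf * B\<close>. The differentiation argument of \<open>ball_average_bound\<close>
  makes this pointwise, and \<open>\<delta>\<close> then tends to 0.\<close>

theorem Linf_estimate:
  assumes w: "wsol y g r" and k: "kato G B" and sgn: "AE x in M. r x * y x \<le> G x * \<bar>y x\<bar>"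
  shows "AE x in M. \<bar>y x\<bar> \<le> Cinf * B"
\<comment> \<open>A point of the domain is what shows that \<open>B\<close> is nonnegative.\<close>
proof (cases "\<Omega> = {}")
  case True
  then show ?thesis by (intro AE_I2) simp
next
  case False
  then obtain x1 where x1: "x1 \<in> \<Omega>" by auto
  have nn0: "nn > 0" using nn_cases by auto
  have "0 \<le> (LINT x|M. G x * Ker x1 1 x)"
  proof (rule integral_nonneg_AE)
    have "AE x in M. x \<in> \<Omega>" by (rule AE_I2) simp
    moreover have "AE x in M. 0 \<le> G x" using k by (simp add: kato_def)
    ultimately show "AE x in M. 0 \<le> G x * Ker x1 1 x"
      by eventually_elim (intro mult_nonneg_nonneg Ker_nonneg x1; simp)
  qed
  also have "\<dots> \<le> B" using k x1 by (simp add: kato_def)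
  finally have B: "B \<ge> 0" .
  have ym: "y \<in> borel_measurable M" using w by (auto simp: wsol_def dest: H0_sqint sqint_measurable)
  have ae: "AE x in M. Xd \<delta> (y x) \<le> Cinf * B" if \<delta>: "\<delta> > 0" for \<delta>
  proof (rule ball_average_bound[OF opn bdd])
    have "continuous_on UNIV (Xd \<delta>)" using Xd_deriv[OF \<delta>] by (intro DERIV_continuous_on) auto
    then show "(\<lambda>x. Xd \<delta> (y x)) \<in> borel_measurable M"
      using measurable_compose[OF ym borel_measurable_continuous_onI] by blast
    show "Cinf * B \<ge> 0" using Cinf_pos B by simp
    fix x \<epsilon> assume c: "cball x \<epsilon> \<subseteq> \<Omega>" and e: "0 < \<epsilon>" "\<epsilon> \<le> (1::real)"
    have x: "x \<in> \<Omega>" using c e by auto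
    \<comment> \<open>The value of \<open>Kw\<close> on the sphere of radius
      \<open>\<epsilon>\<close>, which is its minimum on the ball.\<close>
    define wm where "wm = nn * \<epsilon>\<^sup>2 * (2 * \<epsilon>\<^sup>2) powr (- nn/2 - 1)"
    have wm: "wm > 0" using nn0 e by (simp add: wm_def)
    have Kw_ge: "wm \<le> Kw x \<epsilon> z" if "z \<in> cball x \<epsilon>" for z
    proof -
      have "(norm (z - x))\<^sup>2 \<le> \<epsilon>\<^sup>2" using that by (intro power_mono) (auto simp: dist_norm norm_minus_commute)
      then have "(2 * \<epsilon>\<^sup>2) powr (- nn/2 - 1) \<le> ((norm (z - x))\<^sup>2 + \<epsilon>\<^sup>2) powr (- nn/2 - 1)"
        using nn0 e by (intro powr_mono2') (auto simp: add_nonneg_pos)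
      then show ?thesis unfolding wm_def Kw_def using nn0 by (intro mult_left_mono) auto
    qed
    have Kw0: "Kw x \<epsilon> z \<ge> 0" for z unfolding Kw_def using nn0 by simp
    note st = subsolution_test[OF w k sgn x e \<delta>]
    have "(\<integral>\<^sup>+z. ennreal (Xd \<delta> (y z)) * indicator (cball x \<epsilon>) z \<partial>M) \<le> (\<integral>\<^sup>+z. ennreal (Xd \<delta> (y z) * Kw x \<epsilon> z / wm) \<partial>M)"
    proof (rule nn_integral_mono)
      fix z
      show "ennreal (Xd \<delta> (y z)) * indicator (cball x \<epsilon>) z \<le> ennreal (Xd \<delta> (y z) * Kw x \<epsilon> z / wm)"
      proof (cases "z \<in> cball x \<epsilon>")
        case True
        have "Xd \<delta> (y z) * wm \<le> Xd \<delta> (y z) * Kw x \<epsilon> z" using Kw_ge[OF True] Xd_bounds(1)[OF \<delta>] by (intro mult_left_mono)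
        then have "Xd \<delta> (y z) \<le> Xd \<delta> (y z) * Kw x \<epsilon> z / wm" using wm by (simp add: pos_le_divide_eq)
        then show ?thesis using True by (simp add: ennreal_leI)
      qed simp
    qed
    also have "\<dots> = ennreal (LINT z|M. Xd \<delta> (y z) * Kw x \<epsilon> z / wm)"
      using st(1) Kw0 Xd_bounds(1)[OF \<delta>] wm by (intro nn_integral_eq_integral AE_I2) auto
    also have "\<dots> \<le> ennreal (B / wm)"
      using st(2) wm by (intro ennreal_leI) (simp add: divide_right_mono)
    also have "B / wm = Cinf * B * (unit_ball_vol nn * \<epsilon> ^ CARD('n))"
    proof -
      have "1 / wm = (2 * \<epsilon>\<^sup>2) powr (nn/2 + 1) / (nn * \<epsilon>\<^sup>2)"
        using nn0 e powr_minus_divide[of "2 * \<epsilon>\<^sup>2" "nn/2 + 1"] by (simp add: wm_def)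
      also have "(2 * \<epsilon>\<^sup>2) powr (nn/2 + 1) = 2 powr (nn/2 + 1) * (\<epsilon> ^ CARD('n) * \<epsilon>\<^sup>2)"
      proof -
        have "(\<epsilon>\<^sup>2) powr (nn/2 + 1) = (\<epsilon> powr 2) powr (nn/2 + 1)" using e by simp
        also have "\<dots> = \<epsilon> powr (nn + 2)" by (simp only: powr_powr) (simp add: algebra_simps)
        also have "\<dots> = \<epsilon> powr nn * \<epsilon> powr 2" by (simp only: powr_add)
        also have "\<dots> = \<epsilon> ^ CARD('n) * \<epsilon>\<^sup>2" using e by (simp add: nn_def powr_realpow)
        finally show ?thesis by (simp only: powr_mult)
      qed
      finally have "1 / wm = 2 powr (nn/2 + 1) * \<epsilon> ^ CARD('n) / nn" using e nn0 by (simp add: field_simps)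
      moreover have "Cinf * (unit_ball_vol nn * \<epsilon> ^ CARD('n)) = 2 powr (nn/2 + 1) * \<epsilon> ^ CARD('n) / nn"
      proof -
        have "unit_ball_vol nn \<noteq> 0" using unit_ball_vol_pos[of nn] nn0 by (metis less_imp_le less_irrefl)
        then show ?thesis using nn0 by (simp add: Cinf_def)
      qed
      ultimately have "B * (1 / wm) = B * (Cinf * (unit_ball_vol nn * \<epsilon> ^ CARD('n)))" by simp
      then show ?thesis by (simp add: mult_ac)
    qed
    also have "ennreal \<dots> = ennreal (Cinf * B) * ennreal (unit_ball_vol nn * \<epsilon> ^ CARD('n))"
      using Cinf_pos B by (intro ennreal_mult') simp
    also have "ennreal (unit_ball_vol nn * \<epsilon> ^ CARD('n)) = emeasure lebesgue (cball x \<epsilon>)"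
      using emeasure_cball[of \<epsilon> x] e by (simp add: nn_def)
    finally show "(\<integral>\<^sup>+z. ennreal (Xd \<delta> (y z)) * indicator (cball x \<epsilon>) z \<partial>M) \<le> ennreal (Cinf * B) * emeasure lebesgue (cball x \<epsilon>)" .
  qed
  have "AE x in M. \<forall>m::nat. Xd (inverse (Suc m)) (y x) \<le> Cinf * B"
    by (intro AE_all_countable[THEN iffD2] allI ae) simp
  then show ?thesis
  proof eventually_elim
    case (elim x)
    have "(\<lambda>m. \<bar>y x\<bar> - inverse (real (Suc m))) \<longlonglongrightarrow> \<bar>y x\<bar> - 0"
      by (intro tendsto_diff tendsto_const LIMSEQ_inverse_real_of_nat)
    moreover have "\<bar>y x\<bar> - inverse (real (Suc m)) \<le> Cinf * B" for m
      using Xd_bounds(2)[of "inverse (real (Suc m))" "y x"] elim[rule_format, of m] by simp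
    ultimately show ?case using LIMSEQ_le_const2[of _ "\<bar>y x\<bar> - 0" "Cinf * B"] by auto
  qed
qed

end

section \<open>Monotone semilinear equations\<close>

lemma l2norm_triangle:
  assumes "sqint M u" "sqint M v"
  shows "sqrt (l2sq M (\<lambda>x. u x + v x)) \<le> sqrt (l2sq M u) + sqrt (l2sq M v)"
proof (rule real_le_lsqrt)
  have "l2sq M (\<lambda>x. u x + v x) = l2sq M u + 2 * (LINT x|M. u x \<bullet> v x) + l2sq M v"
    using l2sq_add[OF assms, of 1] by simp
  also have "\<dots> \<le> l2sq M u + 2 * (sqrt (l2sq M u) * sqrt (l2sq M v)) + l2sq M v"
    using l2_inner_le[OF assms] by linarith
  also have "\<dots> = (sqrt (l2sq M u) + sqrt (l2sq M v))\<^sup>2"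
    by (simp add: power2_sum)
  finally show "l2sq M (\<lambda>x. u x + v x) \<le> (sqrt (l2sq M u) + sqrt (l2sq M v))\<^sup>2" .
qed simp

lemma l2sq_mono_AE:
  assumes "sqint M u" "sqint M v" "AE x in M. norm (u x) \<le> norm (v x)"
  shows "l2sq M u \<le> l2sq M v"
  unfolding l2sq_def
proof (rule integral_mono_AE)
  show "AE x in M. (norm (u x))\<^sup>2 \<le> (norm (v x))\<^sup>2" using assms(3) by eventually_elim (simp add: power_mono)
qed (use assms in \<open>simp_all add: sqint_def\<close>)

lemma sqint_domI:
  assumes "sqint M v" "u \<in> borel_measurable M" "AE x in M. norm (u x) \<le> norm (v x)"
  shows "sqint M u"
proof -
  have "integrable M (\<lambda>x. (norm (u x))\<^sup>2)"
  proof (rule Bochner_Integration.integrable_bound)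
    show "integrable M (\<lambda>x. (norm (v x))\<^sup>2)" using assms(1) by (simp add: sqint_def)
    show "AE x in M. norm ((norm (u x))\<^sup>2) \<le> norm ((norm (v x))\<^sup>2)"
      using assms(3) by eventually_elim (simp add: power_mono)
  qed (use assms(2) in measurable)
  with assms(2) show ?thesis by (simp add: sqint_def)
qed

text \<open>A contraction of squared distances by \<open>q\<close> is one of distances by
  \<open>sqrt q\<close>, so the tails are bounded by a geometric series.\<close>

lemma l2_Cauchy_geometric:
  fixes w :: "nat \<Rightarrow> 'a \<Rightarrow> 'b::euclidean_space"
  assumes w: "\<And>k. sqint M (w k)" and q: "0 \<le> q" "q < 1"
    and d: "\<And>n. l2sq M (\<lambda>x. w (Suc (Suc n)) x - w (Suc n) x) \<le> q * l2sq M (\<lambda>x. w (Suc n) x - w n x)"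
    and e: "e > 0"
  shows "\<exists>N. \<forall>m\<ge>N. \<forall>n\<ge>N. l2sq M (\<lambda>x. w m x - w n x) \<le> e"
proof -
  define a where "a n = sqrt (l2sq M (\<lambda>x. w (Suc n) x - w n x))" for n
  define s where "s = sqrt q"
  have s: "0 \<le> s" "s < 1" using q by (auto simp: s_def)
  have a: "a n \<le> a 0 * s ^ n" for n
  proof (induction n)
    case (Suc n)
    have "a (Suc n) \<le> s * a n"
      using real_sqrt_le_mono[OF d[of n]] by (simp add: a_def s_def real_sqrt_mult)
    also have "\<dots> \<le> s * (a 0 * s ^ n)" using Suc s by (intro mult_left_mono)
    finally show ?case by (simp add: mult_ac)
  qed simp
  have a0: "a 0 \<ge> 0" by (simp add: a_def)
  have tail: "sqrt (l2sq M (\<lambda>x. w (n + k) x - w n x)) \<le> a 0 * s ^ n * (\<Sum>j<k. s ^ j)" for n k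
  proof (induction k)
    case 0
    show ?case by (simp add: l2sq_def)
  next
    case (Suc k)
    have "sqrt (l2sq M (\<lambda>x. (w (Suc (n + k)) x - w (n + k) x) + (w (n + k) x - w n x)))
      \<le> a (n + k) + sqrt (l2sq M (\<lambda>x. w (n + k) x - w n x))"
      unfolding a_def by (intro l2norm_triangle sqint_diff w)
    also have "\<dots> \<le> a 0 * s ^ (n + k) + a 0 * s ^ n * (\<Sum>j<k. s ^ j)"
      using a[of "n + k"] Suc by (rule add_mono)
    also have "\<dots> = a 0 * s ^ n * (\<Sum>j<Suc k. s ^ j)" by (simp add: power_add algebra_simps)
    finally show ?case by simp
  qed
  have geo: "(\<Sum>j<k. s ^ j) \<le> 1 / (1 - s)" for k
  proof -
    have "(\<Sum>j<k. s ^ j) \<le> (\<Sum>j. s ^ j)" using s by (intro sum_le_suminf summable_geometric) auto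
    then show ?thesis using s by (simp add: suminf_geometric)
  qed
  have bnd: "sqrt (l2sq M (\<lambda>x. w (n + k) x - w n x)) \<le> a 0 * s ^ n * (1 / (1 - s))" for n k
    by (rule order_trans[OF tail]) (intro mult_left_mono geo mult_nonneg_nonneg a0 zero_le_power s)
  have "(\<lambda>n. a 0 * s ^ n * (1 / (1 - s))) \<longlonglongrightarrow> a 0 * 0 * (1 / (1 - s))"
    using s by (intro tendsto_mult tendsto_const LIMSEQ_realpow_zero)
  then have "(\<lambda>n. a 0 * s ^ n * (1 / (1 - s))) \<longlonglongrightarrow> 0" by simp
  from order_tendstoD(2)[OF this, of "sqrt e"] e obtain N where
    N: "\<And>n. n \<ge> N \<Longrightarrow> a 0 * s ^ n * (1 / (1 - s)) < sqrt e" by (auto simp: eventually_sequentially)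
  have main: "l2sq M (\<lambda>x. w m x - w n x) \<le> e" if "N \<le> n" "n \<le> m" for m n
  proof -
    have "sqrt (l2sq M (\<lambda>x. w m x - w n x)) \<le> sqrt e"
      using order_trans[OF bnd[of n "m - n"] less_imp_le[OF N[OF that(1)]]] that(2) by simp
    then show ?thesis by simp
  qed
  have "l2sq M (\<lambda>x. w m x - w n x) \<le> e" if "N \<le> n" "N \<le> m" for m n
    using main[of n m] main[of m n] that l2sq_minus_commute[of M "w m" "w n"] by (cases "n \<le> m") auto
  then show ?thesis by blast
qed

context bdd_dom
begin

text \<open>Solutions and gradients must converge strongly, whereas the right-hand sides need only
  converge when paired with test functions.\<close>

lemma wsol_limit:
  assumes w: "\<And>k::nat. wsol (y k) (g k) (r k)" and s: "sqint M y'" "sqint M g'"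
    and l: "(\<lambda>k. l2sq M (\<lambda>x. y k x - y' x)) \<longlonglongrightarrow> 0" "(\<lambda>k. l2sq M (\<lambda>x. g k x - g' x)) \<longlonglongrightarrow> 0"
    and r: "integrable M r'" "\<And>\<phi>. test_fun \<Omega> \<phi> \<Longrightarrow> (\<lambda>k. LINT x|M. r k x * \<phi> x) \<longlonglongrightarrow> (LINT x|M. r' x * \<phi> x)"
  shows "wsol y' g' r'"
proof -
  have H: "H0 (y k) (g k)" for k using w by (simp add: wsol_def)
  have "(LINT x|M. g' x \<bullet> grad \<phi> x) = (LINT x|M. r' x * \<phi> x)" if t: "test_fun \<Omega> \<phi>" for \<phi>
  proof -
    have "(\<lambda>k. LINT x|M. g k x \<bullet> grad \<phi> x) \<longlonglongrightarrow> (LINT x|M. g' x \<bullet> grad \<phi> x)"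
      by (rule l2_inner_tendsto_left[OF H0_sqint(2)[OF H] s(2) test_fun_sqint(2)[OF t] l(2)])
    moreover have "(LINT x|M. g k x \<bullet> grad \<phi> x) = (LINT x|M. r k x * \<phi> x)" for k
      using w t by (simp add: wsol_def)
    ultimately have "(\<lambda>k. LINT x|M. r k x * \<phi> x) \<longlonglongrightarrow> (LINT x|M. g' x \<bullet> grad \<phi> x)" by simp
    from LIMSEQ_unique[OF this r(2)[OF t]] show ?thesis .
  qed
  then show ?thesis unfolding wsol_def using H0_limit[OF H s l] r(1) by blast
qed

text \<open>Riesz representation in H^1_0: the pairs (sqrt \<open>lam\<close> times
  \<open>\<phi>\<close>, \<open>grad \<phi>\<close>) turn the energy form of - \<Delta> +
  \<open>lam\<close> into the plain inner product, and \<open>l2_projection\<close> represents the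
  functional given by \<open>g\<close>.\<close>

lemma linear_solution:
  assumes la: "lam > 0" and g: "sqint M g"
  shows "\<exists>y \<zeta>. wsol y \<zeta> (\<lambda>x. g x - lam * y x)"
proof -
  define c where "c = sqrt lam"
  have c: "c > 0" "c * c = lam" using la by (auto simp: c_def)
  define S where "S = {s. \<exists>\<phi>. test_fun \<Omega> \<phi> \<and> s = (\<lambda>x. (c * \<phi> x, grad \<phi> x))}"
  have SE: "\<exists>\<phi>. test_fun \<Omega> \<phi> \<and> s = (\<lambda>x. (c * \<phi> x, grad \<phi> x))" if "s \<in> S" for s
    using that unfolding S_def by (rule CollectD)
  have SI: "s \<in> S" if "test_fun \<Omega> \<phi>" "s = (\<lambda>x. (c * \<phi> x, grad \<phi> x))" for s \<phi>
    unfolding S_def using that by (intro CollectI exI conjI)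
  \<comment> \<open>Its inner product with the pair of \<open>\<phi>\<close> is
    \<open>g x * \<phi> x\<close>, so the projection identity is the weak equation.\<close>
  define T where "T x = (g x / c, 0 :: real^'n)" for x
  have sT: "sqint M T" unfolding T_def sqint_pair_iff
    using sqint_scaleR[OF g, of "1/c"] sqint_bounded[OF fin, of "\<lambda>x. 0 :: real^'n" 0] by simp
  have sS: "sqint M s" if st: "s \<in> S" for s
  proof -
    obtain \<phi> where \<phi>: "s = (\<lambda>x. (c * \<phi> x, grad \<phi> x))" "test_fun \<Omega> \<phi>" using SE[OF st] by blast
    show ?thesis unfolding \<phi>(1) sqint_pair_iff
      using sqint_scaleR[OF test_fun_sqint(1)[OF \<phi>(2)], of c] test_fun_sqint(2)[OF \<phi>(2)] by simp
  qed
  have zS: "(\<lambda>x. 0) \<in> S"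
    by (rule SI[OF test_fun_zero(1)]) (simp only: test_fun_zero(2) zero_prod_def mult_zero_right)
  have lS: "(\<lambda>x. s x + d *\<^sub>R t x) \<in> S" if st: "s \<in> S" "t \<in> S" for s t d
  proof -
    obtain \<phi> where \<phi>: "s = (\<lambda>x. (c * \<phi> x, grad \<phi> x))" "test_fun \<Omega> \<phi>" using SE[OF st(1)] by blast
    obtain \<psi> where \<psi>: "t = (\<lambda>x. (c * \<psi> x, grad \<psi> x))" "test_fun \<Omega> \<psi>" using SE[OF st(2)] by blast
    note a = test_fun_add[OF \<phi>(2) \<psi>(2), of d]
    show ?thesis by (rule SI[OF a(1)]) (simp add: a(2) \<phi>(1) \<psi>(1) algebra_simps)
  qed
  obtain w s where w: "sqint M w" "\<And>k::nat. s k \<in> S" "(\<lambda>k. l2sq M (\<lambda>x. s k x - w x)) \<longlonglongrightarrow> 0"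
    "\<And>t. t \<in> S \<Longrightarrow> (LINT x|M. w x \<bullet> t x) = (LINT x|M. T x \<bullet> t x)"
    using l2_projection[OF sS zS lS sT] by blast
  define a where "a x = fst (w x)" for x
  define b where "b x = snd (w x)" for x
  have wab: "w = (\<lambda>x. (a x, b x))" by (simp add: a_def b_def)
  have sab: "sqint M a" "sqint M b" using w(1) unfolding wab sqint_pair_iff by auto
  define y where "y x = (1/c) *\<^sub>R a x" for x
  have sy: "sqint M y" unfolding y_def[abs_def] by (rule sqint_scaleR[OF sab(1)])
  have "\<forall>k. \<exists>\<phi>. test_fun \<Omega> \<phi> \<and> s k = (\<lambda>x. (c * \<phi> x, grad \<phi> x))" using SE[OF w(2)] by (intro allI)
  from choice[OF this] obtain \<phi> where \<phi>: "\<And>k. test_fun \<Omega> (\<phi> k)" "\<And>k. s k = (\<lambda>x. (c * \<phi> k x, grad (\<phi> k) x))" by blast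
  have eq: "l2sq M (\<lambda>x. s k x - w x) = l2sq M (\<lambda>x. c *\<^sub>R (\<phi> k x - y x)) + l2sq M (\<lambda>x. grad (\<phi> k) x - b x)" for k
  proof -
    have "(\<lambda>x. s k x - w x) = (\<lambda>x. (c *\<^sub>R (\<phi> k x - y x), grad (\<phi> k) x - b x))"
      using c(1) by (simp add: \<phi>(2) wab y_def fun_eq_iff right_diff_distrib)
    then show ?thesis
      using l2sq_pair[OF sqint_scaleR[OF sqint_diff[OF test_fun_sqint(1)[OF \<phi>(1)[of k]] sy], of c] sqint_diff[OF test_fun_sqint(2)[OF \<phi>(1)[of k]] sab(2)]] by simp
  qed
  have H: "H0 y b"
  proof (rule H0I[OF \<phi>(1) sy sab(2)])
    show "(\<lambda>k. l2sq M (\<lambda>x. grad (\<phi> k) x - b x)) \<longlonglongrightarrow> 0"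
      by (rule tendsto_sandwich[OF _ _ tendsto_const w(3)]) (auto simp: eq)
    have "(\<lambda>k. (1/c\<^sup>2) * l2sq M (\<lambda>x. s k x - w x)) \<longlonglongrightarrow> 0" by (rule tendsto_mult_right_zero[OF w(3)])
    then show "(\<lambda>k. l2sq M (\<lambda>x. \<phi> k x - y x)) \<longlonglongrightarrow> 0"
    proof (rule tendsto_sandwich[OF _ _ tendsto_const, rotated 2])
      have "c\<^sup>2 * l2sq M (\<lambda>x. \<phi> k x - y x) \<le> l2sq M (\<lambda>x. s k x - w x)" for k
        unfolding eq l2sq_scaleR by simp
      then show "\<forall>\<^sub>F k in sequentially. l2sq M (\<lambda>x. \<phi> k x - y x) \<le> (1/c\<^sup>2) * l2sq M (\<lambda>x. s k x - w x)"
        using c(1) by (intro always_eventually allI) (simp add: field_simps)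
    qed simp
  qed
  have "(LINT x|M. b x \<bullet> grad \<psi> x) = (LINT x|M. (g x - lam * y x) * \<psi> x)" if t: "test_fun \<Omega> \<psi>" for \<psi>
  proof -
    have "(\<lambda>x. (c * \<psi> x, grad \<psi> x)) \<in> S" by (rule SI[OF t refl])
    from w(4)[OF this] have "(LINT x|M. lam * (y x * \<psi> x) + b x \<bullet> grad \<psi> x) = (LINT x|M. g x * \<psi> x)"
    proof -
      assume h: "(LINT x|M. w x \<bullet> (c * \<psi> x, grad \<psi> x)) = (LINT x|M. T x \<bullet> (c * \<psi> x, grad \<psi> x))"
      have "w x \<bullet> (c * \<psi> x, grad \<psi> x) = lam * (y x * \<psi> x) + b x \<bullet> grad \<psi> x" for x
        using c by (simp add: wab y_def c(2)[symmetric])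
      moreover have "T x \<bullet> (c * \<psi> x, grad \<psi> x) = g x * \<psi> x" for x
        using c by (simp add: T_def)
      ultimately show ?thesis using h by simp
    qed
    moreover have "integrable M (\<lambda>x. y x * \<psi> x)" "integrable M (\<lambda>x. g x * \<psi> x)" "integrable M (\<lambda>x. b x \<bullet> grad \<psi> x)"
      by (intro sqint_mult sqint_inner sy g sab test_fun_sqint t)+
    ultimately show ?thesis by (simp add: left_diff_distrib mult.assoc)
  qed
  moreover have "integrable M (\<lambda>x. g x - lam * y x)"
    using sqint_integrable[OF fin g] sqint_integrable[OF fin sy] by simp
  ultimately have "wsol y b (\<lambda>x. g x - lam * y x)" using H by (simp add: wsol_def)
  then show ?thesis by blast
qed

text \<open>The nonlinearity enters only through superpositions \<open>F x (u x)\<close>, hence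
  measurability is asked of these. Vanishing at 0 normalises the sign of
  \<open>F x s * s\<close>.\<close>

definition mono_lip :: "(real^'n \<Rightarrow> real \<Rightarrow> real) \<Rightarrow> real \<Rightarrow> bool" where
  "mono_lip F L \<longleftrightarrow> L > 0 \<and> (\<forall>u. u \<in> borel_measurable M \<longrightarrow> (\<lambda>x. F x (u x)) \<in> borel_measurable M) \<and>
     (AE x in M. F x 0 = 0) \<and> (AE x in M. \<forall>a b. a \<le> b \<longrightarrow> 0 \<le> F x b - F x a \<and> F x b - F x a \<le> L * (b - a))"

text \<open>The third estimate carries the fixed point argument: monotonicity makes L times the
  identity minus \<open>F\<close> Lipschitz with the same constant \<open>L\<close>, not 2
  L.\<close>

lemma mono_lip_facts:
  assumes "mono_lip F L"
  shows "AE x in M. \<forall>a b. \<bar>F x a - F x b\<bar> \<le> L * \<bar>a - b\<bar> \<and> 0 \<le> (F x a - F x b) * (a - b) \<and>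
     \<bar>L * (a - b) - (F x a - F x b)\<bar> \<le> L * \<bar>a - b\<bar> \<and> 0 \<le> F x a * a"
proof -
  have L: "L > 0" and z: "AE x in M. F x 0 = 0" and m: "AE x in M. \<forall>a b. a \<le> b \<longrightarrow> 0 \<le> F x b - F x a \<and> F x b - F x a \<le> L * (b - a)"
    using assms by (auto simp: mono_lip_def)
  from z m show ?thesis
  proof eventually_elim
    case (elim x)
    have 1: "\<bar>F x a - F x b\<bar> \<le> L * \<bar>a - b\<bar> \<and> 0 \<le> (F x a - F x b) * (a - b) \<and>
     \<bar>L * (a - b) - (F x a - F x b)\<bar> \<le> L * \<bar>a - b\<bar>" if "a \<le> b" for a b
    proof -
      have h: "0 \<le> F x b - F x a" "F x b - F x a \<le> L * (b - a)" using elim(2) that by auto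
      have "0 \<le> (F x b - F x a) * (b - a)" using h that by simp
      then have "0 \<le> (F x a - F x b) * (a - b)" by (simp add: algebra_simps)
      moreover have "L * \<bar>a - b\<bar> = L * (b - a)" "L * (a - b) = - (L * (b - a))" using that by (simp_all add: right_diff_distrib)
      ultimately show ?thesis using h by linarith
    qed
    have 2: "\<bar>F x a - F x b\<bar> \<le> L * \<bar>a - b\<bar> \<and> 0 \<le> (F x a - F x b) * (a - b) \<and>
     \<bar>L * (a - b) - (F x a - F x b)\<bar> \<le> L * \<bar>a - b\<bar>" for a b
    proof (cases "a \<le> b")
      case False
      then have "b \<le> a" by simp
      note h = 1[OF this]
      have "(F x a - F x b) * (a - b) = (F x b - F x a) * (b - a)" by (simp add: algebra_simps)
      moreover have "L * (a - b) - (F x a - F x b) = - (L * (b - a) - (F x b - F x a))" by (simp add: algebra_simps)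
      ultimately show ?thesis using h by (simp only: abs_minus_cancel abs_minus_commute)
    qed (rule 1)
    have "0 \<le> F x a * a" for a using 2[of a 0] elim(1) by simp
    with 2 show ?case by blast
  qed
qed

lemma mono_lip_sqint:
  assumes c: "mono_lip F L" and u: "sqint M u" shows "sqint M (\<lambda>x. F x (u x))"
proof (rule sqint_domI[OF sqint_scaleR[OF u, of L]])
  have "AE x in M. F x 0 = 0" using c by (simp add: mono_lip_def)
  with mono_lip_facts[OF c] show "AE x in M. norm (F x (u x)) \<le> norm (L *\<^sub>R u x)"
  proof eventually_elim
    case (elim x)
    have "\<bar>F x (u x) - F x 0\<bar> \<le> L * \<bar>u x - 0\<bar>" using elim(1) by blast
    then show ?case using elim(2) c by (simp add: mono_lip_def abs_mult)
  qed
qed (use c u in \<open>auto simp: mono_lip_def sqint_def\<close>)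

lemma mono_lip_tendsto:
  assumes c: "mono_lip F L" and u: "\<And>k::nat. sqint M (u k)" "sqint M u'" and l: "(\<lambda>k. l2sq M (\<lambda>x. u k x - u' x)) \<longlonglongrightarrow> 0"
  shows "(\<lambda>k. l2sq M (\<lambda>x. F x (u k x) - F x (u' x))) \<longlonglongrightarrow> 0"
proof (rule tendsto_sandwich[OF _ _ tendsto_const])
  have "l2sq M (\<lambda>x. F x (u k x) - F x (u' x)) \<le> l2sq M (\<lambda>x. L *\<^sub>R (u k x - u' x))" for k
  proof (rule l2sq_mono_AE)
    show "AE x in M. norm (F x (u k x) - F x (u' x)) \<le> norm (L *\<^sub>R (u k x - u' x))"
      using mono_lip_facts[OF c] by eventually_elim (use c in \<open>simp add: mono_lip_def abs_mult\<close>)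
  qed (intro sqint_diff sqint_scaleR mono_lip_sqint[OF c] u)+
  then show "\<forall>\<^sub>F k in sequentially. l2sq M (\<lambda>x. F x (u k x) - F x (u' x)) \<le> L\<^sup>2 * l2sq M (\<lambda>x. u k x - u' x)"
    by (intro always_eventually allI) (simp only: l2sq_scaleR)
  show "(\<lambda>k. L\<^sup>2 * l2sq M (\<lambda>x. u k x - u' x)) \<longlonglongrightarrow> 0" by (rule tendsto_mult_right_zero[OF l])
qed simp

lemma wsol_rhs_tendsto:
  assumes "\<And>k::nat. sqint M (r k)" "sqint M r'" "(\<lambda>k. l2sq M (\<lambda>x. r k x - r' x)) \<longlonglongrightarrow> 0" "test_fun \<Omega> \<phi>"
  shows "(\<lambda>k. LINT x|M. r k x * \<phi> x) \<longlonglongrightarrow> (LINT x|M. r' x * \<phi> x)"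
  using l2_inner_tendsto_left[OF assms(1,2) test_fun_sqint(1)[OF assms(4)] assms(3)] by simp

text \<open>Picard iteration for \<open>- \<Delta> y + L y = g + L u - F u\<close>; the Poincare inequality makes it contract.\<close>
lemma semilinear_solution_L2:
  assumes c: "mono_lip F L" and g: "sqint M g"
  shows "\<exists>y \<zeta>. wsol y \<zeta> (\<lambda>x. g x - F x (y x))"
proof -
  have L: "L > 0" using c by (simp add: mono_lip_def)
  obtain C where C: "C > 0" "\<And>y \<zeta>. H0 y \<zeta> \<Longrightarrow> l2sq M y \<le> C * l2sq M \<zeta>" using Poincare by blast
  \<comment> \<open>Adding \<open>L * u\<close> on both sides trades the nonlinearity for a
    right-hand side with Lipschitz constant \<open>L\<close>, matched by the zero-order term
    \<open>L * y\<close> on the left.\<close>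
  define h where "h u x = g x + (L * u x - F x (u x))" for u x
  have sh: "sqint M (h u)" if "sqint M u" for u
    unfolding h_def[abs_def] using sqint_scaleR[OF that, of L] by (intro sqint_add sqint_diff g mono_lip_sqint[OF c] that) simp
  have "\<forall>u. \<exists>p. sqint M u \<longrightarrow> wsol (fst p) (snd p) (\<lambda>x. h u x - L * fst p x)"
  proof
    fix u
    show "\<exists>p. sqint M u \<longrightarrow> wsol (fst p) (snd p) (\<lambda>x. h u x - L * fst p x)"
    proof (cases "sqint M u")
      case True
      then obtain a b where "wsol a b (\<lambda>x. h u x - L * a x)" using linear_solution[OF L sh[OF True]] by blast
      then show ?thesis by (intro exI[of _ "(a, b)"]) simp
    qed simp
  qed
  from choice[OF this] obtain T where T0: "\<forall>u. sqint M u \<longrightarrow> wsol (fst (T u)) (snd (T u)) (\<lambda>x. h u x - L * fst (T u) x)" by blast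
  have T: "sqint M (fst (T u))" "wsol (fst (T u)) (snd (T u)) (\<lambda>x. h u x - L * fst (T u) x)" if "sqint M u" for u
  proof -
    show "wsol (fst (T u)) (snd (T u)) (\<lambda>x. h u x - L * fst (T u) x)" using T0 that by blast
    then show "sqint M (fst (T u))" unfolding wsol_def using H0_sqint(1) by blast
  qed
  define y where "y n = ((\<lambda>u. fst (T u)) ^^ n) (\<lambda>x. 0)" for n
  define z where "z n = snd (T (y n))" for n
  have yS: "y (Suc n) = fst (T (y n))" for n by (simp add: y_def)
  have sy: "sqint M (y n)" for n
  proof (induction n)
    case 0 show ?case using sqint_bounded[OF fin, of "\<lambda>x. 0::real" 0] by (simp add: y_def)
  next
    case (Suc n) then show ?case by (simp add: yS T(1))
  qed
  have ws: "wsol (y (Suc n)) (z n) (\<lambda>x. h (y n) x - L * y (Suc n) x)" for n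
    using T(2)[OF sy[of n]] by (simp add: yS z_def)
  \<comment> \<open>Testing the difference of two steps with itself: the right-hand side is at most
    \<open>L\<close> times a product of norms, and the arithmetic-geometric mean inequality absorbs
    half of the zero-order term.\<close>
  have contr: "l2sq M (\<lambda>x. z m x - z n x) + L/2 * l2sq M (\<lambda>x. y (Suc m) x - y (Suc n) x) \<le> L/2 * l2sq M (\<lambda>x. y m x - y n x)" for m n
  proof -
    define d where "d x = y (Suc m) x - y (Suc n) x" for x
    define e where "e x = z m x - z n x" for x
    define k where "k x = h (y m) x - h (y n) x" for x
    have sd: "sqint M d" unfolding d_def[abs_def] by (intro sqint_diff sy)
    have sk: "sqint M k" unfolding k_def[abs_def] by (intro sqint_diff sh sy)
    have wd: "wsol d e (\<lambda>x. k x - L * d x)"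
      using wsol_diff[OF ws[of m] ws[of n]] by (simp add: d_def[abs_def] e_def[abs_def] k_def algebra_simps)
    have sr: "sqint M (\<lambda>x. k x - L * d x)" using sqint_scaleR[OF sd, of L] by (intro sqint_diff sk) simp
    have H: "H0 d e" using wd by (simp add: wsol_def)
    have "l2sq M e = (LINT x|M. (k x - L * d x) * d x)"
      using wsol_test_H0[OF wd sr H] by (simp add: l2sq_inner)
    also have "\<dots> = (LINT x|M. k x * d x) - L * l2sq M d"
      using sqint_mult[OF sk sd] sqint_mult[OF sd sd] by (simp add: left_diff_distrib l2sq_inner mult.assoc)
    finally have "l2sq M e + L * l2sq M d = (LINT x|M. k x * d x)" by simp
    also have "\<dots> \<le> sqrt (l2sq M k) * sqrt (l2sq M d)" using l2_inner_le[OF sk sd] by simp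
    also have "\<dots> \<le> (L * sqrt (l2sq M (\<lambda>x. y m x - y n x))) * sqrt (l2sq M d)"
    proof (rule mult_right_mono)
      have "l2sq M k \<le> l2sq M (\<lambda>x. L *\<^sub>R (y m x - y n x))"
      proof (rule l2sq_mono_AE[OF sk])
        show "sqint M (\<lambda>x. L *\<^sub>R (y m x - y n x))" by (intro sqint_scaleR sqint_diff sy)
        show "AE x in M. norm (k x) \<le> norm (L *\<^sub>R (y m x - y n x))"
          using mono_lip_facts[OF c]
        proof eventually_elim
          case (elim x)
          have "\<bar>L * (y m x - y n x) - (F x (y m x) - F x (y n x))\<bar> \<le> L * \<bar>y m x - y n x\<bar>" using elim by blast
          moreover have "k x = L * (y m x - y n x) - (F x (y m x) - F x (y n x))" by (simp add: k_def h_def algebra_simps)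
          ultimately show ?case using L by (simp add: abs_mult)
        qed
      qed
      then have "l2sq M k \<le> L\<^sup>2 * l2sq M (\<lambda>x. y m x - y n x)" by (simp only: l2sq_scaleR)
      from real_sqrt_le_mono[OF this] show "sqrt (l2sq M k) \<le> L * sqrt (l2sq M (\<lambda>x. y m x - y n x))"
        using L by (simp add: real_sqrt_mult)
    qed simp
    also have "\<dots> \<le> L * ((l2sq M (\<lambda>x. y m x - y n x) + l2sq M d) / 2)"
    proof -
      have "sqrt (l2sq M (\<lambda>x. y m x - y n x)) * sqrt (l2sq M d) \<le> (l2sq M (\<lambda>x. y m x - y n x) + l2sq M d) / 2"
        using arith_geo_mean_sqrt[of "l2sq M (\<lambda>x. y m x - y n x)" "l2sq M d"] by (simp add: real_sqrt_mult)
      then show ?thesis using L by (simp only: mult.assoc) (intro mult_left_mono; simp)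
    qed
    finally show ?thesis unfolding e_def[abs_def] d_def[abs_def] by (simp add: field_simps)
  qed
  \<comment> \<open>By Poincare the gradient term is worth 1/C more copies of the squared distance,
    which lowers the factor from 1 to something strictly below it.\<close>
  define q where "q = (L/2) / (1/C + L/2)"
  have den: "1/C + L/2 > 0" using C(1) L by (simp add: add_pos_pos)
  have q: "0 \<le> q" "q < 1" using C(1) L den by (auto simp: q_def)
  have dec: "l2sq M (\<lambda>x. y (Suc m) x - y (Suc n) x) \<le> q * l2sq M (\<lambda>x. y m x - y n x)" for m n
  proof -
    have "H0 (\<lambda>x. y (Suc m) x - y (Suc n) x) (\<lambda>x. z m x - z n x)"
      using wsol_diff[OF ws[of m] ws[of n]] by (simp add: wsol_def)
    from C(2)[OF this] have "(1/C) * l2sq M (\<lambda>x. y (Suc m) x - y (Suc n) x) \<le> l2sq M (\<lambda>x. z m x - z n x)"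
      using C(1) by (simp add: field_simps)
    with contr[of m n] have "(1/C + L/2) * l2sq M (\<lambda>x. y (Suc m) x - y (Suc n) x) \<le> L/2 * l2sq M (\<lambda>x. y m x - y n x)"
      by (simp only: distrib_right)
    then show ?thesis unfolding q_def using den by (simp add: field_simps)
  qed
  have Cy: "\<exists>N. \<forall>m\<ge>N. \<forall>n\<ge>N. l2sq M (\<lambda>x. y m x - y n x) \<le> e" if "e > 0" for e
    by (rule l2_Cauchy_geometric[where w=y and q=q, OF sy q dec that])
  obtain y' where y': "sqint M y'" "(\<lambda>k. l2sq M (\<lambda>x. y k x - y' x)) \<longlonglongrightarrow> 0"
    using l2_complete[OF sy Cy] by blast
  have sz: "sqint M (z n)" for n using ws[of n] H0_sqint(2) unfolding wsol_def by blast
  \<comment> \<open>The same estimate \<open>contr\<close> controls the gradients by the previous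
    iterates.\<close>
  have Cz: "\<exists>N. \<forall>m\<ge>N. \<forall>n\<ge>N. l2sq M (\<lambda>x. z m x - z n x) \<le> e" if e: "e > 0" for e
  proof -
    obtain N where N: "\<And>m n. m \<ge> N \<Longrightarrow> n \<ge> N \<Longrightarrow> l2sq M (\<lambda>x. y m x - y n x) \<le> 2 * e / L"
      using Cy[of "2 * e / L"] e L by auto
    have "l2sq M (\<lambda>x. z m x - z n x) \<le> e" if "m \<ge> N" "n \<ge> N" for m n
    proof -
      have "0 \<le> L/2 * l2sq M (\<lambda>x. y (Suc m) x - y (Suc n) x)" using L by simp
      with contr[of m n] have "l2sq M (\<lambda>x. z m x - z n x) \<le> L/2 * l2sq M (\<lambda>x. y m x - y n x)" by linarith
      also have "\<dots> \<le> L/2 * (2 * e / L)" using L N[OF that] by (intro mult_left_mono) auto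
      finally show ?thesis using L by simp
    qed
    then show ?thesis by blast
  qed
  obtain z' where z': "sqint M z'" "(\<lambda>k. l2sq M (\<lambda>x. z k x - z' x)) \<longlonglongrightarrow> 0"
    using l2_complete[OF sz Cz] by blast
  have yS': "(\<lambda>k. l2sq M (\<lambda>x. y (Suc k) x - y' x)) \<longlonglongrightarrow> 0" by (rule LIMSEQ_Suc[OF y'(2)])
  define r where "r k x = h (y k) x - L * y (Suc k) x" for k x
  define r' where "r' x = g x - F x (y' x)" for x
  have sr: "sqint M (r k)" for k unfolding r_def[abs_def]
    using sqint_scaleR[OF sy, of L "Suc k"] by (intro sqint_diff sh sy) simp
  have sr': "sqint M r'" unfolding r'_def[abs_def] by (intro sqint_diff g mono_lip_sqint[OF c] y')
  have "wsol y' z' r'"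
  proof (rule wsol_limit[OF ws y'(1) z'(1) yS' z'(2) sqint_integrable[OF fin sr']])
    fix \<phi> assume t: "test_fun \<Omega> \<phi>"
    have i: "integrable M (\<lambda>x. g x * \<phi> x)" "integrable M (\<lambda>x. y k x * \<phi> x)" "integrable M (\<lambda>x. F x (y k x) * \<phi> x)"
      "integrable M (\<lambda>x. F x (y' x) * \<phi> x)" for k
      by (intro sqint_mult g sy y' mono_lip_sqint[OF c] test_fun_sqint t)+
    have "(\<lambda>k. (LINT x|M. g x * \<phi> x) + (L * (LINT x|M. y k x * \<phi> x) - (LINT x|M. F x (y k x) * \<phi> x)) - L * (LINT x|M. y (Suc k) x * \<phi> x))
        \<longlonglongrightarrow> (LINT x|M. g x * \<phi> x) + (L * (LINT x|M. y' x * \<phi> x) - (LINT x|M. F x (y' x) * \<phi> x)) - L * (LINT x|M. y' x * \<phi> x)"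
      by (intro tendsto_add tendsto_diff tendsto_const tendsto_mult_left wsol_rhs_tendsto[OF sy y'(1) y'(2) t] wsol_rhs_tendsto[OF sy y'(1) yS' t]
         wsol_rhs_tendsto[OF mono_lip_sqint[OF c sy] mono_lip_sqint[OF c y'(1)] mono_lip_tendsto[OF c sy y'(1,2)] t])
    moreover have "(LINT x|M. (h (y k) x - L * y (Suc k) x) * \<phi> x) = (LINT x|M. g x * \<phi> x) + (L * (LINT x|M. y k x * \<phi> x) - (LINT x|M. F x (y k x) * \<phi> x)) - L * (LINT x|M. y (Suc k) x * \<phi> x)" for k
      using i(1) i(2)[of k] i(2)[of "Suc k"] i(3)[of k] by (simp add: h_def left_diff_distrib distrib_right mult.assoc)
    moreover have "(LINT x|M. r' x * \<phi> x) = (LINT x|M. g x * \<phi> x) + (L * (LINT x|M. y' x * \<phi> x) - (LINT x|M. F x (y' x) * \<phi> x)) - L * (LINT x|M. y' x * \<phi> x)"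
      using i(1,4) by (simp add: r'_def left_diff_distrib)
    ultimately show "(\<lambda>k. LINT x|M. (h (y k) x - L * y (Suc k) x) * \<phi> x) \<longlonglongrightarrow> (LINT x|M. r' x * \<phi> x)" by simp
  qed
  then show ?thesis unfolding r'_def[abs_def] by blast
qed

end

context pde_dom
begin

text \<open>The monotone term satisfies \<open>F x s * s \<ge> 0\<close>, so it drops out of the
  sign condition and only the potential of \<open>g\<close> matters, whatever the Lipschitz
  constant.\<close>

lemma semilinear_Linf:
  assumes w: "wsol y \<zeta> (\<lambda>x. g x - F x (y x))" and c: "mono_lip F L" and k: "kato G B" and le: "AE x in M. \<bar>g x\<bar> \<le> G x"
  shows "AE x in M. \<bar>y x\<bar> \<le> Cinf * B"
proof (rule Linf_estimate[OF w k])
  show "AE x in M. (g x - F x (y x)) * y x \<le> G x * \<bar>y x\<bar>"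
    using mono_lip_facts[OF c] le
  proof eventually_elim
    case (elim x)
    have "0 \<le> F x (y x) * y x" using elim(1) by blast
    moreover have "g x * y x \<le> \<bar>g x\<bar> * \<bar>y x\<bar>" by (metis abs_ge_self abs_mult)
    moreover have "\<bar>g x\<bar> * \<bar>y x\<bar> \<le> G x * \<bar>y x\<bar>" using elim(2) by (intro mult_right_mono) auto
    ultimately show ?case by (simp add: left_diff_distrib)
  qed
qed

text \<open>Data that are not square-integrable are truncated. The essential bound is uniform along
  the truncation because \<open>\<bar>gk n x\<bar> \<le> \<bar>g x\<bar>\<close>, and it compensates
  for the mere L^1 convergence of the data.\<close>

theorem semilinear_solution:
  assumes c: "mono_lip F L" and g: "g \<in> borel_measurable M" and k: "kato (\<lambda>x. \<bar>g x\<bar>) B"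
  shows "\<exists>y \<zeta>. wsol y \<zeta> (\<lambda>x. g x - F x (y x)) \<and> (AE x in M. \<bar>y x\<bar> \<le> Cinf * B)"
proof -
  have gi: "integrable M g"
    by (rule integrable_abs_cancel[OF conjunct1[OF k[unfolded kato_def]] g])
  define gk where "gk n x = max (- real n) (min (real n) (g x))" for n x
  have gkm: "gk n \<in> borel_measurable M" for n unfolding gk_def[abs_def] using g by measurable
  have gk_le: "\<bar>gk n x\<bar> \<le> \<bar>g x\<bar>" "\<bar>gk n x\<bar> \<le> real n" for n x by (auto simp: gk_def)
  have sgk: "sqint M (gk n)" for n by (rule sqint_bounded[OF fin gkm, of _ "real n"]) (auto intro!: AE_I2 gk_le)
  have gki: "integrable M (gk n)" for n by (rule sqint_integrable[OF fin sgk])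
  have gklim: "(\<lambda>n. gk n x) \<longlonglongrightarrow> g x" for x
  proof (rule tendsto_eventually)
    obtain N :: nat where N: "\<bar>g x\<bar> \<le> real N" using real_arch_simple by blast
    then have "gk n x = g x" if "n \<ge> N" for n using that by (auto simp: gk_def)
    then show "\<forall>\<^sub>F n in sequentially. gk n x = g x" by (auto simp: eventually_sequentially)
  qed
  obtain y z where w: "\<And>n. wsol (y n) (z n) (\<lambda>x. gk n x - F x (y n x))"
  proof -
    have "\<forall>n. \<exists>p. wsol (fst p) (snd p) (\<lambda>x. gk n x - F x (fst p x))"
      using semilinear_solution_L2[OF c sgk] by simp
    from choice[OF this] obtain p where "\<And>n. wsol (fst (p n)) (snd (p n)) (\<lambda>x. gk n x - F x (fst (p n) x))" by blast
    then show ?thesis by (rule that)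
  qed
  define m where "m = Cinf * B"
  have ym: "AE x in M. \<bar>y n x\<bar> \<le> m" for n
    unfolding m_def by (rule semilinear_Linf[OF w c k]) (auto intro!: AE_I2 gk_le)
  have H: "H0 (y n) (z n)" for n using w[of n] by (simp add: wsol_def)
  have sy: "sqint M (y n)" "sqint M (z n)" for n using H0_sqint[OF H] by auto
  have sF: "sqint M (\<lambda>x. F x (y n x))" for n by (rule mono_lip_sqint[OF c sy(1)])
  define E where "E n = (LINT x|M. \<bar>gk n x - g x\<bar>)" for n
  have E: "E \<longlonglongrightarrow> 0"
  proof -
    have "(\<lambda>n. LINT x|M. \<bar>gk n x - g x\<bar>) \<longlonglongrightarrow> (LINT x|M. 0)"
    proof (rule integral_dominated_convergence)
      show "integrable M (\<lambda>x. 2 * \<bar>g x\<bar>)" using gi by simp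
      show "AE x in M. (\<lambda>n. \<bar>gk n x - g x\<bar>) \<longlonglongrightarrow> 0"
        using tendsto_rabs[OF LIM_zero[OF gklim]] by (intro AE_I2) simp
      show "AE x in M. norm \<bar>gk n x - g x\<bar> \<le> 2 * \<bar>g x\<bar>" for n
      proof (rule AE_I2)
        show "norm \<bar>gk n x - g x\<bar> \<le> 2 * \<bar>g x\<bar>" for x using gk_le(1)[of n x] by simp
      qed
      show "(\<lambda>x. \<bar>gk n x - g x\<bar>) \<in> borel_measurable M" for n using gkm[of n] g by simp
    qed simp
    then show ?thesis by (simp add: E_def[abs_def])
  qed
  \<comment> \<open>The monotone term has the favourable sign. Since all solutions are bounded by
    \<open>m\<close>, the squared gradient distance is controlled by L^1 distances of the
    data.\<close>
  have energy: "l2sq M (\<lambda>x. z n x - z l x) \<le> 2 * \<bar>m\<bar> * (E n + E l)" for n l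
  proof -
    define d where "d x = y n x - y l x" for x
    define r where "r x = (gk n x - F x (y n x)) - (gk l x - F x (y l x))" for x
    have wd: "wsol d (\<lambda>x. z n x - z l x) r" unfolding d_def[abs_def] r_def[abs_def] by (rule wsol_diff[OF w w])
    have sr: "sqint M r" unfolding r_def[abs_def] by (intro sqint_diff sgk sF)
    have sd: "sqint M d" unfolding d_def[abs_def] by (intro sqint_diff sy)
    have "l2sq M (\<lambda>x. z n x - z l x) = (LINT x|M. r x * d x)"
      unfolding l2sq_inner by (rule wsol_test_H0[OF wd sr]) (use wd in \<open>simp add: wsol_def\<close>)
    also have "\<dots> \<le> (LINT x|M. 2 * \<bar>m\<bar> * (\<bar>gk n x - g x\<bar> + \<bar>gk l x - g x\<bar>))"
    proof (rule integral_mono_AE)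
      show "integrable M (\<lambda>x. r x * d x)" by (rule sqint_mult[OF sr sd])
      show "integrable M (\<lambda>x. 2 * \<bar>m\<bar> * (\<bar>gk n x - g x\<bar> + \<bar>gk l x - g x\<bar>))" using gi gki by simp
      show "AE x in M. r x * d x \<le> 2 * \<bar>m\<bar> * (\<bar>gk n x - g x\<bar> + \<bar>gk l x - g x\<bar>)"
        using mono_lip_facts[OF c] ym[of n] ym[of l]
      proof eventually_elim
        case (elim x)
        have "0 \<le> (F x (y n x) - F x (y l x)) * d x" using elim(1) unfolding d_def by blast
        then have "r x * d x \<le> (gk n x - gk l x) * d x" by (simp add: r_def algebra_simps)
        also have "\<dots> \<le> \<bar>gk n x - gk l x\<bar> * \<bar>d x\<bar>" by (metis abs_ge_self abs_mult)
        also have "\<dots> \<le> (\<bar>gk n x - g x\<bar> + \<bar>gk l x - g x\<bar>) * (2 * \<bar>m\<bar>)"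
        proof (rule mult_mono)
          show "\<bar>gk n x - gk l x\<bar> \<le> \<bar>gk n x - g x\<bar> + \<bar>gk l x - g x\<bar>" by linarith
          show "\<bar>d x\<bar> \<le> 2 * \<bar>m\<bar>" using elim(2,3) unfolding d_def by linarith
        qed simp_all
        finally show ?case by (simp add: mult.commute)
      qed
    qed
    also have "\<dots> = 2 * \<bar>m\<bar> * (E n + E l)" using gi gki by (simp add: E_def)
    finally show ?thesis .
  qed
  have Cz: "\<exists>N. \<forall>a\<ge>N. \<forall>b\<ge>N. l2sq M (\<lambda>x. z a x - z b x) \<le> e" if e: "e > 0" for e
  proof -
    \<comment> \<open>The 1 keeps the denominator positive when \<open>m\<close> is 0.\<close>
    define e' where "e' = e / (4 * (\<bar>m\<bar> + 1))"
    have e': "e' > 0" using e by (simp add: e'_def add_nonneg_pos)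
    obtain N where N: "\<And>n. n \<ge> N \<Longrightarrow> E n < e'"
      using order_tendstoD(2)[OF E e'] by (auto simp: eventually_sequentially)
    have "l2sq M (\<lambda>x. z a x - z b x) \<le> e" if "a \<ge> N" "b \<ge> N" for a b
    proof -
      have "l2sq M (\<lambda>x. z a x - z b x) \<le> 2 * \<bar>m\<bar> * (E a + E b)" by (rule energy)
      also have "\<dots> \<le> 2 * \<bar>m\<bar> * (e' + e')" using N[OF that(1)] N[OF that(2)] by (intro mult_left_mono) auto
      also have "\<dots> \<le> 2 * (\<bar>m\<bar> + 1) * (e' + e')" using e' by (intro mult_right_mono) auto
      also have "\<dots> = (4 * (\<bar>m\<bar> + 1)) * e'" by simp
      also have "\<dots> = e"
      proof -
        have "4 * (\<bar>m\<bar> + 1) > 0" by (intro mult_pos_pos add_nonneg_pos) simp_all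
        then show ?thesis unfolding e'_def by (metis less_irrefl nonzero_mult_div_cancel_left times_divide_eq_right)
      qed
      finally show ?thesis .
    qed
    then show ?thesis by blast
  qed
  obtain C where C: "C > 0" "\<And>y \<zeta>. H0 y \<zeta> \<Longrightarrow> l2sq M y \<le> C * l2sq M \<zeta>" using Poincare by blast
  have Cy: "\<exists>N. \<forall>a\<ge>N. \<forall>b\<ge>N. l2sq M (\<lambda>x. y a x - y b x) \<le> e" if e: "e > 0" for e
  proof -
    obtain N where N: "\<And>a b. a \<ge> N \<Longrightarrow> b \<ge> N \<Longrightarrow> l2sq M (\<lambda>x. z a x - z b x) \<le> e / C" using Cz[of "e / C"] e C(1) by auto
    have "l2sq M (\<lambda>x. y a x - y b x) \<le> e" if "a \<ge> N" "b \<ge> N" for a b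
    proof -
      have "H0 (\<lambda>x. y a x - y b x) (\<lambda>x. z a x - z b x)" using wsol_diff[OF w w] by (simp add: wsol_def)
      from C(2)[OF this] have "l2sq M (\<lambda>x. y a x - y b x) \<le> C * l2sq M (\<lambda>x. z a x - z b x)" .
      also have "\<dots> \<le> C * (e / C)" using C(1) N[OF that] by (intro mult_left_mono) auto
      finally show ?thesis using C(1) by simp
    qed
    then show ?thesis by blast
  qed
  obtain y' where y': "sqint M y'" "(\<lambda>k. l2sq M (\<lambda>x. y k x - y' x)) \<longlonglongrightarrow> 0" using l2_complete[OF sy(1) Cy] by blast
  obtain z' where z': "sqint M z'" "(\<lambda>k. l2sq M (\<lambda>x. z k x - z' x)) \<longlonglongrightarrow> 0" using l2_complete[OF sy(2) Cz] by blast
  have sF': "sqint M (\<lambda>x. F x (y' x))" by (rule mono_lip_sqint[OF c y'(1)])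
  have ws: "wsol y' z' (\<lambda>x. g x - F x (y' x))"
  proof (rule wsol_limit[OF w y'(1) z'(1) y'(2) z'(2)])
    show "integrable M (\<lambda>x. g x - F x (y' x))" using gi sqint_integrable[OF fin sF'] by simp
    fix \<phi> assume t: "test_fun \<Omega> \<phi>"
    obtain b where b: "\<And>x. \<bar>\<phi> x\<bar> \<le> b" using test_fun_bounded[OF t] by blast
    have "(\<lambda>n. LINT x|M. gk n x * \<phi> x) \<longlonglongrightarrow> (LINT x|M. g x * \<phi> x)"
    proof (rule integral_dominated_convergence)
      show "integrable M (\<lambda>x. b * \<bar>g x\<bar>)" using gi by simp
      show "(\<lambda>x. g x * \<phi> x) \<in> borel_measurable M" "(\<lambda>x. gk n x * \<phi> x) \<in> borel_measurable M" for n
        by (intro borel_measurable_times g gkm test_fun_meas t)+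
      show "AE x in M. (\<lambda>n. gk n x * \<phi> x) \<longlonglongrightarrow> g x * \<phi> x" by (intro AE_I2 tendsto_mult_right gklim)
      show "AE x in M. norm (gk n x * \<phi> x) \<le> b * \<bar>g x\<bar>" for n
      proof (rule AE_I2)
        show "norm (gk n x * \<phi> x) \<le> b * \<bar>g x\<bar>" for x
          using mult_mono[OF gk_le(1)[of n x] b[of x]] by (simp add: abs_mult mult.commute)
      qed
    qed
    moreover have "(\<lambda>n. LINT x|M. F x (y n x) * \<phi> x) \<longlonglongrightarrow> (LINT x|M. F x (y' x) * \<phi> x)"
      by (rule wsol_rhs_tendsto[OF sF sF' mono_lip_tendsto[OF c sy(1) y'] t])
    ultimately have "(\<lambda>n. (LINT x|M. gk n x * \<phi> x) - (LINT x|M. F x (y n x) * \<phi> x)) \<longlonglongrightarrow> (LINT x|M. g x * \<phi> x) - (LINT x|M. F x (y' x) * \<phi> x)"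
      by (rule tendsto_diff)
    moreover have "integrable M (\<lambda>x. gk n x * \<phi> x)" "integrable M (\<lambda>x. F x (y n x) * \<phi> x)" for n
      by (intro integrable_mult_test gki sqint_integrable[OF fin sF] t)+
    moreover have "integrable M (\<lambda>x. g x * \<phi> x)" "integrable M (\<lambda>x. F x (y' x) * \<phi> x)"
      by (intro integrable_mult_test gi sqint_integrable[OF fin sF'] t)+
    ultimately show "(\<lambda>n. LINT x|M. (gk n x - F x (y n x)) * \<phi> x) \<longlonglongrightarrow> (LINT x|M. (g x - F x (y' x)) * \<phi> x)"
      by (simp add: left_diff_distrib)
  qed
  moreover have "AE x in M. \<bar>y' x\<bar> \<le> Cinf * B" by (rule semilinear_Linf[OF ws c k]) simp
  ultimately show ?thesis by blast
qed

end

section \<open>Expansion of the reduced objective\<close>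

text \<open>For \<open>f\<close>, \<open>f1\<close>, \<open>f2\<close> at a fixed point x. All four
  come from bounding a derivative on the segment from \<open>a\<close> to \<open>b\<close>, in the
  last two after subtracting the linear part at \<open>a\<close>; this yields \<open>C\<close> where
  Taylor's formula would give C/2.\<close>

lemma mvt_estimates:
  fixes p q r :: "real \<Rightarrow> real"
  assumes d: "\<And>y. (p has_real_derivative q y) (at y)" "\<And>y. (q has_real_derivative r y) (at y)"
    and b: "\<And>y. \<bar>y\<bar> \<le> m \<Longrightarrow> \<bar>q y\<bar> + \<bar>r y\<bar> \<le> C" and ab: "\<bar>a\<bar> \<le> m" "\<bar>b\<bar> \<le> m"
  shows "\<bar>p b - p a\<bar> \<le> C * \<bar>b - a\<bar>" "\<bar>q b - q a\<bar> \<le> C * \<bar>b - a\<bar>"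
    "\<bar>p b - p a - q a * (b - a)\<bar> \<le> C * (b - a)\<^sup>2"
    "\<lbrakk>\<And>y1 y2. \<bar>y1\<bar> \<le> m \<and> \<bar>y2\<bar> \<le> m \<and> \<bar>y2 - y1\<bar> < \<epsilon> \<Longrightarrow> \<bar>r y2 - r y1\<bar> \<le> \<eta>; \<bar>b - a\<bar> < \<epsilon>\<rbrakk>
      \<Longrightarrow> \<bar>q b - q a - r a * (b - a)\<bar> \<le> \<eta> * \<bar>b - a\<bar>"
proof -
  let ?S = "closed_segment a b"
  have S: "\<bar>y\<bar> \<le> m" "\<bar>y - a\<bar> \<le> \<bar>b - a\<bar>" if "y \<in> ?S" for y
    using that ab by (auto simp: closed_segment_eq_real_ivl split: if_splits)
  have dw: "(p has_real_derivative q y) (at y within ?S)" "(q has_real_derivative r y) (at y within ?S)" for y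
    using d by (auto intro: has_field_derivative_at_within)
  have bq: "norm (q y) \<le> C" "norm (r y) \<le> C" if "y \<in> ?S" for y
    using b[OF S(1)[OF that]] by auto
  show "\<bar>p b - p a\<bar> \<le> C * \<bar>b - a\<bar>"
    using field_differentiable_bound[of ?S p q C b a] dw bq by simp
  have q: "\<bar>q y - q a\<bar> \<le> C * \<bar>y - a\<bar>" if "y \<in> ?S" for y
    using field_differentiable_bound[of ?S q r C y a] dw bq that by simp
  then show "\<bar>q b - q a\<bar> \<le> C * \<bar>b - a\<bar>" by simp
  have C0: "C \<ge> 0" using bq(1)[of a] by (simp add: order_trans[OF abs_ge_zero])
  have "norm ((p b - q a * b) - (p a - q a * a)) \<le> (C * \<bar>b - a\<bar>) * norm (b - a)"
  proof (rule field_differentiable_bound[of ?S "\<lambda>y. p y - q a * y" "\<lambda>y. q y - q a"])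
    fix y assume y: "y \<in> ?S"
    show "((\<lambda>y. p y - q a * y) has_real_derivative q y - q a) (at y within ?S)"
      by (auto intro!: derivative_eq_intros dw)
    have "C * \<bar>y - a\<bar> \<le> C * \<bar>b - a\<bar>" using S(2)[OF y] C0 by (rule mult_left_mono)
    then show "norm (q y - q a) \<le> C * \<bar>b - a\<bar>" using q[OF y] by simp
  qed auto
  then show "\<bar>p b - p a - q a * (b - a)\<bar> \<le> C * (b - a)\<^sup>2"
    by (simp add: algebra_simps power2_eq_square flip: abs_mult_self_eq[of "b - a"])
  assume uc: "\<And>y1 y2. \<bar>y1\<bar> \<le> m \<and> \<bar>y2\<bar> \<le> m \<and> \<bar>y2 - y1\<bar> < \<epsilon> \<Longrightarrow> \<bar>r y2 - r y1\<bar> \<le> \<eta>" and e: "\<bar>b - a\<bar> < \<epsilon>"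
  have "norm ((q b - r a * b) - (q a - r a * a)) \<le> \<eta> * norm (b - a)"
  proof (rule field_differentiable_bound[of ?S "\<lambda>y. q y - r a * y" "\<lambda>y. r y - r a"])
    fix y assume y: "y \<in> ?S"
    show "((\<lambda>y. q y - r a * y) has_real_derivative r y - r a) (at y within ?S)"
      by (auto intro!: derivative_eq_intros dw)
    show "norm (r y - r a) \<le> \<eta>" using uc[of a y] S[OF y] ab e by simp
  qed auto
  then show "\<bar>q b - q a - r a * (b - a)\<bar> \<le> \<eta> * \<bar>b - a\<bar>" by (simp add: algebra_simps)
qed

lemma has_real_derivative_quadratic_remainder:
  fixes \<phi> :: "real \<Rightarrow> real"
  assumes "\<And>\<eta>. \<eta> > 0 \<Longrightarrow> \<exists>\<delta>>0. \<forall>s. \<bar>s - t\<bar> < \<delta> \<longrightarrow> \<bar>\<phi> s - \<phi> t - (s - t) * D\<bar> \<le> \<eta> * \<bar>s - t\<bar>"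
  shows "(\<phi> has_real_derivative D) (at t)"
  unfolding has_field_derivative_def has_derivative_at_alt
proof (intro conjI allI impI)
  show "bounded_linear ((*) D)" by (rule bounded_linear_mult_right)
  fix e :: real assume "0 < e"
  from assms[OF this] obtain \<delta> where "\<delta> > 0" "\<And>s. \<bar>s - t\<bar> < \<delta> \<Longrightarrow> \<bar>\<phi> s - \<phi> t - (s - t) * D\<bar> \<le> e * \<bar>s - t\<bar>" by blast
  then show "\<exists>d>0. \<forall>y. norm (y - t) < d \<longrightarrow> norm (\<phi> y - \<phi> t - D * (y - t)) \<le> e * norm (y - t)"
    by (intro exI[of _ \<delta>]) (simp add: mult.commute[of D])
qed

lemma lebesgue_on_subset_integral:
  fixes h :: "'a::euclidean_space \<Rightarrow> real"
  assumes "\<omega> \<in> sets lebesgue" "\<Omega> \<in> sets lebesgue" "\<omega> \<subseteq> \<Omega>"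
  shows "(LINT x|lebesgue_on \<Omega>. indicator \<omega> x * h x) = (LINT x|lebesgue_on \<omega>. h x)"
    "integrable (lebesgue_on \<Omega>) (\<lambda>x. indicator \<omega> x * h x) \<longleftrightarrow> integrable (lebesgue_on \<omega>) h"
proof -
  have eq: "indicator \<Omega> x *\<^sub>R (indicator \<omega> x * h x) = indicator \<omega> x *\<^sub>R h x" for x
    using assms(3) by (auto simp: indicator_def)
  show "(LINT x|lebesgue_on \<Omega>. indicator \<omega> x * h x) = (LINT x|lebesgue_on \<omega>. h x)"
    using assms by (simp add: integral_restrict_space eq del: real_scaleR_def)
  show "integrable (lebesgue_on \<Omega>) (\<lambda>x. indicator \<omega> x * h x) \<longleftrightarrow> integrable (lebesgue_on \<omega>) h"
    using assms by (simp add: integrable_restrict_space eq del: real_scaleR_def)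
qed

section \<open>Existence of the state and bounds for it\<close>

locale ctrl = pde_dom \<Omega> nn for \<Omega> :: "(real^'n) set" and nn :: real +
  fixes \<omega> :: "(real^'n) set" and f f1 f2 :: "real^'n \<Rightarrow> real \<Rightarrow> real"
  assumes om: "open \<omega>" "\<omega> \<subseteq> \<Omega>"
    and f_borel: "(\<lambda>p. f (fst p) (snd p)) \<in> borel_measurable (restrict_space borel (\<Omega> \<times> UNIV))"
    and f_C2: "AE x in lebesgue_on \<Omega>. (\<forall>y. (f x has_real_derivative f1 x y) (at y)
                 \<and> (f1 x has_real_derivative f2 x y) (at y)) \<and> continuous_on UNIV (f2 x)"
    and f_0: "\<exists>p. p > nn / 2 \<and> (\<lambda>x. f x 0) \<in> borel_measurable (lebesgue_on \<Omega>)
                 \<and> integrable (lebesgue_on \<Omega>) (\<lambda>x. \<bar>f x 0\<bar> powr p)"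
    and f_mono: "AE x in lebesgue_on \<Omega>. \<forall>y. f1 x y \<ge> 0"
    and f_bd: "\<forall>M. \<exists>C. AE x in lebesgue_on \<Omega>. \<forall>y. \<bar>y\<bar> \<le> M \<longrightarrow> \<bar>f1 x y\<bar> + \<bar>f2 x y\<bar> \<le> C"
    and f_uc: "\<forall>M \<rho>. \<rho> > 0 \<longrightarrow> (\<exists>\<epsilon>>0. AE x in lebesgue_on \<Omega>. \<forall>y1 y2.
                 \<bar>y1\<bar> \<le> M \<and> \<bar>y2\<bar> \<le> M \<and> \<bar>y2 - y1\<bar> < \<epsilon> \<longrightarrow> \<bar>f2 x y2 - f2 x y1\<bar> \<le> \<rho>)"
begin

lemma om_sets [simp]: "\<omega> \<in> sets lebesgue"
  using om(1) by (simp add: borel_open sets_completionI_sets)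

lemma f_comp_meas:
  assumes u: "u \<in> borel_measurable M" shows "(\<lambda>x. f x (u x)) \<in> borel_measurable M"
proof -
  have "(\<lambda>x. x) \<in> borel_measurable M" by (rule borel_M) simp
  then have "(\<lambda>x. (x, u x)) \<in> borel_measurable M" using u by (rule borel_measurable_Pair)
  then have "(\<lambda>x. (x, u x)) \<in> measurable M (restrict_space borel (\<Omega> \<times> UNIV))"
    by (intro measurable_restrict_space2) auto
  from measurable_compose[OF this f_borel] show ?thesis by simp
qed

text \<open>\<open>f1\<close> and \<open>f2\<close> are not assumed measurable, so they are replaced by limits of difference quotients of \<open>f\<close>.\<close>
lemma f_deriv_meas:
  assumes u: "u \<in> borel_measurable M"
  shows "\<exists>a\<in>borel_measurable M. AE x in M. a x = f1 x (u x)" "\<exists>b\<in>borel_measurable M. AE x in M. b x = f2 x (u x)"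
proof -
  define h where "h k = inverse (real (Suc k))" for k
  have h: "h k > 0" "h \<longlonglongrightarrow> 0" for k using LIMSEQ_inverse_real_of_nat by (auto simp: h_def[abs_def])
  have fl: "filterlim h (at 0) sequentially"
    by (rule filterlim_atI[OF h(2)]) (use h(1) in \<open>auto intro!: always_eventually simp: less_imp_neq[symmetric] dest: less_imp_neq\<close>)
  have quot: "(\<lambda>k. (p (s + h k) - p s) / h k) \<longlonglongrightarrow> d" if "(p has_real_derivative d) (at s)" for p s d
  proof -
    have "((\<lambda>t. (p (s + t) - p s) / t) \<longlongrightarrow> d) (at 0)" using that by (simp add: DERIV_def)
    from filterlim_compose[OF this fl] show ?thesis .
  qed
  define A where "A u x = lim (\<lambda>k. (f x (u x + h k) - f x (u x)) / h k)" for u x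
  have Am: "A u \<in> borel_measurable M" if "u \<in> borel_measurable M" for u
    unfolding A_def[abs_def]
    by (intro borel_measurable_lim_metric borel_measurable_divide borel_measurable_diff borel_measurable_const f_comp_meas borel_measurable_add that)
  have A: "AE x in M. \<forall>u. A u x = f1 x (u x)"
    using f_C2 by eventually_elim (auto simp: A_def intro!: limI quot)
  define B where "B u x = lim (\<lambda>k. (A (\<lambda>x. u x + h k) x - A u x) / h k)" for u x
  have Bm: "B u \<in> borel_measurable M"
    unfolding B_def[abs_def]
    by (intro borel_measurable_lim_metric borel_measurable_divide borel_measurable_diff borel_measurable_const Am borel_measurable_add u)
  have B: "AE x in M. B u x = f2 x (u x)"
    using f_C2 A
  proof eventually_elim
    case (elim x)
    have "(\<lambda>k. (f1 x (u x + h k) - f1 x (u x)) / h k) \<longlonglongrightarrow> f2 x (u x)" by (rule quot) (use elim(1) in blast)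
    then show ?case unfolding B_def using elim(2) by (simp add: limI)
  qed
  show "\<exists>a\<in>borel_measurable M. AE x in M. a x = f1 x (u x)"
    using A by (intro bexI[OF _ Am[OF u]]) (elim eventually_mono, blast)
  show "\<exists>b\<in>borel_measurable M. AE x in M. b x = f2 x (u x)" by (rule bexI[where x="B u"]) (rule B, rule Bm)
qed

definition ext :: "(real^'n \<Rightarrow> real) \<Rightarrow> real^'n \<Rightarrow> real" where "ext u x = indicator \<omega> x * u x"

lemma ext_sqint: "L2 \<omega> u \<Longrightarrow> sqint M (ext u)"
proof -
  assume u: "L2 \<omega> u"
  have m: "ext u \<in> borel_measurable M"
  proof -
    have "(\<lambda>x. indicator \<omega> x * u x) \<in> borel_measurable lebesgue"
      using u borel_measurable_restrict_space_iff[of \<omega> lebesgue u] by (simp add: L2_def mult.commute)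
    then show ?thesis unfolding ext_def[abs_def] by (rule measurable_restrict_space1)
  qed
  have "(norm (ext u x))\<^sup>2 = indicator \<omega> x * (u x)\<^sup>2" for x by (simp add: ext_def indicator_def)
  then have "integrable M (\<lambda>x. (norm (ext u x))\<^sup>2)"
    using u lebesgue_on_subset_integral(2)[OF om_sets dom_sets om(2), of "\<lambda>x. (u x)\<^sup>2"] by (simp add: L2_def)
  with m show ?thesis by (simp add: sqint_def)
qed

lemma f0: "\<exists>B. kato (\<lambda>x. \<bar>f x 0\<bar>) B"
  using f_0 kato_Lp by blast

lemma f0_integrable: "integrable M (\<lambda>x. f x 0)"
proof -
  obtain B where "kato (\<lambda>x. \<bar>f x 0\<bar>) B" using f0 by blast
  then have "integrable M (\<lambda>x. \<bar>f x 0\<bar>)" by (simp add: kato_def)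
  then show ?thesis by (rule integrable_abs_cancel) (rule f_comp_meas, simp)
qed

lemma f_sign: "AE x in M. \<forall>s. 0 \<le> (f x s - f x 0) * s"
  using f_C2 f_mono
proof eventually_elim
  case (elim x)
  have inc: "f x a \<le> f x b" if "a \<le> b" for a b
    by (rule DERIV_nonneg_imp_nondecreasing[OF that]) (use elim in blast)
  show ?case
  proof
    fix s :: real
    show "0 \<le> (f x s - f x 0) * s"
    proof (cases "0 \<le> s")
      case True then show ?thesis using inc[OF True] by simp
    next
      case False then show ?thesis using inc[of s 0] by (simp add: mult_nonpos_nonpos)
    qed
  qed
qed

definition trunc :: "real \<Rightarrow> real \<Rightarrow> real" where "trunc m s = max (- m) (min m s)"

text \<open>The bound on \<open>f1\<close> over \<open>\<bar>y\<bar> \<le> m\<close> becomes a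
  global Lipschitz constant once the argument is truncated; subtracting \<open>f x 0\<close> gives
  the normalisation at 0.\<close>

lemma trunc_mono_lip:
  assumes m: "m > 0" shows "\<exists>L. mono_lip (\<lambda>x s. f x (trunc m s) - f x 0) L"
proof -
  obtain C where C: "AE x in M. \<forall>y. \<bar>y\<bar> \<le> m \<longrightarrow> \<bar>f1 x y\<bar> + \<bar>f2 x y\<bar> \<le> C" using f_bd by blast
  define L where "L = \<bar>C\<bar> + 1"
  have "AE x in M. \<forall>a b. a \<le> b \<longrightarrow> 0 \<le> (f x (trunc m b) - f x 0) - (f x (trunc m a) - f x 0)
     \<and> (f x (trunc m b) - f x 0) - (f x (trunc m a) - f x 0) \<le> L * (b - a)"
    using f_C2 f_mono C
  proof eventually_elim
    case (elim x)
    show ?case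
    proof (intro allI impI)
      fix a b :: real assume ab: "a \<le> b"
      define a' b' where "a' = trunc m a" and "b' = trunc m b"
      have t: "\<bar>a'\<bar> \<le> m" "\<bar>b'\<bar> \<le> m" "a' \<le> b'" "b' - a' \<le> b - a"
        using ab m by (auto simp: a'_def b'_def trunc_def)
      have inc: "f x a' \<le> f x b'"
        by (rule DERIV_nonneg_imp_nondecreasing[OF t(3)]) (use elim in blast)
      have "\<bar>f x b' - f x a'\<bar> \<le> C * \<bar>b' - a'\<bar>"
        by (rule mvt_estimates(1)[of "f x" "f1 x" "f2 x" m C a' b']) (use elim t in blast)+
      also have "\<dots> \<le> L * (b - a)" unfolding L_def using t by (intro mult_mono) auto
      finally show "0 \<le> (f x (trunc m b) - f x 0) - (f x (trunc m a) - f x 0)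
         \<and> (f x (trunc m b) - f x 0) - (f x (trunc m a) - f x 0) \<le> L * (b - a)"
        using inc by (simp add: a'_def b'_def)
    qed
  qed
  moreover have "(\<lambda>x. f x (trunc m (u x)) - f x 0) \<in> borel_measurable M" if "u \<in> borel_measurable M" for u
  proof (intro borel_measurable_diff f_comp_meas borel_measurable_const)
    show "(\<lambda>x. trunc m (u x)) \<in> borel_measurable M" unfolding trunc_def using that by measurable
  qed
  moreover have "L > 0" by (simp add: L_def add_nonneg_pos)
  ultimately show ?thesis using m by (intro exI[of _ L]) (simp add: mono_lip_def trunc_def)
qed

text \<open>Splitting the integral in \<open>state_sol\<close> requires \<open>f x (y x)\<close> to
  be integrable, which follows from the essential bound on \<open>y\<close> and integrability of
  \<open>f x 0\<close>.\<close>

lemma wsol_state: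
  assumes s: "state_sol \<Omega> \<omega> f u y" and u: "L2 \<omega> u"
  shows "\<exists>\<zeta>. wsol y \<zeta> (\<lambda>x. ext u x - f x (y x))"
proof -
  obtain g K where g: "H10 \<Omega> y g" and K: "AE x in M. \<bar>y x\<bar> \<le> K"
    and eq: "\<And>\<phi>. test_fun \<Omega> \<phi> \<Longrightarrow> (LINT x|lebesgue_on \<Omega>. g x \<bullet> grad \<phi> x + f x (y x) * \<phi> x) = (LINT x|lebesgue_on \<omega>. u x * \<phi> x)"
    using s by (auto simp: state_sol_def)
  have H: "H0 y g" using g by (simp add: H10_iff)
  have ym: "y \<in> borel_measurable M" using H0_sqint(1)[OF H] by (simp add: sqint_def)
  obtain C where C: "AE x in M. \<forall>y. \<bar>y\<bar> \<le> \<bar>K\<bar> \<longrightarrow> \<bar>f1 x y\<bar> + \<bar>f2 x y\<bar> \<le> C" using f_bd by blast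
  have "integrable M (\<lambda>x. f x (y x) - f x 0)"
  proof (rule integrable_bounded[OF fin])
    show "(\<lambda>x. f x (y x) - f x 0) \<in> borel_measurable M" by (intro borel_measurable_diff f_comp_meas ym borel_measurable_const)
    show "AE x in M. norm (f x (y x) - f x 0) \<le> \<bar>C\<bar> * \<bar>K\<bar>"
      using f_C2 C K
    proof eventually_elim
      case (elim x)
      have y: "\<bar>y x\<bar> \<le> \<bar>K\<bar>" using elim(3) by simp
      have "\<bar>f x (y x) - f x 0\<bar> \<le> C * \<bar>y x - 0\<bar>"
        by (rule mvt_estimates(1)[of "f x" "f1 x" "f2 x" "\<bar>K\<bar>" C 0 "y x"]) (use elim y in \<open>simp_all\<close>)
      also have "\<dots> \<le> \<bar>C\<bar> * \<bar>K\<bar>" using y by (intro mult_mono) auto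
      finally show ?case by simp
    qed
  qed
  from Bochner_Integration.integrable_add[OF this f0_integrable] have fi: "integrable M (\<lambda>x. f x (y x))" by simp
  have ei: "integrable M (ext u)" by (rule sqint_integrable[OF fin ext_sqint[OF u]])
  have "(LINT x|M. g x \<bullet> grad \<phi> x) = (LINT x|M. (ext u x - f x (y x)) * \<phi> x)" if t: "test_fun \<Omega> \<phi>" for \<phi>
  proof -
    have i: "integrable M (\<lambda>x. g x \<bullet> grad \<phi> x)" "integrable M (\<lambda>x. f x (y x) * \<phi> x)" "integrable M (\<lambda>x. ext u x * \<phi> x)"
      by (intro sqint_inner H0_sqint[OF H] test_fun_sqint t integrable_mult_test fi ei)+
    have "(LINT x|M. g x \<bullet> grad \<phi> x) + (LINT x|M. f x (y x) * \<phi> x) = (LINT x|lebesgue_on \<omega>. u x * \<phi> x)"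
      using eq[OF t] i by simp
    also have "\<dots> = (LINT x|M. ext u x * \<phi> x)"
      using lebesgue_on_subset_integral(1)[OF om_sets dom_sets om(2), of "\<lambda>x. u x * \<phi> x"] by (simp add: ext_def mult.assoc)
    finally show ?thesis using i by (simp add: left_diff_distrib)
  qed
  then have "wsol y g (\<lambda>x. ext u x - f x (y x))" using H fi ei by (simp add: wsol_def)
  then show ?thesis by blast
qed

lemma state_solI:
  assumes w: "wsol y \<zeta> (\<lambda>x. ext u x - f x (y x))" and K: "AE x in M. \<bar>y x\<bar> \<le> K" and u: "L2 \<omega> u"
  shows "state_sol \<Omega> \<omega> f u y"
  unfolding state_sol_def
proof (intro exI[of _ \<zeta>] conjI allI impI)
  have H: "H0 y \<zeta>" using w by (simp add: wsol_def)
  show "H10 \<Omega> y \<zeta>" using H by (simp add: H10_iff)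
  show "\<exists>K. AE x in M. \<bar>y x\<bar> \<le> K" using K by blast
  fix \<phi> assume t: "test_fun \<Omega> \<phi>"
  have ei: "integrable M (ext u)" by (rule sqint_integrable[OF fin ext_sqint[OF u]])
  have "integrable M (\<lambda>x. ext u x - f x (y x))" using w by (simp add: wsol_def)
  from Bochner_Integration.integrable_diff[OF ei this] have fi: "integrable M (\<lambda>x. f x (y x))" by simp
  have i: "integrable M (\<lambda>x. \<zeta> x \<bullet> grad \<phi> x)" "integrable M (\<lambda>x. f x (y x) * \<phi> x)" "integrable M (\<lambda>x. ext u x * \<phi> x)"
    by (intro sqint_inner H0_sqint[OF H] test_fun_sqint t integrable_mult_test fi ei)+
  have "(LINT x|M. \<zeta> x \<bullet> grad \<phi> x) = (LINT x|M. (ext u x - f x (y x)) * \<phi> x)" using w t by (simp add: wsol_def)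
  then have "(LINT x|M. \<zeta> x \<bullet> grad \<phi> x + f x (y x) * \<phi> x) = (LINT x|M. ext u x * \<phi> x)"
    using i by (simp add: left_diff_distrib)
  also have "\<dots> = (LINT x|lebesgue_on \<omega>. u x * \<phi> x)"
    using lebesgue_on_subset_integral(1)[OF om_sets dom_sets om(2), of "\<lambda>x. u x * \<phi> x"] by (simp add: ext_def mult.assoc)
  finally show "(LINT x|M. \<zeta> x \<bullet> grad \<phi> x + f x (y x) * \<phi> x) = (LINT x|lebesgue_on \<omega>. u x * \<phi> x)" .
qed

lemma kato_abs_add:
  assumes "kato (\<lambda>x. \<bar>g x\<bar>) B" "kato (\<lambda>x. \<bar>h x\<bar>) D" "g \<in> borel_measurable M" "h \<in> borel_measurable M"
  shows "kato (\<lambda>x. \<bar>g x + c * h x\<bar>) (B + \<bar>c\<bar> * D)"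
proof (rule kato_mono[OF kato_lin[OF assms(1,2) abs_ge_zero[of c]]])
  show "(\<lambda>x. \<bar>g x + c * h x\<bar>) \<in> borel_measurable M" using assms(3,4) by measurable
  show "AE x in M. 0 \<le> \<bar>g x + c * h x\<bar> \<and> \<bar>g x + c * h x\<bar> \<le> \<bar>g x\<bar> + \<bar>c\<bar> * \<bar>h x\<bar>"
  proof (rule AE_I2)
    fix x show "0 \<le> \<bar>g x + c * h x\<bar> \<and> \<bar>g x + c * h x\<bar> \<le> \<bar>g x\<bar> + \<bar>c\<bar> * \<bar>h x\<bar>"
      using abs_triangle_ineq[of "g x" "c * h x"] by (simp add: abs_mult)
  qed
qed

text \<open>The truncated equation obeys an a priori bound that does not see the truncation level.
  With the level chosen above that bound, the truncation is inactive on the solution.\<close>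

lemma state_exists:
  assumes u: "L2 \<omega> u" shows "state_sol \<Omega> \<omega> f u (state \<Omega> \<omega> f u)"
proof -
  obtain B0 where B0: "kato (\<lambda>x. \<bar>f x 0\<bar>) B0" using f0 by blast
  obtain B where B: "kato (\<lambda>x. \<bar>ext u x\<bar>) B" using kato_sqint[OF ext_sqint[OF u]] by blast
  have em: "ext u \<in> borel_measurable M" using ext_sqint[OF u] by (simp add: sqint_def)
  have fm: "(\<lambda>x. f x 0) \<in> borel_measurable M" by (intro f_comp_meas borel_measurable_const)
  have k: "kato (\<lambda>x. \<bar>ext u x - f x 0\<bar>) (B + B0)" using kato_abs_add[OF B B0 em fm, of "-1"] by simp
  \<comment> \<open>Above the a priori bound; the 1 makes it positive.\<close>
  define m where "m = \<bar>Cinf * (B + B0)\<bar> + 1"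
  have m: "m > 0" by (simp add: m_def add_nonneg_pos)
  obtain L where L: "mono_lip (\<lambda>x s. f x (trunc m s) - f x 0) L" using trunc_mono_lip[OF m] by blast
  have gm: "(\<lambda>x. ext u x - f x 0) \<in> borel_measurable M" by (intro borel_measurable_diff em fm)
  obtain y \<zeta> where y: "wsol y \<zeta> (\<lambda>x. (ext u x - f x 0) - (f x (trunc m (y x)) - f x 0))" "AE x in M. \<bar>y x\<bar> \<le> Cinf * (B + B0)"
    using semilinear_solution[OF L gm k] by blast
  have ym: "y \<in> borel_measurable M" using y(1) H0_sqint(1) unfolding wsol_def sqint_def by blast
  have "wsol y \<zeta> (\<lambda>x. ext u x - f x (y x))"
  proof (rule wsol_cong_rhs[OF y(1)])
    show "AE x in M. (ext u x - f x 0) - (f x (trunc m (y x)) - f x 0) = ext u x - f x (y x)"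
      using y(2)
    proof eventually_elim
      case (elim x)
      then have "trunc m (y x) = y x" by (auto simp: trunc_def m_def)
      then show ?case by simp
    qed
    show "(\<lambda>x. ext u x - f x (y x)) \<in> borel_measurable M" by (intro borel_measurable_diff em f_comp_meas ym)
  qed
  from state_solI[OF this y(2) u] have "\<exists>y. state_sol \<Omega> \<omega> f u y" by blast
  then show ?thesis unfolding state_def by (rule someI_ex)
qed

text \<open>\<open>state\<close> is an arbitrary choice, so the bound is derived for any solution
  directly from monotonicity of \<open>f\<close>, not from the way existence was shown.\<close>

lemma state_bound:
  assumes u: "L2 \<omega> u" and B: "kato (\<lambda>x. \<bar>ext u x\<bar>) B" and B0: "kato (\<lambda>x. \<bar>f x 0\<bar>) B0"
  shows "\<exists>\<zeta>. wsol (state \<Omega> \<omega> f u) \<zeta> (\<lambda>x. ext u x - f x (state \<Omega> \<omega> f u x)) \<and> (AE x in M. \<bar>state \<Omega> \<omega> f u x\<bar> \<le> Cinf * (B + B0))"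
proof -
  define y where "y = state \<Omega> \<omega> f u"
  obtain \<zeta> where w: "wsol y \<zeta> (\<lambda>x. ext u x - f x (y x))" using wsol_state[OF state_exists[OF u] u] by (auto simp: y_def)
  have em: "ext u \<in> borel_measurable M" using ext_sqint[OF u] by (simp add: sqint_def)
  have fm: "(\<lambda>x. f x 0) \<in> borel_measurable M" by (intro f_comp_meas borel_measurable_const)
  have k: "kato (\<lambda>x. \<bar>ext u x - f x 0\<bar>) (B + B0)" using kato_abs_add[OF B B0 em fm, of "-1"] by simp
  have "AE x in M. \<bar>y x\<bar> \<le> Cinf * (B + B0)"
  proof (rule Linf_estimate[OF w k])
    show "AE x in M. (ext u x - f x (y x)) * y x \<le> \<bar>ext u x - f x 0\<bar> * \<bar>y x\<bar>"
      using f_sign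
    proof eventually_elim
      case (elim x)
      have "0 \<le> (f x (y x) - f x 0) * y x" using elim by blast
      moreover have "(ext u x - f x 0) * y x \<le> \<bar>ext u x - f x 0\<bar> * \<bar>y x\<bar>" by (metis abs_ge_self abs_mult)
      moreover have "(ext u x - f x (y x)) * y x = (ext u x - f x 0) * y x - (f x (y x) - f x 0) * y x" by (simp add: algebra_simps)
      ultimately show ?case by linarith
    qed
  qed
  with w show ?thesis unfolding y_def by blast
qed

end

context pde_dom
begin

lemma kato_abs_bound: "kato G B \<Longrightarrow> kato G \<bar>B\<bar>"
  unfolding kato_def by (meson abs_ge_self order_trans)

lemma kato_scale:
  assumes "kato G B" "c \<ge> 0" shows "kato (\<lambda>x. c * G x) (c * B)"
proof -
  have "kato (\<lambda>x. 0) 0" by (simp add: kato_def)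
  from kato_lin[OF this assms] show ?thesis by simp
qed

lemma Linf_bounded_rhs:
  assumes w: "wsol y \<zeta> r" and B: "kato (\<lambda>x. 1) B" and c: "c \<ge> 0" and sgn: "AE x in M. r x * y x \<le> c * \<bar>y x\<bar>"
  shows "AE x in M. \<bar>y x\<bar> \<le> Cinf * (c * B)"
  using Linf_estimate[OF w kato_scale[OF B c]] sgn by simp

text \<open>A bounded nonnegative potential is the linear case of a monotone Lipschitz nonlinearity;
  this provides both linearised states.\<close>

lemma linear_coefficient_solution:
  assumes a: "a \<in> borel_measurable M" "AE x in M. 0 \<le> a x \<and> a x \<le> C" and g: "g \<in> borel_measurable M" and k: "kato (\<lambda>x. \<bar>g x\<bar>) B"
  shows "\<exists>z \<zeta>. wsol z \<zeta> (\<lambda>x. g x - a x * z x) \<and> (AE x in M. \<bar>z x\<bar> \<le> Cinf * B)"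
proof -
  have "mono_lip (\<lambda>x s. a x * s) (\<bar>C\<bar> + 1)"
    unfolding mono_lip_def
  proof (intro conjI allI impI)
    show "\<bar>C\<bar> + 1 > 0" by (simp add: add_nonneg_pos)
    show "(\<lambda>x. a x * u x) \<in> borel_measurable M" if "u \<in> borel_measurable M" for u by (intro borel_measurable_times a that)
    show "AE x in M. a x * 0 = 0" by simp
    show "AE x in M. \<forall>s t. s \<le> t \<longrightarrow> 0 \<le> a x * t - a x * s \<and> a x * t - a x * s \<le> (\<bar>C\<bar> + 1) * (t - s)"
      using a(2)
    proof eventually_elim
      case (elim x)
      show ?case
      proof (intro allI impI)
        fix s t :: real assume "s \<le> t"
        then have "0 \<le> a x * (t - s)" "a x * (t - s) \<le> (\<bar>C\<bar> + 1) * (t - s)"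
          using elim by (auto intro!: mult_right_mono)
        then show "0 \<le> a x * t - a x * s \<and> a x * t - a x * s \<le> (\<bar>C\<bar> + 1) * (t - s)"
          by (simp only: right_diff_distrib)
      qed
    qed
  qed
  from semilinear_solution[OF this g k] show ?thesis .
qed

end

text \<open>The sign condition of the essential bound for an equation - \<Delta> e = - a e - R: the
  damping term only helps, and a bound on the residual \<open>R\<close> remains.\<close>

lemma damped_sign:
  fixes a e R c :: real
  assumes "a \<ge> 0" "\<bar>R\<bar> \<le> c" "r = - (a * e) - R"
  shows "r * e \<le> c * \<bar>e\<bar>"
proof -
  have "r * e = - (a * (e * e)) + (- R) * e" by (simp add: assms(3) algebra_simps)
  moreover have "0 \<le> a * (e * e)" using assms(1) by simp
  moreover have "(- R) * e \<le> \<bar>R\<bar> * \<bar>e\<bar>" by (metis abs_ge_self abs_minus_cancel abs_mult)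
  moreover have "\<bar>R\<bar> * \<bar>e\<bar> \<le> c * \<bar>e\<bar>" using assms(2) by (intro mult_right_mono) auto
  ultimately show ?thesis by linarith
qed

section \<open>Expansion of the state along a line of controls\<close>

context ctrl
begin

lemma L2_lin:
  assumes "L2 \<omega> u" "L2 \<omega> v" shows "L2 \<omega> (\<lambda>x. u x + t * v x)"
proof -
  have iff: "L2 \<omega> u \<longleftrightarrow> sqint (lebesgue_on \<omega>) u" for u by (simp add: L2_def sqint_def)
  show ?thesis using sqint_add[of "lebesgue_on \<omega>" u "\<lambda>x. t *\<^sub>R v x"] sqint_scaleR[of "lebesgue_on \<omega>" v t] assms
    unfolding iff by simp
qed

text \<open>\<open>Z t\<close> is the first derivative of the state along the line at \<open>t\<close>, and \<open>W\<close> the second one at 0.\<close>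
lemma state_line_expansion:
  assumes ub: "L2 \<omega> ub" and v: "L2 \<omega> v"
  defines "Y \<equiv> \<lambda>t. state \<Omega> \<omega> f (\<lambda>x. ub x + t * v x)"
  shows "\<exists>Z W K. K \<ge> 0 \<and> (\<forall>t. Y t \<in> borel_measurable M) \<and> (\<forall>t. \<bar>t\<bar> \<le> 1 \<longrightarrow> Z t \<in> borel_measurable M) \<and> W \<in> borel_measurable M
     \<and> (AE x in M. \<bar>W x\<bar> \<le> K) \<and> (\<forall>t. \<bar>t\<bar> \<le> 1 \<longrightarrow> (AE x in M. \<bar>Y t x\<bar> \<le> K \<and> \<bar>Z t x\<bar> \<le> K))
     \<and> (\<forall>s t. \<bar>s\<bar> \<le> 1 \<longrightarrow> \<bar>t\<bar> \<le> 1 \<longrightarrow> (AE x in M. \<bar>Y s x - Y t x\<bar> \<le> K * \<bar>s - t\<bar> \<and> \<bar>Z s x - Z t x\<bar> \<le> K * \<bar>s - t\<bar>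
           \<and> \<bar>Y s x - Y t x - (s - t) * Z t x\<bar> \<le> K * (s - t)\<^sup>2))
     \<and> (\<forall>\<eta>>0. \<exists>\<delta>>0. \<forall>s. \<bar>s\<bar> < \<delta> \<longrightarrow> (AE x in M. \<bar>Z s x - Z 0 x - s * W x\<bar> \<le> \<eta> * \<bar>s\<bar>))"
proof -
  define u where "u t x = ub x + t * v x" for t x
  have Y: "Y t = state \<Omega> \<omega> f (u t)" for t by (simp add: Y_def u_def[abs_def])
  have Lu: "L2 \<omega> (u t)" for t unfolding u_def[abs_def] by (rule L2_lin[OF ub v])
  have em: "ext ub \<in> borel_measurable M" "ext v \<in> borel_measurable M" using ext_sqint[OF ub] ext_sqint[OF v] by (auto simp: sqint_def)
  have eu: "ext (u t) x = ext ub x + t * ext v x" for t x by (simp add: ext_def u_def distrib_left mult.left_commute)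
  obtain Bu where Bu: "kato (\<lambda>x. \<bar>ext ub x\<bar>) Bu" using kato_sqint[OF ext_sqint[OF ub]] by blast
  obtain Bv where Bv: "kato (\<lambda>x. \<bar>ext v x\<bar>) Bv" "Bv \<ge> 0"
    using kato_sqint[OF ext_sqint[OF v]] kato_abs_bound abs_ge_zero by blast
  obtain B0 where B0: "kato (\<lambda>x. \<bar>f x 0\<bar>) B0" using f0 by blast
  obtain B1 where B1: "kato (\<lambda>x. 1) B1" "B1 \<ge> 0" using kato_one kato_abs_bound abs_ge_zero by blast
  have Cp: "Cinf > 0" by (rule Cinf_pos)
  \<comment> \<open>A common bound for all states with \<open>\<bar>t\<bar> \<le> 1\<close>, since
    the potential of the control grows at most by \<open>\<bar>t\<bar> * Bv\<close>.\<close>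
  define m where "m = Cinf * ((Bu + Bv) + B0)"
  have kut: "kato (\<lambda>x. \<bar>ext (u t) x\<bar>) (Bu + \<bar>t\<bar> * Bv)" for t
    using kato_abs_add[OF Bu Bv(1) em, of t] by (simp add: eu)
  have wY: "\<exists>\<zeta>. wsol (Y t) \<zeta> (\<lambda>x. ext (u t) x - f x (Y t x))" for t
    using state_bound[OF Lu kut B0, of t] unfolding Y by blast
  have Ym: "Y t \<in> borel_measurable M" for t using wY[of t] H0_sqint(1) unfolding wsol_def sqint_def by blast
  have Yb: "AE x in M. \<bar>Y t x\<bar> \<le> m" if "\<bar>t\<bar> \<le> 1" for t
  proof -
    have "Cinf * ((Bu + \<bar>t\<bar> * Bv) + B0) \<le> m" unfolding m_def
      using Cp mult_right_mono[OF that Bv(2)] by (intro mult_left_mono add_mono) auto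
    moreover have "AE x in M. \<bar>Y t x\<bar> \<le> Cinf * ((Bu + \<bar>t\<bar> * Bv) + B0)"
      using state_bound[OF Lu kut B0, of t] unfolding Y by blast
    ultimately show ?thesis by (elim eventually_mono) linarith
  qed
  obtain C' where C': "AE x in M. \<forall>y. \<bar>y\<bar> \<le> m \<longrightarrow> \<bar>f1 x y\<bar> + \<bar>f2 x y\<bar> \<le> C'" using f_bd by blast
  define C where "C = \<bar>C'\<bar>"
  have C0: "C \<ge> 0" by (simp add: C_def)
  have C: "AE x in M. \<forall>y. \<bar>y\<bar> \<le> m \<longrightarrow> \<bar>f1 x y\<bar> + \<bar>f2 x y\<bar> \<le> C"
    using C' unfolding C_def by (elim eventually_mono) (meson abs_ge_self order_trans)
  have good: "AE x in M. (\<forall>y. (f x has_real_derivative f1 x y) (at y)) \<and> (\<forall>y. (f1 x has_real_derivative f2 x y) (at y))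
     \<and> (\<forall>y. 0 \<le> f1 x y) \<and> (\<forall>y. \<bar>y\<bar> \<le> m \<longrightarrow> \<bar>f1 x y\<bar> + \<bar>f2 x y\<bar> \<le> C)"
    using f_C2 f_mono C by eventually_elim blast
  \<comment> \<open>Measurable representatives of the coefficients; the linear solution theory asks
    for measurable potentials.\<close>
  have "\<forall>t. \<exists>a. a \<in> borel_measurable M \<and> (AE x in M. a x = f1 x (Y t x))" using f_deriv_meas(1)[OF Ym] by blast
  from choice[OF this] obtain a where a: "\<And>t. a t \<in> borel_measurable M" "\<And>t. AE x in M. a t x = f1 x (Y t x)" by blast
  obtain b where b: "b \<in> borel_measurable M" "AE x in M. b x = f2 x (Y 0 x)" using f_deriv_meas(2)[OF Ym] by blast
  have ab: "AE x in M. 0 \<le> a t x \<and> a t x \<le> C" if "\<bar>t\<bar> \<le> 1" for t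
    using good a(2)[of t] Yb[OF that]
  proof eventually_elim
    case (elim x)
    have "\<bar>f1 x (Y t x)\<bar> + \<bar>f2 x (Y t x)\<bar> \<le> C" using elim(1,3) by blast
    moreover have "0 \<le> f1 x (Y t x)" using elim(1) by blast
    ultimately show ?case using elim(2) by simp
  qed
  \<comment> \<open>Bounds \<open>Z t\<close> and is also the Lipschitz constant of the state: in
    both equations the damping has the good sign and \<open>ext v\<close> is the datum.\<close>
  define k1 where "k1 = Cinf * Bv"
  have k1: "k1 \<ge> 0" using Cp Bv(2) by (simp add: k1_def)
  have "\<forall>t. \<exists>z. \<bar>t\<bar> \<le> 1 \<longrightarrow> (\<exists>\<zeta>. wsol z \<zeta> (\<lambda>x. ext v x - a t x * z x)) \<and> (AE x in M. \<bar>z x\<bar> \<le> k1)"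
  proof
    fix t
    show "\<exists>z. \<bar>t\<bar> \<le> 1 \<longrightarrow> (\<exists>\<zeta>. wsol z \<zeta> (\<lambda>x. ext v x - a t x * z x)) \<and> (AE x in M. \<bar>z x\<bar> \<le> k1)"
    proof (cases "\<bar>t\<bar> \<le> 1")
      case True
      from linear_coefficient_solution[OF a(1) ab[OF True] em(2) Bv(1)] show ?thesis unfolding k1_def by blast
    qed simp
  qed
  from choice[OF this] obtain Z where Z0: "\<forall>t. \<bar>t\<bar> \<le> 1 \<longrightarrow> (\<exists>\<zeta>. wsol (Z t) \<zeta> (\<lambda>x. ext v x - a t x * Z t x)) \<and> (AE x in M. \<bar>Z t x\<bar> \<le> k1)" by blast
  have wZ: "\<exists>\<zeta>. wsol (Z t) \<zeta> (\<lambda>x. ext v x - a t x * Z t x)" and Zb: "AE x in M. \<bar>Z t x\<bar> \<le> k1" if "\<bar>t\<bar> \<le> 1" for t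
    using Z0 that by blast+
  have Zm: "Z t \<in> borel_measurable M" if "\<bar>t\<bar> \<le> 1" for t using wZ[OF that] H0_sqint(1) unfolding wsol_def sqint_def by blast
  have dY: "AE x in M. \<bar>Y s x - Y t x\<bar> \<le> k1 * \<bar>s - t\<bar>" for s t
  proof -
    obtain \<zeta> \<xi> where w: "wsol (Y s) \<zeta> (\<lambda>x. ext (u s) x - f x (Y s x))" "wsol (Y t) \<xi> (\<lambda>x. ext (u t) x - f x (Y t x))" using wY by blast
    have "AE x in M. \<bar>Y s x - Y t x\<bar> \<le> Cinf * (\<bar>s - t\<bar> * Bv)"
    proof (rule Linf_estimate[OF wsol_diff[OF w] kato_scale[OF Bv(1) abs_ge_zero[of "s - t"]]])
      show "AE x in M. ((ext (u s) x - f x (Y s x)) - (ext (u t) x - f x (Y t x))) * (Y s x - Y t x) \<le> \<bar>s - t\<bar> * \<bar>ext v x\<bar> * \<bar>Y s x - Y t x\<bar>"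
        using good
      proof eventually_elim
        case (elim x)
        have inc: "f x p \<le> f x q" if "p \<le> q" for p q
          by (rule DERIV_nonneg_imp_nondecreasing[OF that]) (use elim in blast)
        have "0 \<le> (f x (Y s x) - f x (Y t x)) * (Y s x - Y t x)"
          using inc[of "Y s x" "Y t x"] inc[of "Y t x" "Y s x"]
          by (cases "Y s x \<le> Y t x") (auto intro: mult_nonpos_nonpos mult_nonneg_nonneg)
        moreover have "((s - t) * ext v x) * (Y s x - Y t x) \<le> \<bar>(s - t) * ext v x\<bar> * \<bar>Y s x - Y t x\<bar>" by (metis abs_ge_self abs_mult)
        moreover have "((ext (u s) x - f x (Y s x)) - (ext (u t) x - f x (Y t x))) * (Y s x - Y t x)
          = ((s - t) * ext v x) * (Y s x - Y t x) - (f x (Y s x) - f x (Y t x)) * (Y s x - Y t x)"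
          by (simp add: eu algebra_simps)
        ultimately show ?case by (simp add: abs_mult)
      qed
    qed
    then show ?thesis by (simp add: k1_def mult_ac)
  qed
  \<comment> \<open>Residuals bounded by \<open>C * k1\<^sup>2\<close> times a power of
    \<open>\<bar>s - t\<bar>\<close>, passed through the essential bound with the potential
    \<open>B1\<close> of the constant 1.\<close>
  define k2 where "k2 = Cinf * (C * k1\<^sup>2 * B1)"
  have k2: "k2 \<ge> 0" using Cp C0 B1(2) by (simp add: k2_def)
  \<comment> \<open>The remainder e solves - \<Delta> e + \<open>a t\<close> e = - R, with R the
    first-order Taylor remainder of \<open>f x\<close> between the two states.\<close>
  have dE: "AE x in M. \<bar>Y s x - Y t x - (s - t) * Z t x\<bar> \<le> k2 * (s - t)\<^sup>2" if st: "\<bar>s\<bar> \<le> 1" "\<bar>t\<bar> \<le> 1" for s t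
  proof -
    obtain \<zeta> \<xi> \<upsilon> where w: "wsol (Y s) \<zeta> (\<lambda>x. ext (u s) x - f x (Y s x))" "wsol (Y t) \<xi> (\<lambda>x. ext (u t) x - f x (Y t x))"
      "wsol (Z t) \<upsilon> (\<lambda>x. ext v x - a t x * Z t x)" using wY wZ[OF st(2)] by blast
    have "AE x in M. \<bar>(Y s x - Y t x) + (- (s - t)) * Z t x\<bar> \<le> Cinf * ((C * k1\<^sup>2 * (s - t)\<^sup>2) * B1)"
    proof (rule Linf_bounded_rhs[OF wsol_lin[OF wsol_diff[OF w(1,2)] w(3)] B1(1)])
      show "0 \<le> C * k1\<^sup>2 * (s - t)\<^sup>2" using C0 by simp
      show "AE x in M. (((ext (u s) x - f x (Y s x)) - (ext (u t) x - f x (Y t x))) + (- (s - t)) * (ext v x - a t x * Z t x))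
         * ((Y s x - Y t x) + (- (s - t)) * Z t x) \<le> C * k1\<^sup>2 * (s - t)\<^sup>2 * \<bar>(Y s x - Y t x) + (- (s - t)) * Z t x\<bar>"
        using good dY[of s t] Yb[OF st(1)] Yb[OF st(2)] a(2)[of t]
      proof eventually_elim
        case (elim x)
        show ?case
        proof (rule damped_sign[where a="a t x" and R="f x (Y s x) - f x (Y t x) - a t x * (Y s x - Y t x)"])
          show "0 \<le> a t x" using elim(1,5) by simp
          have "\<bar>f x (Y s x) - f x (Y t x) - f1 x (Y t x) * (Y s x - Y t x)\<bar> \<le> C * (Y s x - Y t x)\<^sup>2"
            by (rule mvt_estimates(3)[of "f x" "f1 x" "f2 x" m]) (use elim in blast)+
          also have "\<dots> \<le> C * (k1 * \<bar>s - t\<bar>)\<^sup>2" using elim(2) C0 by (intro mult_left_mono) (auto simp flip: abs_le_square_iff)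
          finally show "\<bar>f x (Y s x) - f x (Y t x) - a t x * (Y s x - Y t x)\<bar> \<le> C * k1\<^sup>2 * (s - t)\<^sup>2"
            by (simp add: elim(5) power_mult_distrib)
        qed (simp add: eu algebra_simps)
      qed
    qed
    moreover have "(Y s x - Y t x) + (- (s - t)) * Z t x = Y s x - Y t x - (s - t) * Z t x" for x by (simp only: mult_minus_left diff_conv_add_uminus)
    moreover have "Cinf * ((C * k1\<^sup>2 * (s - t)\<^sup>2) * B1) = k2 * (s - t)\<^sup>2" by (simp add: k2_def mult_ac)
    ultimately show ?thesis by (simp only:)
  qed
  \<comment> \<open>The difference is damped by \<open>a t\<close>, with residual
    \<open>(a s x - a t x) * Z s x\<close>.\<close>
  have dZ: "AE x in M. \<bar>Z s x - Z t x\<bar> \<le> k2 * \<bar>s - t\<bar>" if st: "\<bar>s\<bar> \<le> 1" "\<bar>t\<bar> \<le> 1" for s t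
  proof -
    obtain \<zeta> \<upsilon> where w: "wsol (Z s) \<zeta> (\<lambda>x. ext v x - a s x * Z s x)" "wsol (Z t) \<upsilon> (\<lambda>x. ext v x - a t x * Z t x)"
      using wZ st by blast
    have "AE x in M. \<bar>Z s x - Z t x\<bar> \<le> Cinf * ((C * k1\<^sup>2 * \<bar>s - t\<bar>) * B1)"
    proof (rule Linf_bounded_rhs[OF wsol_diff[OF w] B1(1)])
      show "0 \<le> C * k1\<^sup>2 * \<bar>s - t\<bar>" using C0 by simp
      show "AE x in M. ((ext v x - a s x * Z s x) - (ext v x - a t x * Z t x)) * (Z s x - Z t x) \<le> C * k1\<^sup>2 * \<bar>s - t\<bar> * \<bar>Z s x - Z t x\<bar>"
        using good dY[of s t] Yb[OF st(1)] Yb[OF st(2)] a(2)[of t] a(2)[of s] Zb[OF st(1)]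
      proof eventually_elim
        case (elim x)
        show ?case
        proof (rule damped_sign[where a="a t x" and R="(a s x - a t x) * Z s x"])
          show "0 \<le> a t x" using elim(1,5) by simp
          have "\<bar>f1 x (Y s x) - f1 x (Y t x)\<bar> \<le> C * \<bar>Y s x - Y t x\<bar>"
            by (rule mvt_estimates(2)[of "f x" "f1 x" "f2 x" m]) (use elim in blast)+
          also have "\<dots> \<le> C * (k1 * \<bar>s - t\<bar>)" using elim(2) C0 by (intro mult_left_mono)
          finally have "\<bar>a s x - a t x\<bar> \<le> C * (k1 * \<bar>s - t\<bar>)" by (simp add: elim(5,6))
          then have "\<bar>a s x - a t x\<bar> * \<bar>Z s x\<bar> \<le> (C * (k1 * \<bar>s - t\<bar>)) * k1" using elim(7) k1 C0 by (intro mult_mono) auto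
          then show "\<bar>(a s x - a t x) * Z s x\<bar> \<le> C * k1\<^sup>2 * \<bar>s - t\<bar>" by (simp add: abs_mult power2_eq_square mult_ac)
        qed (simp add: algebra_simps)
      qed
    qed
    then show ?thesis by (simp add: k2_def mult_ac)
  qed
  have z1: "\<bar>0::real\<bar> \<le> 1" by simp
  have bb: "AE x in M. \<bar>b x\<bar> \<le> C"
    using good b(2) Yb[OF z1]
  proof eventually_elim
    case (elim x)
    have "\<bar>f1 x (Y 0 x)\<bar> + \<bar>f2 x (Y 0 x)\<bar> \<le> C" using elim(1,3) by blast
    then show ?case using elim(2) abs_ge_zero[of "f1 x (Y 0 x)"] by simp
  qed
  have gm: "(\<lambda>x. - (b x * (Z 0 x)\<^sup>2)) \<in> borel_measurable M" using b(1) Zm[OF z1] by measurable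
  have kg: "kato (\<lambda>x. \<bar>- (b x * (Z 0 x)\<^sup>2)\<bar>) (C * k1\<^sup>2 * B1)"
  proof (rule kato_mono[OF kato_scale[OF B1(1)]])
    show "0 \<le> C * k1\<^sup>2" using C0 by simp
    show "(\<lambda>x. \<bar>- (b x * (Z 0 x)\<^sup>2)\<bar>) \<in> borel_measurable M" using gm by measurable
    show "AE x in M. 0 \<le> \<bar>- (b x * (Z 0 x)\<^sup>2)\<bar> \<and> \<bar>- (b x * (Z 0 x)\<^sup>2)\<bar> \<le> C * k1\<^sup>2 * 1"
      using bb Zb[OF z1]
    proof eventually_elim
      case (elim x)
      have "(Z 0 x)\<^sup>2 \<le> k1\<^sup>2" using elim(2) k1 by (simp flip: abs_le_square_iff)
      then have "\<bar>b x\<bar> * (Z 0 x)\<^sup>2 \<le> C * k1\<^sup>2" using elim(1) C0 by (intro mult_mono) auto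
      then show ?case by (simp add: abs_mult)
    qed
  qed
  \<comment> \<open>Formally differentiating - \<Delta> Z + f1(x,Y) Z = v once more in t gives this
    equation for the second derivative.\<close>
  obtain W \<omega>W where W: "wsol W \<omega>W (\<lambda>x. - (b x * (Z 0 x)\<^sup>2) - a 0 x * W x)" "AE x in M. \<bar>W x\<bar> \<le> Cinf * (C * k1\<^sup>2 * B1)"
    using linear_coefficient_solution[OF a(1) ab[OF z1] gm kg] by blast
  have Wm: "W \<in> borel_measurable M" using W(1) H0_sqint(1) unfolding wsol_def sqint_def by blast
  have dW: "\<exists>\<delta>>0. \<forall>s. \<bar>s\<bar> < \<delta> \<longrightarrow> (AE x in M. \<bar>Z s x - Z 0 x - s * W x\<bar> \<le> \<eta> * \<bar>s\<bar>)" if eta: "\<eta> > 0" for \<eta>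
  proof -
    define E where "E = Cinf * B1"
    have E0: "E \<ge> 0" using Cp B1(2) by (simp add: E_def)
    \<comment> \<open>The modulus required of \<open>f2\<close>; its contribution to the final bound
      is then at most \<open>\<eta> / 2\<close> times \<open>\<bar>s\<bar>\<close>.\<close>
    define \<theta> where "\<theta> = \<eta> / (2 * (E * k1\<^sup>2 + 1))"
    have d1: "2 * (E * k1\<^sup>2 + 1) > 0" using E0 by (intro mult_pos_pos add_nonneg_pos) auto
    have th: "\<theta> > 0" using eta d1 by (simp add: \<theta>_def)
    obtain \<epsilon> where ep: "\<epsilon> > 0" "AE x in M. \<forall>y1 y2. \<bar>y1\<bar> \<le> m \<and> \<bar>y2\<bar> \<le> m \<and> \<bar>y2 - y1\<bar> < \<epsilon> \<longrightarrow> \<bar>f2 x y2 - f2 x y1\<bar> \<le> \<theta>"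
      using f_uc th by blast
    define Q where "Q = 2 * C * k1 * k2"
    have Q0: "Q \<ge> 0" using C0 k1 k2 by (simp add: Q_def)
    have d2: "2 * (E * Q + 1) > 0" using E0 Q0 by (intro mult_pos_pos add_nonneg_pos) auto
    \<comment> \<open>The second entry keeps the state increment below \<open>\<epsilon>\<close>,
      the third keeps the part quadratic in \<open>s\<close> below \<open>\<eta> / 2\<close> times
      \<open>\<bar>s\<bar>\<close>.\<close>
    define \<delta> where "\<delta> = min 1 (min (\<epsilon> / (k1 + 1)) (\<eta> / (2 * (E * Q + 1))))"
    have del: "\<delta> > 0" using ep(1) k1 eta d2 by (simp add: \<delta>_def)
    have "AE x in M. \<bar>Z s x - Z 0 x - s * W x\<bar> \<le> \<eta> * \<bar>s\<bar>" if s: "\<bar>s\<bar> < \<delta>" for s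
    proof -
      have s1: "\<bar>s\<bar> \<le> 1" using s by (simp add: \<delta>_def)
      have se: "k1 * \<bar>s\<bar> < \<epsilon>"
      proof -
        have "k1 * \<bar>s\<bar> \<le> (k1 + 1) * \<bar>s\<bar>" by (intro mult_right_mono) auto
        also have "\<dots> < (k1 + 1) * (\<epsilon> / (k1 + 1))" using s k1 by (intro mult_strict_left_mono) (auto simp: \<delta>_def)
        also have "\<dots> = \<epsilon>" using k1 by simp
        finally show ?thesis .
      qed
      obtain \<zeta> \<upsilon> where w: "wsol (Z s) \<zeta> (\<lambda>x. ext v x - a s x * Z s x)" "wsol (Z 0) \<upsilon> (\<lambda>x. ext v x - a 0 x * Z 0 x)"
        using wZ s1 z1 by blast
      have "AE x in M. \<bar>(Z s x - Z 0 x) + (- s) * W x\<bar> \<le> Cinf * (((\<theta> * k1\<^sup>2 + Q * \<bar>s\<bar>) * \<bar>s\<bar>) * B1)"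
      proof (rule Linf_bounded_rhs[OF wsol_lin[OF wsol_diff[OF w] W(1)] B1(1)])
        show "0 \<le> (\<theta> * k1\<^sup>2 + Q * \<bar>s\<bar>) * \<bar>s\<bar>" using th Q0 by simp
        show "AE x in M. (((ext v x - a s x * Z s x) - (ext v x - a 0 x * Z 0 x)) + (- s) * (- (b x * (Z 0 x)\<^sup>2) - a 0 x * W x))
           * ((Z s x - Z 0 x) + (- s) * W x) \<le> (\<theta> * k1\<^sup>2 + Q * \<bar>s\<bar>) * \<bar>s\<bar> * \<bar>(Z s x - Z 0 x) + (- s) * W x\<bar>"
          using good ep(2) dY[of s 0] Yb[OF s1] Yb[OF z1] a(2)[of s] a(2)[of 0] b(2) Zb[OF s1] Zb[OF z1] dE[OF s1 z1] dZ[OF s1 z1] bb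
        proof eventually_elim
          case (elim x)
          show ?case
          \<comment> \<open>The residual
            \<open>(a s x - a 0 x) * Z s x - s * b x * (Z 0 x)\<^sup>2\<close> is split into the
            Taylor remainder of \<open>f1\<close>, small by uniform continuity of \<open>f2\<close>,
            the second-order remainder of the state, and the variation of \<open>Z\<close>; the last
            two are quadratic in \<open>s\<close>.\<close>
          proof (rule damped_sign[where a="a 0 x" and R="(a s x - a 0 x - b x * (Y s x - Y 0 x)) * Z s x + (b x * (Y s x - Y 0 x - (s - 0) * Z 0 x)) * Z s x + (s * b x * Z 0 x) * (Z s x - Z 0 x)"])
            show "0 \<le> a 0 x" using elim(1,7) by simp
            have d: "\<bar>Y s x - Y 0 x\<bar> \<le> k1 * \<bar>s\<bar>" using elim(3) by simp
            have "\<bar>f1 x (Y s x) - f1 x (Y 0 x) - f2 x (Y 0 x) * (Y s x - Y 0 x)\<bar> \<le> \<theta> * \<bar>Y s x - Y 0 x\<bar>"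
            proof (rule mvt_estimates(4)[of "f x" "f1 x" "f2 x" m C "Y 0 x" "Y s x" \<epsilon>])
              show "\<bar>Y s x - Y 0 x\<bar> < \<epsilon>" using d se by linarith
            qed (use elim in blast)+
            also have "\<dots> \<le> \<theta> * (k1 * \<bar>s\<bar>)" using d th by (intro mult_left_mono) auto
            finally have "\<bar>a s x - a 0 x - b x * (Y s x - Y 0 x)\<bar> \<le> \<theta> * (k1 * \<bar>s\<bar>)" by (simp add: elim(6,7,8))
            then have r1: "\<bar>a s x - a 0 x - b x * (Y s x - Y 0 x)\<bar> * \<bar>Z s x\<bar> \<le> (\<theta> * (k1 * \<bar>s\<bar>)) * k1"
              by (rule mult_mono[OF _ elim(9)]) (use th k1 in auto)
            have "\<bar>b x\<bar> * \<bar>Y s x - Y 0 x - (s - 0) * Z 0 x\<bar> \<le> C * (k2 * (s - 0)\<^sup>2)"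
              using elim(11,13) C0 by (intro mult_mono) auto
            then have r2: "(\<bar>b x\<bar> * \<bar>Y s x - Y 0 x - (s - 0) * Z 0 x\<bar>) * \<bar>Z s x\<bar> \<le> (C * (k2 * (s - 0)\<^sup>2)) * k1"
              by (rule mult_mono[OF _ elim(9)]) (use C0 k2 in auto)
            have "\<bar>s\<bar> * \<bar>b x\<bar> \<le> \<bar>s\<bar> * C" using elim(13) by (intro mult_left_mono) auto
            then have "(\<bar>s\<bar> * \<bar>b x\<bar>) * \<bar>Z 0 x\<bar> \<le> (\<bar>s\<bar> * C) * k1"
              by (rule mult_mono[OF _ elim(10)]) (use C0 in auto)
            then have r3: "((\<bar>s\<bar> * \<bar>b x\<bar>) * \<bar>Z 0 x\<bar>) * \<bar>Z s x - Z 0 x\<bar> \<le> ((\<bar>s\<bar> * C) * k1) * (k2 * \<bar>s - 0\<bar>)"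
              by (rule mult_mono[OF _ elim(12)]) (use C0 k1 in auto)
            have ss: "(s - 0)\<^sup>2 = \<bar>s\<bar> * \<bar>s\<bar>" by (simp only: diff_0_right power2_eq_square abs_mult_self_eq)
            define S where "S = \<bar>s\<bar>"
            have sum: "(\<theta> * (k1 * \<bar>s\<bar>)) * k1 + (C * (k2 * (s - 0)\<^sup>2)) * k1 + ((\<bar>s\<bar> * C) * k1) * (k2 * \<bar>s - 0\<bar>) = (\<theta> * k1\<^sup>2 + Q * \<bar>s\<bar>) * \<bar>s\<bar>"
              unfolding ss unfolding diff_0_right S_def[symmetric] Q_def power2_eq_square by (simp add: algebra_simps)
            have p1: "\<bar>(a s x - a 0 x - b x * (Y s x - Y 0 x)) * Z s x\<bar> \<le> (\<theta> * (k1 * \<bar>s\<bar>)) * k1"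
              using r1 by (simp only: abs_mult)
            have p2: "\<bar>(b x * (Y s x - Y 0 x - (s - 0) * Z 0 x)) * Z s x\<bar> \<le> (C * (k2 * (s - 0)\<^sup>2)) * k1"
              using r2 by (simp only: abs_mult)
            have p3: "\<bar>(s * b x * Z 0 x) * (Z s x - Z 0 x)\<bar> \<le> ((\<bar>s\<bar> * C) * k1) * (k2 * \<bar>s - 0\<bar>)"
              using r3 by (simp only: abs_mult)
            show "\<bar>(a s x - a 0 x - b x * (Y s x - Y 0 x)) * Z s x + (b x * (Y s x - Y 0 x - (s - 0) * Z 0 x)) * Z s x + (s * b x * Z 0 x) * (Z s x - Z 0 x)\<bar>
               \<le> (\<theta> * k1\<^sup>2 + Q * \<bar>s\<bar>) * \<bar>s\<bar>"
              unfolding sum[symmetric]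
              by (intro order_trans[OF abs_triangle_ineq add_mono[OF order_trans[OF abs_triangle_ineq add_mono[OF p1 p2]] p3]])
          qed (simp add: algebra_simps power2_eq_square)
        qed
      qed
      moreover have "Cinf * (((\<theta> * k1\<^sup>2 + Q * \<bar>s\<bar>) * \<bar>s\<bar>) * B1) \<le> \<eta> * \<bar>s\<bar>"
      proof -
        have half: "g * (e / (2 * g)) = e / 2" if "2 * g > 0" for g e :: real using that by (simp add: field_simps)
        have "E * k1\<^sup>2 * \<theta> \<le> (E * k1\<^sup>2 + 1) * \<theta>" using th by (intro mult_right_mono) auto
        also have "\<dots> = \<eta> / 2" unfolding \<theta>_def by (rule half[OF d1])
        finally have 1: "E * k1\<^sup>2 * \<theta> \<le> \<eta> / 2" .
        have "E * Q * \<bar>s\<bar> \<le> (E * Q + 1) * (\<eta> / (2 * (E * Q + 1)))" using s E0 Q0 eta d2 by (intro mult_mono) (auto simp: \<delta>_def)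
        also have "\<dots> = \<eta> / 2" by (rule half[OF d2])
        finally have 2: "E * Q * \<bar>s\<bar> \<le> \<eta> / 2" .
        have "E * (\<theta> * k1\<^sup>2 + Q * \<bar>s\<bar>) \<le> \<eta>" using 1 2 by (simp add: algebra_simps)
        from mult_right_mono[OF this abs_ge_zero[of s]] show ?thesis by (simp add: E_def mult_ac)
      qed
      ultimately show ?thesis by (elim eventually_mono) simp
    qed
    with del show ?thesis by blast
  qed
  define K where "K = \<bar>m\<bar> + k1 + k2"
  have K: "K \<ge> 0" "m \<le> K" "k1 \<le> K" "k2 \<le> K" using k1 k2 by (auto simp: K_def)
  show ?thesis
  proof (rule exI[of _ Z], rule exI[of _ W], rule exI[of _ K], intro conjI allI impI Ym Zm Wm K(1))
    show "AE x in M. \<bar>W x\<bar> \<le> K" using W(2) K(4) by (elim eventually_mono) (simp add: k2_def)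
    show "AE x in M. \<bar>Y t x\<bar> \<le> K \<and> \<bar>Z t x\<bar> \<le> K" if "\<bar>t\<bar> \<le> 1" for t
      using Yb[OF that] Zb[OF that] by eventually_elim (use K in simp)
    show "AE x in M. \<bar>Y s x - Y t x\<bar> \<le> K * \<bar>s - t\<bar> \<and> \<bar>Z s x - Z t x\<bar> \<le> K * \<bar>s - t\<bar>
           \<and> \<bar>Y s x - Y t x - (s - t) * Z t x\<bar> \<le> K * (s - t)\<^sup>2" if st: "\<bar>s\<bar> \<le> 1" "\<bar>t\<bar> \<le> 1" for s t
      using dY[of s t] dZ[OF st] dE[OF st]
    proof eventually_elim
      case (elim x)
      have "k1 * \<bar>s - t\<bar> \<le> K * \<bar>s - t\<bar>" "k2 * \<bar>s - t\<bar> \<le> K * \<bar>s - t\<bar>" "k2 * (s - t)\<^sup>2 \<le> K * (s - t)\<^sup>2"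
        using K by (auto intro!: mult_right_mono)
      with elim show ?case by linarith
    qed
    show "\<exists>\<delta>>0. \<forall>s. \<bar>s\<bar> < \<delta> \<longrightarrow> (AE x in M. \<bar>Z s x - Z 0 x - s * W x\<bar> \<le> \<eta> * \<bar>s\<bar>)" if "\<eta> > 0" for \<eta>
      by (rule dW[OF that])
  qed
qed

end

text \<open>One application of l'Hopital's rule leaves the difference quotient of
  \<open>\<phi>'\<close> at 0, so \<open>\<phi>'\<close> has to be differentiable at that single
  point only.\<close>

lemma taylor_second_order_right:
  fixes \<phi> \<phi>' :: "real \<Rightarrow> real"
  assumes d: "\<And>t. \<bar>t\<bar> < 1 \<Longrightarrow> (\<phi> has_real_derivative \<phi>' t) (at t)" and d2: "(\<phi>' has_real_derivative D) (at 0)"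
  shows "((\<lambda>\<rho>. (\<phi> \<rho> - \<phi> 0 - \<rho> * \<phi>' 0) / \<rho>\<^sup>2) \<longlongrightarrow> D / 2) (at_right 0)"
proof (rule lhopital_right_0)
  have c: "isCont \<phi> 0" using d[of 0] by (simp add: DERIV_isCont)
  have "((\<lambda>\<rho>. \<phi> \<rho> - \<phi> 0 - \<rho> * \<phi>' 0) \<longlongrightarrow> \<phi> 0 - \<phi> 0 - 0 * \<phi>' 0) (at 0)"
    using c by (intro tendsto_intros) (simp add: isCont_def)
  then show "((\<lambda>\<rho>. \<phi> \<rho> - \<phi> 0 - \<rho> * \<phi>' 0) \<longlongrightarrow> 0) (at_right 0)"
    using tendsto_mono[OF at_le[of "{0<..}" UNIV]] by simp
  have "((\<lambda>\<rho>::real. \<rho>\<^sup>2) \<longlongrightarrow> 0\<^sup>2) (at_right 0)" by (intro tendsto_intros)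
  then show "((\<lambda>\<rho>::real. \<rho>\<^sup>2) \<longlongrightarrow> 0) (at_right 0)" by simp
  have pos: "\<forall>\<^sub>F \<rho> in at_right (0::real). \<rho> > 0" by (simp add: eventually_at_right_less)
  then show "\<forall>\<^sub>F \<rho>::real in at_right 0. \<rho>\<^sup>2 \<noteq> 0" by eventually_elim simp
  from pos show "\<forall>\<^sub>F \<rho>::real in at_right 0. 2 * \<rho> \<noteq> 0" by eventually_elim simp
  have "\<forall>\<^sub>F \<rho> in at_right (0::real). \<rho> < 1" by (rule eventually_at_right_real[of 0 1, THEN eventually_mono]) auto
  with pos show "\<forall>\<^sub>F \<rho> in at_right 0. ((\<lambda>\<rho>. \<phi> \<rho> - \<phi> 0 - \<rho> * \<phi>' 0) has_real_derivative (\<phi>' \<rho> - \<phi>' 0)) (at \<rho>)"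
  proof eventually_elim
    case (elim \<rho>)
    have "(\<phi> has_real_derivative \<phi>' \<rho>) (at \<rho>)" using elim by (intro d) simp
    then show ?case by (auto intro!: derivative_eq_intros)
  qed
  show "\<forall>\<^sub>F \<rho>::real in at_right 0. ((\<lambda>\<rho>. \<rho>\<^sup>2) has_real_derivative 2 * \<rho>) (at \<rho>)"
    by (auto intro!: always_eventually derivative_eq_intros)
  have "((\<lambda>\<rho>. (\<phi>' (0 + \<rho>) - \<phi>' 0) / \<rho>) \<longlongrightarrow> D) (at 0)" using d2 unfolding DERIV_def .
  then have "((\<lambda>\<rho>. (\<phi>' \<rho> - \<phi>' 0) / \<rho>) \<longlongrightarrow> D) (at_right 0)"
    using tendsto_mono[OF at_le[of "{0<..}" UNIV]] by simp
  then have "((\<lambda>\<rho>. ((\<phi>' \<rho> - \<phi>' 0) / \<rho>) / 2) \<longlongrightarrow> D / 2) (at_right 0)" by (rule tendsto_divide) auto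
  then show "((\<lambda>\<rho>. (\<phi>' \<rho> - \<phi>' 0) / (2 * \<rho>)) \<longlongrightarrow> D / 2) (at_right 0)"
    by (simp add: mult.commute)
qed

context ctrl
begin

lemma integral_abs_le:
  fixes g h :: "real^'n \<Rightarrow> real"
  assumes "integrable M g" "integrable M h" "AE x in M. \<bar>g x\<bar> \<le> h x"
  shows "\<bar>LINT x|M. g x\<bar> \<le> (LINT x|M. h x)"
proof -
  have "\<bar>LINT x|M. g x\<bar> \<le> (LINT x|M. \<bar>g x\<bar>)" using integral_abs_bound[of M g] by simp
  also have "\<dots> \<le> (LINT x|M. h x)" using assms by (intro integral_mono_AE) auto
  finally show ?thesis .
qed

text \<open>\<open>R t\<close> is the integral of \<open>(Y t - yd) * Z t\<close>, half of the
  derivative, matching the factor 1/2 in the objective. The derivative of \<open>R\<close> at 0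
  combines the square of \<open>Z 0\<close> with the product of the misfit and
  \<open>W\<close>.\<close>

lemma tracking_derivatives:
  assumes ub: "L2 \<omega> ub" and v: "L2 \<omega> v" and yd: "L2 \<Omega> yd"
  shows "\<exists>R D. (\<forall>t. \<bar>t\<bar> < 1 \<longrightarrow> ((\<lambda>t. LINT x|M. (state \<Omega> \<omega> f (\<lambda>x. ub x + t * v x) x - yd x)\<^sup>2) has_real_derivative 2 * R t) (at t))
     \<and> (R has_real_derivative D) (at 0)"
proof -
  define Y where "Y t = state \<Omega> \<omega> f (\<lambda>x. ub x + t * v x)" for t
  obtain Z W K where K: "K \<ge> 0" and Ym: "\<And>t. Y t \<in> borel_measurable M" and Zm: "\<And>t. \<bar>t\<bar> \<le> 1 \<Longrightarrow> Z t \<in> borel_measurable M"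
    and Wm: "W \<in> borel_measurable M" and Wb: "AE x in M. \<bar>W x\<bar> \<le> K"
    and YZb: "\<And>t. \<bar>t\<bar> \<le> 1 \<Longrightarrow> AE x in M. \<bar>Y t x\<bar> \<le> K \<and> \<bar>Z t x\<bar> \<le> K"
    and dYZ: "\<And>s t. \<bar>s\<bar> \<le> 1 \<Longrightarrow> \<bar>t\<bar> \<le> 1 \<Longrightarrow> AE x in M. \<bar>Y s x - Y t x\<bar> \<le> K * \<bar>s - t\<bar> \<and> \<bar>Z s x - Z t x\<bar> \<le> K * \<bar>s - t\<bar>
           \<and> \<bar>Y s x - Y t x - (s - t) * Z t x\<bar> \<le> K * (s - t)\<^sup>2"
    and dW: "\<And>\<eta>. \<eta> > 0 \<Longrightarrow> \<exists>\<delta>>0. \<forall>s. \<bar>s\<bar> < \<delta> \<longrightarrow> (AE x in M. \<bar>Z s x - Z 0 x - s * W x\<bar> \<le> \<eta> * \<bar>s\<bar>)"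
    using state_line_expansion[OF ub v] unfolding Y_def[abs_def] by blast
  have sy: "sqint M yd" using yd by (simp add: L2_def sqint_def)
  have sY: "sqint M (Y t)" if "\<bar>t\<bar> \<le> 1" for t
  proof (rule sqint_bounded[OF fin Ym])
    show "AE x in M. norm (Y t x) \<le> K" using YZb[OF that] by eventually_elim simp
  qed
  have sZ: "sqint M (Z t)" if "\<bar>t\<bar> \<le> 1" for t
  proof (rule sqint_bounded[OF fin Zm[OF that]])
    show "AE x in M. norm (Z t x) \<le> K" using YZb[OF that] by eventually_elim simp
  qed
  have sW: "sqint M W" by (rule sqint_bounded[OF fin Wm]) (use Wb in simp)
  define G where "G t x = Y t x - yd x" for t x
  have sG: "sqint M (G t)" if "\<bar>t\<bar> \<le> 1" for t unfolding G_def[abs_def] by (intro sqint_diff sY sy that)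
  define \<mu> where "\<mu> = (LINT x|M. (1::real))"
  have i1: "integrable M (\<lambda>x. c::real)" for c by (rule integrable_bounded[OF fin, where B="\<bar>c\<bar>"]) auto
  \<comment> \<open>\<open>yd\<close> is only square-integrable, so the misfit has no essential
    bound; its L^1 norm multiplies the essential bounds of the remainders.\<close>
  define c where "c t = (LINT x|M. \<bar>G t x\<bar>)" for t
  have iG: "integrable M (\<lambda>x. \<bar>G t x\<bar>)" if "\<bar>t\<bar> \<le> 1" for t
    using sqint_integrable[OF fin sG[OF that]] by simp
  have c0: "c t \<ge> 0" for t by (simp add: c_def)
  have m0: "\<mu> \<ge> 0" by (simp add: \<mu>_def)
  have const: "(LINT x|M. d) = d * \<mu>" for d :: real by (simp add: \<mu>_def)
  define R where "R t = (LINT x|M. G t x * Z t x)" for t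
  define D where "D = (LINT x|M. Z 0 x * Z 0 x + G 0 x * W x)"
  have dP: "((\<lambda>t. LINT x|M. (G t x)\<^sup>2) has_real_derivative 2 * R t) (at t)" if t: "\<bar>t\<bar> < 1" for t
  proof (rule has_real_derivative_quadratic_remainder)
    fix \<eta> :: real assume eta: "\<eta> > 0"
    define q where "q = K\<^sup>2 * \<mu> + 2 * K * c t + 1"
    have q: "q > 0" unfolding q_def using K c0 m0 by (intro add_nonneg_pos add_nonneg_nonneg mult_nonneg_nonneg) auto
    define \<delta> where "\<delta> = min (1 - \<bar>t\<bar>) (\<eta> / q)"
    have t1: "\<bar>t\<bar> \<le> 1" using t by simp
    have "\<bar>(LINT x|M. (G s x)\<^sup>2) - (LINT x|M. (G t x)\<^sup>2) - (s - t) * (2 * R t)\<bar> \<le> \<eta> * \<bar>s - t\<bar>" if s: "\<bar>s - t\<bar> < \<delta>" for s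
    proof -
      have s1: "\<bar>s\<bar> \<le> 1" using s by (auto simp: \<delta>_def)
      \<comment> \<open>The exact remainder of the squared misfit, written so that each term
        contains a quadratic remainder or the square of an increment.\<close>
      define r where "r x = (Y s x - Y t x)\<^sup>2 + 2 * (G t x * (Y s x - Y t x - (s - t) * Z t x))" for x
      have sr: "sqint M (\<lambda>x. Y s x - Y t x)" "sqint M (\<lambda>x. Y s x - Y t x - (s - t) * Z t x)"
        using sqint_scaleR[OF sZ[OF t1], of "s - t"] by (auto intro!: sqint_diff sY s1 t1)
      have ir: "integrable M r"
        unfolding r_def[abs_def] power2_eq_square
        by (intro Bochner_Integration.integrable_add integrable_mult_right sqint_mult sr sG t1)
      have "(LINT x|M. (G s x)\<^sup>2) - (LINT x|M. (G t x)\<^sup>2) - (s - t) * (2 * R t) = (LINT x|M. r x)"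
      proof -
        have "(LINT x|M. r x) = (LINT x|M. (G s x * G s x) - (G t x * G t x) - (s - t) * (2 * (G t x * Z t x)))"
          by (intro Bochner_Integration.integral_cong) (simp_all add: r_def G_def power2_eq_square algebra_simps)
        then show ?thesis
          using sqint_mult[OF sG[OF s1] sG[OF s1]] sqint_mult[OF sG[OF t1] sG[OF t1]] sqint_mult[OF sG[OF t1] sZ[OF t1]]
          by (simp add: R_def power2_eq_square)
      qed
      also have "\<bar>LINT x|M. r x\<bar> \<le> (LINT x|M. K\<^sup>2 * (s - t)\<^sup>2 + (2 * K * (s - t)\<^sup>2) * \<bar>G t x\<bar>)"
      proof (rule integral_abs_le[OF ir])
        show "integrable M (\<lambda>x. K\<^sup>2 * (s - t)\<^sup>2 + (2 * K * (s - t)\<^sup>2) * \<bar>G t x\<bar>)" using i1 iG[OF t1] by simp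
        show "AE x in M. \<bar>r x\<bar> \<le> K\<^sup>2 * (s - t)\<^sup>2 + (2 * K * (s - t)\<^sup>2) * \<bar>G t x\<bar>"
          using dYZ[OF s1 t1]
        proof eventually_elim
          case (elim x)
          have "\<bar>Y s x - Y t x\<bar> \<le> \<bar>K * (s - t)\<bar>" using elim K by (simp add: abs_mult)
          then have 1: "(Y s x - Y t x)\<^sup>2 \<le> (K * (s - t))\<^sup>2" unfolding abs_le_square_iff .
          have 2: "\<bar>G t x\<bar> * \<bar>Y s x - Y t x - (s - t) * Z t x\<bar> \<le> \<bar>G t x\<bar> * (K * (s - t)\<^sup>2)" using elim by (intro mult_left_mono) auto
          have "\<bar>r x\<bar> \<le> \<bar>(Y s x - Y t x)\<^sup>2\<bar> + \<bar>2 * (G t x * (Y s x - Y t x - (s - t) * Z t x))\<bar>"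
            unfolding r_def by (rule abs_triangle_ineq)
          also have "\<dots> = (Y s x - Y t x)\<^sup>2 + 2 * (\<bar>G t x\<bar> * \<bar>Y s x - Y t x - (s - t) * Z t x\<bar>)" by (simp add: abs_mult)
          also have "\<dots> \<le> (K * (s - t))\<^sup>2 + 2 * (\<bar>G t x\<bar> * (K * (s - t)\<^sup>2))" using 1 2 by linarith
          finally show ?case by (simp add: power_mult_distrib mult_ac)
        qed
      qed
      also have "\<dots> = (s - t)\<^sup>2 * (K\<^sup>2 * \<mu> + 2 * K * c t)"
      proof -
        have "(LINT x|M. K\<^sup>2 * (s - t)\<^sup>2 + (2 * K * (s - t)\<^sup>2) * \<bar>G t x\<bar>) = (LINT x|M. K\<^sup>2 * (s - t)\<^sup>2) + (LINT x|M. (2 * K * (s - t)\<^sup>2) * \<bar>G t x\<bar>)"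
          using i1 iG[OF t1] by (intro Bochner_Integration.integral_add) auto
        then show ?thesis unfolding const by (simp add: c_def algebra_simps)
      qed
      also have "\<dots> \<le> (s - t)\<^sup>2 * q" by (intro mult_left_mono) (auto simp: q_def)
      also have "\<dots> = (\<bar>s - t\<bar> * q) * \<bar>s - t\<bar>" by (simp add: power2_eq_square)
      also have "\<dots> \<le> \<eta> * \<bar>s - t\<bar>"
      proof (rule mult_right_mono)
        have "\<bar>s - t\<bar> \<le> \<eta> / q" using s by (simp add: \<delta>_def)
        then show "\<bar>s - t\<bar> * q \<le> \<eta>" using q by (simp add: pos_le_divide_eq)
      qed simp
      finally show ?thesis .
    qed
    moreover have "\<delta> > 0" using t eta q by (simp add: \<delta>_def)
    ultimately show "\<exists>\<delta>>0. \<forall>s. \<bar>s - t\<bar> < \<delta> \<longrightarrow> \<bar>(LINT x|M. (G s x)\<^sup>2) - (LINT x|M. (G t x)\<^sup>2) - (s - t) * (2 * R t)\<bar> \<le> \<eta> * \<bar>s - t\<bar>" by blast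
  qed
  have z1: "\<bar>0::real\<bar> \<le> 1" by simp
  have dR: "(R has_real_derivative D) (at 0)"
  proof (rule has_real_derivative_quadratic_remainder)
    fix \<eta> :: real assume eta: "\<eta> > 0"
    define q where "q = 2 * K\<^sup>2 * \<mu> + 1"
    have q: "q > 0" unfolding q_def using m0 by (intro add_nonneg_pos) auto
    define \<theta> where "\<theta> = \<eta> / (2 * (c 0 + 1))"
    have cp: "2 * (c 0 + 1) > 0" using c0[of 0] by simp
    have th: "\<theta> > 0" using eta cp by (simp add: \<theta>_def)
    obtain \<delta>0 where d0: "\<delta>0 > 0" "\<And>s. \<bar>s\<bar> < \<delta>0 \<Longrightarrow> AE x in M. \<bar>Z s x - Z 0 x - s * W x\<bar> \<le> \<theta> * \<bar>s\<bar>" using dW[OF th] by blast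
    define \<delta> where "\<delta> = min 1 (min \<delta>0 (\<eta> / (2 * q)))"
    have "\<bar>R s - R 0 - (s - 0) * D\<bar> \<le> \<eta> * \<bar>s - 0\<bar>" if s: "\<bar>s - 0\<bar> < \<delta>" for s
    proof -
      have s1: "\<bar>s\<bar> \<le> 1" and sd: "\<bar>s\<bar> < \<delta>0" using s by (auto simp: \<delta>_def)
      \<comment> \<open>The exact remainder of the product of misfit and \<open>Z\<close>: the first
        two terms are quadratic in \<open>s\<close>, the last is o(s) through the expansion of
        \<open>Z\<close> by \<open>W\<close>.\<close>
      define r where "r x = (Y s x - Y 0 x - (s - 0) * Z 0 x) * Z s x + (s * (Z 0 x * (Z s x - Z 0 x)) + G 0 x * (Z s x - Z 0 x - s * W x))" for x
      have sr: "sqint M (\<lambda>x. Y s x - Y 0 x - (s - 0) * Z 0 x)" "sqint M (\<lambda>x. Z s x - Z 0 x)" "sqint M (\<lambda>x. Z s x - Z 0 x - s * W x)"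
        using sqint_scaleR[OF sZ[OF z1], of s] sqint_scaleR[OF sW, of s] by (auto intro!: sqint_diff sY sZ s1 z1)
      have ir: "integrable M r" unfolding r_def[abs_def]
        by (intro Bochner_Integration.integrable_add integrable_mult_right sqint_mult sr sG sZ s1 z1)
      have "R s - R 0 - (s - 0) * D = (LINT x|M. r x)"
      proof -
        have "(LINT x|M. r x) = (LINT x|M. (G s x * Z s x - G 0 x * Z 0 x) - s * (Z 0 x * Z 0 x + G 0 x * W x))"
          by (intro Bochner_Integration.integral_cong) (simp_all add: r_def G_def algebra_simps)
        then show ?thesis
          using sqint_mult[OF sG[OF s1] sZ[OF s1]] sqint_mult[OF sG[OF z1] sZ[OF z1]] sqint_mult[OF sZ[OF z1] sZ[OF z1]] sqint_mult[OF sG[OF z1] sW]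
          by (simp add: R_def D_def)
      qed
      also have "\<bar>LINT x|M. r x\<bar> \<le> (LINT x|M. 2 * K\<^sup>2 * s\<^sup>2 + (\<theta> * \<bar>s\<bar>) * \<bar>G 0 x\<bar>)"
      proof (rule integral_abs_le[OF ir])
        show "integrable M (\<lambda>x. 2 * K\<^sup>2 * s\<^sup>2 + (\<theta> * \<bar>s\<bar>) * \<bar>G 0 x\<bar>)" using i1 iG[OF z1] by simp
        show "AE x in M. \<bar>r x\<bar> \<le> 2 * K\<^sup>2 * s\<^sup>2 + (\<theta> * \<bar>s\<bar>) * \<bar>G 0 x\<bar>"
          using dYZ[OF s1 z1] YZb[OF s1] YZb[OF z1] d0(2)[OF sd]
        proof eventually_elim
          case (elim x)
          have 1: "\<bar>Y s x - Y 0 x - (s - 0) * Z 0 x\<bar> * \<bar>Z s x\<bar> \<le> (K * (s - 0)\<^sup>2) * K"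
            by (rule mult_mono) (use elim K in auto)
          have "\<bar>Z 0 x\<bar> * \<bar>Z s x - Z 0 x\<bar> \<le> K * (K * \<bar>s - 0\<bar>)"
            by (rule mult_mono) (use elim K in auto)
          then have 2: "\<bar>s\<bar> * (\<bar>Z 0 x\<bar> * \<bar>Z s x - Z 0 x\<bar>) \<le> \<bar>s\<bar> * (K * (K * \<bar>s - 0\<bar>))" by (rule mult_left_mono) simp
          have 3: "\<bar>G 0 x\<bar> * \<bar>Z s x - Z 0 x - s * W x\<bar> \<le> \<bar>G 0 x\<bar> * (\<theta> * \<bar>s\<bar>)" using elim by (intro mult_left_mono) auto
          have "\<bar>r x\<bar> \<le> \<bar>Y s x - Y 0 x - (s - 0) * Z 0 x\<bar> * \<bar>Z s x\<bar> + (\<bar>s\<bar> * (\<bar>Z 0 x\<bar> * \<bar>Z s x - Z 0 x\<bar>) + \<bar>G 0 x\<bar> * \<bar>Z s x - Z 0 x - s * W x\<bar>)"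
            unfolding r_def abs_mult[symmetric] by (intro order_trans[OF abs_triangle_ineq add_left_mono] abs_triangle_ineq)
          also have "\<dots> \<le> (K * (s - 0)\<^sup>2) * K + (\<bar>s\<bar> * (K * (K * \<bar>s - 0\<bar>)) + \<bar>G 0 x\<bar> * (\<theta> * \<bar>s\<bar>))"
            using 1 2 3 by (intro add_mono)
          also have "\<bar>s\<bar> * (K * (K * \<bar>s - 0\<bar>)) = K\<^sup>2 * s\<^sup>2"
          proof -
            have "\<bar>s\<bar> * (K * (K * \<bar>s - 0\<bar>)) = K * K * (\<bar>s\<bar> * \<bar>s\<bar>)" by (simp only: diff_0_right mult_ac)
            then show ?thesis by (simp only: abs_mult_self_eq power2_eq_square)
          qed
          finally show ?case by (simp add: power2_eq_square mult_ac)
        qed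
      qed
      also have "\<dots> = \<bar>s\<bar> * (2 * K\<^sup>2 * \<mu> * \<bar>s\<bar> + \<theta> * c 0)"
      proof -
        have "(LINT x|M. 2 * K\<^sup>2 * s\<^sup>2 + (\<theta> * \<bar>s\<bar>) * \<bar>G 0 x\<bar>) = (LINT x|M. 2 * K\<^sup>2 * s\<^sup>2) + (LINT x|M. (\<theta> * \<bar>s\<bar>) * \<bar>G 0 x\<bar>)"
          using i1 iG[OF z1] by (intro Bochner_Integration.integral_add) auto
        also have "\<dots> = 2 * K\<^sup>2 * s\<^sup>2 * \<mu> + (\<theta> * \<bar>s\<bar>) * c 0" unfolding const by (simp add: c_def)
        also have "\<dots> = \<bar>s\<bar> * (2 * K\<^sup>2 * \<mu> * \<bar>s\<bar> + \<theta> * c 0)"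
        proof -
          have "2 * K\<^sup>2 * s\<^sup>2 * \<mu> = 2 * K\<^sup>2 * (\<bar>s\<bar> * \<bar>s\<bar>) * \<mu>" by (simp only: abs_mult_self_eq power2_eq_square)
          then show ?thesis by (simp only: distrib_left mult_ac)
        qed
        finally show ?thesis .
      qed
      also have "\<dots> \<le> \<bar>s\<bar> * \<eta>"
      proof (rule mult_left_mono)
        have half: "g * (e / (2 * g)) = e / 2" if "2 * g > 0" for g e :: real using that by (simp add: field_simps)
        have "2 * K\<^sup>2 * \<mu> * \<bar>s\<bar> \<le> q * \<bar>s\<bar>" by (intro mult_right_mono) (auto simp: q_def)
        also have "\<dots> \<le> q * (\<eta> / (2 * q))" using s q by (intro mult_left_mono) (auto simp: \<delta>_def)
        also have "\<dots> = \<eta> / 2" using q by (intro half) simp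
        finally have 1: "2 * K\<^sup>2 * \<mu> * \<bar>s\<bar> \<le> \<eta> / 2" .
        have "c 0 * \<theta> \<le> (c 0 + 1) * \<theta>" using th by (intro mult_right_mono) auto
        also have "\<dots> = \<eta> / 2" unfolding \<theta>_def by (rule half[OF cp])
        finally show "2 * K\<^sup>2 * \<mu> * \<bar>s\<bar> + \<theta> * c 0 \<le> \<eta>" using 1 by (simp add: mult.commute)
      qed simp
      finally show ?thesis by (simp add: mult.commute)
    qed
    moreover have "\<delta> > 0" using d0(1) eta q by (simp add: \<delta>_def)
    ultimately show "\<exists>\<delta>>0. \<forall>s. \<bar>s - 0\<bar> < \<delta> \<longrightarrow> \<bar>R s - R 0 - (s - 0) * D\<bar> \<le> \<eta> * \<bar>s - 0\<bar>" by blast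
  qed
  show ?thesis
    by (rule exI[of _ R], rule exI[of _ D]) (use dP dR in \<open>simp add: G_def Y_def\<close>)
qed

text \<open>Apart from the tracking term the objective is a quadratic polynomial in t along the
  line. The work is to identify the values of \<open>deriv\<close> in \<open>dF\<close> and
  \<open>d2F\<close> with actual derivatives.\<close>

theorem Fobj_taylor:
  assumes ub: "L2 \<omega> ub" and v: "L2 \<omega> v" and yd: "L2 \<Omega> yd"
  shows "((\<lambda>\<rho>. (Fobj \<Omega> \<omega> f yd \<beta> \<gamma> (\<lambda>x. ub x + \<rho> * v x) - Fobj \<Omega> \<omega> f yd \<beta> \<gamma> ub - \<rho> * dF \<Omega> \<omega> f yd \<beta> \<gamma> ub v) / \<rho>\<^sup>2)
     \<longlongrightarrow> d2F \<Omega> \<omega> f yd \<beta> \<gamma> ub v / 2) (at_right 0)"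
proof -
  define \<phi> where "\<phi> t = Fobj \<Omega> \<omega> f yd \<beta> \<gamma> (\<lambda>x. ub x + t * v x)" for t
  obtain R D where RD: "\<And>t. \<bar>t\<bar> < 1 \<Longrightarrow> ((\<lambda>t. LINT x|M. (state \<Omega> \<omega> f (\<lambda>x. ub x + t * v x) x - yd x)\<^sup>2) has_real_derivative 2 * R t) (at t)"
    "(R has_real_derivative D) (at 0)"
    using tracking_derivatives[OF ub v yd] by blast
  let ?N = "lebesgue_on \<omega>"
  have su: "sqint ?N ub" and sv: "sqint ?N v" using ub v by (auto simp: L2_def sqint_def)
  have finN: "finite_measure ?N"
  proof
    have "\<omega> \<in> lmeasurable" using om bdd by (intro lmeasurable_open) (auto intro: bounded_subset)
    then show "emeasure ?N (space ?N) \<noteq> \<infinity>"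
      by (simp add: emeasure_restrict_space fmeasurable_def top.not_eq_extremum)
  qed
  define A B where "A = (LINT x|?N. ub x)" and "B = (LINT x|?N. v x)"
  define p q r where "p = (LINT x|?N. ub x * ub x)" and "q = (LINT x|?N. ub x * v x)" and "r = (LINT x|?N. v x * v x)"
  have int1: "(LINT x|?N. ub x + t * v x) = A + t * B" for t
    using sqint_integrable[OF finN su] sqint_integrable[OF finN sv] by (simp add: A_def B_def)
  have int2: "(LINT x|?N. (ub x + t * v x)\<^sup>2) = p + 2 * t * q + t\<^sup>2 * r" for t
  proof -
    have "(LINT x|?N. (ub x + t * v x)\<^sup>2) = (LINT x|?N. ub x * ub x + 2 * t * (ub x * v x) + t\<^sup>2 * (v x * v x))"
      by (intro Bochner_Integration.integral_cong) (simp_all add: power2_eq_square algebra_simps)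
    then show ?thesis using sqint_mult[OF su su] sqint_mult[OF su sv] sqint_mult[OF sv sv] by (simp add: p_def q_def r_def)
  qed
  define \<phi>' where "\<phi>' t = R t + \<beta> * (A + t * B) * B + \<gamma> * (q + t * r)" for t
  have \<phi>: "\<phi> = (\<lambda>t. 1/2 * (LINT x|M. (state \<Omega> \<omega> f (\<lambda>x. ub x + t * v x) x - yd x)\<^sup>2) + \<beta>/2 * (A + t * B)\<^sup>2 + \<gamma>/2 * (p + 2 * t * q + t\<^sup>2 * r))"
    by (simp add: \<phi>_def Fobj_def int1 int2 fun_eq_iff)
  have d1: "(\<phi> has_real_derivative \<phi>' t) (at t)" if "\<bar>t\<bar> < 1" for t
    unfolding \<phi>
    by (rule derivative_eq_intros RD(1)[OF that] refl)+ (simp add: \<phi>'_def algebra_simps)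
  have d2: "(\<phi>' has_real_derivative (D + \<beta> * B * B + \<gamma> * r)) (at 0)"
    unfolding \<phi>'_def[abs_def]
    by (rule derivative_eq_intros RD(2) refl)+ (simp add: algebra_simps)
  have dF: "dF \<Omega> \<omega> f yd \<beta> \<gamma> ub v = \<phi>' 0"
    using DERIV_imp_deriv[OF d1[of 0]] by (simp add: dF_def \<phi>_def[abs_def])
  have "((\<lambda>s. deriv \<phi> s) has_real_derivative (D + \<beta> * B * B + \<gamma> * r)) (at 0)"
  \<comment> \<open>\<open>deriv \<phi>\<close> is known to equal \<open>\<phi>'\<close> only for
    \<open>\<bar>t\<bar> < 1\<close>, which suffices for the derivative at 0.\<close>
  proof (rule has_field_derivative_transform_within_open[OF d2])
    show "open {-1<..<1::real}" "0 \<in> {-1<..<1::real}" by auto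
    show "\<phi>' s = deriv \<phi> s" if "s \<in> {-1<..<1}" for s using that DERIV_imp_deriv[OF d1[of s]] by auto
  qed
  then have d2F: "d2F \<Omega> \<omega> f yd \<beta> \<gamma> ub v = D + \<beta> * B * B + \<gamma> * r"
    using DERIV_imp_deriv by (simp add: d2F_def \<phi>_def[abs_def])
  have "\<phi> 0 = Fobj \<Omega> \<omega> f yd \<beta> \<gamma> ub" by (simp add: \<phi>_def)
  with taylor_second_order_right[OF d1 d2] show ?thesis by (simp add: dF d2F \<phi>_def)
qed

end

section \<open>Total variation\<close>

text \<open>A cut-off profile; the square makes its derivative continuous at 1.\<close>

definition hat :: "real \<Rightarrow> real" where "hat s = (max 0 (1 - s))\<^sup>2"

lemma hat_deriv: "(hat has_real_derivative (- 2 * max 0 (1 - t))) (at t)"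
proof (rule has_real_derivative_quadratic_remainder)
  fix \<eta> :: real assume eta: "\<eta> > 0"
  have key: "\<bar>hat s - hat t - (s - t) * (- 2 * max 0 (1 - t))\<bar> \<le> \<bar>s - t\<bar> * \<bar>s - t\<bar>" for s
  proof -
    have "\<bar>hat s - hat t - (s - t) * (- 2 * max 0 (1 - t))\<bar> \<le> (s - t) * (s - t)"
    proof (cases "s \<le> 1"; cases "t \<le> 1")
      assume "s \<le> 1" "t \<le> 1"
      then have "hat s - hat t - (s - t) * (- 2 * max 0 (1 - t)) = (s - t) * (s - t)"
        by (simp add: hat_def power2_eq_square algebra_simps)
      then show ?thesis by simp
    next
      assume st: "\<not> s \<le> 1" "t \<le> 1"
      define b where "b = 1 - t"
      have b: "0 \<le> b" "b \<le> s - t" using st by (auto simp: b_def)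
      have eq: "hat s - hat t - (s - t) * (- 2 * max 0 (1 - t)) = b * (2 * (s - t) - b)"
        using st by (simp add: hat_def b_def power2_eq_square algebra_simps)
      have "0 \<le> b * (2 * (s - t) - b)" using b by (intro mult_nonneg_nonneg) auto
      moreover have "0 \<le> (s - t - b) * (s - t - b)" by simp
      then have "b * (2 * (s - t) - b) \<le> (s - t) * (s - t)" by (simp add: algebra_simps)
      ultimately show ?thesis unfolding eq by simp
    next
      assume st: "s \<le> 1" "\<not> t \<le> 1"
      then have eq: "hat s - hat t - (s - t) * (- 2 * max 0 (1 - t)) = (1 - s) * (1 - s)"
        by (simp add: hat_def power2_eq_square)
      have "(1 - s) * (1 - s) \<le> (t - s) * (t - s)" using st by (intro mult_mono) auto
      also have "\<dots> = (s - t) * (s - t)" by (simp add: algebra_simps)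
      finally show ?thesis unfolding eq by simp
    next
      assume "\<not> s \<le> 1" "\<not> t \<le> 1"
      then have "hat s - hat t - (s - t) * (- 2 * max 0 (1 - t)) = 0" by (simp add: hat_def)
      then show ?thesis by simp
    qed
    then show ?thesis by simp
  qed
  show "\<exists>\<delta>>0. \<forall>s. \<bar>s - t\<bar> < \<delta> \<longrightarrow> \<bar>hat s - hat t - (s - t) * (- 2 * max 0 (1 - t))\<bar> \<le> \<eta> * \<bar>s - t\<bar>"
  proof (intro exI[of _ \<eta>] conjI eta allI impI)
    fix s assume "\<bar>s - t\<bar> < \<eta>"
    then have "\<bar>s - t\<bar> * \<bar>s - t\<bar> \<le> \<eta> * \<bar>s - t\<bar>" by (intro mult_right_mono) auto
    with key[of s] show "\<bar>hat s - hat t - (s - t) * (- 2 * max 0 (1 - t))\<bar> \<le> \<eta> * \<bar>s - t\<bar>" by linarith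
  qed
qed

lemma hat_cont: "continuous_on UNIV (\<lambda>t::real. - 2 * max 0 (1 - t))"
  by (intro continuous_intros)

lemma hat_range: "0 \<le> hat s" "0 \<le> s \<Longrightarrow> hat s \<le> 1" "1 \<le> s \<Longrightarrow> hat s = 0" "s < 1 \<Longrightarrow> hat s > 0" "hat 0 = 1"
  by (auto simp: hat_def power_le_one)

lemma bump_exists:
  fixes c :: "real^'n"
  assumes r: "r > 0" and U: "cball c r \<subseteq> U"
  shows "\<exists>\<phi>. test_fun U \<phi> \<and> (\<forall>x. 0 \<le> \<phi> x) \<and> (\<forall>x\<in>ball c r. 0 < \<phi> x)"
proof -
  define q where "q x = (1/r\<^sup>2) * (norm (x - c))\<^sup>2" for x
  have qC: "C1 q (\<lambda>x. (1/r\<^sup>2) *\<^sub>R (2 *\<^sub>R (x - c)))"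
    using C1_add[OF C1_const[of 0] C1_dist_sq[of c 0], of "1/r\<^sup>2"] by (simp add: q_def[abs_def])
  note hC = C1_compose[OF qC hat_deriv hat_cont]
  have "test_fun U (\<lambda>x. hat (q x))"
  proof (rule test_funI[OF hC compact_cball U])
    fix x assume "x \<notin> cball c r"
    then have "r \<le> norm (x - c)" by (simp add: dist_norm norm_minus_commute)
    then have "r\<^sup>2 \<le> (norm (x - c))\<^sup>2" using r by (intro power_mono) auto
    then have "1 \<le> q x" using r by (simp add: q_def field_simps)
    then show "hat (q x) = 0" by (rule hat_range)
  qed
  moreover have "0 < hat (q x)" if "x \<in> ball c r" for x
  proof (rule hat_range(4))
    have "norm (x - c) < r" using that by (simp add: dist_norm norm_minus_commute)
    then have "(norm (x - c))\<^sup>2 < r\<^sup>2" by (intro power_strict_mono) auto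
    then show "q x < 1" using r by (simp add: q_def field_simps)
  qed
  ultimately show ?thesis using hat_range(1) by blast
qed

text \<open>A finite sum of bumps is positive on \<open>K\<close>, with some lower bound
  \<open>m > 0\<close> there. Composing it with 1 - hat(s/m) yields 1 where the sum is at least
  \<open>m\<close> and keeps 0 where it vanishes.\<close>

lemma cutoff_exists:
  fixes K U :: "(real^'n) set"
  assumes K: "compact K" and U: "open U" "K \<subseteq> U"
  shows "\<exists>\<phi>. test_fun U \<phi> \<and> (\<forall>x. 0 \<le> \<phi> x \<and> \<phi> x \<le> 1) \<and> (\<forall>x\<in>K. \<phi> x = 1)"
proof -
  define F where "F = {B. \<exists>c r. r > 0 \<and> cball c r \<subseteq> U \<and> B = ball c r}"
  have "K \<subseteq> \<Union>F"
  proof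
    fix x assume "x \<in> K"
    then obtain r where "r > 0" "cball x r \<subseteq> U" using U open_contains_cball by blast
    then have "ball x r \<in> F" "x \<in> ball x r" by (auto simp: F_def)
    then show "x \<in> \<Union>F" by blast
  qed
  moreover have "open B" if "B \<in> F" for B using that by (auto simp: F_def)
  ultimately obtain F' where F': "F' \<subseteq> F" "finite F'" "K \<subseteq> \<Union>F'"
    by (rule compactE[OF K]) (assumption | rule that)+
  have "\<exists>\<phi>. test_fun U \<phi> \<and> (\<forall>x. 0 \<le> \<phi> x) \<and> (\<forall>x\<in>\<Union>F'. 0 < \<phi> x)"
    using F'(2,1)
  proof (induction F' rule: finite_induct)
    case empty
    show ?case using test_fun_zero(1) by (intro exI[of _ "\<lambda>x. 0"]) auto
  next
    case (insert B G)
    then obtain \<phi> where \<phi>: "test_fun U \<phi>" "\<forall>x. 0 \<le> \<phi> x" "\<forall>x\<in>\<Union>G. 0 < \<phi> x" by blast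
    obtain c r where "r > 0" "cball c r \<subseteq> U" "B = ball c r" using insert by (auto simp: F_def)
    then obtain \<psi> where \<psi>: "test_fun U \<psi>" "\<forall>x. 0 \<le> \<psi> x" "\<forall>x\<in>B. 0 < \<psi> x" using bump_exists[of r c U] by blast
    show ?case
    proof (rule exI[of _ "\<lambda>x. \<phi> x + 1 * \<psi> x"], intro conjI test_fun_add \<phi>(1) \<psi>(1) allI ballI)
      show "0 \<le> \<phi> x + 1 * \<psi> x" for x using \<phi>(2) \<psi>(2) by simp
      show "0 < \<phi> x + 1 * \<psi> x" if "x \<in> \<Union>(insert B G)" for x
      proof (cases "x \<in> B")
        case True then show ?thesis using \<phi>(2) \<psi>(3) by (simp add: add_nonneg_pos)
      next
        case False then show ?thesis using \<phi>(3) \<psi>(2) that by (auto intro: add_pos_nonneg)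
      qed
    qed
  qed
  then obtain \<phi> where \<phi>: "test_fun U \<phi>" "\<And>x. 0 \<le> \<phi> x" "\<And>x. x \<in> K \<Longrightarrow> 0 < \<phi> x" using F'(3) by blast
  have "\<exists>m>0. \<forall>x\<in>K. m \<le> \<phi> x"
  proof (cases "K = {}")
    case True then show ?thesis by (intro exI[of _ 1]) auto
  next
    case False
    from continuous_attains_inf[OF K False test_fun_continuous(1)[OF \<phi>(1)]] obtain x0 where "x0 \<in> K" "\<forall>y\<in>K. \<phi> x0 \<le> \<phi> y" by blast
    then show ?thesis using \<phi>(3) by blast
  qed
  then obtain m where m: "m > 0" "\<And>x. x \<in> K \<Longrightarrow> m \<le> \<phi> x" by blast
  have d: "((\<lambda>s. 1 - hat (s / m)) has_real_derivative (2 * max 0 (1 - s / m) / m)) (at s)" for s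
  proof -
    have "((\<lambda>s. s / m) has_real_derivative 1 / m) (at s)" by (rule DERIV_cdivide[OF DERIV_ident])
    from DERIV_diff[OF DERIV_const[of 1] DERIV_chain2[OF hat_deriv this]] show ?thesis by simp
  qed
  have c: "continuous_on UNIV (\<lambda>s. 2 * max 0 (1 - s / m) / m)" using m(1) by (intro continuous_intros) auto
  show ?thesis
  proof (intro exI[of _ "\<lambda>x. 1 - hat (\<phi> x / m)"] conjI allI ballI)
    show "test_fun U (\<lambda>x. 1 - hat (\<phi> x / m))"
      by (rule test_fun_compose(1)[OF \<phi>(1) d c]) (simp add: hat_range)
    have "0 \<le> \<phi> x / m" for x using \<phi>(2)[of x] m(1) by simp
    then show "0 \<le> 1 - hat (\<phi> x / m)" "1 - hat (\<phi> x / m) \<le> 1" for x using hat_range(1,2)[of "\<phi> x / m"] by auto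
    show "1 - hat (\<phi> x / m) = 1" if "x \<in> K" for x using hat_range(3)[of "\<phi> x / m"] m(1) m(2)[OF that] by simp
  qed
qed

section \<open>Finite Borel measures on an open set and density of test functions\<close>

locale borel_on =
  fixes \<omega> :: "(real^'n) set" and lam :: "(real^'n) measure"
  assumes w_open: "open \<omega>" and lam_sets: "sets lam = sets (restrict_space borel \<omega>)" and lam_fin: "finite_measure lam"
begin

lemma lam_space: "space lam = \<omega>"
  using sets_eq_imp_space_eq[OF lam_sets] by (simp add: space_restrict_space)

lemma borel_lam: "f \<in> borel_measurable borel \<Longrightarrow> f \<in> borel_measurable lam"
  by (subst measurable_cong_sets[OF lam_sets refl]) (rule measurable_restrict_space1)

lemma lam_sets_iff: "A \<in> sets lam \<longleftrightarrow> A \<in> sets borel \<and> A \<subseteq> \<omega>"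
  using w_open unfolding lam_sets by (subst sets_restrict_space_iff) auto

text \<open>Inner and outer regularity are facts about Borel measures on the whole space, so the
  measure is pushed there; intersecting the outer set with the open set \<open>\<omega>\<close>
  brings it back.\<close>

lemma lam_regular:
  assumes A: "A \<in> sets lam" and e: "e > 0"
  shows "\<exists>K U. compact K \<and> open U \<and> K \<subseteq> A \<and> A \<subseteq> U \<and> U \<subseteq> \<omega> \<and> measure lam (U - K) \<le> e"
proof -
  interpret L: finite_measure lam by (rule lam_fin)
  define N where "N = distr lam borel (\<lambda>x. x)"
  have idm: "(\<lambda>x. x) \<in> measurable lam borel" by (rule borel_lam) simp
  have Ns: "sets N = sets borel" by (simp add: N_def)
  interpret N: finite_measure N unfolding N_def by (rule L.finite_measure_distr[OF idm])
  have Nf: "emeasure N (space N) \<noteq> \<infinity>" by (simp add: N.emeasure_eq_measure)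
  have NB: "measure N B = measure lam (B \<inter> \<omega>)" if "B \<in> sets borel" for B
    using measure_distr[OF idm that] lam_space by (simp add: N_def)
  have AB: "A \<in> sets borel" "A \<subseteq> \<omega>" using A lam_sets_iff by auto
  have "\<exists>K. K \<subseteq> A \<and> compact K \<and> measure N A \<le> measure N K + e/2"
  proof (rule ccontr)
    assume "\<not> ?thesis"
    then have n: "measure N K \<le> measure N A - e/2" if "K \<subseteq> A" "compact K" for K using that by force
    have "0 \<le> measure N A - e/2" using n[of "{}"] by simp
    have "emeasure N A \<le> ennreal (measure N A - e/2)"
      unfolding inner_regular[OF Ns Nf AB(1)]
      by (rule SUP_least) (auto simp: N.emeasure_eq_measure intro!: ennreal_leI n)
    then have "measure N A \<le> measure N A - e/2"
      using \<open>0 \<le> measure N A - e/2\<close> by (simp add: N.emeasure_eq_measure)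
    then show False using e by simp
  qed
  then obtain K where K: "K \<subseteq> A" "compact K" "measure N A \<le> measure N K + e/2" by blast
  have "\<exists>U. A \<subseteq> U \<and> open U \<and> measure N U \<le> measure N A + e/2"
  proof (rule ccontr)
    assume "\<not> ?thesis"
    then have n: "measure N A + e/2 \<le> measure N U" if "A \<subseteq> U" "open U" for U using that by force
    have "ennreal (measure N A + e/2) \<le> emeasure N A"
      unfolding outer_regular[OF Ns Nf AB(1)]
      by (rule INF_greatest) (auto simp: N.emeasure_eq_measure intro!: ennreal_leI n)
    then have "measure N A + e/2 \<le> measure N A"
      by (simp add: N.emeasure_eq_measure)
    then show False using e by simp
  qed
  then obtain U where U: "A \<subseteq> U" "open U" "measure N U \<le> measure N A + e/2" by blast
  have Kb: "K \<in> sets borel" and Ub: "U \<in> sets borel" using K U by (auto intro: borel_compact)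
  have "measure lam (U \<inter> \<omega> - K) = measure N (U - K)"
    using Kb Ub by (subst NB) (auto intro!: arg_cong[of _ _ "measure lam"])
  also have "\<dots> = measure N U - measure N K"
    using Kb Ub K(1) U(1) by (intro N.finite_measure_Diff) (auto simp: Ns)
  also have "\<dots> \<le> e" using K(3) U(3) by simp
  finally have "measure lam (U \<inter> \<omega> - K) \<le> e" .
  then show ?thesis using K U AB w_open by (intro exI[of _ K] exI[of _ "U \<inter> \<omega>"]) auto
qed

lemma test_fun_lam:
  assumes "test_fun \<omega> \<phi>" shows "\<phi> \<in> borel_measurable lam" "integrable lam \<phi>"
proof -
  interpret L: finite_measure lam by (rule lam_fin)
  show m: "\<phi> \<in> borel_measurable lam" by (intro borel_lam test_fun_borel[OF assms])
  obtain B where "\<And>x. \<bar>\<phi> x\<bar> \<le> B" using test_fun_bounded[OF assms] by blast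
  then show "integrable lam \<phi>" by (intro integrable_bounded[OF lam_fin m, of B]) simp
qed

text \<open>For an indicator, a cut-off between the compact and the open set of
  \<open>lam_regular\<close> differs from it only on their difference. Sums and dominated limits are
  handled by induction on integrable functions.\<close>

lemma test_fun_dense_L1:
  fixes g :: "real^'n \<Rightarrow> real"
  assumes "integrable lam g"
  shows "\<forall>e>0. \<exists>\<phi>. test_fun \<omega> \<phi> \<and> (LINT x|lam. \<bar>g x - \<phi> x\<bar>) \<le> e"
  using assms
proof (induction rule: integrable_induct)
  case (base A c)
  interpret L: finite_measure lam by (rule lam_fin)
  show ?case
  proof (intro allI impI)
    fix e :: real assume e: "e > 0"
    define e' where "e' = e / (\<bar>c\<bar> + 1)"
    have e': "e' > 0" using e by (simp add: e'_def add_nonneg_pos)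
    obtain K U where KU: "compact K" "open U" "K \<subseteq> A" "A \<subseteq> U" "U \<subseteq> \<omega>" "measure lam (U - K) \<le> e'"
      using lam_regular[OF base(1) e'] by blast
    have KU': "K \<subseteq> U" using KU by blast
    obtain \<phi> where \<phi>: "test_fun U \<phi>" "\<And>x. 0 \<le> \<phi> x \<and> \<phi> x \<le> 1" "\<And>x. x \<in> K \<Longrightarrow> \<phi> x = 1"
      using cutoff_exists[OF KU(1,2) KU'] by blast
    have t: "test_fun \<omega> \<phi>" by (rule test_fun_mono[OF \<phi>(1) KU(5)])
    have t2: "test_fun \<omega> (\<lambda>x. 0 + c * \<phi> x)" by (rule test_fun_add(1)[OF test_fun_zero(1) t])
    have UK: "U - K \<in> sets lam" using KU by (subst lam_sets_iff) (auto intro: borel_compact)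
    have "(LINT x|lam. \<bar>indicator A x *\<^sub>R c - (0 + c * \<phi> x)\<bar>) \<le> (LINT x|lam. \<bar>c\<bar> * indicator (U - K) x)"
    proof (rule integral_mono)
      show "integrable lam (\<lambda>x. \<bar>indicator A x *\<^sub>R c - (0 + c * \<phi> x)\<bar>)"
        using base test_fun_lam(2)[OF t2] by (intro integrable_abs Bochner_Integration.integrable_diff) auto
      show "integrable lam (\<lambda>x. \<bar>c\<bar> * indicator (U - K) x)" using UK by (intro integrable_mult_right) (simp add: L.emeasure_eq_measure)
      fix x
      have eq: "indicator A x *\<^sub>R c - (0 + c * \<phi> x) = c * (indicator A x - \<phi> x)" by (simp add: algebra_simps)
      have "\<bar>indicator A x - \<phi> x\<bar> \<le> indicator (U - K) x"
      proof (cases "x \<in> U - K")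
        case True then show ?thesis using \<phi>(2)[of x] by (auto simp: indicator_def abs_le_iff)
      next
        case False
        show ?thesis
        proof (cases "x \<in> K")
          case True then show ?thesis using \<phi>(3) KU(3) by auto
        next
          case F: False
          with False have "x \<notin> U" by blast
          then have "\<phi> x = 0" "x \<notin> A" using test_fun_outside(1)[OF \<phi>(1)] KU(4) by auto
          then show ?thesis by simp
        qed
      qed
      then show "\<bar>indicator A x *\<^sub>R c - (0 + c * \<phi> x)\<bar> \<le> \<bar>c\<bar> * indicator (U - K) x"
        unfolding eq abs_mult by (intro mult_left_mono) auto
    qed
    also have "\<dots> = \<bar>c\<bar> * measure lam (U - K)" using UK by simp
    also have "\<dots> \<le> (\<bar>c\<bar> + 1) * e'" using KU(6) e' by (intro mult_mono) auto
    also have "\<dots> = e"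
    proof -
      have "\<bar>c\<bar> + 1 \<noteq> 0" using add_nonneg_pos[of "\<bar>c\<bar>" 1] by simp
      then show ?thesis by (simp add: e'_def)
    qed
    finally show "\<exists>\<phi>. test_fun \<omega> \<phi> \<and> (LINT x|lam. \<bar>indicator A x *\<^sub>R c - \<phi> x\<bar>) \<le> e" using t2 by blast
  qed
next
  case (add f g)
  show ?case
  proof (intro allI impI)
    fix e :: real assume e: "e > 0"
    obtain \<phi> where \<phi>: "test_fun \<omega> \<phi>" "(LINT x|lam. \<bar>f x - \<phi> x\<bar>) \<le> e/2" using add.IH(1) e half_gt_zero by blast
    obtain \<psi> where \<psi>: "test_fun \<omega> \<psi>" "(LINT x|lam. \<bar>g x - \<psi> x\<bar>) \<le> e/2" using add.IH(2) e half_gt_zero by blast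
    have i: "integrable lam (\<lambda>x. \<bar>f x - \<phi> x\<bar>)" "integrable lam (\<lambda>x. \<bar>g x - \<psi> x\<bar>)"
      using add.hyps test_fun_lam(2)[OF \<phi>(1)] test_fun_lam(2)[OF \<psi>(1)] by auto
    have t: "test_fun \<omega> (\<lambda>x. \<phi> x + 1 * \<psi> x)" by (rule test_fun_add(1)[OF \<phi>(1) \<psi>(1)])
    have "(LINT x|lam. \<bar>f x + g x - (\<phi> x + 1 * \<psi> x)\<bar>) \<le> (LINT x|lam. \<bar>f x - \<phi> x\<bar> + \<bar>g x - \<psi> x\<bar>)"
      using i add.hyps test_fun_lam(2)[OF t] by (intro integral_mono) auto
    also have "\<dots> \<le> e" using i \<phi>(2) \<psi>(2) by simp
    finally show "\<exists>\<phi>. test_fun \<omega> \<phi> \<and> (LINT x|lam. \<bar>f x + g x - \<phi> x\<bar>) \<le> e" using t by blast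
  qed
next
  case (lim f s)
  show ?case
  proof (intro allI impI)
    fix e :: real assume e: "e > 0"
    have "(\<lambda>i. LINT x|lam. \<bar>f x - s i x\<bar>) \<longlonglongrightarrow> (LINT x|lam. 0)"
    proof (rule integral_dominated_convergence)
      show "integrable lam (\<lambda>x. 3 * \<bar>f x\<bar>)" using lim.hyps by auto
      show "AE x in lam. (\<lambda>i. \<bar>f x - s i x\<bar>) \<longlonglongrightarrow> 0"
      proof (rule AE_I2)
        fix x assume "x \<in> space lam"
        from lim.hyps(2)[OF this] have "(\<lambda>i. f x - s i x) \<longlonglongrightarrow> f x - f x" by (intro tendsto_intros)
        then show "(\<lambda>i. \<bar>f x - s i x\<bar>) \<longlonglongrightarrow> 0" using tendsto_rabs_zero by simp
      qed
      show "AE x in lam. norm \<bar>f x - s i x\<bar> \<le> 3 * \<bar>f x\<bar>" for i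
      proof (rule AE_I2)
        fix x assume "x \<in> space lam"
        from lim.hyps(3)[OF this, of i] show "norm \<bar>f x - s i x\<bar> \<le> 3 * \<bar>f x\<bar>" by simp
      qed
    qed (use lim.hyps in auto)
    then have "(\<lambda>i. LINT x|lam. \<bar>f x - s i x\<bar>) \<longlonglongrightarrow> 0" by simp
    from order_tendstoD(2)[OF this, of "e/2"] e obtain i where i: "(LINT x|lam. \<bar>f x - s i x\<bar>) < e/2"
      by (auto simp: eventually_sequentially)
    obtain \<phi> where \<phi>: "test_fun \<omega> \<phi>" "(LINT x|lam. \<bar>s i x - \<phi> x\<bar>) \<le> e/2" using lim.IH[of i] e half_gt_zero by blast
    have ii: "integrable lam (\<lambda>x. \<bar>f x - s i x\<bar>)" "integrable lam (\<lambda>x. \<bar>s i x - \<phi> x\<bar>)" "integrable lam (\<lambda>x. \<bar>f x - \<phi> x\<bar>)"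
      using lim.hyps test_fun_lam(2)[OF \<phi>(1)] by auto
    have "(LINT x|lam. \<bar>f x - \<phi> x\<bar>) \<le> (LINT x|lam. \<bar>f x - s i x\<bar> + \<bar>s i x - \<phi> x\<bar>)"
      using ii by (intro integral_mono) auto
    also have "\<dots> \<le> e" using ii i \<phi>(2) by simp
    finally show "\<exists>\<phi>. test_fun \<omega> \<phi> \<and> (LINT x|lam. \<bar>f x - \<phi> x\<bar>) \<le> e" using \<phi>(1) by blast
  qed
qed

end

lemma C1_sum:
  assumes "finite I" "\<And>i. i \<in> I \<Longrightarrow> C1 (p i) (D i)"
  shows "C1 (\<lambda>x. \<Sum>i\<in>I. p i x) (\<lambda>x. \<Sum>i\<in>I. D i x)"
  using assms
proof (induction I rule: finite_induct)
  case empty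
  show ?case using C1_const[of 0] by simp
next
  case (insert j I)
  have "C1 (\<lambda>x. p j x + 1 * (\<Sum>i\<in>I. p i x)) (\<lambda>x. D j x + 1 *\<^sub>R (\<Sum>i\<in>I. D i x))"
    by (intro C1_add insert) auto
  then show ?case using insert(1,2) by simp
qed

lemma norm_vec_sq: "(norm (z :: real^'n))\<^sup>2 = (\<Sum>i\<in>UNIV. z $ i * z $ i)"
  by (simp add: power2_norm_eq_inner inner_vec_def)

context borel_on
begin

text \<open>Near-optimal dual fields: approximate the polar density in \<open>L\<^sup>1\<close> by test fields and squash them smoothly into the unit ball.\<close>
lemma polar_density_approx:
  assumes k: "k \<in> borel_measurable lam" "AE x in lam. norm (k x) = 1" and e: "e > 0"
  shows "\<exists>\<phi>. test_field \<omega> \<phi> \<and> (\<forall>x. norm (\<phi> x) \<le> 1) \<and> measure lam \<omega> - e \<le> (LINT x|lam. \<phi> x \<bullet> k x)"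
proof -
  interpret L: finite_measure lam by (rule lam_fin)
  have km: "(\<lambda>x. k x $ i) \<in> borel_measurable lam" for i using k(1) borel_measurable_vec_iff by blast
  have ki: "integrable lam (\<lambda>x. k x $ i)" for i
  proof (rule integrable_bounded[OF lam_fin km])
    show "AE x in lam. norm (k x $ i) \<le> 1" using k(2)
    proof eventually_elim
      case (elim x) then show ?case using component_le_norm_cart[of "k x" i] by simp
    qed
  qed
  have "\<forall>p. \<exists>\<phi>. test_fun \<omega> \<phi> \<and> (LINT x|lam. \<bar>k x $ snd p - \<phi> x\<bar>) \<le> inverse (Suc (fst p))" for p :: "nat \<times> 'n"
    using test_fun_dense_L1[OF ki] by auto
  then have "\<forall>p :: nat \<times> 'n. \<exists>\<phi>. test_fun \<omega> \<phi> \<and> (LINT x|lam. \<bar>k x $ snd p - \<phi> x\<bar>) \<le> inverse (Suc (fst p))" by blast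
  from choice[OF this] obtain \<phi>0 where \<phi>0: "\<forall>p :: nat \<times> 'n. test_fun \<omega> (\<phi>0 p) \<and> (LINT x|lam. \<bar>k x $ snd p - \<phi>0 p x\<bar>) \<le> inverse (Suc (fst p))" by blast
  define \<phi> where "\<phi> j i = \<phi>0 (j, i)" for j i
  have \<phi>: "test_fun \<omega> (\<phi> j i)" "(LINT x|lam. \<bar>k x $ i - \<phi> j i x\<bar>) \<le> inverse (Suc j)" for j i
    using spec[OF \<phi>0, of "(j, i)"] by (auto simp: \<phi>_def)
  define \<Phi> where "\<Phi> j x = (\<chi> i. \<phi> j i x)" for j x
  have \<Phi>i: "\<Phi> j x $ i = \<phi> j i x" for j x i by (simp add: \<Phi>_def)
  have \<Phi>m: "\<Phi> j \<in> borel_measurable lam" for j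
    unfolding borel_measurable_vec_iff \<Phi>i using test_fun_lam(1)[OF \<phi>(1)] by blast
  have idiff: "integrable lam (\<lambda>x. \<bar>k x $ i - \<phi> j i x\<bar>)" for i j using ki test_fun_lam(2)[OF \<phi>(1)] by auto
  have ni: "integrable lam (\<lambda>x. norm (k x - \<Phi> j x))" and nle: "(LINT x|lam. norm (k x - \<Phi> j x)) \<le> CARD('n) * inverse (Suc j)" for j
  proof -
    have le: "norm (k x - \<Phi> j x) \<le> (\<Sum>i\<in>UNIV. \<bar>k x $ i - \<phi> j i x\<bar>)" for x
      using norm_le_l1_cart[of "k x - \<Phi> j x"] by (simp add: \<Phi>i)
    have si: "integrable lam (\<lambda>x. \<Sum>i\<in>UNIV. \<bar>k x $ i - \<phi> j i x\<bar>)" by (intro Bochner_Integration.integrable_sum idiff)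
    show ni: "integrable lam (\<lambda>x. norm (k x - \<Phi> j x))"
    proof (rule Bochner_Integration.integrable_bound[OF si])
      show "(\<lambda>x. norm (k x - \<Phi> j x)) \<in> borel_measurable lam" using k(1) \<Phi>m by measurable
      show "AE x in lam. norm (norm (k x - \<Phi> j x)) \<le> norm (\<Sum>i\<in>UNIV. \<bar>k x $ i - \<phi> j i x\<bar>)"
      proof (rule AE_I2)
        fix x show "norm (norm (k x - \<Phi> j x)) \<le> norm (\<Sum>i\<in>UNIV. \<bar>k x $ i - \<phi> j i x\<bar>)"
          using le[of x] by (simp add: sum_nonneg)
      qed
    qed
    have "(LINT x|lam. norm (k x - \<Phi> j x)) \<le> (LINT x|lam. (\<Sum>i\<in>UNIV. \<bar>k x $ i - \<phi> j i x\<bar>))"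
      by (rule integral_mono[OF ni si le])
    also have "\<dots> = (\<Sum>i\<in>UNIV. LINT x|lam. \<bar>k x $ i - \<phi> j i x\<bar>)" by (rule Bochner_Integration.integral_sum) (rule idiff)
    also have "\<dots> \<le> (\<Sum>i\<in>(UNIV::'n set). inverse (Suc j))" by (intro sum_mono \<phi>(2))
    finally show "(LINT x|lam. norm (k x - \<Phi> j x)) \<le> CARD('n) * inverse (Suc j)" by simp
  qed
  have "\<exists>r. strict_mono r \<and> (AE x in lam. (\<lambda>j. norm (k x - \<Phi> (r j) x)) \<longlonglongrightarrow> 0)"
  proof (rule tendsto_L1_AE_subseq[OF ni])
    have "(\<lambda>j. CARD('n) * inverse (real (Suc j))) \<longlonglongrightarrow> 0"
      by (rule tendsto_mult_right_zero[OF LIMSEQ_inverse_real_of_nat])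
    then show "(\<lambda>j. LINT x|lam. norm (norm (k x - \<Phi> j x))) \<longlonglongrightarrow> 0"
    proof (rule tendsto_sandwich[OF _ _ tendsto_const, rotated 2])
      show "\<forall>\<^sub>F j in sequentially. (LINT x|lam. norm (norm (k x - \<Phi> j x))) \<le> CARD('n) * inverse (real (Suc j))"
        using nle by (intro always_eventually allI) simp
    qed simp
  qed
  then obtain r where r: "AE x in lam. (\<lambda>j. norm (k x - \<Phi> (r j) x)) \<longlonglongrightarrow> 0" by blast
  define m where "m = measure lam \<omega>"
  have m0: "m \<ge> 0" by (simp add: m_def)
  \<comment> \<open>The squashed unit vector has length 1 / sqrt(1 + \<delta>), which is at least 1
    - \<delta>; the loss of mass m \<delta> is then below \<open>e\<close>.\<close>
  define \<delta> where "\<delta> = e / (2 * (m + 1))"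
  have d: "\<delta> > 0" using e m0 by (simp add: \<delta>_def add_nonneg_pos)
  \<comment> \<open>Multiplying z by \<theta>(|z|^2) gives z / sqrt(|z|^2 + \<delta>), a smooth map
    into the unit ball that fixes 0 and hence preserves supports.\<close>
  define \<theta> where "\<theta> s = (s + \<delta>) powr (- (1/2))" for s :: real
  have \<theta>p: "\<theta> s > 0" if "s \<ge> 0" for s using that d by (simp add: \<theta>_def add_nonneg_pos)
  have \<theta>s: "\<theta> s = 1 / sqrt (s + \<delta>)" if "s \<ge> 0" for s
  proof -
    have "0 \<le> s + \<delta>" using that d by simp
    then show ?thesis unfolding \<theta>_def powr_minus by (simp only: powr_half_sqrt inverse_eq_divide)
  qed
  define \<Psi> where "\<Psi> j x = \<theta> ((norm (\<Phi> j x))\<^sup>2) *\<^sub>R \<Phi> j x" for j x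
  have \<Psi>1: "norm (\<Psi> j x) \<le> 1" for j x
  proof -
    define z where "z = norm (\<Phi> j x)"
    have z: "z\<^sup>2 + \<delta> > 0" using d by (simp add: add_nonneg_pos)
    have "z \<le> sqrt (z\<^sup>2 + \<delta>)" using d by (intro real_le_rsqrt) simp
    moreover have "\<theta> (z\<^sup>2) = 1 / sqrt (z\<^sup>2 + \<delta>)" by (rule \<theta>s) simp
    moreover have "sqrt (z\<^sup>2 + \<delta>) > 0" using z by simp
    ultimately have "\<theta> (z\<^sup>2) * z \<le> 1" by simp
    moreover have "norm (\<Psi> j x) = \<theta> (z\<^sup>2) * z" unfolding \<Psi>_def norm_scaleR z_def[symmetric] using \<theta>p[of "z\<^sup>2"] by simp
    ultimately show ?thesis by simp
  qed
  have \<Psi>t: "test_field \<omega> (\<Psi> j)" for j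
    unfolding test_field_def
  proof
    fix i
    have n: "C1 (\<lambda>x. \<delta> + 1 * (\<Sum>l\<in>UNIV. \<phi> j l x * \<phi> j l x)) (\<lambda>x. 0 + 1 *\<^sub>R (\<Sum>l\<in>UNIV. \<phi> j l x *\<^sub>R grad (\<phi> j l) x + \<phi> j l x *\<^sub>R grad (\<phi> j l) x))"
      by (intro C1_add[OF C1_const C1_sum] C1_mult test_funD[OF \<phi>(1)]) simp
    have pos: "\<delta> + 1 * (\<Sum>l\<in>UNIV. \<phi> j l x * \<phi> j l x) > 0" for x using d by (simp add: add_pos_nonneg sum_nonneg)
    have pd: "((\<lambda>s. s powr (- (1/2))) has_real_derivative (- (1/2) * s powr (- (1/2) - 1))) (at s)" if "s > 0" for s :: real
      using that by (auto intro!: derivative_eq_intros)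
    have P: "C1 (\<lambda>x. (\<delta> + 1 * (\<Sum>l\<in>UNIV. \<phi> j l x * \<phi> j l x)) powr (- (1/2)))
       (\<lambda>x. (- (1/2) * (\<delta> + 1 * (\<Sum>l\<in>UNIV. \<phi> j l x * \<phi> j l x)) powr (- (1/2) - 1)) *\<^sub>R (0 + 1 *\<^sub>R (\<Sum>l\<in>UNIV. \<phi> j l x *\<^sub>R grad (\<phi> j l) x + \<phi> j l x *\<^sub>R grad (\<phi> j l) x)))"
      by (rule C1_compose_pos[OF n pos pd]) (auto intro!: continuous_intros)
    have "(\<lambda>x. \<Psi> j x $ i) = (\<lambda>x. \<phi> j i x * (\<delta> + 1 * (\<Sum>l\<in>UNIV. \<phi> j l x * \<phi> j l x)) powr (- (1/2)))"
      by (simp add: \<Psi>_def \<Phi>i \<theta>_def norm_vec_sq fun_eq_iff add.commute mult.commute)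
    then show "test_fun \<omega> (\<lambda>x. \<Psi> j x $ i)" using test_fun_mult_C1(1)[OF \<phi>(1) P] by simp
  qed
  have lim: "(\<lambda>j. LINT x|lam. \<Psi> (r j) x \<bullet> k x) \<longlonglongrightarrow> (LINT x|lam. \<theta> 1)"
  proof (rule integral_dominated_convergence)
    show "integrable lam (\<lambda>x. 1::real)" by simp
    have "(\<lambda>x. \<Psi> j x) \<in> borel_measurable lam" for j
      unfolding borel_measurable_vec_iff
    proof
      fix i show "(\<lambda>x. \<Psi> j x $ i) \<in> borel_measurable lam"
        using \<Psi>t[of j] unfolding test_field_def by (intro test_fun_lam(1)) blast
    qed
    then show "(\<lambda>x. \<Psi> (r j) x \<bullet> k x) \<in> borel_measurable lam" for j using k(1) by (intro borel_measurable_inner)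
    show "AE x in lam. norm (\<Psi> (r j) x \<bullet> k x) \<le> 1" for j
      using k(2)
    proof eventually_elim
      case (elim x)
      have "\<bar>\<Psi> (r j) x \<bullet> k x\<bar> \<le> norm (\<Psi> (r j) x) * norm (k x)" by (rule Cauchy_Schwarz_ineq2)
      also have "\<dots> \<le> 1" using \<Psi>1 elim by simp
      finally show ?case by simp
    qed
    show "AE x in lam. (\<lambda>j. \<Psi> (r j) x \<bullet> k x) \<longlonglongrightarrow> \<theta> 1"
      using r k(2)
    proof eventually_elim
      case (elim x)
      have l: "(\<lambda>j. \<Phi> (r j) x) \<longlonglongrightarrow> k x"
        using elim(1) by (subst tendsto_dist_iff) (simp add: dist_norm norm_minus_commute)
      have "(\<lambda>j. \<theta> ((norm (\<Phi> (r j) x))\<^sup>2)) \<longlonglongrightarrow> \<theta> ((norm (k x))\<^sup>2)"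
        unfolding \<theta>_def using d by (intro tendsto_intros l) (simp add: add_nonneg_eq_0_iff)
      then have "(\<lambda>j. \<Psi> (r j) x \<bullet> k x) \<longlonglongrightarrow> (\<theta> ((norm (k x))\<^sup>2) *\<^sub>R k x) \<bullet> k x"
        unfolding \<Psi>_def by (intro tendsto_intros l)
      moreover have "k x \<bullet> k x = 1" using elim(2) by (simp flip: power2_norm_eq_inner)
      ultimately show ?case using elim(2) by simp
    qed
  qed simp
  have eq: "(LINT x|lam. \<theta> 1) = m * \<theta> 1" by (simp add: m_def lam_space)
  have lt: "m - e < m * \<theta> 1"
  proof -
    have "sqrt (1 + \<delta>) \<le> 1 + \<delta>" using d by (intro real_le_lsqrt) (auto simp: power2_eq_square algebra_simps)
    then have "1 / (1 + \<delta>) \<le> 1 / sqrt (1 + \<delta>)" using d by (intro divide_left_mono) auto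
    moreover have "\<theta> 1 = 1 / sqrt (1 + \<delta>)" by (rule \<theta>s) simp
    moreover have "1 - \<delta> \<le> 1 / (1 + \<delta>)"
    proof -
      have "(1 - \<delta>) * (1 + \<delta>) \<le> 1" by (simp add: algebra_simps)
      then show ?thesis using d by (simp add: pos_le_divide_eq)
    qed
    ultimately have "1 - \<delta> \<le> \<theta> 1" by simp
    from mult_left_mono[OF this m0] have "m - m * \<delta> \<le> m * \<theta> 1" by (simp add: algebra_simps)
    moreover have "m * \<delta> < e"
    proof -
      have "m * \<delta> \<le> (m + 1) * \<delta>" using d by simp
      also have "\<dots> = e / 2"
      proof -
        have half: "g * (a / (2 * g)) = a / 2" if "g > 0" for g a :: real using that by (simp add: field_simps)
        have "m + 1 > 0" using m0 by simp
        then show ?thesis unfolding \<delta>_def by (rule half)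
      qed
      also have "\<dots> < e" using e by simp
      finally show ?thesis .
    qed
    ultimately show ?thesis by simp
  qed
  have "\<forall>\<^sub>F j in sequentially. m - e < (LINT x|lam. \<Psi> (r j) x \<bullet> k x)"
    by (rule order_tendstoD(1)[OF lim[unfolded eq] lt])
  from eventually_happens'[OF sequentially_bot this] obtain j where "m - e < (LINT x|lam. \<Psi> (r j) x \<bullet> k x)" by blast
  then show ?thesis using \<Psi>t \<Psi>1 by (intro exI[of _ "\<Psi> (r j)"]) (auto simp: m_def)
qed

end

section \<open>The total variation equals the mass of any polar representation of the
  gradient\<close>

lemma vmeas_borel_on: "open \<omega> \<Longrightarrow> vmeas_on \<omega> lam k \<Longrightarrow> borel_on \<omega> lam"
  by (simp add: vmeas_on_def borel_on_def)

lemma pairing_le_mass: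
  assumes o: "open \<omega>" and v: "vmeas_on \<omega> lam k" and z: "\<And>x. x \<in> \<omega> \<Longrightarrow> norm (z x) \<le> 1"
  shows "(LINT x|lam. z x \<bullet> k x) \<le> measure lam \<omega>"
proof -
  interpret borel_on \<omega> lam by (rule vmeas_borel_on[OF o v])
  interpret L: finite_measure lam by (rule lam_fin)
  show ?thesis
  proof (cases "integrable lam (\<lambda>x. z x \<bullet> k x)")
    case True
    have "AE x in lam. norm (k x) = 1" using v by (simp add: vmeas_on_def)
    moreover have "AE x in lam. x \<in> \<omega>" by (rule AE_I2) (simp add: lam_space)
    ultimately have "AE x in lam. z x \<bullet> k x \<le> 1"
    proof eventually_elim
      case (elim x)
      have "z x \<bullet> k x \<le> norm (z x) * norm (k x)" by (rule norm_cauchy_schwarz)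
      then show ?case using z[OF elim(2)] elim(1) by simp
    qed
    then have "(LINT x|lam. z x \<bullet> k x) \<le> (LINT x|lam. 1)" using True by (intro integral_mono_AE) auto
    then show ?thesis by (simp add: lam_space)
  next
    case False
    \<comment> \<open>The integral of a function that is not integrable is 0 by convention, which is
      below the mass.\<close>
    then show ?thesis by (simp add: not_integrable_integral_eq)
  qed
qed

lemma test_field_C0:
  assumes o: "open \<omega>" and t: "test_field \<omega> \<phi>" shows "C0 \<omega> \<phi>"
proof -
  have ti: "test_fun \<omega> (\<lambda>x. \<phi> x $ i)" for i using t by (simp add: test_field_def)
  have "continuous_on (closure \<omega>) (\<lambda>x. \<chi> i. \<phi> x $ i)" by (intro continuous_on_vec_lambda test_fun_continuous[OF ti])
  moreover have "\<phi> x = 0" if "x \<in> frontier \<omega>" for x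
  proof -
    have "x \<notin> \<omega>" using that o by (simp add: frontier_def interior_open)
    then show ?thesis using test_fun_outside(1)[OF ti] by (simp add: vec_eq_iff)
  qed
  ultimately show ?thesis by (simp add: C0_def)
qed

text \<open>Cauchy-Schwarz bounds every pairing by the mass, and the near-optimal test fields of
  \<open>polar_density_approx\<close> belong to \<open>C0\<close>, so they approach it.\<close>

lemma mnorm_eq_mass:
  assumes o: "open \<omega>" and v: "vmeas_on \<omega> lam k"
  shows "mnorm \<omega> lam k = measure lam \<omega>"
proof -
  interpret borel_on \<omega> lam by (rule vmeas_borel_on[OF o v])
  let ?S = "{LINT x|lam. z x \<bullet> k x | z. C0 \<omega> z \<and> (\<forall>x\<in>closure \<omega>. norm (z x) \<le> 1)}"
  have ub: "s \<le> measure lam \<omega>" if "s \<in> ?S" for s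
    using that closure_subset[of \<omega>] by (auto intro!: pairing_le_mass[OF o v])
  have "measure lam \<omega> \<le> Sup ?S"
  proof (rule field_le_epsilon)
    fix e :: real assume "e > 0"
    then obtain \<phi> where \<phi>: "test_field \<omega> \<phi>" "\<forall>x. norm (\<phi> x) \<le> 1" "measure lam \<omega> - e \<le> (LINT x|lam. \<phi> x \<bullet> k x)"
      using polar_density_approx[of k e] v by (auto simp: vmeas_on_def)
    have "(LINT x|lam. \<phi> x \<bullet> k x) \<in> ?S" using test_field_C0[OF o \<phi>(1)] \<phi>(2) by blast
    then have "(LINT x|lam. \<phi> x \<bullet> k x) \<le> Sup ?S" using ub by (intro cSup_upper bdd_aboveI)
    with \<phi>(3) show "measure lam \<omega> \<le> Sup ?S + e" by simp
  qed
  moreover have "Sup ?S \<le> measure lam \<omega>"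
  proof (rule cSup_least[OF _ ub])
    have "C0 \<omega> (\<lambda>x. 0)" by (simp add: C0_def)
    then show "?S \<noteq> {}" by force
  qed
  ultimately show ?thesis by (simp add: mnorm_def)
qed

text \<open>Pairings with test fields depend on \<open>u\<close> alone, so a near-optimal field for
  one representation also tests the other.\<close>

lemma mass_unique:
  assumes o: "open \<omega>" and r: "grad_rep \<omega> u lam k" "grad_rep \<omega> u lam' k'"
  shows "measure lam \<omega> \<le> measure lam' \<omega>"
proof (rule field_le_epsilon)
  fix e :: real assume e: "e > 0"
  have v: "vmeas_on \<omega> lam k" "vmeas_on \<omega> lam' k'" using r by (auto simp: grad_rep_def)
  interpret borel_on \<omega> lam by (rule vmeas_borel_on[OF o v(1)])
  obtain \<phi> where \<phi>: "test_field \<omega> \<phi>" "\<forall>x. norm (\<phi> x) \<le> 1" "measure lam \<omega> - e \<le> (LINT x|lam. \<phi> x \<bullet> k x)"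
    using polar_density_approx[of k e] v e by (auto simp: vmeas_on_def)
  have "(LINT x|lam. \<phi> x \<bullet> k x) = (LINT x|lam'. \<phi> x \<bullet> k' x)" using r \<phi>(1) by (simp add: grad_rep_def)
  also have "\<dots> \<le> measure lam' \<omega>" using \<phi>(2) by (intro pairing_le_mass[OF o v(2)]) simp
  finally show "measure lam \<omega> \<le> measure lam' \<omega> + e" using \<phi>(3) by simp
qed

text \<open>Resolves the choice in \<open>TV\<close>: by \<open>mass_unique\<close> in both
  directions every representation yields the same number.\<close>

theorem TV_eq_mass:
  assumes o: "open \<omega>" and r: "grad_rep \<omega> u lam k"
  shows "TV \<omega> u = measure lam \<omega>"
  unfolding TV_def
proof (rule some_equality)
  have m: "mnorm \<omega> lam k = measure lam \<omega>" using r by (intro mnorm_eq_mass[OF o]) (simp add: grad_rep_def)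
  then show "\<exists>lam' k'. grad_rep \<omega> u lam' k' \<and> measure lam \<omega> = mnorm \<omega> lam' k'" using r by metis
  fix t assume "\<exists>lam' k'. grad_rep \<omega> u lam' k' \<and> t = mnorm \<omega> lam' k'"
  then obtain lam' k' where l: "grad_rep \<omega> u lam' k'" "t = mnorm \<omega> lam' k'" by blast
  have "mnorm \<omega> lam' k' = measure lam' \<omega>" using l by (intro mnorm_eq_mass[OF o]) (simp add: grad_rep_def)
  then show "t = measure lam \<omega>" using mass_unique[OF o r l(1)] mass_unique[OF o l(1) r] l(2) by simp
qed

text \<open>Assembles the absolutely continuous and the singular part of a gradient measure into one
  measure.\<close>

definition madd :: "'a measure \<Rightarrow> 'a measure \<Rightarrow> 'a measure" where
  "madd A B = measure_of (space A) (sets A) (\<lambda>S. emeasure A S + emeasure B S)"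

context
  fixes A B :: "'a measure"
  assumes sAB: "sets A = sets B"
begin

lemma sets_madd: "sets (madd A B) = sets A" by (simp add: madd_def)
lemma space_madd: "space (madd A B) = space A" by (simp add: madd_def)

lemma emeasure_madd:
  assumes S: "S \<in> sets A" shows "emeasure (madd A B) S = emeasure A S + emeasure B S"
proof (rule emeasure_measure_of[OF madd_def])
  show "positive (sets (madd A B)) (\<lambda>S. emeasure A S + emeasure B S)" by (simp add: positive_def)
  show "countably_additive (sets (madd A B)) (\<lambda>S. emeasure A S + emeasure B S)"
  proof (rule countably_additiveI)
    fix F :: "nat \<Rightarrow> 'a set"
    assume F: "range F \<subseteq> sets (madd A B)" "disjoint_family F"
    then have "range F \<subseteq> sets A" "range F \<subseteq> sets B" using sAB by (auto simp: sets_madd)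
    then show "(\<Sum>i. emeasure A (F i) + emeasure B (F i)) = emeasure A (\<Union> (range F)) + emeasure B (\<Union> (range F))"
      using F(2) by (simp add: suminf_add[symmetric] suminf_emeasure)
  qed
qed (use S sets.space_closed in \<open>auto simp: sets_madd\<close>)

text \<open>The exceptional points lie in both null sets, and their intersection is null for either
  measure.\<close>

lemma AE_madd:
  assumes "AE x in A. P x" "AE x in B. P x" shows "AE x in madd A B. P x"
proof -
  obtain N1 where N1: "{x \<in> space A. \<not> P x} \<subseteq> N1" "N1 \<in> sets A" "emeasure A N1 = 0" using assms(1) by (rule AE_E) (rule that)
  obtain N2 where N2: "{x \<in> space B. \<not> P x} \<subseteq> N2" "N2 \<in> sets B" "emeasure B N2 = 0" using assms(2) by (rule AE_E) (rule that)
  have sp: "space A = space B" by (rule sets_eq_imp_space_eq[OF sAB])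
  have N: "N1 \<inter> N2 \<in> sets A" using N1(2) N2(2) sAB by auto
  have "emeasure A (N1 \<inter> N2) \<le> emeasure A N1" using N1(2) by (intro emeasure_mono) auto
  moreover have "emeasure B (N1 \<inter> N2) \<le> emeasure B N2" using N2(2) by (intro emeasure_mono) auto
  ultimately have "emeasure (madd A B) (N1 \<inter> N2) = 0" using N1(3) N2(3) by (simp add: emeasure_madd[OF N])
  then show ?thesis using N N1(1) N2(1) sp by (intro AE_I[of _ _ "N1 \<inter> N2"]) (auto simp: sets_madd space_madd)
qed

lemma nn_integral_madd:
  assumes "f \<in> borel_measurable A"
  shows "(\<integral>\<^sup>+x. f x \<partial>madd A B) = (\<integral>\<^sup>+x. f x \<partial>A) + (\<integral>\<^sup>+x. f x \<partial>B)"
  using assms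
proof (induction rule: borel_measurable_induct)
  case (cong f g)
  have sp: "space A = space B" by (rule sets_eq_imp_space_eq[OF sAB])
  have "(\<integral>\<^sup>+x. f x \<partial>madd A B) = (\<integral>\<^sup>+x. g x \<partial>madd A B)" "(\<integral>\<^sup>+x. f x \<partial>A) = (\<integral>\<^sup>+x. g x \<partial>A)" "(\<integral>\<^sup>+x. f x \<partial>B) = (\<integral>\<^sup>+x. g x \<partial>B)"
    using cong(3) sp by (auto intro!: nn_integral_cong simp: space_madd)
  with cong(4) show ?case by simp
next
  case (set S)
  then show ?case using sAB by (simp add: emeasure_madd sets_madd)
next
  case (mult u c)
  have "u \<in> borel_measurable (madd A B)" "u \<in> borel_measurable B" using mult(2) sAB by (auto simp: sets_madd cong: measurable_cong_sets)
  with mult show ?case by (simp add: nn_integral_cmult distrib_left)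
next
  case (add u v)
  have "u \<in> borel_measurable (madd A B)" "u \<in> borel_measurable B" "v \<in> borel_measurable (madd A B)" "v \<in> borel_measurable B"
  proof -
    have "u \<in> borel_measurable A" "v \<in> borel_measurable A" using add by auto
    then show "u \<in> borel_measurable (madd A B)" "u \<in> borel_measurable B" "v \<in> borel_measurable (madd A B)" "v \<in> borel_measurable B"
      using sAB by (auto simp: sets_madd cong: measurable_cong_sets)
  qed
  with add show ?case by (simp add: nn_integral_add ac_simps)
next
  case (seq U)
  have m: "U i \<in> borel_measurable (madd A B)" "U i \<in> borel_measurable B" for i using seq.hyps(1) sAB by (auto simp: sets_madd cong: measurable_cong_sets)
  have inc: "incseq (\<lambda>i. \<integral>\<^sup>+x. U i x \<partial>A)" "incseq (\<lambda>i. \<integral>\<^sup>+x. U i x \<partial>B)"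
    using seq.hyps(3) by (auto simp: incseq_def le_fun_def intro!: nn_integral_mono)
  have "(\<integral>\<^sup>+x. Sup (range U) x \<partial>madd A B) = (SUP i. \<integral>\<^sup>+x. U i x \<partial>madd A B)"
    using nn_integral_monotone_convergence_SUP[OF seq.hyps(3) m(1)] by (simp add: image_comp)
  also have "\<dots> = (SUP i. (\<integral>\<^sup>+x. U i x \<partial>A) + (\<integral>\<^sup>+x. U i x \<partial>B))" using seq.IH by simp
  also have "\<dots> = (SUP i. \<integral>\<^sup>+x. U i x \<partial>A) + (SUP i. \<integral>\<^sup>+x. U i x \<partial>B)"
    by (rule ennreal_SUP_add[OF inc])
  also have "(SUP i. \<integral>\<^sup>+x. U i x \<partial>A) = (\<integral>\<^sup>+x. Sup (range U) x \<partial>A)"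
    using nn_integral_monotone_convergence_SUP[OF seq.hyps(3) seq.hyps(1)] by (simp add: image_comp)
  also have "(SUP i. \<integral>\<^sup>+x. U i x \<partial>B) = (\<integral>\<^sup>+x. Sup (range U) x \<partial>B)"
    using nn_integral_monotone_convergence_SUP[OF seq.hyps(3) m(2)] by (simp add: image_comp)
  finally show ?case by simp
qed

lemma integral_madd:
  fixes g :: "'a \<Rightarrow> real"
  assumes i: "integrable A g" "integrable B g"
  shows "(LINT x|madd A B. g x) = (LINT x|A. g x) + (LINT x|B. g x)"
proof -
  have gm: "g \<in> borel_measurable A" using i by simp
  have gm': "g \<in> borel_measurable (madd A B)" using gm by (simp add: sets_madd cong: measurable_cong_sets)
  have nn: "(\<integral>\<^sup>+x. ennreal (norm (g x)) \<partial>madd A B) = (\<integral>\<^sup>+x. ennreal (norm (g x)) \<partial>A) + (\<integral>\<^sup>+x. ennreal (norm (g x)) \<partial>B)"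
    using gm by (intro nn_integral_madd) simp
  have im: "integrable (madd A B) g"
    using i gm' unfolding integrable_iff_bounded nn by (simp add: less_top[symmetric])
  have fin: "(\<integral>\<^sup>+x. ennreal (g x) \<partial>A) < \<infinity>" "(\<integral>\<^sup>+x. ennreal (g x) \<partial>B) < \<infinity>" "(\<integral>\<^sup>+x. ennreal (- g x) \<partial>A) < \<infinity>" "(\<integral>\<^sup>+x. ennreal (- g x) \<partial>B) < \<infinity>"
    using i unfolding real_integrable_def by (auto simp: less_top)
  have "(\<integral>\<^sup>+x. ennreal (g x) \<partial>madd A B) = (\<integral>\<^sup>+x. ennreal (g x) \<partial>A) + (\<integral>\<^sup>+x. ennreal (g x) \<partial>B)"
    "(\<integral>\<^sup>+x. ennreal (- g x) \<partial>madd A B) = (\<integral>\<^sup>+x. ennreal (- g x) \<partial>A) + (\<integral>\<^sup>+x. ennreal (- g x) \<partial>B)"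
    using gm by (auto intro!: nn_integral_madd)
  then show ?thesis
    using fin unfolding real_lebesgue_integral_def[OF im] real_lebesgue_integral_def[OF i(1)] real_lebesgue_integral_def[OF i(2)]
    by (simp add: enn2real_plus)
qed

end

section \<open>Second-order necessary condition\<close>

lemma test_field_measurable:
  assumes t: "test_field \<omega> \<phi>" shows "\<phi> \<in> borel_measurable borel" "\<exists>b>0. \<forall>x. norm (\<phi> x) \<le> b"
    "divg \<phi> \<in> borel_measurable borel" "\<exists>b. \<forall>x. \<bar>divg \<phi> x\<bar> \<le> b"
proof -
  have ti: "test_fun \<omega> (\<lambda>x. \<phi> x $ i)" for i using t by (simp add: test_field_def)
  show m: "\<phi> \<in> borel_measurable borel" unfolding borel_measurable_vec_iff using test_fun_borel[OF ti] by blast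
  have "\<forall>i. \<exists>b>0. \<forall>x. \<bar>\<phi> x $ i\<bar> \<le> b \<and> norm (grad (\<lambda>x. \<phi> x $ i) x) \<le> b" using test_fun_bounded[OF ti] by blast
  from choice[OF this] obtain b where b: "\<And>i. b i > 0" "\<And>i x. \<bar>\<phi> x $ i\<bar> \<le> b i" "\<And>i x. norm (grad (\<lambda>x. \<phi> x $ i) x) \<le> b i" by blast
  have "norm (\<phi> x) \<le> sum b UNIV" for x
    using norm_le_l1_cart[of "\<phi> x"] sum_mono[of UNIV "\<lambda>i. \<bar>\<phi> x $ i\<bar>" b] b(2) by (meson order_trans)
  moreover have "sum b UNIV > 0" using b(1) by (intro sum_pos) auto
  ultimately show "\<exists>b>0. \<forall>x. norm (\<phi> x) \<le> b" by blast
  have g: "(\<lambda>x. grad (\<lambda>y. \<phi> y $ i) x $ i) \<in> borel_measurable borel" for i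
    using test_fun_grad_borel[OF ti] borel_measurable_vec_iff by blast
  show "divg \<phi> \<in> borel_measurable borel" unfolding divg_def[abs_def] by (intro borel_measurable_sum g)
  have "\<bar>divg \<phi> x\<bar> \<le> sum b UNIV" for x
  proof -
    have "\<bar>divg \<phi> x\<bar> \<le> (\<Sum>i\<in>UNIV. \<bar>grad (\<lambda>y. \<phi> y $ i) x $ i\<bar>)" unfolding divg_def by (rule sum_abs)
    also have "\<dots> \<le> sum b UNIV" by (intro sum_mono order_trans[OF component_le_norm_cart b(3)])
    finally show ?thesis .
  qed
  then show "\<exists>b. \<forall>x. \<bar>divg \<phi> x\<bar> \<le> b" by blast
qed

lemma integrable_mult_divg:
  assumes "bdd_dom \<omega>" "integrable (lebesgue_on \<omega>) u" "test_field \<omega> \<phi>"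
  shows "integrable (lebesgue_on \<omega>) (\<lambda>x. u x * divg \<phi> x)"
proof -
  interpret bdd_dom \<omega> by fact
  obtain b where "\<And>x. \<bar>divg \<phi> x\<bar> \<le> b" using test_field_measurable(4)[OF assms(3)] by blast
  then show ?thesis
    by (intro integrable_mult_bounded[OF assms(2) borel_M[OF test_field_measurable(3)[OF assms(3)]], of b]) auto
qed

lemma integrable_field_inner:
  fixes H :: "real^'n \<Rightarrow> real^'n"
  assumes b: "borel_on \<omega> lam" and t: "test_field \<omega> \<phi>" and H: "integrable lam H"
  shows "integrable lam (\<lambda>x. \<phi> x \<bullet> H x)"
proof -
  interpret borel_on \<omega> lam by (rule b)
  obtain c where c: "c > 0" "\<And>x. norm (\<phi> x) \<le> c" using test_field_measurable(2)[OF t] by blast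
  show ?thesis
  proof (rule Bochner_Integration.integrable_bound)
    show "integrable lam (\<lambda>x. c * norm (H x))" using H by simp
    show "(\<lambda>x. \<phi> x \<bullet> H x) \<in> borel_measurable lam"
      using borel_lam[OF test_field_measurable(1)[OF t]] H by (intro borel_measurable_inner) auto
    show "AE x in lam. norm (\<phi> x \<bullet> H x) \<le> norm (c * norm (H x))"
    proof (rule AE_I2)
      fix x
      have "\<bar>\<phi> x \<bullet> H x\<bar> \<le> norm (\<phi> x) * norm (H x)" by (rule Cauchy_Schwarz_ineq2)
      also have "\<dots> \<le> c * norm (H x)" using c(2) by (intro mult_right_mono) auto
      finally show "norm (\<phi> x \<bullet> H x) \<le> norm (c * norm (H x))" using c(1) by simp
    qed
  qed
qed

lemma polar_integrable:
  assumes v: "vmeas_on \<omega> lam k" shows "integrable lam k"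
proof -
  have k: "k \<in> borel_measurable lam" "AE x in lam. norm (k x) = 1" "finite_measure lam" using v by (auto simp: vmeas_on_def)
  show ?thesis by (rule integrable_bounded[OF k(3,1), of 1]) (use k(2) in \<open>elim eventually_mono, simp\<close>)
qed

text \<open>The gradient measure of \<open>u + \<rho> v\<close>: absolutely continuous part with density \<open>h\<^sub>b + \<rho> h\<close>
  off the null set \<open>N\<close>, plus the singular part carried by \<open>N\<close>.\<close>
lemma grad_rep_line:
  fixes \<omega> :: "(real^'n) set"
  assumes o: "open \<omega>" "bounded \<omega>" and rb: "grad_rep \<omega> ub lamb hb" and iu: "integrable (lebesgue_on \<omega>) ub" "integrable (lebesgue_on \<omega>) v"
    and h: "h \<in> borel_measurable lamb" "integrable lamb h" and vs: "vmeas_on \<omega> lams ks"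
    and N: "N \<in> sets lamb" "emeasure lamb N = 0" "emeasure lams (\<omega> - N) = 0"
    and rv: "\<And>\<phi>. test_field \<omega> \<phi> \<Longrightarrow> (LINT x|lebesgue_on \<omega>. v x * divg \<phi> x) = - ((LINT x|lamb. \<phi> x \<bullet> h x) + (LINT x|lams. \<phi> x \<bullet> ks x))"
    and \<rho>: "\<rho> > 0"
  shows "\<exists>\<mu> \<kappa>. grad_rep \<omega> (\<lambda>x. ub x + \<rho> * v x) \<mu> \<kappa> \<and> measure \<mu> \<omega> = (LINT x|lamb. norm (hb x + \<rho> *\<^sub>R h x)) + \<rho> * measure lams \<omega>"
proof -
  have vb: "vmeas_on \<omega> lamb hb" using rb by (simp add: grad_rep_def)
  interpret b: borel_on \<omega> lamb by (rule vmeas_borel_on[OF o(1) vb])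
  interpret s: borel_on \<omega> lams by (rule vmeas_borel_on[OF o(1) vs])
  interpret D: bdd_dom \<omega> by unfold_locales (use o in auto)
  interpret lb: finite_measure lamb by (rule b.lam_fin)
  interpret ls: finite_measure lams by (rule s.lam_fin)
  have sbs: "sets lams = sets lamb" using b.lam_sets s.lam_sets by simp
  have hbm: "hb \<in> borel_measurable lamb" and ksm: "ks \<in> borel_measurable lams" and ks1: "AE x in lams. norm (ks x) = 1"
    using vb vs by (auto simp: vmeas_on_def)
  define H where "H x = hb x + \<rho> *\<^sub>R h x" for x
  have Hm: "H \<in> borel_measurable lamb" unfolding H_def[abs_def] by (intro borel_measurable_add borel_measurable_scaleR borel_measurable_const hbm h)
  have Hi: "integrable lamb H" unfolding H_def[abs_def] using polar_integrable[OF vb] h(2) by simp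
  \<comment> \<open>A polar representation needs a positive measure and a unit density, so the
    length of \<open>H\<close> goes into the measure and its direction into
    \<open>\<kappa>\<close>.\<close>
  define A where "A = density lamb (\<lambda>x. ennreal (norm (H x)))"
  define B where "B = density lams (\<lambda>x. ennreal \<rho>)"
  have sAB: "sets A = sets B" by (simp add: A_def B_def sbs)
  have sA: "sets A = sets lamb" by (simp add: A_def)
  define \<mu> where "\<mu> = madd A B"
  \<comment> \<open>\<open>N\<close> separates the two parts: it is null for \<open>lamb\<close> and
    carries \<open>lams\<close>, so the two branches never compete.\<close>
  define \<kappa> where "\<kappa> x = (if x \<in> N then ks x else (1 / norm (H x)) *\<^sub>R H x)" for x
  have \<kappa>m: "\<kappa> \<in> borel_measurable lamb"
    unfolding \<kappa>_def[abs_def]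
  proof (rule measurable_If_set)
    show "ks \<in> borel_measurable lamb" using ksm sbs by (simp cong: measurable_cong_sets)
    show "(\<lambda>x. (1 / norm (H x)) *\<^sub>R H x) \<in> borel_measurable lamb" using Hm by measurable
    show "N \<inter> space lamb \<in> sets lamb" using N(1) by auto
  qed
  have \<kappa>ms: "\<kappa> \<in> borel_measurable lams" using \<kappa>m sbs by (simp cong: measurable_cong_sets)
  have Nb: "AE x in lamb. x \<notin> N" by (rule AE_not_in) (use N in auto)
  have Ns: "AE x in lams. x \<in> N"
  proof (rule AE_I[of _ _ "\<omega> - N"])
    show "{x \<in> space lams. x \<notin> N} \<subseteq> \<omega> - N" by (auto simp: s.lam_space)
    show "\<omega> - N \<in> sets lams" using N(1) sbs sets.top[of lamb] b.lam_space by (auto intro: sets.Diff)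
  qed (rule N(3))
  have \<kappa>b: "AE x in lamb. norm (H x) *\<^sub>R \<kappa> x = H x"
    using Nb by eventually_elim (simp add: \<kappa>_def)
  have \<kappa>s: "AE x in lams. \<kappa> x = ks x" using Ns by eventually_elim (simp add: \<kappa>_def)
  have nHm: "(\<lambda>x. ennreal (norm (H x))) \<in> borel_measurable lamb" using Hm by measurable
  \<comment> \<open>Where \<open>H\<close> vanishes \<open>\<kappa>\<close> is not a unit vector,
    but those points have density 0 with respect to \<open>lamb\<close> and form a null set of
    \<open>A\<close>.\<close>
  have "AE x in A. norm (\<kappa> x) = 1"
    unfolding A_def AE_density[OF nHm] using Nb by eventually_elim (auto simp: \<kappa>_def)
  moreover have "AE x in B. norm (\<kappa> x) = 1"
    unfolding B_def using ks1 \<kappa>s by (subst AE_density) (auto elim: eventually_elim2)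
  ultimately have \<kappa>1: "AE x in \<mu>. norm (\<kappa> x) = 1" unfolding \<mu>_def by (rule AE_madd[OF sAB])
  have spA: "space A = \<omega>" by (simp add: A_def b.lam_space)
  have top: "\<omega> \<in> sets A" using sets.top[of A] spA by simp
  have eA: "emeasure A \<omega> = ennreal (LINT x|lamb. norm (H x))"
  proof -
    have "emeasure A \<omega> = (\<integral>\<^sup>+x. ennreal (norm (H x)) * indicator \<omega> x \<partial>lamb)"
      using top unfolding A_def by (intro emeasure_density nHm) simp
    also have "\<dots> = (\<integral>\<^sup>+x. ennreal (norm (H x)) \<partial>lamb)" by (intro nn_integral_cong) (simp add: b.lam_space)
    also have "\<dots> = ennreal (LINT x|lamb. norm (H x))" using Hi by (intro nn_integral_eq_integral) auto
    finally show ?thesis .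
  qed
  have eB: "emeasure B \<omega> = ennreal (\<rho> * measure lams \<omega>)"
  proof -
    have "\<omega> \<in> sets lams" using top sA sbs by simp
    then have "emeasure B \<omega> = ennreal \<rho> * emeasure lams \<omega>"
      unfolding B_def by (subst emeasure_density) (auto simp: nn_integral_cmult_indicator)
    then show ?thesis using \<rho> by (simp add: ls.emeasure_eq_measure ennreal_mult)
  qed
  have e\<mu>: "emeasure \<mu> \<omega> = ennreal ((LINT x|lamb. norm (H x)) + \<rho> * measure lams \<omega>)"
    unfolding \<mu>_def emeasure_madd[OF sAB top] eA eB using \<rho> by (intro ennreal_plus[symmetric]) auto
  have mass: "measure \<mu> \<omega> = (LINT x|lamb. norm (H x)) + \<rho> * measure lams \<omega>"
    unfolding measure_def e\<mu> by (rule enn2real_ennreal) (use \<rho> in auto)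
  have vm: "vmeas_on \<omega> \<mu> \<kappa>"
    unfolding vmeas_on_def
  proof (intro conjI)
    show "sets \<mu> = sets (restrict_space borel \<omega>)" by (simp add: \<mu>_def sets_madd[OF sAB] sA b.lam_sets)
    show "finite_measure \<mu>"
      by (rule finite_measureI) (simp add: \<mu>_def space_madd[OF sAB] spA e\<mu>[unfolded \<mu>_def])
    show "\<kappa> \<in> borel_measurable \<mu>" using \<kappa>m by (simp add: \<mu>_def sets_madd[OF sAB] sA cong: measurable_cong_sets)
  qed (rule \<kappa>1)
  have "grad_rep \<omega> (\<lambda>x. ub x + \<rho> * v x) \<mu> \<kappa>"
    unfolding grad_rep_def
  proof (intro conjI allI impI vm)
    fix \<phi> assume t: "test_field \<omega> \<phi>"
    have pm: "\<phi> \<in> borel_measurable lamb" "\<phi> \<in> borel_measurable lams"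
      using b.borel_lam s.borel_lam test_field_measurable(1)[OF t] by auto
    have iH: "integrable lamb (\<lambda>x. \<phi> x \<bullet> H x)" by (rule integrable_field_inner[OF b.borel_on_axioms t Hi])
    have m1: "(\<lambda>x. \<phi> x \<bullet> \<kappa> x) \<in> borel_measurable lamb" "(\<lambda>x. \<phi> x \<bullet> \<kappa> x) \<in> borel_measurable lams"
      by (intro borel_measurable_inner pm \<kappa>m \<kappa>ms)+
    have nm: "(\<lambda>x. norm (H x)) \<in> borel_measurable lamb" using Hm by measurable
    have aeH: "AE x in lamb. norm (H x) *\<^sub>R (\<phi> x \<bullet> \<kappa> x) = \<phi> x \<bullet> H x"
      using \<kappa>b by eventually_elim (metis inner_scaleR_right real_scaleR_def)
    have m2: "(\<lambda>x. norm (H x) *\<^sub>R (\<phi> x \<bullet> \<kappa> x)) \<in> borel_measurable lamb" by (intro borel_measurable_scaleR nm m1)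
    have m3: "(\<lambda>x. \<phi> x \<bullet> H x) \<in> borel_measurable lamb" by (intro borel_measurable_inner pm Hm)
    have iA': "integrable lamb (\<lambda>x. norm (H x) *\<^sub>R (\<phi> x \<bullet> \<kappa> x))"
      by (rule integrable_cong_AE_imp[OF iH m2]) (use aeH in \<open>elim eventually_mono, simp\<close>)
    have iA: "integrable A (\<lambda>x. \<phi> x \<bullet> \<kappa> x)"
      unfolding A_def by (subst integrable_density[OF m1(1) nm]) (use iA' in auto)
    have lA: "(LINT x|A. \<phi> x \<bullet> \<kappa> x) = (LINT x|lamb. \<phi> x \<bullet> H x)"
    proof -
      have "(LINT x|A. \<phi> x \<bullet> \<kappa> x) = (LINT x|lamb. norm (H x) *\<^sub>R (\<phi> x \<bullet> \<kappa> x))"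
        unfolding A_def by (rule integral_density[OF m1(1) nm]) simp
      also have "\<dots> = (LINT x|lamb. \<phi> x \<bullet> H x)" by (rule integral_cong_AE[OF m2 m3 aeH])
      finally show ?thesis .
    qed
    have iks: "integrable lams (\<lambda>x. \<phi> x \<bullet> ks x)" by (rule integrable_field_inner[OF s.borel_on_axioms t polar_integrable[OF vs]])
    have aes: "AE x in lams. \<phi> x \<bullet> \<kappa> x = \<phi> x \<bullet> ks x" using \<kappa>s by eventually_elim simp
    have m4: "(\<lambda>x. \<phi> x \<bullet> ks x) \<in> borel_measurable lams" by (intro borel_measurable_inner pm ksm)
    have iks': "integrable lams (\<lambda>x. \<phi> x \<bullet> \<kappa> x)"
      by (rule integrable_cong_AE_imp[OF iks m1(2)]) (use aes in \<open>elim eventually_mono, simp\<close>)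
    have iB: "integrable B (\<lambda>x. \<phi> x \<bullet> \<kappa> x)"
      unfolding B_def by (subst integrable_density[OF m1(2)]) (use iks' \<rho> in auto)
    have lB: "(LINT x|B. \<phi> x \<bullet> \<kappa> x) = \<rho> * (LINT x|lams. \<phi> x \<bullet> ks x)"
    proof -
      have "(LINT x|B. \<phi> x \<bullet> \<kappa> x) = (LINT x|lams. \<rho> *\<^sub>R (\<phi> x \<bullet> \<kappa> x))"
        unfolding B_def by (rule integral_density[OF m1(2)]) (use \<rho> in auto)
      also have "\<dots> = \<rho> * (LINT x|lams. \<phi> x \<bullet> \<kappa> x)" by simp
      also have "(LINT x|lams. \<phi> x \<bullet> \<kappa> x) = (LINT x|lams. \<phi> x \<bullet> ks x)" by (rule integral_cong_AE[OF m1(2) m4 aes])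
      finally show ?thesis .
    qed
    have ihb: "integrable lamb (\<lambda>x. \<phi> x \<bullet> hb x)" by (rule integrable_field_inner[OF b.borel_on_axioms t polar_integrable[OF vb]])
    have ih: "integrable lamb (\<lambda>x. \<phi> x \<bullet> h x)" by (rule integrable_field_inner[OF b.borel_on_axioms t h(2)])
    have "(LINT x|\<mu>. \<phi> x \<bullet> \<kappa> x) = (LINT x|lamb. \<phi> x \<bullet> H x) + \<rho> * (LINT x|lams. \<phi> x \<bullet> ks x)"
      unfolding \<mu>_def integral_madd[OF sAB iA iB] lA lB ..
    also have "(LINT x|lamb. \<phi> x \<bullet> H x) = (LINT x|lamb. \<phi> x \<bullet> hb x) + \<rho> * (LINT x|lamb. \<phi> x \<bullet> h x)"
      using ihb ih by (simp add: H_def inner_add_right)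
    finally have R: "(LINT x|\<mu>. \<phi> x \<bullet> \<kappa> x) = (LINT x|lamb. \<phi> x \<bullet> hb x) + \<rho> * (LINT x|lamb. \<phi> x \<bullet> h x) + \<rho> * (LINT x|lams. \<phi> x \<bullet> ks x)" .
    have "(LINT x|lebesgue_on \<omega>. (ub x + \<rho> * v x) * divg \<phi> x) = (LINT x|lebesgue_on \<omega>. ub x * divg \<phi> x) + \<rho> * (LINT x|lebesgue_on \<omega>. v x * divg \<phi> x)"
      using integrable_mult_divg[OF D.bdd_dom_axioms iu(1) t] integrable_mult_divg[OF D.bdd_dom_axioms iu(2) t] by (simp add: distrib_right mult.assoc)
    also have "(LINT x|lebesgue_on \<omega>. ub x * divg \<phi> x) = - (LINT x|lamb. \<phi> x \<bullet> hb x)" using rb t by (simp add: grad_rep_def)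
    also have "(LINT x|lebesgue_on \<omega>. v x * divg \<phi> x) = - ((LINT x|lamb. \<phi> x \<bullet> h x) + (LINT x|lams. \<phi> x \<bullet> ks x))" by (rule rv[OF t])
    finally show "(LINT x|lebesgue_on \<omega>. (ub x + \<rho> * v x) * divg \<phi> x) = - (LINT x|\<mu>. \<phi> x \<bullet> \<kappa> x)"
      unfolding R by (simp add: algebra_simps)
  qed
  with mass show ?thesis unfolding H_def by blast
qed

text \<open>Makes the increment \<open>\<rho> * v\<close> small in the norm for which local
  minimality is defined.\<close>

lemma TV_scale:
  fixes \<omega> :: "(real^'n) set"
  assumes o: "open \<omega>" and r: "grad_rep \<omega> v lam k" and \<rho>: "\<rho> > 0"
  shows "TV \<omega> (\<lambda>x. \<rho> * v x) = \<rho> * measure lam \<omega>"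
proof -
  have vm: "vmeas_on \<omega> lam k" using r by (simp add: grad_rep_def)
  interpret b: borel_on \<omega> lam by (rule vmeas_borel_on[OF o vm])
  interpret L: finite_measure lam by (rule b.lam_fin)
  define B where "B = density lam (\<lambda>x. ennreal \<rho>)"
  have top: "\<omega> \<in> sets lam" using sets.top[of lam] b.lam_space by simp
  have eB: "emeasure B \<omega> = ennreal (\<rho> * measure lam \<omega>)"
  proof -
    have "emeasure B \<omega> = ennreal \<rho> * emeasure lam \<omega>"
      unfolding B_def using top by (subst emeasure_density) (auto simp: nn_integral_cmult_indicator)
    then show ?thesis using \<rho> by (simp add: L.emeasure_eq_measure ennreal_mult)
  qed
  have km: "k \<in> borel_measurable lam" and k1: "AE x in lam. norm (k x) = 1" using vm by (auto simp: vmeas_on_def)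
  have "grad_rep \<omega> (\<lambda>x. \<rho> * v x) B k"
    unfolding grad_rep_def vmeas_on_def
  proof (intro conjI allI impI)
    show "sets B = sets (restrict_space borel \<omega>)" by (simp add: B_def b.lam_sets)
    show "finite_measure B" by (rule finite_measureI) (use eB in \<open>simp add: B_def b.lam_space\<close>)
    show "k \<in> borel_measurable B" using km by (simp add: B_def)
    show "AE x in B. norm (k x) = 1" unfolding B_def using k1 by (subst AE_density) auto
    fix \<phi> assume t: "test_field \<omega> \<phi>"
    have m: "(\<lambda>x. \<phi> x \<bullet> k x) \<in> borel_measurable lam"
      by (intro borel_measurable_inner km b.borel_lam test_field_measurable(1)[OF t])
    have "(LINT x|B. \<phi> x \<bullet> k x) = (LINT x|lam. \<rho> *\<^sub>R (\<phi> x \<bullet> k x))"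
      unfolding B_def by (rule integral_density[OF m]) (use \<rho> in auto)
    also have "\<dots> = \<rho> * (LINT x|lam. \<phi> x \<bullet> k x)" by simp
    also have "(LINT x|lam. \<phi> x \<bullet> k x) = - (LINT x|lebesgue_on \<omega>. v x * divg \<phi> x)" using r t by (simp add: grad_rep_def)
    finally show "(LINT x|lebesgue_on \<omega>. \<rho> * v x * divg \<phi> x) = - (LINT x|B. \<phi> x \<bullet> k x)" by (simp add: mult.assoc)
  qed
  from TV_eq_mass[OF o this] show ?thesis using \<rho> by (simp add: measure_def eB)
qed

text \<open>The lower bound is Cauchy-Schwarz against the unit vector \<open>a\<close>; the upper
  one is 2 s \<le> 1 + s^2 with s the norm of the perturbed vector.\<close>

lemma norm_expansion:
  fixes a b :: "'a::real_inner"
  assumes a: "norm a = 1"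
  shows "0 \<le> norm (a + \<rho> *\<^sub>R b) - 1 - \<rho> * (a \<bullet> b)"
    "norm (a + \<rho> *\<^sub>R b) - 1 - \<rho> * (a \<bullet> b) \<le> \<rho>\<^sup>2 * ((norm b)\<^sup>2 / 2)"
proof -
  have aa: "a \<bullet> a = 1" using a by (simp add: norm_eq_1)
  have "a \<bullet> (a + \<rho> *\<^sub>R b) \<le> norm a * norm (a + \<rho> *\<^sub>R b)" by (rule norm_cauchy_schwarz)
  then show "0 \<le> norm (a + \<rho> *\<^sub>R b) - 1 - \<rho> * (a \<bullet> b)" using a aa by (simp add: inner_add_right)
  have sq: "(norm (a + \<rho> *\<^sub>R b))\<^sup>2 = 1 + 2 * \<rho> * (a \<bullet> b) + \<rho>\<^sup>2 * (norm b)\<^sup>2"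
    unfolding power2_norm_eq_inner by (simp add: inner_add_left inner_add_right inner_commute[of b a] aa power2_eq_square algebra_simps)
  have "2 * norm (a + \<rho> *\<^sub>R b) \<le> 1 + (norm (a + \<rho> *\<^sub>R b))\<^sup>2" using sum_squares_bound[of 1 "norm (a + \<rho> *\<^sub>R b)"] by simp
  then show "norm (a + \<rho> *\<^sub>R b) - 1 - \<rho> * (a \<bullet> b) \<le> \<rho>\<^sup>2 * ((norm b)\<^sup>2 / 2)" unfolding sq by simp
qed

text \<open>Multiplying s - 1 - r (a \<bullet> b) by its conjugate s + 1 + r (a \<bullet> b) gives
  exactly r^2 (|b|^2 - (a \<bullet> b)^2), and the conjugate tends to 2.\<close>

lemma norm_expansion_limit:
  fixes a b :: "'a::real_inner"
  assumes a: "norm a = 1" and r: "r \<longlonglongrightarrow> 0" "\<And>n. r n > 0"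
  shows "(\<lambda>n. (norm (a + r n *\<^sub>R b) - 1 - r n * (a \<bullet> b)) / (r n)\<^sup>2) \<longlonglongrightarrow> ((norm b)\<^sup>2 - (a \<bullet> b)\<^sup>2) / 2"
proof -
  have aa: "a \<bullet> a = 1" using a by (simp add: norm_eq_1)
  define s where "s n = norm (a + r n *\<^sub>R b)" for n
  have "(\<lambda>n. s n) \<longlonglongrightarrow> norm (a + 0 *\<^sub>R b)" unfolding s_def by (intro tendsto_intros r)
  then have s1: "s \<longlonglongrightarrow> 1" using a by simp
  have "(\<lambda>n. s n + 1 + r n * (a \<bullet> b)) \<longlonglongrightarrow> 1 + 1 + 0 * (a \<bullet> b)" by (intro tendsto_intros s1 r)
  then have den: "(\<lambda>n. s n + 1 + r n * (a \<bullet> b)) \<longlonglongrightarrow> 2" by simp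
  have lim: "(\<lambda>n. ((norm b)\<^sup>2 - (a \<bullet> b)\<^sup>2) / (s n + 1 + r n * (a \<bullet> b))) \<longlonglongrightarrow> ((norm b)\<^sup>2 - (a \<bullet> b)\<^sup>2) / 2"
    by (intro tendsto_divide tendsto_const den) simp
  have "\<forall>\<^sub>F n in sequentially. s n + 1 + r n * (a \<bullet> b) > 0" using order_tendstoD(1)[OF den, of 0] by simp
  then have "\<forall>\<^sub>F n in sequentially. ((norm b)\<^sup>2 - (a \<bullet> b)\<^sup>2) / (s n + 1 + r n * (a \<bullet> b)) = (norm (a + r n *\<^sub>R b) - 1 - r n * (a \<bullet> b)) / (r n)\<^sup>2"
  proof eventually_elim
    case (elim n)
    have sq: "(s n)\<^sup>2 = 1 + 2 * r n * (a \<bullet> b) + (r n)\<^sup>2 * (norm b)\<^sup>2"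
      unfolding s_def power2_norm_eq_inner by (simp add: inner_add_left inner_add_right inner_commute[of b a] aa power2_eq_square algebra_simps)
    have "(s n - 1 - r n * (a \<bullet> b)) * (s n + 1 + r n * (a \<bullet> b)) = (s n)\<^sup>2 - (1 + r n * (a \<bullet> b))\<^sup>2"
      by (simp add: power2_eq_square algebra_simps)
    also have "\<dots> = (r n)\<^sup>2 * ((norm b)\<^sup>2 - (a \<bullet> b)\<^sup>2)" unfolding sq by (simp add: power2_eq_square algebra_simps)
    finally have "(s n - 1 - r n * (a \<bullet> b)) * (s n + 1 + r n * (a \<bullet> b)) = (r n)\<^sup>2 * ((norm b)\<^sup>2 - (a \<bullet> b)\<^sup>2)" .
    moreover have "(r n)\<^sup>2 \<noteq> 0" using r(2)[of n] by simp
    ultimately have "((norm b)\<^sup>2 - (a \<bullet> b)\<^sup>2) / (s n + 1 + r n * (a \<bullet> b)) = (s n - 1 - r n * (a \<bullet> b)) / (r n)\<^sup>2"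
      using elim by (subst frac_eq_eq) (auto simp: mult.commute)
    then show ?case by (simp only: s_def)
  qed
  from Lim_transform_eventually[OF lim this] show ?thesis .
qed

text \<open>The expansion is exact for every positive \<open>\<rho>\<close>, not merely asymptotic.
  The remainder integral is nonnegative and at most of order \<open>\<rho>\<^sup>2\<close>, which
  shows that the limit in \<open>dTV\<close> exists and identifies it.\<close>

lemma TV_line:
  fixes \<omega> :: "(real^'n) set"
  assumes o: "open \<omega>" "bounded \<omega>" and rb: "grad_rep \<omega> ub lamb hb"
    and iu: "integrable (lebesgue_on \<omega>) ub" "integrable (lebesgue_on \<omega>) v"
    and ld: "leb_decomp \<omega> lamb v h" and h2: "integrable lamb (\<lambda>x. (norm (h x))\<^sup>2)"
  shows "\<And>\<rho>. \<rho> > 0 \<Longrightarrow> (\<exists>\<mu> \<kappa>. grad_rep \<omega> (\<lambda>x. ub x + \<rho> * v x) \<mu> \<kappa>)"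
    and "\<And>\<rho>. \<rho> > 0 \<Longrightarrow> TV \<omega> (\<lambda>x. ub x + \<rho> * v x) - TV \<omega> ub =
           \<rho> * dTV \<omega> ub v + (LINT x|lamb. norm (hb x + \<rho> *\<^sub>R h x) - 1 - \<rho> * (hb x \<bullet> h x))"
proof -
  obtain lams ks N where h: "h \<in> borel_measurable lamb" "integrable lamb h" and vs: "vmeas_on \<omega> lams ks"
    and N: "N \<in> sets lamb" "emeasure lamb N = 0" "emeasure lams (\<omega> - N) = 0"
    and rv: "\<And>\<phi>. test_field \<omega> \<phi> \<Longrightarrow> (LINT x|lebesgue_on \<omega>. v x * divg \<phi> x) = - ((LINT x|lamb. \<phi> x \<bullet> h x) + (LINT x|lams. \<phi> x \<bullet> ks x))"
    using ld unfolding leb_decomp_def by auto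
  have vb: "vmeas_on \<omega> lamb hb" using rb by (simp add: grad_rep_def)
  interpret b: borel_on \<omega> lamb by (rule vmeas_borel_on[OF o(1) vb])
  interpret lb: finite_measure lamb by (rule b.lam_fin)
  have hbm: "hb \<in> borel_measurable lamb" and hb1: "AE x in lamb. norm (hb x) = 1" using vb by (auto simp: vmeas_on_def)
  have ihb: "integrable lamb hb" by (rule polar_integrable[OF vb])
  note line = grad_rep_line[OF o rb iu h vs N rv]
  show "\<exists>\<mu> \<kappa>. grad_rep \<omega> (\<lambda>x. ub x + \<rho> * v x) \<mu> \<kappa>" if "\<rho> > 0" for \<rho> using line[OF _ that] by blast
  define E where "E \<rho> = (LINT x|lamb. norm (hb x + \<rho> *\<^sub>R h x) - 1 - \<rho> * (hb x \<bullet> h x))" for \<rho>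
  have ihh: "integrable lamb (\<lambda>x. hb x \<bullet> h x)"
  proof (rule Bochner_Integration.integrable_bound[OF integrable_norm[OF h(2)]])
    show "(\<lambda>x. hb x \<bullet> h x) \<in> borel_measurable lamb" using hbm h(1) by (intro borel_measurable_inner)
    show "AE x in lamb. norm (hb x \<bullet> h x) \<le> norm (norm (h x))"
      using hb1
    proof eventually_elim
      case (elim x) then show ?case using Cauchy_Schwarz_ineq2[of "hb x" "h x"] by simp
    qed
  qed
  \<comment> \<open>The directional derivative. On the carrier of \<open>lams\<close> the measure of
    \<open>ub\<close> has no mass, so the perturbation contributes its full length there instead of
    a projection onto \<open>hb\<close>.\<close>
  define G where "G = (LINT x|lamb. hb x \<bullet> h x) + measure lams \<omega>"
  have TVb: "TV \<omega> ub = measure lamb \<omega>" by (rule TV_eq_mass[OF o(1) rb])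
  have iN: "integrable lamb (\<lambda>x. norm (hb x + \<rho> *\<^sub>R h x))" for \<rho> using ihb h(2) by simp
  have expand: "TV \<omega> (\<lambda>x. ub x + \<rho> * v x) - TV \<omega> ub = \<rho> * G + E \<rho>" if \<rho>: "\<rho> > 0" for \<rho>
  proof -
    obtain \<mu> \<kappa> where r: "grad_rep \<omega> (\<lambda>x. ub x + \<rho> * v x) \<mu> \<kappa>"
      and m: "measure \<mu> \<omega> = (LINT x|lamb. norm (hb x + \<rho> *\<^sub>R h x)) + \<rho> * measure lams \<omega>"
      using line[OF _ \<rho>] by blast
    have "E \<rho> = (LINT x|lamb. norm (hb x + \<rho> *\<^sub>R h x)) - measure lamb \<omega> - \<rho> * (LINT x|lamb. hb x \<bullet> h x)"
      unfolding E_def using iN ihh by (simp add: b.lam_space)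
    then show ?thesis unfolding TV_eq_mass[OF o(1) r] TVb m G_def by (simp add: algebra_simps)
  qed
  have E_bounds: "0 \<le> E \<rho>" "E \<rho> \<le> \<rho>\<^sup>2 * ((LINT x|lamb. (norm (h x))\<^sup>2) / 2)" for \<rho>
  proof -
    show "0 \<le> E \<rho>" unfolding E_def
      by (rule integral_nonneg_AE) (rule eventually_mono[OF hb1 norm_expansion(1)])
    have "E \<rho> \<le> (LINT x|lamb. \<rho>\<^sup>2 * ((norm (h x))\<^sup>2 / 2))" unfolding E_def
    proof (rule integral_mono_AE)
      show "integrable lamb (\<lambda>x. norm (hb x + \<rho> *\<^sub>R h x) - 1 - \<rho> * (hb x \<bullet> h x))" using iN ihh by simp
      show "integrable lamb (\<lambda>x. \<rho>\<^sup>2 * ((norm (h x))\<^sup>2 / 2))" using h2 by simp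
      show "AE x in lamb. norm (hb x + \<rho> *\<^sub>R h x) - 1 - \<rho> * (hb x \<bullet> h x) \<le> \<rho>\<^sup>2 * ((norm (h x))\<^sup>2 / 2)"
        using hb1 by (elim eventually_mono) (rule norm_expansion(2))
    qed
    then show "E \<rho> \<le> \<rho>\<^sup>2 * ((LINT x|lamb. (norm (h x))\<^sup>2) / 2)" by simp
  qed
  define c where "c = (LINT x|lamb. (norm (h x))\<^sup>2) / 2"
  have pos: "\<forall>\<^sub>F \<rho> in at_right 0. \<rho> > (0::real)" by (rule eventually_at_right_less)
  have "((\<lambda>\<rho>. G + \<rho> * c) \<longlongrightarrow> G + 0 * c) (at_right 0)" by (intro tendsto_intros)
  then have up: "((\<lambda>\<rho>. G + \<rho> * c) \<longlongrightarrow> G) (at_right 0)" by simp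
  have "((\<lambda>\<rho>. (TV \<omega> (\<lambda>x. ub x + \<rho> * v x) - TV \<omega> ub) / \<rho>) \<longlongrightarrow> G) (at_right 0)"
  proof (rule tendsto_sandwich[OF _ _ tendsto_const up])
    show "\<forall>\<^sub>F \<rho> in at_right 0. G \<le> (TV \<omega> (\<lambda>x. ub x + \<rho> * v x) - TV \<omega> ub) / \<rho>"
      using pos
    proof eventually_elim
      case (elim \<rho>) then show ?case unfolding expand[OF elim] using E_bounds(1)[of \<rho>] by (simp add: pos_le_divide_eq mult.commute)
    qed
    show "\<forall>\<^sub>F \<rho> in at_right 0. (TV \<omega> (\<lambda>x. ub x + \<rho> * v x) - TV \<omega> ub) / \<rho> \<le> G + \<rho> * c"
      using pos
    proof eventually_elim
      case (elim \<rho>) then show ?case unfolding expand[OF elim] using E_bounds(2)[of \<rho>]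
        by (simp add: pos_divide_le_eq c_def algebra_simps power2_eq_square)
    qed
  qed
  \<comment> \<open>\<open>Lim\<close> is meaningful only after this convergence is known.\<close>
  then have "dTV \<omega> ub v = G" unfolding dTV_def by (intro tendsto_Lim) auto
  then show "TV \<omega> (\<lambda>x. ub x + \<rho> * v x) - TV \<omega> ub =
           \<rho> * dTV \<omega> ub v + (LINT x|lamb. norm (hb x + \<rho> *\<^sub>R h x) - 1 - \<rho> * (hb x \<bullet> h x))" if "\<rho> > 0" for \<rho>
    using expand[OF that] by (simp add: E_def)
qed

text \<open>By \<open>norm_expansion\<close> the scaled integrand lies between 0 and
  \<open>(norm (h x))\<^sup>2 / 2\<close>; here the square integrability of \<open>h\<close>
  required in the critical cone provides the dominating function.\<close>

lemma second_variation_limit: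
  fixes hb h :: "'a \<Rightarrow> 'b::euclidean_space"
  assumes m: "hb \<in> borel_measurable M" "h \<in> borel_measurable M" and hb1: "AE x in M. norm (hb x) = 1"
    and h2: "integrable M (\<lambda>x. (norm (h x))\<^sup>2)" and r: "r \<longlonglongrightarrow> 0" "\<And>n. r n > 0"
  shows "(\<lambda>n. (LINT x|M. norm (hb x + r n *\<^sub>R h x) - 1 - r n * (hb x \<bullet> h x)) / (r n)\<^sup>2)
     \<longlonglongrightarrow> (LINT x|M. (norm (h x))\<^sup>2 - (hb x \<bullet> h x)\<^sup>2) / 2"
proof -
  have "(\<lambda>n. LINT x|M. (norm (hb x + r n *\<^sub>R h x) - 1 - r n * (hb x \<bullet> h x)) / (r n)\<^sup>2)
     \<longlonglongrightarrow> (LINT x|M. ((norm (h x))\<^sup>2 - (hb x \<bullet> h x)\<^sup>2) / 2)"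
  proof (rule integral_dominated_convergence[where w = "\<lambda>x. (norm (h x))\<^sup>2 / 2"])
    show "(\<lambda>x. ((norm (h x))\<^sup>2 - (hb x \<bullet> h x)\<^sup>2) / 2) \<in> borel_measurable M" using m by measurable
    show "(\<lambda>x. (norm (hb x + r n *\<^sub>R h x) - 1 - r n * (hb x \<bullet> h x)) / (r n)\<^sup>2) \<in> borel_measurable M" for n using m by measurable
    show "integrable M (\<lambda>x. (norm (h x))\<^sup>2 / 2)" using h2 by simp
    show "AE x in M. (\<lambda>n. (norm (hb x + r n *\<^sub>R h x) - 1 - r n * (hb x \<bullet> h x)) / (r n)\<^sup>2) \<longlonglongrightarrow> ((norm (h x))\<^sup>2 - (hb x \<bullet> h x)\<^sup>2) / 2"
      using hb1 by (elim eventually_mono) (rule norm_expansion_limit[OF _ r])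
    show "AE x in M. norm ((norm (hb x + r n *\<^sub>R h x) - 1 - r n * (hb x \<bullet> h x)) / (r n)\<^sup>2) \<le> (norm (h x))\<^sup>2 / 2" for n
      using hb1
    proof eventually_elim
      case (elim x)
      from norm_expansion[OF elim, of "r n" "h x"] show ?case
        using r(2)[of n] by (simp add: pos_divide_le_eq mult.commute)
    qed
  qed
  then show ?thesis by simp
qed

theorem theorem5p4:
  fixes \<Omega> \<omega> :: "(real^'n) set" and f f1 f2 :: "real^'n \<Rightarrow> real \<Rightarrow> real"
    and yd ub :: "real^'n \<Rightarrow> real" and \<alpha> \<beta> \<gamma> :: real
    and lamb :: "(real^'n) measure" and hb :: "real^'n \<Rightarrow> real^'n"
  assumes dim: "CARD('n) = 2 \<or> CARD('n) = 3"
    and dom: "bounded_lipschitz_domain \<Omega>" and om: "open \<omega>" "\<omega> \<subseteq> \<Omega>"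
    and par: "\<alpha> > 0" "\<beta> \<ge> 0" "\<gamma> \<ge> 0" and yd: "L2 \<Omega> yd"
    and gam3: "CARD('n) = 3 \<longrightarrow> \<gamma> > 0"
    and f_borel: "(\<lambda>p. f (fst p) (snd p)) \<in> borel_measurable (restrict_space borel (\<Omega> \<times> UNIV))"
    and f_C2: "AE x in lebesgue_on \<Omega>. (\<forall>y. (f x has_real_derivative f1 x y) (at y)
                 \<and> (f1 x has_real_derivative f2 x y) (at y)) \<and> continuous_on UNIV (f2 x)"
    and f_0: "\<exists>p. p > real CARD('n) / 2 \<and> (\<lambda>x. f x 0) \<in> borel_measurable (lebesgue_on \<Omega>)
                 \<and> integrable (lebesgue_on \<Omega>) (\<lambda>x. \<bar>f x 0\<bar> powr p)"
    and f_mono: "AE x in lebesgue_on \<Omega>. \<forall>y. f1 x y \<ge> 0"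
    and f_bd: "\<forall>M. \<exists>C. AE x in lebesgue_on \<Omega>. \<forall>y. \<bar>y\<bar> \<le> M \<longrightarrow> \<bar>f1 x y\<bar> + \<bar>f2 x y\<bar> \<le> C"
    and f_uc: "\<forall>M \<rho>. \<rho> > 0 \<longrightarrow> (\<exists>\<epsilon>>0. AE x in lebesgue_on \<Omega>. \<forall>y1 y2.
                 \<bar>y1\<bar> \<le> M \<and> \<bar>y2\<bar> \<le> M \<and> \<bar>y2 - y1\<bar> < \<epsilon> \<longrightarrow> \<bar>f2 x y2 - f2 x y1\<bar> \<le> \<rho>)"
    and locmin: "loc_min \<Omega> \<omega> f yd \<alpha> \<beta> \<gamma> ub"
    and polar: "grad_rep \<omega> ub lamb hb"
  shows "\<forall>v h. BV \<omega> v \<and> L2 \<omega> v \<and> leb_decomp \<omega> lamb v h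
           \<and> dF \<Omega> \<omega> f yd \<beta> \<gamma> ub v + \<alpha> * dTV \<omega> ub v = 0
           \<and> integrable lamb (\<lambda>x. (norm (h x))^2)
         \<longrightarrow> d2F \<Omega> \<omega> f yd \<beta> \<gamma> ub v
             + \<alpha> * (LINT x|lamb. (norm (h x))^2 - (hb x \<bullet> h x)^2) \<ge> 0"
proof (intro allI impI, elim conjE)
  fix v h
  assume BVv: "BV \<omega> v" and L2v: "L2 \<omega> v" and ld: "leb_decomp \<omega> lamb v h"
    and crit: "dF \<Omega> \<omega> f yd \<beta> \<gamma> ub v + \<alpha> * dTV \<omega> ub v = 0"
    and h2: "integrable lamb (\<lambda>x. (norm (h x))\<^sup>2)"
  have \<Omega>: "open \<Omega>" "bounded \<Omega>" using dom by (auto simp: bounded_lipschitz_domain_def)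
  interpret ctrl \<Omega> "real CARD('n)" \<omega> f f1 f2
  proof (intro_locales)
    show "pde_dom \<Omega> (real CARD('n))" by unfold_locales (use \<Omega> dim in auto)
    show "ctrl_axioms \<Omega> (real CARD('n)) \<omega> f f1 f2"
      by (rule ctrl_axioms.intro) (rule om f_borel f_C2 f_0 f_mono f_bd f_uc)+
  qed
  have bo: "bounded \<omega>" using bounded_subset[OF \<Omega>(2) om(2)] .
  obtain r where BVu: "BV \<omega> ub" and L2u: "L2 \<omega> ub" and r: "r > 0"
    and min: "\<And>u. BV \<omega> u \<Longrightarrow> L2 \<omega> u \<Longrightarrow> L2norm \<omega> (\<lambda>x. u x - ub x) + TV \<omega> (\<lambda>x. u x - ub x) < r
      \<Longrightarrow> Jobj \<Omega> \<omega> f yd \<alpha> \<beta> \<gamma> ub \<le> Jobj \<Omega> \<omega> f yd \<alpha> \<beta> \<gamma> u"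
    using locmin unfolding loc_min_def by blast
  have iu: "integrable (lebesgue_on \<omega>) ub" "integrable (lebesgue_on \<omega>) v" using BVu BVv by (auto simp: BV_def)
  obtain lamv kv where rv: "grad_rep \<omega> v lamv kv" using BVv by (auto simp: BV_def)
  note TVl = TV_line[OF om(1) bo polar iu ld h2]
  define E where "E \<rho> = (LINT x|lamb. norm (hb x + \<rho> *\<^sub>R h x) - 1 - \<rho> * (hb x \<bullet> h x))" for \<rho>
  define \<Phi> where "\<Phi> \<rho> = (Fobj \<Omega> \<omega> f yd \<beta> \<gamma> (\<lambda>x. ub x + \<rho> * v x) - Fobj \<Omega> \<omega> f yd \<beta> \<gamma> ub - \<rho> * dF \<Omega> \<omega> f yd \<beta> \<gamma> ub v) / \<rho>\<^sup>2" for \<rho>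
  \<comment> \<open>One sequence of step sizes suffices and suits dominated convergence.\<close>
  define s where "s n = inverse (real (Suc n))" for n
  have s: "s \<longlonglongrightarrow> 0" "\<And>n. s n > 0" unfolding s_def by (rule LIMSEQ_inverse_real_of_nat) simp
  have "filterlim s (at_right 0) sequentially"
    unfolding at_within_def
    by (rule filterlim_inf[THEN iffD2], intro conjI s(1)) (use s(2) in \<open>simp add: filterlim_principal less_imp_neq[symmetric]\<close>)
  from filterlim_compose[OF Fobj_taylor[OF L2u L2v yd, of \<beta> \<gamma>] this]
  have lim1: "(\<lambda>n. \<Phi> (s n)) \<longlonglongrightarrow> d2F \<Omega> \<omega> f yd \<beta> \<gamma> ub v / 2" by (simp only: \<Phi>_def)
  have lim2: "(\<lambda>n. E (s n) / (s n)\<^sup>2) \<longlonglongrightarrow> (LINT x|lamb. (norm (h x))\<^sup>2 - (hb x \<bullet> h x)\<^sup>2) / 2"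
    unfolding E_def
  proof (rule second_variation_limit[OF _ _ _ h2 s])
    show "hb \<in> borel_measurable lamb" "AE x in lamb. norm (hb x) = 1" using polar by (auto simp: grad_rep_def vmeas_on_def)
    show "h \<in> borel_measurable lamb" using ld by (simp add: leb_decomp_def)
  qed
  have lim: "(\<lambda>n. \<Phi> (s n) + \<alpha> * (E (s n) / (s n)\<^sup>2)) \<longlonglongrightarrow> d2F \<Omega> \<omega> f yd \<beta> \<gamma> ub v / 2 + \<alpha> * ((LINT x|lamb. (norm (h x))\<^sup>2 - (hb x \<bullet> h x)\<^sup>2) / 2)"
    by (intro tendsto_intros lim1 lim2)
  \<comment> \<open>The norm of \<open>v\<close> in the space where \<open>ub\<close> is a local
    minimum, so that a step of size \<open>s n\<close> has norm \<open>s n * c\<close>.\<close>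
  define c where "c = L2norm \<omega> v + measure lamv \<omega>"
  have "(\<lambda>n. s n * c) \<longlonglongrightarrow> 0 * c" by (intro tendsto_intros s)
  then have "\<forall>\<^sub>F n in sequentially. s n * c < r" using r by (intro order_tendstoD(2)) auto
  then have "\<forall>\<^sub>F n in sequentially. 0 \<le> \<Phi> (s n) + \<alpha> * (E (s n) / (s n)\<^sup>2)"
  proof eventually_elim
    case (elim n)
    define \<rho> where "\<rho> = s n"
    have \<rho>: "\<rho> > 0" using s(2) by (simp add: \<rho>_def)
    let ?u = "\<lambda>x. ub x + \<rho> * v x"
    have "BV \<omega> ?u" unfolding BV_def using TVl(1)[OF \<rho>] iu by auto
    moreover have "L2 \<omega> ?u" by (rule L2_lin[OF L2u L2v])
    moreover have "L2norm \<omega> (\<lambda>x. ?u x - ub x) + TV \<omega> (\<lambda>x. ?u x - ub x) < r"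
    proof -
      have "L2norm \<omega> (\<lambda>x. \<rho> * v x) = \<rho> * L2norm \<omega> v"
        using \<rho> by (simp add: L2norm_def power_mult_distrib real_sqrt_mult)
      then show ?thesis using elim TV_scale[OF om(1) rv \<rho>] by (simp add: c_def \<rho>_def[symmetric] distrib_left)
    qed
    ultimately have "Jobj \<Omega> \<omega> f yd \<alpha> \<beta> \<gamma> ub \<le> Jobj \<Omega> \<omega> f yd \<alpha> \<beta> \<gamma> ?u" by (rule min)
    then have J: "0 \<le> (Fobj \<Omega> \<omega> f yd \<beta> \<gamma> ?u - Fobj \<Omega> \<omega> f yd \<beta> \<gamma> ub) + \<alpha> * (TV \<omega> ?u - TV \<omega> ub)"
      by (simp add: Jobj_def algebra_simps)
    have T: "TV \<omega> ?u - TV \<omega> ub = \<rho> * dTV \<omega> ub v + E \<rho>" using TVl(2)[OF \<rho>] by (simp add: E_def)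
    have F: "Fobj \<Omega> \<omega> f yd \<beta> \<gamma> ?u - Fobj \<Omega> \<omega> f yd \<beta> \<gamma> ub = \<rho>\<^sup>2 * \<Phi> \<rho> + \<rho> * dF \<Omega> \<omega> f yd \<beta> \<gamma> ub v"
      using \<rho> by (simp add: \<Phi>_def)
    \<comment> \<open>Collects the first-order terms into the factor that vanishes for a critical
      direction.\<close>
    have "0 \<le> \<rho>\<^sup>2 * \<Phi> \<rho> + \<alpha> * E \<rho> + \<rho> * (dF \<Omega> \<omega> f yd \<beta> \<gamma> ub v + \<alpha> * dTV \<omega> ub v)"
      using J unfolding F T by (simp add: algebra_simps)
    then have "0 \<le> \<rho>\<^sup>2 * \<Phi> \<rho> + \<alpha> * E \<rho>" unfolding crit by simp
    then have "0 \<le> (\<rho>\<^sup>2 * \<Phi> \<rho> + \<alpha> * E \<rho>) / \<rho>\<^sup>2" by simp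
    also have "\<dots> = \<Phi> \<rho> + \<alpha> * (E \<rho> / \<rho>\<^sup>2)" using \<rho> by (simp add: add_divide_distrib)
    finally show ?case by (simp add: \<rho>_def)
  qed
  from tendsto_lowerbound[OF lim this]
  show "d2F \<Omega> \<omega> f yd \<beta> \<gamma> ub v + \<alpha> * (LINT x|lamb. (norm (h x))\<^sup>2 - (hb x \<bullet> h x)\<^sup>2) \<ge> 0" by simp
qed

end
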